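(* Let $k$ be a field, let $A$ be a finite dimensional basic $k$-algebra satisfying $Z(A)=k$, where $Z(A)$ is the center of $A$, and let $d\geq 2$. Assume that each element in $k$ has a $d$-th root. Let $C_d$ be the cyclic group of order $d$. Then the following sets are in one-to-one correspondence to each other: (1) the set of isoclasses of $k$-linear $C_d$-actions on ${\rm mod}\mbox{-}A$; (2) the set of isoclasses of $k$-linear weak $C_d$-actions on $A$; (3) the set of $d$-compatible elements in ${\rm Out}_k(A)$. Moreover, the bijection between (2) and (3) induces a bijection between the set of equivalence classes of $k$-linear $C_d$-crossed systems $(A,\rho,c)$ and the set of conjugacy classes formed by $d$-compatible elements in ${\rm Out}_k(A)$.
   Context: ${\rm mod}\mbox{-}A$ is the category of finitely presented right $A$-modules. For a group $G$, a $G$-action on a category consists of autoequivalences $F_g$ ($g\in G$) and natural isomorphisms $\varepsilon_{g,h}\colon F_gF_h\to F_{gh}$ with $\varepsilon_{gh,l}\circ\varepsilon_{g,h}F_l=\varepsilon_{g,hl}\circ F_g\varepsilon_{h,l}$ for all $g,h,l\in G$; it is $k$-linear if each $F_g$ is $k$-linear. Two $G$-actions $\{F_g,\varepsilon_{g,h}\}$ and $\{F'_g,\varepsilon'_{g,h}\}$ are isomorphic if there are natural isomorphisms $\delta_g\colon F_g\to F'_g$ with $\delta_{gh}\circ\varepsilon_{g,h}=\varepsilon'_{g,h}\circ(F'_g\delta_h\circ\delta_gF_h)$ for all $g,h\in G$. Let $R$ be a ring with identity, with automorphism group ${\rm Aut}(R)$ and group of invertible elements $R^\times$. A weak $G$-action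 on $R$ is a pair $(\rho,c)$ of maps $\rho\colon G\to{\rm Aut}(R)$ and $c\colon G\times G\to R^\times$ with $\rho(gh)(x)=c(g,h)^{-1}\cdot\rho(g)(\rho(h)(x))\cdot c(g,h)$ and $c(g,h)\cdot c(gh,l)=\rho(g)(c(h,l))\cdot c(g,hl)$ for all $g,h,l\in G$ and $x\in R$; the triple $(R,\rho,c)$ is called a $G$-crossed system. Two weak $G$-actions $(\rho,c)$ and $(\rho',c')$ on $R$ are isomorphic if there is a map $\delta\colon G\to R^\times$ with $\rho'(g)(x)=\delta(g)^{-1}\cdot\rho(g)(x)\cdot\delta(g)$ and $c'(g,h)=\delta(g)^{-1}\cdot\rho(g)(\delta(h)^{-1})\cdot c(g,h)\cdot\delta(gh)$. Two $G$-crossed systems $(R,\rho,c)$ and $(R',\rho',c')$ are equivalent if there is an isomorphism $f\colon R\to R'$ of rings such that the weak $G$-action $(\bar\rho,\bar c)$ on $R'$ given by $\bar\rho(g)=f\circ\rho(g)\circ f^{-1}$ and $\bar c=f\circ c$ is isomorphic to $(\rho',c')$. ${\rm Aut}_k(A)$ is the group of $k$-algebra automorphisms of $A$. A weak $G$-action $(\rho,c)$ on $A$ (and the crossed system $(A,\rho,c)$) is $k$-linear if $\rho$ takes values in ${\rm Aut}_k(A)$. ${\rm Out}_k(A)={\rm Aut}_k(A)/{\rm Inn}_k(A)$ is the outer automorphism group, where ${\rm Inn}_k(A)$ consists of the inner automorphisms $x\mapsto a^{-1}xa$ with $a\in A^\times$. An automorphism $\sigma\in{\rm Aut}_k(A)$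 is $d$-compatible if there is some $a\in A^\times$ with $\sigma(a)=a$ and $\sigma^d(x)=a^{-1}xa$ for all $x\in A$; this depends only on the class of $\sigma$ in ${\rm Out}_k(A)$, and that class is then also called $d$-compatible. The $d$-compatible elements of ${\rm Out}_k(A)$ are closed under conjugation.
   Formalization: Equivalence of k-linear crossed systems is taken via k-algebra isomorphisms, not arbitrary ring isomorphisms (with the latter the "moreover" fails, e.g. 3-Kronecker algebra over C, d=7); mod-A is modelled by an equivalent full subcategory containing a copy of every finitely presented module. *)

theory Defs
  imports "HOL-Algebra.Module" "HOL-Algebra.Bij" "HOL-Algebra.QuotRing" "HOL-Algebra.Elementary_Groups"
begin

section \<open>Finite dimensional algebras\<close>

text \<open>The library's \<^locale>\<open>algebra\<close> is commutative, so associative algebras are introduced here.\<close>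

locale assoc_algebra = module K A + ring A for K (structure) and A (structure) +
  assumes smult_mult_left:
      "\<lbrakk>t \<in> carrier K; x \<in> carrier A; y \<in> carrier A\<rbrakk> \<Longrightarrow>
        (t \<odot>\<^bsub>A\<^esub> x) \<otimes>\<^bsub>A\<^esub> y = t \<odot>\<^bsub>A\<^esub> (x \<otimes>\<^bsub>A\<^esub> y)"
    and smult_mult_right:
      "\<lbrakk>t \<in> carrier K; x \<in> carrier A; y \<in> carrier A\<rbrakk> \<Longrightarrow>
        x \<otimes>\<^bsub>A\<^esub> (t \<odot>\<^bsub>A\<^esub> y) = t \<odot>\<^bsub>A\<^esub> (x \<otimes>\<^bsub>A\<^esub> y)"

definition finite_dimensional ::
    "('k, 'x) ring_scheme \<Rightarrow> ('k, 'a, 'y) module_scheme \<Rightarrow> bool" where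
  "finite_dimensional K A \<longleftrightarrow>
     (\<exists>B. finite B \<and> B \<subseteq> carrier A \<and>
       (\<forall>x \<in> carrier A. \<exists>t \<in> B \<rightarrow> carrier K. x = (\<Oplus>\<^bsub>A\<^esub>b \<in> B. t b \<odot>\<^bsub>A\<^esub> b)))"

definition center :: "('a, 'x) ring_scheme \<Rightarrow> 'a set" where
  "center R = {z \<in> carrier R. \<forall>x \<in> carrier R. z \<otimes>\<^bsub>R\<^esub> x = x \<otimes>\<^bsub>R\<^esub> z}"

text \<open>
  \<open>Z(A) = k\<close> means that the structure map \<open>t \<mapsto> t 1\<close> is a bijection onto the centre; in particular
  the zero algebra is excluded.
\<close>

definition center_is_base ::
    "('k, 'x) ring_scheme \<Rightarrow> ('k, 'a, 'y) module_scheme \<Rightarrow> bool" where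
  "center_is_base K A \<longleftrightarrow> bij_betw (\<lambda>t. t \<odot>\<^bsub>A\<^esub> \<one>\<^bsub>A\<^esub>) (carrier K) (center A)"


section \<open>Right modules\<close>

text \<open>
  As for the library's record \<^type>\<open>module\<close>, the fields for multiplication and unit that are
  inherited from \<^type>\<open>ring\<close> play no role.
\<close>

record ('a, 'm) rmodule = "'m ring" +
  ract :: "'m \<Rightarrow> 'a \<Rightarrow> 'm" (infixl \<open>\<triangleleft>\<index>\<close> 70)

locale right_module = R?: ring R + M?: abelian_group M
  for R :: "('a, 'x) ring_scheme" (structure) and M :: "('a, 'm, 'y) rmodule_scheme" (structure) +
  assumes ract_closed:
      "\<lbrakk>x \<in> carrier M; a \<in> carrier R\<rbrakk> \<Longrightarrow> x \<triangleleft>\<^bsub>M\<^esub> a \<in> carrier M"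
    and ract_add_left:
      "\<lbrakk>x \<in> carrier M; y \<in> carrier M; a \<in> carrier R\<rbrakk> \<Longrightarrow>
        (x \<oplus>\<^bsub>M\<^esub> y) \<triangleleft>\<^bsub>M\<^esub> a = x \<triangleleft>\<^bsub>M\<^esub> a \<oplus>\<^bsub>M\<^esub> y \<triangleleft>\<^bsub>M\<^esub> a"
    and ract_add_right:
      "\<lbrakk>x \<in> carrier M; a \<in> carrier R; b \<in> carrier R\<rbrakk> \<Longrightarrow>
        x \<triangleleft>\<^bsub>M\<^esub> (a \<oplus>\<^bsub>R\<^esub> b) = x \<triangleleft>\<^bsub>M\<^esub> a \<oplus>\<^bsub>M\<^esub> x \<triangleleft>\<^bsub>M\<^esub> b"
    and ract_mult:
      "\<lbrakk>x \<in> carrier M; a \<in> carrier R; b \<in> carrier R\<rbrakk> \<Longrightarrow>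
        x \<triangleleft>\<^bsub>M\<^esub> (a \<otimes>\<^bsub>R\<^esub> b) = (x \<triangleleft>\<^bsub>M\<^esub> a) \<triangleleft>\<^bsub>M\<^esub> b"
    and ract_one: "x \<in> carrier M \<Longrightarrow> x \<triangleleft>\<^bsub>M\<^esub> \<one>\<^bsub>R\<^esub> = x"

definition rmod_hom ::
    "('a, 'x) ring_scheme \<Rightarrow> ('a, 'm, 'y) rmodule_scheme \<Rightarrow> ('a, 'n, 'z) rmodule_scheme
      \<Rightarrow> ('m \<Rightarrow> 'n) set" where
  "rmod_hom R M N =
     {f \<in> carrier M \<rightarrow>\<^sub>E carrier N.
        (\<forall>x \<in> carrier M. \<forall>y \<in> carrier M. f (x \<oplus>\<^bsub>M\<^esub> y) = f x \<oplus>\<^bsub>N\<^esub> f y) \<and>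
        (\<forall>x \<in> carrier M. \<forall>a \<in> carrier R. f (x \<triangleleft>\<^bsub>M\<^esub> a) = f x \<triangleleft>\<^bsub>N\<^esub> a)}"

definition rmod_isomorphic ::
    "('a, 'x) ring_scheme \<Rightarrow> ('a, 'm, 'y) rmodule_scheme \<Rightarrow> ('a, 'n, 'z) rmodule_scheme
      \<Rightarrow> bool" where
  "rmod_isomorphic R M N \<longleftrightarrow> (\<exists>f \<in> rmod_hom R M N. bij_betw f (carrier M) (carrier N))"

definition free_rmod :: "('a, 'x) ring_scheme \<Rightarrow> nat \<Rightarrow> ('a, nat \<Rightarrow> 'a) rmodule" where
  "free_rmod R n =
     \<lparr>carrier = {..<n} \<rightarrow>\<^sub>E carrier R,
      monoid.mult = undefined, one = undefined,
      ring.zero = (\<lambda>i \<in> {..<n}. \<zero>\<^bsub>R\<^esub>),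
      ring.add = (\<lambda>v w. \<lambda>i \<in> {..<n}. v i \<oplus>\<^bsub>R\<^esub> w i),
      ract = (\<lambda>v a. \<lambda>i \<in> {..<n}. v i \<otimes>\<^bsub>R\<^esub> a)\<rparr>"

text \<open>There is an exact sequence \<open>R\<^sup>m \<rightarrow> R\<^sup>n \<rightarrow> M \<rightarrow> 0\<close>.\<close>

definition finitely_presented ::
    "('a, 'x) ring_scheme \<Rightarrow> ('a, 'm, 'y) rmodule_scheme \<Rightarrow> bool" where
  "finitely_presented R M \<longleftrightarrow>
     (\<exists>m n f g. f \<in> rmod_hom R (free_rmod R m) (free_rmod R n) \<and>
        g \<in> rmod_hom R (free_rmod R n) M \<and>
        g ` carrier (free_rmod R n) = carrier M \<and>
        f ` carrier (free_rmod R m) = {v \<in> carrier (free_rmod R n). g v = \<zero>\<^bsub>M\<^esub>})"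


section \<open>Basic algebras\<close>

definition principal_rmod :: "('a, 'x) ring_scheme \<Rightarrow> 'a \<Rightarrow> ('a, 'a) rmodule" where
  "principal_rmod R e =
     \<lparr>carrier = {e \<otimes>\<^bsub>R\<^esub> a | a. a \<in> carrier R},
      monoid.mult = undefined, one = undefined,
      ring.zero = \<zero>\<^bsub>R\<^esub>, ring.add = (\<oplus>\<^bsub>R\<^esub>), ract = (\<otimes>\<^bsub>R\<^esub>)\<rparr>"

definition idempotent :: "('a, 'x) ring_scheme \<Rightarrow> 'a \<Rightarrow> bool" where
  "idempotent R e \<longleftrightarrow> e \<in> carrier R \<and> e \<otimes>\<^bsub>R\<^esub> e = e"

definition orthogonal :: "('a, 'x) ring_scheme \<Rightarrow> 'a \<Rightarrow> 'a \<Rightarrow> bool" where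
  "orthogonal R e f \<longleftrightarrow> e \<otimes>\<^bsub>R\<^esub> f = \<zero>\<^bsub>R\<^esub> \<and> f \<otimes>\<^bsub>R\<^esub> e = \<zero>\<^bsub>R\<^esub>"

definition primitive_idempotent :: "('a, 'x) ring_scheme \<Rightarrow> 'a \<Rightarrow> bool" where
  "primitive_idempotent R e \<longleftrightarrow>
     idempotent R e \<and> e \<noteq> \<zero>\<^bsub>R\<^esub> \<and>
     (\<forall>f g. idempotent R f \<longrightarrow> idempotent R g \<longrightarrow> orthogonal R f g \<longrightarrow> e = f \<oplus>\<^bsub>R\<^esub> g \<longrightarrow>
        f = \<zero>\<^bsub>R\<^esub> \<or> g = \<zero>\<^bsub>R\<^esub>)"

text \<open>
  \<open>1\<close> is a sum of primitive orthogonal idempotents \<open>e\<^sub>1, \<dots>, e\<^sub>n\<close> with the \<open>e\<^sub>iR\<close> pairwise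
  non-isomorphic; that is, the regular right module is a direct sum of pairwise non-isomorphic
  indecomposables.
\<close>

definition basic :: "('a, 'x) ring_scheme \<Rightarrow> bool" where
  "basic R \<longleftrightarrow>
     (\<exists>E. finite E \<and> (\<forall>e \<in> E. primitive_idempotent R e) \<and>
        (\<forall>e \<in> E. \<forall>f \<in> E. e \<noteq> f \<longrightarrow> orthogonal R e f) \<and>
        (\<Oplus>\<^bsub>R\<^esub>e \<in> E. e) = \<one>\<^bsub>R\<^esub> \<and>
        (\<forall>e \<in> E. \<forall>f \<in> E. e \<noteq> f \<longrightarrow>
           \<not> rmod_isomorphic R (principal_rmod R e) (principal_rmod R f)))"


section \<open>Linear categories and group actions on them\<close>

text \<open>
  Hom-sets are indexed by source and target and need not be disjoint, so composition, as well as a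
  functor on arrows, takes the objects as arguments: \<open>comps C X Y Z g f\<close> is \<open>g \<circ> f\<close> for
  \<open>f : X \<rightarrow> Y\<close> and \<open>g : Y \<rightarrow> Z\<close>.
\<close>

record ('o, 'f) category =
  objs :: "'o set"
  homs :: "'o \<Rightarrow> 'o \<Rightarrow> 'f set"
  ident :: "'o \<Rightarrow> 'f"
  comps :: "'o \<Rightarrow> 'o \<Rightarrow> 'o \<Rightarrow> 'f \<Rightarrow> 'f \<Rightarrow> 'f"

record ('k, 'o, 'f) lin_category = "('o, 'f) category" +
  hom_add :: "'o \<Rightarrow> 'o \<Rightarrow> 'f \<Rightarrow> 'f \<Rightarrow> 'f"
  hom_smult :: "'o \<Rightarrow> 'o \<Rightarrow> 'k \<Rightarrow> 'f \<Rightarrow> 'f"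

record ('o, 'f, 'p, 'h) cat_functor =
  omap :: "'o \<Rightarrow> 'p"
  amap :: "'o \<Rightarrow> 'o \<Rightarrow> 'f \<Rightarrow> 'h"

locale is_category =
  fixes C :: "('o, 'f, 'z) category_scheme"
  assumes ident_in_homs: "X \<in> objs C \<Longrightarrow> ident C X \<in> homs C X X"
    and comps_in_homs:
      "\<lbrakk>X \<in> objs C; Y \<in> objs C; Z \<in> objs C; f \<in> homs C X Y; g \<in> homs C Y Z\<rbrakk> \<Longrightarrow>
        comps C X Y Z g f \<in> homs C X Z"
    and comps_ident_right:
      "\<lbrakk>X \<in> objs C; Y \<in> objs C; f \<in> homs C X Y\<rbrakk> \<Longrightarrow> comps C X X Y f (ident C X) = f"
    and comps_ident_left:
      "\<lbrakk>X \<in> objs C; Y \<in> objs C; f \<in> homs C X Y\<rbrakk> \<Longrightarrow> comps C X Y Y (ident C Y) f = f"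
    and comps_assoc:
      "\<lbrakk>W \<in> objs C; X \<in> objs C; Y \<in> objs C; Z \<in> objs C;
        f \<in> homs C W X; g \<in> homs C X Y; h \<in> homs C Y Z\<rbrakk> \<Longrightarrow>
        comps C W X Z (comps C X Y Z h g) f = comps C W Y Z h (comps C W X Y g f)"

definition is_functor ::
    "('o, 'f, 'y) category_scheme \<Rightarrow> ('p, 'h, 'z) category_scheme \<Rightarrow> ('o, 'f, 'p, 'h) cat_functor
      \<Rightarrow> bool" where
  "is_functor C D F \<longleftrightarrow>
     (\<forall>X \<in> objs C. omap F X \<in> objs D) \<and>
     (\<forall>X \<in> objs C. \<forall>Y \<in> objs C. \<forall>f \<in> homs C X Y.
        amap F X Y f \<in> homs D (omap F X) (omap F Y)) \<and>
     (\<forall>X \<in> objs C. amap F X X (ident C X) = ident D (omap F X)) \<and>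
     (\<forall>X \<in> objs C. \<forall>Y \<in> objs C. \<forall>Z \<in> objs C. \<forall>f \<in> homs C X Y. \<forall>g \<in> homs C Y Z.
        amap F X Z (comps C X Y Z g f) =
          comps D (omap F X) (omap F Y) (omap F Z) (amap F Y Z g) (amap F X Y f))"

definition linear_functor ::
    "('k, 'x) ring_scheme \<Rightarrow> ('k, 'o, 'f, 'y) lin_category_scheme
      \<Rightarrow> ('k, 'p, 'h, 'z) lin_category_scheme \<Rightarrow> ('o, 'f, 'p, 'h) cat_functor \<Rightarrow> bool" where
  "linear_functor K C D F \<longleftrightarrow>
     is_functor C D F \<and>
     (\<forall>X \<in> objs C. \<forall>Y \<in> objs C. \<forall>f \<in> homs C X Y. \<forall>g \<in> homs C X Y.
        amap F X Y (hom_add C X Y f g) =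
          hom_add D (omap F X) (omap F Y) (amap F X Y f) (amap F X Y g)) \<and>
     (\<forall>X \<in> objs C. \<forall>Y \<in> objs C. \<forall>t \<in> carrier K. \<forall>f \<in> homs C X Y.
        amap F X Y (hom_smult C X Y t f) =
          hom_smult D (omap F X) (omap F Y) t (amap F X Y f))"

definition id_functor :: "('o, 'f, 'o, 'f) cat_functor" where
  "id_functor = \<lparr>omap = (\<lambda>X. X), amap = (\<lambda>X Y f. f)\<rparr>"

definition comp_functor ::
    "('p, 'h, 'q, 'i) cat_functor \<Rightarrow> ('o, 'f, 'p, 'h) cat_functor
      \<Rightarrow> ('o, 'f, 'q, 'i) cat_functor" where
  "comp_functor F' F =
     \<lparr>omap = (\<lambda>X. omap F' (omap F X)),
      amap = (\<lambda>X Y f. amap F' (omap F X) (omap F Y) (amap F X Y f))\<rparr>"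

definition iso_arrow :: "('o, 'f, 'y) category_scheme \<Rightarrow> 'o \<Rightarrow> 'o \<Rightarrow> 'f \<Rightarrow> bool" where
  "iso_arrow C X Y f \<longleftrightarrow>
     f \<in> homs C X Y \<and>
     (\<exists>g \<in> homs C Y X. comps C X Y X g f = ident C X \<and> comps C Y X Y f g = ident C Y)"

definition natural_iso ::
    "('o, 'f, 'y) category_scheme \<Rightarrow> ('p, 'h, 'z) category_scheme \<Rightarrow> ('o, 'f, 'p, 'h) cat_functor
      \<Rightarrow> ('o, 'f, 'p, 'h) cat_functor \<Rightarrow> ('o \<Rightarrow> 'h) \<Rightarrow> bool" where
  "natural_iso C D F F' \<eta> \<longleftrightarrow>
     (\<forall>X \<in> objs C. iso_arrow D (omap F X) (omap F' X) (\<eta> X)) \<and>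
     (\<forall>X \<in> objs C. \<forall>Y \<in> objs C. \<forall>f \<in> homs C X Y.
        comps D (omap F X) (omap F Y) (omap F' Y) (\<eta> Y) (amap F X Y f) =
        comps D (omap F X) (omap F' X) (omap F' Y) (amap F' X Y f) (\<eta> X))"

definition autoequivalence ::
    "('o, 'f, 'y) category_scheme \<Rightarrow> ('o, 'f, 'o, 'f) cat_functor \<Rightarrow> bool" where
  "autoequivalence C F \<longleftrightarrow>
     is_functor C C F \<and>
     (\<exists>F'. is_functor C C F' \<and>
        (\<exists>\<eta>. natural_iso C C id_functor (comp_functor F' F) \<eta>) \<and>
        (\<exists>\<theta>. natural_iso C C (comp_functor F F') id_functor \<theta>))"

text \<open>
  Actions are pairs \<open>(F, \<epsilon>)\<close>; the value of \<open>\<epsilon> g h\<close> at \<open>X\<close> is the component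
  \<open>F\<^sub>g F\<^sub>h X \<rightarrow> F\<^bsub>gh\<^esub> X\<close>.
\<close>

type_synonym ('g, 'o, 'f) cat_action =
  "('g \<Rightarrow> ('o, 'f, 'o, 'f) cat_functor) \<times> ('g \<Rightarrow> 'g \<Rightarrow> 'o \<Rightarrow> 'f)"

definition is_action ::
    "('g, 'x) monoid_scheme \<Rightarrow> ('o, 'f, 'y) category_scheme \<Rightarrow> ('g, 'o, 'f) cat_action
      \<Rightarrow> bool" where
  "is_action G C = (\<lambda>(F, \<epsilon>).
     (\<forall>g \<in> carrier G. autoequivalence C (F g)) \<and>
     (\<forall>g \<in> carrier G. \<forall>h \<in> carrier G.
        natural_iso C C (comp_functor (F g) (F h)) (F (g \<otimes>\<^bsub>G\<^esub> h)) (\<epsilon> g h)) \<and>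
     (\<forall>g \<in> carrier G. \<forall>h \<in> carrier G. \<forall>l \<in> carrier G. \<forall>X \<in> objs C.
        let gh = g \<otimes>\<^bsub>G\<^esub> h; hl = h \<otimes>\<^bsub>G\<^esub> l; ghl = g \<otimes>\<^bsub>G\<^esub> h \<otimes>\<^bsub>G\<^esub> l;
            FlX = omap (F l) X; FhFlX = omap (F h) FlX; S = omap (F g) FhFlX;
            T = omap (F ghl) X
        in comps C S (omap (F gh) FlX) T (\<epsilon> gh l X) (\<epsilon> g h FlX) =
           comps C S (omap (F g) (omap (F hl) X)) T (\<epsilon> g hl X)
             (amap (F g) FhFlX (omap (F hl) X) (\<epsilon> h l X))))"

definition linear_actions ::
    "('g, 'w) monoid_scheme \<Rightarrow> ('k, 'x) ring_scheme \<Rightarrow> ('k, 'o, 'f, 'y) lin_category_scheme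
      \<Rightarrow> ('g, 'o, 'f) cat_action set" where
  "linear_actions G K C =
     {(F, \<epsilon>). is_action G C (F, \<epsilon>) \<and> (\<forall>g \<in> carrier G. linear_functor K C C (F g))}"

definition action_iso ::
    "('g, 'x) monoid_scheme \<Rightarrow> ('o, 'f, 'y) category_scheme \<Rightarrow> ('g, 'o, 'f) cat_action
      \<Rightarrow> ('g, 'o, 'f) cat_action \<Rightarrow> bool" where
  "action_iso G C = (\<lambda>(F, \<epsilon>) (F', \<epsilon>').
     \<exists>\<delta>. (\<forall>g \<in> carrier G. natural_iso C C (F g) (F' g) (\<delta> g)) \<and>
       (\<forall>g \<in> carrier G. \<forall>h \<in> carrier G. \<forall>X \<in> objs C.
          let gh = g \<otimes>\<^bsub>G\<^esub> h; S = omap (F g) (omap (F h) X);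
              S' = omap (F' g) (omap (F' h) X); T' = omap (F' gh) X
          in comps C S (omap (F gh) X) T' (\<delta> gh X) (\<epsilon> g h X) =
             comps C S S' T' (\<epsilon>' g h X)
               (comps C S (omap (F' g) (omap (F h) X)) S'
                  (amap (F' g) (omap (F h) X) (omap (F' h) X) (\<delta> h X))
                  (\<delta> g (omap (F h) X)))))"


section \<open>The category of finitely presented right modules\<close>

text \<open>
  Objects are the finitely presented right modules with carrier in the type
  \<^typ>\<open>(nat \<Rightarrow> 'a) set\<close>. It contains the cosets making up the quotients of the \<open>A\<^sup>n\<close>, so every
  finitely presented module over any type is isomorphic to an object, by
  \<open>finitely_presented_representable\<close> below.
\<close>

type_synonym 'a fp_rmodule = "('a, (nat \<Rightarrow> 'a) set) rmodule"

type_synonym 'a fp_arrow = "(nat \<Rightarrow> 'a) set \<Rightarrow> (nat \<Rightarrow> 'a) set"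

definition mod_category ::
    "('k, 'a, 'y) module_scheme \<Rightarrow> ('k, 'a fp_rmodule, 'a fp_arrow) lin_category" where
  "mod_category A =
     \<lparr>objs = {M. right_module A M \<and> finitely_presented A M},
      homs = rmod_hom A,
      ident = (\<lambda>M. \<lambda>x \<in> carrier M. x),
      comps = (\<lambda>L M N g f. compose (carrier L) g f),
      hom_add = (\<lambda>M N f g. \<lambda>x \<in> carrier M. f x \<oplus>\<^bsub>N\<^esub> g x),
      hom_smult = (\<lambda>M N t f. \<lambda>x \<in> carrier M. f x \<triangleleft>\<^bsub>N\<^esub> (t \<odot>\<^bsub>A\<^esub> \<one>\<^bsub>A\<^esub>))\<rparr>"

lemma mod_category_is_category: "is_category (mod_category A)"
proof
  fix X f Y assume "f \<in> homs (mod_category A) X Y"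
  then have f: "f \<in> extensional (carrier X)" "f \<in> carrier X \<rightarrow> carrier Y"
    by (auto simp: mod_category_def rmod_hom_def PiE_def)
  then show "comps (mod_category A) X X Y f (ident (mod_category A) X) = f"
    "comps (mod_category A) X Y Y (ident (mod_category A) Y) f = f"
    by (auto simp: mod_category_def)
next
  fix X assume "X \<in> objs (mod_category A)"
  then interpret right_module A X by (simp add: mod_category_def)
  show "ident (mod_category A) X \<in> homs (mod_category A) X X"
    by (auto simp: mod_category_def rmod_hom_def ract_closed)
next
  fix X Y Z f g
  assume obj: "X \<in> objs (mod_category A)" and f: "f \<in> homs (mod_category A) X Y"
    and g: "g \<in> homs (mod_category A) Y Z"
  from obj interpret right_module A X by (simp add: mod_category_def)
  have [simp]: "f x \<in> carrier Y" if "x \<in> carrier X" for x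
    using f that by (auto simp: mod_category_def rmod_hom_def)
  have [simp]: "g y \<in> carrier Z" if "y \<in> carrier Y" for y
    using g that by (auto simp: mod_category_def rmod_hom_def)
  show "comps (mod_category A) X Y Z g f \<in> homs (mod_category A) X Z"
    using f g by (simp add: mod_category_def rmod_hom_def compose_def ract_closed)
next
  fix W X Y Z f g h
  assume "f \<in> homs (mod_category A) W X"
  then have "f \<in> carrier W \<rightarrow> carrier X" by (auto simp: mod_category_def rmod_hom_def)
  then show "comps (mod_category A) W X Z (comps (mod_category A) X Y Z h g) f =
      comps (mod_category A) W Y Z h (comps (mod_category A) W X Y g f)"
    by (simp add: mod_category_def compose_assoc)
qed

lemma finitely_presented_representable:
  assumes "right_module A M" and "finitely_presented A M"
  shows "\<exists>N \<in> objs (mod_category A). rmod_isomorphic A M N"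
proof -
  interpret right_module A M by fact
  obtain m n f g where f: "f \<in> rmod_hom A (free_rmod A m) (free_rmod A n)"
    and g: "g \<in> rmod_hom A (free_rmod A n) M"
    and gM: "g ` carrier (free_rmod A n) = carrier M"
    and ker: "f ` carrier (free_rmod A m) = {v \<in> carrier (free_rmod A n). g v = \<zero>\<^bsub>M\<^esub>}"
    using assms(2) unfolding finitely_presented_def by (elim exE conjE) (rule that)
  define q where "q x = {v \<in> carrier (free_rmod A n). g v = x}" for x
  define p where "p S = g (SOME v. v \<in> S)" for S
  have pq [simp]: "p (q x) = x" if "x \<in> carrier M" for x
  proof -
    have "x \<in> g ` carrier (free_rmod A n)" using that gM by simp
    then have "\<exists>v. v \<in> q x" by (auto simp: q_def)
    then have "(SOME v. v \<in> q x) \<in> q x" by (rule someI_ex)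
    then show ?thesis by (simp add: p_def q_def)
  qed
  define N :: "'a fp_rmodule" where
    "N = \<lparr>carrier = q ` carrier M, monoid.mult = undefined, one = undefined, ring.zero = q \<zero>\<^bsub>M\<^esub>,
      ring.add = (\<lambda>S T. q (p S \<oplus>\<^bsub>M\<^esub> p T)), ract = (\<lambda>S a. q (p S \<triangleleft>\<^bsub>M\<^esub> a))\<rparr>"
  have N [simp]: "carrier N = q ` carrier M" "ring.zero N = q \<zero>\<^bsub>M\<^esub>"
    "ring.add N = (\<lambda>S T. q (p S \<oplus>\<^bsub>M\<^esub> p T))" "ract N = (\<lambda>S a. q (p S \<triangleleft>\<^bsub>M\<^esub> a))"
    by (simp_all add: N_def)
  have "abelian_group N"
  proof (rule abelian_groupI)
    fix S assume "S \<in> carrier N"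
    then obtain x where "x \<in> carrier M" "S = q x" by auto
    then show "\<exists>T \<in> carrier N. T \<oplus>\<^bsub>N\<^esub> S = \<zero>\<^bsub>N\<^esub>"
      by (intro bexI[of _ "q (\<ominus>\<^bsub>M\<^esub> x)"]) (auto simp: M.l_neg)
  next
    fix S T U assume "S \<in> carrier N" "T \<in> carrier N" "U \<in> carrier N"
    then show "S \<oplus>\<^bsub>N\<^esub> T \<oplus>\<^bsub>N\<^esub> U = S \<oplus>\<^bsub>N\<^esub> (T \<oplus>\<^bsub>N\<^esub> U)"
      by (auto simp: M.a_assoc)
  next
    fix S T assume "S \<in> carrier N" "T \<in> carrier N"
    then show "S \<oplus>\<^bsub>N\<^esub> T = T \<oplus>\<^bsub>N\<^esub> S"
      by (auto simp: M.a_comm)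
  qed auto
  moreover have "right_module_axioms A N"
    by unfold_locales
      (auto simp: ract_closed ract_add_left ract_add_right ract_mult ract_one)
  ultimately have rN: "right_module A N"
    by (simp add: right_module_def R.ring_axioms)
  let ?Q = "restrict q (carrier M)"
  have Q: "?Q \<in> rmod_hom A M N"
    by (auto simp: rmod_hom_def ract_closed)
  have inj: "q x = q y \<longleftrightarrow> x = y" if "x \<in> carrier M" "y \<in> carrier M" for x y
    using that pq by metis
  have bij: "bij_betw ?Q (carrier M) (carrier N)"
    by (auto simp: bij_betw_def inj_on_def inj)
  let ?F = "free_rmod A n"
  have gcl: "g v \<in> carrier M" if "v \<in> carrier ?F" for v using gM that by blast
  have "v \<oplus>\<^bsub>?F\<^esub> w \<in> carrier ?F" "v \<triangleleft>\<^bsub>?F\<^esub> a \<in> carrier ?F"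
    if "v \<in> carrier ?F" "w \<in> carrier ?F" "a \<in> carrier A" for v w a
    using that by (auto simp: free_rmod_def)
  then have "compose (carrier ?F) ?Q g \<in> rmod_hom A ?F N"
    using g gcl by (auto simp: rmod_hom_def compose_def ract_closed)
  moreover have "compose (carrier ?F) ?Q g ` carrier ?F = carrier N"
  proof -
    have "compose (carrier ?F) ?Q g ` carrier ?F = q ` g ` carrier ?F"
      unfolding image_image by (intro image_cong refl) (simp add: compose_def gcl)
    then show ?thesis by (simp add: gM)
  qed
  moreover have "f ` carrier (free_rmod A m) =
      {v \<in> carrier ?F. compose (carrier ?F) ?Q g v = \<zero>\<^bsub>N\<^esub>}"
    unfolding ker by (intro Collect_cong conj_cong refl) (simp add: compose_def gcl inj)
  ultimately have "finitely_presented A N"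
    using f unfolding finitely_presented_def by (intro exI conjI)
  with rN have "N \<in> objs (mod_category A)" by (simp add: mod_category_def)
  moreover from bij Q have "rmod_isomorphic A M N" unfolding rmod_isomorphic_def by (rule bexI)
  ultimately show ?thesis by blast
qed


section \<open>Weak actions and crossed systems\<close>

definition ring_auto :: "('a, 'x) ring_scheme \<Rightarrow> ('a \<Rightarrow> 'a) set" where
  "ring_auto R = ring_iso R R \<inter> Bij (carrier R)"

definition alg_iso ::
    "('k, 'x) ring_scheme \<Rightarrow> ('k, 'a, 'y) module_scheme \<Rightarrow> ('k, 'b, 'z) module_scheme
      \<Rightarrow> ('a \<Rightarrow> 'b) set" where
  "alg_iso K A B =
     {f \<in> ring_iso A B. \<forall>t \<in> carrier K. \<forall>x \<in> carrier A. f (t \<odot>\<^bsub>A\<^esub> x) = t \<odot>\<^bsub>B\<^esub> f x}"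

definition alg_auto ::
    "('k, 'x) ring_scheme \<Rightarrow> ('k, 'a, 'y) module_scheme \<Rightarrow> ('a \<Rightarrow> 'a) set" where
  "alg_auto K A = alg_iso K A A \<inter> Bij (carrier A)"

type_synonym ('g, 'a) weak_action = "('g \<Rightarrow> 'a \<Rightarrow> 'a) \<times> ('g \<Rightarrow> 'g \<Rightarrow> 'a)"

definition is_weak_action ::
    "('g, 'x) monoid_scheme \<Rightarrow> ('a, 'y) ring_scheme \<Rightarrow> ('g, 'a) weak_action \<Rightarrow> bool" where
  "is_weak_action G R = (\<lambda>(\<rho>, c).
     \<rho> \<in> carrier G \<rightarrow> ring_auto R \<and>
     c \<in> carrier G \<rightarrow> carrier G \<rightarrow> Units R \<and>
     (\<forall>g \<in> carrier G. \<forall>h \<in> carrier G. \<forall>x \<in> carrier R.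
        \<rho> (g \<otimes>\<^bsub>G\<^esub> h) x = inv\<^bsub>R\<^esub> (c g h) \<otimes>\<^bsub>R\<^esub> \<rho> g (\<rho> h x) \<otimes>\<^bsub>R\<^esub> c g h) \<and>
     (\<forall>g \<in> carrier G. \<forall>h \<in> carrier G. \<forall>l \<in> carrier G.
        c g h \<otimes>\<^bsub>R\<^esub> c (g \<otimes>\<^bsub>G\<^esub> h) l = \<rho> g (c h l) \<otimes>\<^bsub>R\<^esub> c g (h \<otimes>\<^bsub>G\<^esub> l)))"

definition weak_action_iso ::
    "('g, 'x) monoid_scheme \<Rightarrow> ('a, 'y) ring_scheme \<Rightarrow> ('g, 'a) weak_action
      \<Rightarrow> ('g, 'a) weak_action \<Rightarrow> bool" where
  "weak_action_iso G R = (\<lambda>(\<rho>, c) (\<rho>', c').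
     \<exists>\<delta> \<in> carrier G \<rightarrow> Units R.
       (\<forall>g \<in> carrier G. \<forall>x \<in> carrier R.
          \<rho>' g x = inv\<^bsub>R\<^esub> (\<delta> g) \<otimes>\<^bsub>R\<^esub> \<rho> g x \<otimes>\<^bsub>R\<^esub> \<delta> g) \<and>
       (\<forall>g \<in> carrier G. \<forall>h \<in> carrier G.
          c' g h = inv\<^bsub>R\<^esub> (\<delta> g) \<otimes>\<^bsub>R\<^esub> \<rho> g (inv\<^bsub>R\<^esub> (\<delta> h)) \<otimes>\<^bsub>R\<^esub> c g h \<otimes>\<^bsub>R\<^esub> \<delta> (g \<otimes>\<^bsub>G\<^esub> h)))"

definition linear_weak_actions ::
    "('g, 'x) monoid_scheme \<Rightarrow> ('k, 'y) ring_scheme \<Rightarrow> ('k, 'a, 'z) module_scheme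
      \<Rightarrow> ('g, 'a) weak_action set" where
  "linear_weak_actions G K A =
     {(\<rho>, c). is_weak_action G A (\<rho>, c) \<and> \<rho> \<in> carrier G \<rightarrow> alg_auto K A}"

definition transport_weak_action ::
    "('a, 'x) ring_scheme \<Rightarrow> ('b, 'y) ring_scheme \<Rightarrow> ('a \<Rightarrow> 'b) \<Rightarrow> ('g, 'a) weak_action
      \<Rightarrow> ('g, 'b) weak_action" where
  "transport_weak_action R R' f = (\<lambda>(\<rho>, c).
     (\<lambda>g. \<lambda>y \<in> carrier R'. f (\<rho> g (inv_into (carrier R) f y)), \<lambda>g h. f (c g h)))"

text \<open>
  An equivalence of \<open>k\<close>-linear crossed systems is given by an isomorphism of \<open>k\<close>-algebras. An
  arbitrary ring isomorphism could act nontrivially on \<open>k\<close> and would identify elements of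
  \<open>Out\<^sub>k(A)\<close> that are not conjugate there.
\<close>

definition crossed_system_equiv ::
    "('g, 'w) monoid_scheme \<Rightarrow> ('k, 'x) ring_scheme \<Rightarrow>
     ('k, 'a, 'y) module_scheme \<times> ('g, 'a) weak_action \<Rightarrow>
     ('k, 'b, 'z) module_scheme \<times> ('g, 'b) weak_action \<Rightarrow> bool" where
  "crossed_system_equiv G K = (\<lambda>(A, w) (A', w').
     \<exists>f \<in> alg_iso K A A'. weak_action_iso G A' (transport_weak_action A A' f w) w')"


section \<open>Outer automorphisms\<close>

definition alg_auto_group ::
    "('k, 'x) ring_scheme \<Rightarrow> ('k, 'a, 'y) module_scheme \<Rightarrow> ('a \<Rightarrow> 'a) monoid" where
  "alg_auto_group K A = BijGroup (carrier A) \<lparr>carrier := alg_auto K A\<rparr>"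

definition inner_auto :: "('a, 'x) ring_scheme \<Rightarrow> ('a \<Rightarrow> 'a) set" where
  "inner_auto R = {\<lambda>x \<in> carrier R. inv\<^bsub>R\<^esub> a \<otimes>\<^bsub>R\<^esub> x \<otimes>\<^bsub>R\<^esub> a | a. a \<in> Units R}"

definition outer_auto_group ::
    "('k, 'x) ring_scheme \<Rightarrow> ('k, 'a, 'y) module_scheme \<Rightarrow> ('a \<Rightarrow> 'a) set monoid" where
  "outer_auto_group K A = alg_auto_group K A Mod inner_auto A"

definition outer_class ::
    "('k, 'x) ring_scheme \<Rightarrow> ('k, 'a, 'y) module_scheme \<Rightarrow> ('a \<Rightarrow> 'a) \<Rightarrow> ('a \<Rightarrow> 'a) set" where
  "outer_class K A \<sigma> = inner_auto A #>\<^bsub>alg_auto_group K A\<^esub> \<sigma>"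

definition compatible :: "('a, 'x) ring_scheme \<Rightarrow> nat \<Rightarrow> ('a \<Rightarrow> 'a) \<Rightarrow> bool" where
  "compatible R d \<sigma> \<longleftrightarrow>
     (\<exists>a \<in> Units R. \<sigma> a = a \<and>
        (\<forall>x \<in> carrier R. (\<sigma> ^^ d) x = inv\<^bsub>R\<^esub> a \<otimes>\<^bsub>R\<^esub> x \<otimes>\<^bsub>R\<^esub> a))"

definition compatible_outer ::
    "('k, 'x) ring_scheme \<Rightarrow> ('k, 'a, 'y) module_scheme \<Rightarrow> nat \<Rightarrow> ('a \<Rightarrow> 'a) set set" where
  "compatible_outer K A d =
     {outer_class K A \<sigma> | \<sigma>. \<sigma> \<in> alg_auto K A \<and> compatible A d \<sigma>}"

definition conj_class :: "('g, 'x) monoid_scheme \<Rightarrow> 'g \<Rightarrow> 'g set" where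
  "conj_class G x = {y \<otimes>\<^bsub>G\<^esub> x \<otimes>\<^bsub>G\<^esub> inv\<^bsub>G\<^esub> y | y. y \<in> carrier G}"


section \<open>Sets of classes\<close>

definition rel_on :: "'s set \<Rightarrow> ('s \<Rightarrow> 's \<Rightarrow> bool) \<Rightarrow> 's rel" where
  "rel_on S P = {(x, y). x \<in> S \<and> y \<in> S \<and> P x y}"

definition action_classes ::
    "('g, 'w) monoid_scheme \<Rightarrow> ('k, 'x) ring_scheme \<Rightarrow> ('k, 'o, 'f, 'y) lin_category_scheme
      \<Rightarrow> ('g, 'o, 'f) cat_action set set" where
  "action_classes G K C =
     linear_actions G K C // rel_on (linear_actions G K C) (action_iso G C)"

definition weak_action_rel ::
    "('g, 'w) monoid_scheme \<Rightarrow> ('k, 'x) ring_scheme \<Rightarrow> ('k, 'a, 'y) module_scheme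
      \<Rightarrow> ('g, 'a) weak_action rel" where
  "weak_action_rel G K A = rel_on (linear_weak_actions G K A) (weak_action_iso G A)"

definition weak_action_classes ::
    "('g, 'w) monoid_scheme \<Rightarrow> ('k, 'x) ring_scheme \<Rightarrow> ('k, 'a, 'y) module_scheme
      \<Rightarrow> ('g, 'a) weak_action set set" where
  "weak_action_classes G K A = linear_weak_actions G K A // weak_action_rel G K A"

text \<open>A crossed system \<open>(A, \<rho>, c)\<close> on the fixed algebra \<open>A\<close> is represented by \<open>(\<rho>, c)\<close>.\<close>

definition crossed_system_rel ::
    "('g, 'w) monoid_scheme \<Rightarrow> ('k, 'x) ring_scheme \<Rightarrow> ('k, 'a, 'y) module_scheme
      \<Rightarrow> ('g, 'a) weak_action rel" where
  "crossed_system_rel G K A =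
     rel_on (linear_weak_actions G K A) (\<lambda>w w'. crossed_system_equiv G K (A, w) (A, w'))"

definition crossed_system_classes ::
    "('g, 'w) monoid_scheme \<Rightarrow> ('k, 'x) ring_scheme \<Rightarrow> ('k, 'a, 'y) module_scheme
      \<Rightarrow> ('g, 'a) weak_action set set" where
  "crossed_system_classes G K A = linear_weak_actions G K A // crossed_system_rel G K A"

end

theory Submission
  imports Defs "HOL-Algebra.Embedded_Algebras"
begin

text \<open>
  The proof has two halves: weak actions of the cyclic group \<open>G\<close> of order \<open>d\<close> are classified by
  outer automorphism classes, and actions on the module category are the same thing as weak actions.

  A weak action \<open>(\<rho>, c)\<close> is best seen through its crossed product, the free left \<open>A\<close>-module with
  basis \<open>u\<^sub>g\<close> and multiplication \<open>u\<^sub>g x = \<rho>(g)(x) u\<^sub>g\<close>, \<open>u\<^sub>g u\<^sub>h = c(g, h) u\<^bsub>gh\<^esub>\<close>. An isomorphism of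
  weak actions is a change of basis \<open>u\<^sub>g \<mapsto> \<delta>(g)\<^sup>-\<^sup>1 u\<^sub>g\<close>. As \<open>G\<close> is cyclic, the powers \<open>u\<^sub>1\<^sup>m\<close>
  with \<open>0 \<le> m < d\<close> form such a basis, so \<open>(\<rho>, c)\<close> is isomorphic to a weak action that depends only
  on \<open>\<sigma> = \<rho>(1)\<close> and \<open>b = u\<^sub>1\<^sup>d \<in> A\<close> (\<open>iso_std\<close>). Here \<open>\<sigma>(b) = b\<close> and \<open>\<sigma>\<^sup>d\<close> is conjugation by
  \<open>b\<close>, which says that \<open>\<sigma>\<close> is \<open>d\<close>-compatible; conversely every such pair gives a weak action
  (\<open>std_weak_action_linear\<close>). For a given \<open>\<sigma>\<close> the unit \<open>b\<close> is unique up to the centre, that is, up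
  to a scalar. Replacing \<open>u\<^sub>1\<close> by \<open>t u\<^sub>1\<close> for a scalar \<open>t\<close> leaves \<open>\<sigma>\<close> alone and multiplies \<open>b\<close> by
  \<open>t\<^sup>d\<close>. All scalars have \<open>d\<close>-th roots, so the outer class of \<open>\<rho>(1)\<close> is a complete invariant of
  weak actions (\<open>weak_action_iso_iff\<close>). Transport along an automorphism conjugates \<open>\<rho>(1)\<close> by it, so
  the conjugacy class of this outer class is a complete invariant of crossed systems
  (\<open>crossed_system_equiv_iff\<close>).

  For the second half, let \<open>F\<close> be a linear autoequivalence of the module category. Because \<open>A\<close> is basic,
  \<open>F\<close> sends the regular module \<open>A\<close> to a module isomorphic to \<open>A\<close> (\<open>image_free\<close>): the maps from
  \<open>FA\<close> to \<open>A\<close> generate \<open>A\<close> (\<open>trace_one\<close>); an indecomposable projective \<open>eA\<close> has a local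
  endomorphism ring, so it is already a summand of \<open>FA\<close> (\<open>splits_off_primitive\<close>); pairwise
  non-isomorphic ones can be split off together (\<open>splits_off_one\<close>), which makes \<open>A\<close> a summand of
  \<open>FA\<close>; by symmetry \<open>FA\<close> is a summand of \<open>A\<close>; and in \<open>A\<close> one-sided inverses are two-sided. A free
  generator \<open>b\<close> of \<open>FA\<close> yields natural bijections \<open>\<gamma>: M \<rightarrow> FM\<close>, semilinear along an automorphism
  of \<open>A\<close> (\<open>gamma_bij\<close>, \<open>gamma_auto\<close>). For an action \<open>(F\<^sub>g, \<epsilon>\<^bsub>g,h\<^esub>)\<close> with chosen generators these
  automorphisms are the \<open>\<rho>(g)\<close>, and the units comparing \<open>\<epsilon>\<^bsub>g,h\<^esub> \<gamma>\<^sub>g \<gamma>\<^sub>h\<close> with \<open>\<gamma>\<^bsub>gh\<^esub>\<close> are the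
  \<open>c(g, h)\<close>. The relation \<open>represents\<close> between actions and weak actions obtained in this way is total,
  and it is onto since modules can be twisted (\<open>exists_represented_action\<close>). Changing the generators
  is the same as changing \<open>(\<rho>, c)\<close> within its class (\<open>change_generators\<close>), and actions represented
  by the same \<open>(\<rho>, c)\<close> are isomorphic (\<open>represented_actions_iso\<close>). So the classes correspond.
\<close>

section \<open>Units and automorphisms of a ring\<close>

declare (in monoid) Units_closed [simp]

context monoid
begin

lemma Units_cancel_left [simp]:
  assumes "a \<in> Units G" "x \<in> carrier G"
  shows "inv a \<otimes> (a \<otimes> x) = x" "a \<otimes> (inv a \<otimes> x) = x"
  using assms by (simp_all flip: m_assoc)

lemma inv_mult_Units:
  assumes "a \<in> Units G" "b \<in> Units G"
  shows "inv (a \<otimes> b) = inv b \<otimes> inv a"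
proof (rule inv_unique'[symmetric])
  show "a \<otimes> b \<otimes> (inv b \<otimes> inv a) = \<one>" "inv b \<otimes> inv a \<otimes> (a \<otimes> b) = \<one>"
    using assms by (simp_all add: m_assoc)
qed (use assms in auto)

lemma inv_eqI:
  assumes "a \<in> Units G" "b \<in> carrier G" "a \<otimes> b = \<one>"
  shows "b = inv a"
  by (metis Units_cancel_left(1) Units_inv_closed assms r_one)

end

lemma (in monoid) UnitsI:
  "\<lbrakk>x \<in> carrier G; y \<in> carrier G; x \<otimes> y = \<one>; y \<otimes> x = \<one>\<rbrakk> \<Longrightarrow> x \<in> Units G"
  unfolding Units_def by blast

lemma (in ring) ring_auto_props:
  assumes "f \<in> ring_auto R"
  shows "x \<in> carrier R \<Longrightarrow> f x \<in> carrier R"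
    and "\<lbrakk>x \<in> carrier R; y \<in> carrier R\<rbrakk> \<Longrightarrow> f (x \<otimes> y) = f x \<otimes> f y"
    and "f \<one> = \<one>"
    and "bij_betw f (carrier R) (carrier R)"
    and "a \<in> Units R \<Longrightarrow> f a \<in> Units R"
    and "a \<in> Units R \<Longrightarrow> f (inv a) = inv (f a)"
proof -
  have f: "f \<in> ring_iso R R" using assms by (simp add: ring_auto_def)
  note E = ring_iso_memE[OF f]
  show "x \<in> carrier R \<Longrightarrow> f x \<in> carrier R"
    and "\<lbrakk>x \<in> carrier R; y \<in> carrier R\<rbrakk> \<Longrightarrow> f (x \<otimes> y) = f x \<otimes> f y"
    and "f \<one> = \<one>" and "bij_betw f (carrier R) (carrier R)"
    using E by auto
  have *: "f a \<otimes> f (inv a) = \<one>" "f (inv a) \<otimes> f a = \<one>" if "a \<in> Units R" for a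
    using that E(2)[of a "inv a"] E(2)[of "inv a" a] E(4) by auto
  show U: "f a \<in> Units R" if "a \<in> Units R" for a
  proof -
    have "f a \<in> carrier R" "f (inv a) \<in> carrier R" using E(1) that by simp_all
    then show ?thesis using *[OF that] unfolding Units_def[of R] by blast
  qed
  show "a \<in> Units R \<Longrightarrow> f (inv a) = inv (f a)"
    using * U E(1) by (intro inv_eqI) auto
qed


section \<open>Weak actions of a cyclic group\<close>

locale weak_action = ring R + G: group G
  for R (structure) and G (structure) and \<rho> c +
  assumes is_weak: "is_weak_action G R (\<rho>, c)"
begin

lemma rho_auto [intro]: "g \<in> carrier G \<Longrightarrow> \<rho> g \<in> ring_auto R"
  and c_Units [simp, intro]: "\<lbrakk>g \<in> carrier G; h \<in> carrier G\<rbrakk> \<Longrightarrow> c g h \<in> Units R"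
  and rho_mult: "\<lbrakk>g \<in> carrier G; h \<in> carrier G; x \<in> carrier R\<rbrakk> \<Longrightarrow>
        \<rho> (g \<otimes>\<^bsub>G\<^esub> h) x = inv\<^bsub>R\<^esub> (c g h) \<otimes>\<^bsub>R\<^esub> \<rho> g (\<rho> h x) \<otimes>\<^bsub>R\<^esub> c g h"
  and cocycle: "\<lbrakk>g \<in> carrier G; h \<in> carrier G; l \<in> carrier G\<rbrakk> \<Longrightarrow>
        c g h \<otimes>\<^bsub>R\<^esub> c (g \<otimes>\<^bsub>G\<^esub> h) l = \<rho> g (c h l) \<otimes>\<^bsub>R\<^esub> c g (h \<otimes>\<^bsub>G\<^esub> l)"
  using is_weak unfolding is_weak_action_def by (auto simp: Pi_iff)

lemma c_closed [simp, intro]: "\<lbrakk>g \<in> carrier G; h \<in> carrier G\<rbrakk> \<Longrightarrow> c g h \<in> carrier R"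
  by simp

lemmas rho [simp] = ring_auto_props(1-3,5-6)[OF rho_auto]
lemmas rho_bij = ring_auto_props(4)[OF rho_auto]

lemma rho_one:
  assumes "x \<in> carrier R"
  shows "\<rho> \<one>\<^bsub>G\<^esub> x = c \<one>\<^bsub>G\<^esub> \<one>\<^bsub>G\<^esub> \<otimes>\<^bsub>R\<^esub> x \<otimes>\<^bsub>R\<^esub> inv\<^bsub>R\<^esub> (c \<one>\<^bsub>G\<^esub> \<one>\<^bsub>G\<^esub>)"
proof -
  let ?c = "c \<one>\<^bsub>G\<^esub> \<one>\<^bsub>G\<^esub>"
  obtain y where y: "y \<in> carrier R" "x = \<rho> \<one>\<^bsub>G\<^esub> y"
    using rho_bij[of "\<one>\<^bsub>G\<^esub>"] assms by (auto simp: bij_betw_def)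
  then have "x = inv\<^bsub>R\<^esub> ?c \<otimes>\<^bsub>R\<^esub> \<rho> \<one>\<^bsub>G\<^esub> x \<otimes>\<^bsub>R\<^esub> ?c" using rho_mult[of "\<one>\<^bsub>G\<^esub>" "\<one>\<^bsub>G\<^esub>" y] by simp
  then have "?c \<otimes>\<^bsub>R\<^esub> x \<otimes>\<^bsub>R\<^esub> inv\<^bsub>R\<^esub> ?c =
    ?c \<otimes>\<^bsub>R\<^esub> (inv\<^bsub>R\<^esub> ?c \<otimes>\<^bsub>R\<^esub> \<rho> \<one>\<^bsub>G\<^esub> x \<otimes>\<^bsub>R\<^esub> ?c) \<otimes>\<^bsub>R\<^esub> inv\<^bsub>R\<^esub> ?c" by simp
  then show ?thesis using assms by (simp add: m_assoc)
qed

lemma c_one_right: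
  assumes "g \<in> carrier G"
  shows "c g \<one>\<^bsub>G\<^esub> = \<rho> g (c \<one>\<^bsub>G\<^esub> \<one>\<^bsub>G\<^esub>)"
proof -
  have "c g \<one>\<^bsub>G\<^esub> \<otimes>\<^bsub>R\<^esub> c g \<one>\<^bsub>G\<^esub> \<otimes>\<^bsub>R\<^esub> inv\<^bsub>R\<^esub> (c g \<one>\<^bsub>G\<^esub>) =
      \<rho> g (c \<one>\<^bsub>G\<^esub> \<one>\<^bsub>G\<^esub>) \<otimes>\<^bsub>R\<^esub> c g \<one>\<^bsub>G\<^esub> \<otimes>\<^bsub>R\<^esub> inv\<^bsub>R\<^esub> (c g \<one>\<^bsub>G\<^esub>)"
    using cocycle[of g "\<one>\<^bsub>G\<^esub>" "\<one>\<^bsub>G\<^esub>"] assms by simp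
  then show ?thesis using assms by (simp add: m_assoc)
qed

lemma c_one_left:
  assumes "g \<in> carrier G"
  shows "c \<one>\<^bsub>G\<^esub> g = c \<one>\<^bsub>G\<^esub> \<one>\<^bsub>G\<^esub>"
proof -
  let ?c = "c \<one>\<^bsub>G\<^esub> \<one>\<^bsub>G\<^esub>"
  have "?c \<otimes>\<^bsub>R\<^esub> c \<one>\<^bsub>G\<^esub> g \<otimes>\<^bsub>R\<^esub> inv\<^bsub>R\<^esub> (c \<one>\<^bsub>G\<^esub> g) = \<rho> \<one>\<^bsub>G\<^esub> (c \<one>\<^bsub>G\<^esub> g) \<otimes>\<^bsub>R\<^esub> c \<one>\<^bsub>G\<^esub> g \<otimes>\<^bsub>R\<^esub> inv\<^bsub>R\<^esub> (c \<one>\<^bsub>G\<^esub> g)"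
    using cocycle[of "\<one>\<^bsub>G\<^esub>" "\<one>\<^bsub>G\<^esub>" g] assms by simp
  then have "?c = ?c \<otimes>\<^bsub>R\<^esub> c \<one>\<^bsub>G\<^esub> g \<otimes>\<^bsub>R\<^esub> inv\<^bsub>R\<^esub> ?c"
    using assms by (simp add: m_assoc rho_one)
  then have "inv\<^bsub>R\<^esub> ?c \<otimes>\<^bsub>R\<^esub> ?c \<otimes>\<^bsub>R\<^esub> ?c = inv\<^bsub>R\<^esub> ?c \<otimes>\<^bsub>R\<^esub> (?c \<otimes>\<^bsub>R\<^esub> c \<one>\<^bsub>G\<^esub> g \<otimes>\<^bsub>R\<^esub> inv\<^bsub>R\<^esub> ?c) \<otimes>\<^bsub>R\<^esub> ?c"
    by simp
  then show ?thesis using assms by (simp add: m_assoc)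
qed

end

locale cyclic_weak_action = weak_action R "integer_mod_group d" \<rho> c
  for R (structure) and d \<rho> c +
  assumes d_ge_2: "d \<ge> 2"
begin

definition res :: "nat \<Rightarrow> int" where "res m = int m mod int d"

lemma d_simps [simp]: "d \<noteq> 0" "0 < d" "d \<noteq> Suc 0"
  using d_ge_2 by auto

lemma res [simp]: "res m \<in> carrier (integer_mod_group d)"
  "(res i + res j) mod int d = res (i + j)" "(res i + 1) mod int d = res (Suc i)"
  "res 0 = 0" "res d = 0" "res (m + d) = res m" "res (Suc 0) = 1"
  "1 \<in> carrier (integer_mod_group d)"
  using d_ge_2 by (auto simp: res_def carrier_integer_mod_group mod_simps add.commute)

text \<open>
  In the crossed product, where \<open>u\<^sub>0 = c(0, 0)\<close>, the element \<open>nu v m\<close> is the coefficient of a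
  power: \<open>(v u\<^sub>1)\<^sup>m = nu v m u\<^bsub>m mod d\<^esub>\<close>. Also \<open>conj_rho v\<close> is conjugation by \<open>v u\<^sub>1\<close>, and
  \<open>dth_power v\<close> is \<open>(v u\<^sub>1)\<^sup>d\<close>, which lies in \<open>R\<close>.
\<close>

primrec nu :: "'a \<Rightarrow> nat \<Rightarrow> 'a" where
  "nu v 0 = inv (c 0 0)"
| "nu v (Suc m) = nu v m \<otimes> \<rho> (res m) v \<otimes> c (res m) 1"

definition conj_rho :: "'a \<Rightarrow> 'a \<Rightarrow> 'a" where
  "conj_rho v x = v \<otimes> \<rho> 1 x \<otimes> inv v"

definition dth_power :: "'a \<Rightarrow> 'a" where "dth_power v = nu v d \<otimes> c 0 0"

lemma c_zero: "g \<in> carrier (integer_mod_group d) \<Longrightarrow> c g 0 = \<rho> g (c 0 0)"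
  "g \<in> carrier (integer_mod_group d) \<Longrightarrow> c 0 g = c 0 0"
  using c_one_right[of g] c_one_left[of g] by auto

context
  fixes v assumes v [simp]: "v \<in> Units R"
begin

lemma nu_Units [simp]: "nu v m \<in> Units R"
  by (induction m) auto

lemma dth_power_Units [simp]: "dth_power v \<in> Units R"
  by (simp add: dth_power_def)

text \<open>The power law \<open>(v u\<^sub>1)\<^sup>i (v u\<^sub>1)\<^sup>j = (v u\<^sub>1)\<^bsup>i+j\<^esup>\<close> of the crossed product; the facts up to
  \<open>conj_rho_dth_power\<close> are all instances of the arithmetic of these powers.\<close>

lemma nu_add: "nu v i \<otimes> \<rho> (res i) (nu v j) \<otimes> c (res i) (res j) = nu v (i + j)"
proof (induction j)
  case 0
  then show ?case by (simp add: c_zero(1)[of "res i"] m_assoc)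
next
  case (Suc j)
  have "\<rho> (res (i + j)) v =
      inv (c (res i) (res j)) \<otimes> \<rho> (res i) (\<rho> (res j) v) \<otimes> c (res i) (res j)"
    using rho_mult[of "res i" "res j" v] by simp
  then have comm: "\<rho> (res i) (\<rho> (res j) v) \<otimes> c (res i) (res j) = c (res i) (res j) \<otimes> \<rho> (res (i + j)) v"
    by (simp add: m_assoc)
  have "nu v i \<otimes> \<rho> (res i) (nu v (Suc j)) \<otimes> c (res i) (res (Suc j)) =
      nu v i \<otimes> \<rho> (res i) (nu v j) \<otimes> \<rho> (res i) (\<rho> (res j) v) \<otimes>
        (\<rho> (res i) (c (res j) 1) \<otimes> c (res i) (res (Suc j)))"
    by (simp add: m_assoc)
  also have "\<dots> = nu v i \<otimes> \<rho> (res i) (nu v j) \<otimes>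
      (\<rho> (res i) (\<rho> (res j) v) \<otimes> c (res i) (res j)) \<otimes> c (res (i + j)) 1"
    using cocycle[of "res i" "res j" 1] by (simp add: m_assoc)
  also have "\<dots> = nu v i \<otimes> \<rho> (res i) (nu v j) \<otimes> c (res i) (res j) \<otimes>
      \<rho> (res (i + j)) v \<otimes> c (res (i + j)) 1"
    unfolding comm by (simp add: m_assoc)
  finally show ?case by (simp add: Suc)
qed

lemma nu_wrap: "nu v (m + d) = dth_power v \<otimes> nu v m"
proof -
  have "nu v (m + d) = nu v d \<otimes> \<rho> (res d) (nu v m) \<otimes> c (res d) (res m)"
    by (metis nu_add add.commute)
  also have "\<dots> = dth_power v \<otimes> nu v m"
    using rho_one[of "nu v m"] c_zero(2)[of "res m"] by (simp add: dth_power_def m_assoc)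
  finally show ?thesis .
qed

lemma nu_one: "nu v (Suc 0) = v"
  using c_zero(2)[of 1] rho_one[of v] by (simp add: m_assoc)

lemma nu_Suc: "nu v (Suc m) = v \<otimes> \<rho> 1 (nu v m) \<otimes> c 1 (res m)"
  using nu_add[of 1 m] nu_one by simp

lemma rho_conj_power:
  assumes "x \<in> carrier R"
  shows "nu v m \<otimes> \<rho> (res m) x \<otimes> inv (nu v m) = (conj_rho v ^^ m) x"
proof (induction m)
  case 0
  then show ?case using rho_one[of x] assms by (simp add: m_assoc)
next
  case (Suc m)
  have eq: "\<rho> (res (Suc m)) x = inv (c 1 (res m)) \<otimes> \<rho> 1 (\<rho> (res m) x) \<otimes> c 1 (res m)"
    using rho_mult[of 1 "res m" x] assms res(2)[of 1 m] by simp
  have "nu v (Suc m) \<otimes> \<rho> (res (Suc m)) x \<otimes> inv (nu v (Suc m)) =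
      v \<otimes> (\<rho> 1 (nu v m) \<otimes> \<rho> 1 (\<rho> (res m) x) \<otimes> inv (\<rho> 1 (nu v m))) \<otimes> inv v"
    unfolding nu_Suc eq using assms by (simp add: m_assoc inv_mult_Units)
  also have "\<dots> = conj_rho v (nu v m \<otimes> \<rho> (res m) x \<otimes> inv (nu v m))"
    using assms by (simp add: conj_rho_def)
  finally show ?case by (simp add: Suc)
qed

lemma dth_power_fixed: "conj_rho v (dth_power v) = dth_power v"
proof -
  have "v \<otimes> \<rho> 1 (nu v d) \<otimes> c 1 0 = dth_power v \<otimes> v"
    using nu_Suc[of d] nu_wrap[of 1] nu_one by simp
  then have "v \<otimes> \<rho> 1 (dth_power v) \<otimes> inv v = dth_power v \<otimes> v \<otimes> inv v"
    using c_zero(1)[of 1] by (simp add: dth_power_def m_assoc)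
  then show ?thesis by (simp add: conj_rho_def m_assoc)
qed

lemma conj_rho_dth_power:
  assumes "x \<in> carrier R"
  shows "(conj_rho v ^^ d) x = dth_power v \<otimes> x \<otimes> inv (dth_power v)"
  using rho_conj_power[of x d] assms rho_one[of x]
  by (simp add: dth_power_def inv_mult_Units m_assoc)

end

text \<open>A central element fixed by the action commutes with \<open>v u\<^sub>1\<close>.\<close>

lemma dth_power_scale:
  assumes v: "v \<in> Units R" and t: "t \<in> Units R" and tx: "\<And>x. x \<in> carrier R \<Longrightarrow> t \<otimes> x = x \<otimes> t"
    and fixed: "\<And>g. g \<in> carrier (integer_mod_group d) \<Longrightarrow> \<rho> g t = t"
  shows "dth_power (t \<otimes> v) = t [^] d \<otimes> dth_power v"
proof -
  have "nu (t \<otimes> v) m = t [^] m \<otimes> nu v m" for m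
  proof (induction m)
    case (Suc m)
    have tm: "t [^] m \<in> carrier R" using t by simp
    have "nu (t \<otimes> v) (Suc m) =
        t [^] m \<otimes> (nu v m \<otimes> t) \<otimes> \<rho> (res m) v \<otimes> c (res m) 1"
      using Suc v t tm by (simp add: fixed m_assoc)
    also have "nu v m \<otimes> t = t \<otimes> nu v m" using tx[of "nu v m"] v by simp
    finally show ?case using v t tm by (simp add: m_assoc)
  qed (use v in simp)
  then show ?thesis using v t by (simp add: dth_power_def m_assoc)
qed

end

text \<open>When \<open>\<sigma>\<close> fixes \<open>b\<close> and \<open>\<sigma>\<^sup>d\<close> is conjugation by \<open>b\<close>, the crossed product has the basis
  \<open>1, u, \<dots>, u\<^bsup>d-1\<^esup>\<close> with \<open>u x = \<sigma>(x) u\<close> and \<open>u\<^sup>d = b\<close>.\<close>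

definition std_weak_action ::
    "('a, 'x) ring_scheme \<Rightarrow> nat \<Rightarrow> ('a \<Rightarrow> 'a) \<Rightarrow> 'a \<Rightarrow> (int, 'a) weak_action" where
  "std_weak_action R d \<sigma> b =
     (\<lambda>i. \<lambda>x \<in> carrier R. (\<sigma> ^^ nat i) x, \<lambda>i j. if i + j < int d then \<one>\<^bsub>R\<^esub> else b)"

text \<open>The change of basis from \<open>u\<^sub>g\<close> to \<open>(v u\<^sub>1)\<^sup>g\<close> for \<open>0 \<le> g < d\<close>. Its coefficient is \<open>nu v g\<close>, so
  \<open>\<delta>(g)\<close> is the inverse of that.\<close>

lemma (in cyclic_weak_action) iso_std:
  assumes v [simp]: "v \<in> Units R"
  shows "weak_action_iso (integer_mod_group d) R (\<rho>, c) (std_weak_action R d (conj_rho v) (dth_power v))"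
proof -
  define \<delta> where "\<delta> g = inv (nu v (nat g))" for g
  have r: "res (nat g) = g" "g < int d" "g \<ge> 0" if "g \<in> carrier (integer_mod_group d)" for g
    using that d_ge_2 by (auto simp: carrier_integer_mod_group res_def)
  have 1: "(conj_rho v ^^ nat g) x = inv (\<delta> g) \<otimes> \<rho> g x \<otimes> \<delta> g"
    if "g \<in> carrier (integer_mod_group d)" "x \<in> carrier R" for g x
    using that rho_conj_power[OF v, of x "nat g"] by (simp add: \<delta>_def r)
  have 2: "(if g + h < int d then \<one> else dth_power v) =
      inv (\<delta> g) \<otimes> \<rho> g (inv (\<delta> h)) \<otimes> c g h \<otimes> \<delta> ((g + h) mod int d)"
    if g: "g \<in> carrier (integer_mod_group d)" and h: "h \<in> carrier (integer_mod_group d)" for g h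
  proof -
    have eq: "inv (\<delta> g) \<otimes> \<rho> g (inv (\<delta> h)) \<otimes> c g h = nu v (nat (g + h))"
      using nu_add[OF v, of "nat g" "nat h"] g h by (simp add: \<delta>_def r nat_add_distrib)
    show ?thesis
    proof (cases "g + h < int d")
      case True
      then have "(g + h) mod int d = g + h" using r(3)[OF g] r(3)[OF h] by simp
      then show ?thesis using True unfolding eq by (simp add: \<delta>_def)
    next
      case False
      have "(g + h) mod int d = g + h - int d"
        using False r(2,3)[OF g] r(2,3)[OF h] mod_pos_pos_trivial[of "g + h - int d" "int d"] by simp
      moreover have "nat (g + h) = nat (g + h - int d) + d" using False by auto
      ultimately show ?thesis using False unfolding eq by (simp add: \<delta>_def nu_wrap m_assoc)
    qed
  qed
  show ?thesis unfolding weak_action_iso_def std_weak_action_def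
    using 1 2 by (auto intro!: bexI[of _ \<delta>] simp: \<delta>_def)
qed

lemma weak_action_isoE:
  assumes "weak_action_iso G R (\<rho>, c) (\<rho>', c')"
  obtains \<delta> where "\<And>g. g \<in> carrier G \<Longrightarrow> \<delta> g \<in> Units R"
    and "\<And>g x. \<lbrakk>g \<in> carrier G; x \<in> carrier R\<rbrakk> \<Longrightarrow> \<rho>' g x = inv\<^bsub>R\<^esub> (\<delta> g) \<otimes>\<^bsub>R\<^esub> \<rho> g x \<otimes>\<^bsub>R\<^esub> \<delta> g"
    and "\<And>g h. \<lbrakk>g \<in> carrier G; h \<in> carrier G\<rbrakk> \<Longrightarrow>
      c' g h = inv\<^bsub>R\<^esub> (\<delta> g) \<otimes>\<^bsub>R\<^esub> \<rho> g (inv\<^bsub>R\<^esub> (\<delta> h)) \<otimes>\<^bsub>R\<^esub> c g h \<otimes>\<^bsub>R\<^esub> \<delta> (g \<otimes>\<^bsub>G\<^esub> h)"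
proof -
  obtain \<delta> where d: "\<delta> \<in> carrier G \<rightarrow> Units R"
    "\<forall>g \<in> carrier G. \<forall>x \<in> carrier R. \<rho>' g x = inv\<^bsub>R\<^esub> (\<delta> g) \<otimes>\<^bsub>R\<^esub> \<rho> g x \<otimes>\<^bsub>R\<^esub> \<delta> g"
    "\<forall>g \<in> carrier G. \<forall>h \<in> carrier G.
      c' g h = inv\<^bsub>R\<^esub> (\<delta> g) \<otimes>\<^bsub>R\<^esub> \<rho> g (inv\<^bsub>R\<^esub> (\<delta> h)) \<otimes>\<^bsub>R\<^esub> c g h \<otimes>\<^bsub>R\<^esub> \<delta> (g \<otimes>\<^bsub>G\<^esub> h)"
    using assms unfolding weak_action_iso_def prod.case by (elim bexE conjE) (rule that)
  show ?thesis
  proof (rule that)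
    show "\<delta> g \<in> Units R" if "g \<in> carrier G" for g using d(1) that by auto
  qed (use d(2,3) in blast)+
qed

text \<open>The form of symmetry and transitivity that compares two weak actions through a common
  normal form: \<open>\<delta>\<close> for one leg and \<open>\<eta>\<close> for the other combine to \<open>\<delta>(g) \<eta>(g)\<^sup>-\<^sup>1\<close>.\<close>

lemma weak_action_iso_euclidean:
  assumes "weak_action R G \<rho> c" "weak_action R G \<rho>' c'"
    and "weak_action_iso G R (\<rho>, c) (\<sigma>, s)" "weak_action_iso G R (\<rho>', c') (\<sigma>, s)"
  shows "weak_action_iso G R (\<rho>, c) (\<rho>', c')"
proof -
  interpret weak_action R G \<rho> c by fact
  interpret W: weak_action R G \<rho>' c' by fact
  obtain \<delta> where d: "\<And>g. g \<in> carrier G \<Longrightarrow> \<delta> g \<in> Units R"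
    "\<And>g x. \<lbrakk>g \<in> carrier G; x \<in> carrier R\<rbrakk> \<Longrightarrow> \<sigma> g x = inv\<^bsub>R\<^esub> (\<delta> g) \<otimes>\<^bsub>R\<^esub> \<rho> g x \<otimes>\<^bsub>R\<^esub> \<delta> g"
    "\<And>g h. \<lbrakk>g \<in> carrier G; h \<in> carrier G\<rbrakk> \<Longrightarrow>
      s g h = inv\<^bsub>R\<^esub> (\<delta> g) \<otimes>\<^bsub>R\<^esub> \<rho> g (inv\<^bsub>R\<^esub> (\<delta> h)) \<otimes>\<^bsub>R\<^esub> c g h \<otimes>\<^bsub>R\<^esub> \<delta> (g \<otimes>\<^bsub>G\<^esub> h)"
    by (rule weak_action_isoE[OF assms(3)]) (rule that)
  obtain \<eta> where e: "\<And>g. g \<in> carrier G \<Longrightarrow> \<eta> g \<in> Units R"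
    "\<And>g x. \<lbrakk>g \<in> carrier G; x \<in> carrier R\<rbrakk> \<Longrightarrow> \<sigma> g x = inv\<^bsub>R\<^esub> (\<eta> g) \<otimes>\<^bsub>R\<^esub> \<rho>' g x \<otimes>\<^bsub>R\<^esub> \<eta> g"
    "\<And>g h. \<lbrakk>g \<in> carrier G; h \<in> carrier G\<rbrakk> \<Longrightarrow>
      s g h = inv\<^bsub>R\<^esub> (\<eta> g) \<otimes>\<^bsub>R\<^esub> \<rho>' g (inv\<^bsub>R\<^esub> (\<eta> h)) \<otimes>\<^bsub>R\<^esub> c' g h \<otimes>\<^bsub>R\<^esub> \<eta> (g \<otimes>\<^bsub>G\<^esub> h)"
    by (rule weak_action_isoE[OF assms(4)]) (rule that)
  define \<zeta> where "\<zeta> g = \<delta> g \<otimes>\<^bsub>R\<^esub> inv\<^bsub>R\<^esub> (\<eta> g)" for g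
  have z: "\<zeta> g \<in> Units R" if "g \<in> carrier G" for g
    using that d(1) e(1) by (simp add: \<zeta>_def)
  have r: "\<rho>' g x = inv\<^bsub>R\<^esub> (\<zeta> g) \<otimes>\<^bsub>R\<^esub> \<rho> g x \<otimes>\<^bsub>R\<^esub> \<zeta> g"
    if g: "g \<in> carrier G" and x: "x \<in> carrier R" for g x
  proof -
    have "\<rho>' g x = \<eta> g \<otimes>\<^bsub>R\<^esub> (inv\<^bsub>R\<^esub> (\<eta> g) \<otimes>\<^bsub>R\<^esub> \<rho>' g x \<otimes>\<^bsub>R\<^esub> \<eta> g) \<otimes>\<^bsub>R\<^esub> inv\<^bsub>R\<^esub> (\<eta> g)"
      using g x e(1) by (simp add: m_assoc)
    also have "\<dots> = \<eta> g \<otimes>\<^bsub>R\<^esub> (inv\<^bsub>R\<^esub> (\<delta> g) \<otimes>\<^bsub>R\<^esub> \<rho> g x \<otimes>\<^bsub>R\<^esub> \<delta> g) \<otimes>\<^bsub>R\<^esub> inv\<^bsub>R\<^esub> (\<eta> g)"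
      using d(2)[OF g x] e(2)[OF g x] by simp
    finally show ?thesis using g x d(1) e(1) by (simp add: \<zeta>_def m_assoc inv_mult_Units)
  qed
  have cc: "c' g h = inv\<^bsub>R\<^esub> (\<zeta> g) \<otimes>\<^bsub>R\<^esub> \<rho> g (inv\<^bsub>R\<^esub> (\<zeta> h)) \<otimes>\<^bsub>R\<^esub> c g h \<otimes>\<^bsub>R\<^esub> \<zeta> (g \<otimes>\<^bsub>G\<^esub> h)"
    if g: "g \<in> carrier G" and h: "h \<in> carrier G" for g h
  proof -
    have gh: "g \<otimes>\<^bsub>G\<^esub> h \<in> carrier G" using g h by simp
    note U = g h gh d(1) e(1)
    have "c' g h = \<rho>' g (\<eta> h) \<otimes>\<^bsub>R\<^esub> \<eta> g \<otimes>\<^bsub>R\<^esub>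
        (inv\<^bsub>R\<^esub> (\<eta> g) \<otimes>\<^bsub>R\<^esub> \<rho>' g (inv\<^bsub>R\<^esub> (\<eta> h)) \<otimes>\<^bsub>R\<^esub> c' g h \<otimes>\<^bsub>R\<^esub> \<eta> (g \<otimes>\<^bsub>G\<^esub> h)) \<otimes>\<^bsub>R\<^esub> inv\<^bsub>R\<^esub> (\<eta> (g \<otimes>\<^bsub>G\<^esub> h))"
      using U by (simp add: m_assoc)
    also have "\<dots> = \<rho>' g (\<eta> h) \<otimes>\<^bsub>R\<^esub> \<eta> g \<otimes>\<^bsub>R\<^esub>
        (inv\<^bsub>R\<^esub> (\<delta> g) \<otimes>\<^bsub>R\<^esub> \<rho> g (inv\<^bsub>R\<^esub> (\<delta> h)) \<otimes>\<^bsub>R\<^esub> c g h \<otimes>\<^bsub>R\<^esub> \<delta> (g \<otimes>\<^bsub>G\<^esub> h)) \<otimes>\<^bsub>R\<^esub> inv\<^bsub>R\<^esub> (\<eta> (g \<otimes>\<^bsub>G\<^esub> h))"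
      using d(3)[OF g h] e(3)[OF g h] by simp
    also have "\<rho>' g (\<eta> h) = inv\<^bsub>R\<^esub> (\<zeta> g) \<otimes>\<^bsub>R\<^esub> \<rho> g (\<eta> h) \<otimes>\<^bsub>R\<^esub> \<zeta> g"
      using U by (simp add: r)
    finally show ?thesis using U by (simp add: \<zeta>_def m_assoc inv_mult_Units)
  qed
  show ?thesis unfolding weak_action_iso_def
    using z r cc by (auto intro!: bexI[of _ \<zeta>])
qed

section \<open>Outer automorphism classes\<close>

context assoc_algebra
begin

lemma alg_autoI:
  assumes "f \<in> ring_auto A" "\<And>t x. \<lbrakk>t \<in> carrier K; x \<in> carrier A\<rbrakk> \<Longrightarrow> f (t \<odot>\<^bsub>A\<^esub> x) = t \<odot>\<^bsub>A\<^esub> f x"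
  shows "f \<in> alg_auto K A"
  using assms by (auto simp: alg_auto_def alg_iso_def ring_auto_def)

lemma alg_auto_ring_auto: "f \<in> alg_auto K A \<Longrightarrow> f \<in> ring_auto A"
  by (auto simp: alg_auto_def alg_iso_def ring_auto_def)

lemmas alg_auto = ring_auto_props[OF alg_auto_ring_auto]

lemma alg_auto_smult:
  "\<lbrakk>f \<in> alg_auto K A; t \<in> carrier K; x \<in> carrier A\<rbrakk> \<Longrightarrow> f (t \<odot>\<^bsub>A\<^esub> x) = t \<odot>\<^bsub>A\<^esub> f x"
  by (auto simp: alg_auto_def alg_iso_def)

lemma alg_auto_Bij: "f \<in> alg_auto K A \<Longrightarrow> f \<in> Bij (carrier A)"
  by (simp add: alg_auto_def)

lemma alg_auto_add:
  "\<lbrakk>f \<in> alg_auto K A; x \<in> carrier A; y \<in> carrier A\<rbrakk> \<Longrightarrow> f (x \<oplus>\<^bsub>A\<^esub> y) = f x \<oplus>\<^bsub>A\<^esub> f y"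
  by (auto simp: alg_auto_def alg_iso_def intro: ring_iso_memE(3))

lemma alg_iso_restrict:
  assumes "f \<in> alg_iso K A A"
  shows "restrict f (carrier A) \<in> alg_auto K A"
proof -
  have f: "f \<in> ring_iso A A" using assms by (simp add: alg_iso_def)
  have "restrict f (carrier A) \<in> ring_iso A A"
    by (rule ring_iso_restrict[OF f]) simp
  moreover have "restrict f (carrier A) \<in> Bij (carrier A)"
    using ring_iso_memE(5)[OF f] by (simp add: Bij_def)
  ultimately show ?thesis
    using assms by (auto simp: alg_auto_def alg_iso_def)
qed

lemma alg_auto_compose:
  assumes "f \<in> alg_auto K A" "g \<in> alg_auto K A"
  shows "compose (carrier A) f g \<in> alg_auto K A"
proof -
  have B: "compose (carrier A) f g \<in> Bij (carrier A)"
    using assms by (simp add: alg_auto_Bij compose_Bij)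
  moreover have "compose (carrier A) f g \<in> ring_iso A A"
  proof (rule ring_iso_memI)
    show "bij_betw (compose (carrier A) f g) (carrier A) (carrier A)" using B by (simp add: Bij_def)
  qed (use assms in \<open>simp_all add: compose_def alg_auto alg_auto_add\<close>)
  ultimately show ?thesis
    using assms alg_auto(1) by (intro alg_autoI) (auto simp: ring_auto_def compose_def alg_auto_smult)
qed

lemma alg_auto_id: "(\<lambda>x \<in> carrier A. x) \<in> alg_auto K A"
proof (rule alg_autoI)
  have B: "(\<lambda>x \<in> carrier A. x) \<in> Bij (carrier A)" by (rule id_Bij)
  moreover have "(\<lambda>x \<in> carrier A. x) \<in> ring_iso A A"
    using B by (intro ring_iso_memI) (simp_all add: Bij_def)
  ultimately show "(\<lambda>x \<in> carrier A. x) \<in> ring_auto A" by (simp add: ring_auto_def)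
qed simp

lemma alg_auto_inv_into:
  assumes f: "f \<in> alg_auto K A"
  shows "restrict (inv_into (carrier A) f) (carrier A) \<in> alg_auto K A"
proof -
  let ?g = "inv_into (carrier A) f"
  have bij: "bij_betw f (carrier A) (carrier A)" using alg_auto(4)[OF f] .
  have g: "?g y \<in> carrier A" "f (?g y) = y" if "y \<in> carrier A" for y
    using bij that by (auto simp: bij_betw_def inv_into_into f_inv_into_f)
  have eqI: "?g y = x" if "x \<in> carrier A" "f x = y" for x y
    using bij that by (auto simp: bij_betw_def)
  have B: "restrict ?g (carrier A) \<in> Bij (carrier A)"
    using alg_auto_Bij[OF f] by (rule restrict_inv_into_Bij)
  moreover have "restrict ?g (carrier A) \<in> ring_iso A A"
  proof (rule ring_iso_memI)
    show "bij_betw (restrict ?g (carrier A)) (carrier A) (carrier A)" using B by (simp add: Bij_def)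
    show "restrict ?g (carrier A) (x \<otimes>\<^bsub>A\<^esub> y) = restrict ?g (carrier A) x \<otimes>\<^bsub>A\<^esub> restrict ?g (carrier A) y"
      if "x \<in> carrier A" "y \<in> carrier A" for x y
      using that g alg_auto(2)[OF f] by (auto intro!: eqI)
    show "restrict ?g (carrier A) (x \<oplus>\<^bsub>A\<^esub> y) = restrict ?g (carrier A) x \<oplus>\<^bsub>A\<^esub> restrict ?g (carrier A) y"
      if "x \<in> carrier A" "y \<in> carrier A" for x y
      using that g alg_auto_add[OF f] by (auto intro!: eqI)
  qed (use g eqI alg_auto(3)[OF f] in auto)
  ultimately show ?thesis
    using g by (intro alg_autoI) (auto simp: ring_auto_def alg_auto_smult[OF f] intro!: eqI)
qed

abbreviation "Aut \<equiv> alg_auto_group K A"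

lemma Aut_simps [simp]: "carrier Aut = alg_auto K A" "\<one>\<^bsub>Aut\<^esub> = (\<lambda>x \<in> carrier A. x)"
  "\<lbrakk>f \<in> alg_auto K A; g \<in> alg_auto K A\<rbrakk> \<Longrightarrow> f \<otimes>\<^bsub>Aut\<^esub> g = compose (carrier A) f g"
  by (auto simp: alg_auto_group_def BijGroup_def alg_auto_Bij)

lemma subgroup_alg_auto: "subgroup (alg_auto K A) (BijGroup (carrier A))"
proof (rule subgroup.intro)
  show "f \<otimes>\<^bsub>BijGroup (carrier A)\<^esub> g \<in> alg_auto K A"
    if "f \<in> alg_auto K A" "g \<in> alg_auto K A" for f g
    using that Aut_simps(3)[OF that] alg_auto_compose[OF that] by (simp add: alg_auto_group_def)
  show "inv\<^bsub>BijGroup (carrier A)\<^esub> f \<in> alg_auto K A" if "f \<in> alg_auto K A" for f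
    using that by (simp only: inv_BijGroup alg_auto_Bij alg_auto_inv_into)
qed (auto simp: BijGroup_def alg_auto_Bij alg_auto_id)

lemma group_Aut: "group Aut"
  unfolding alg_auto_group_def
  by (rule subgroup.subgroup_is_group[OF subgroup_alg_auto group_BijGroup])

definition inn :: "'c \<Rightarrow> 'c \<Rightarrow> 'c" where
  "inn a = (\<lambda>x \<in> carrier A. inv\<^bsub>A\<^esub> a \<otimes>\<^bsub>A\<^esub> x \<otimes>\<^bsub>A\<^esub> a)"

lemma inner_auto_eq: "inner_auto A = inn ` Units A"
  by (auto simp: inner_auto_def inn_def)

lemma inn_compose:
  assumes "a \<in> Units A" "b \<in> Units A"
  shows "compose (carrier A) (inn a) (inn b) = inn (b \<otimes>\<^bsub>A\<^esub> a)"
proof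
  fix x show "compose (carrier A) (inn a) (inn b) x = inn (b \<otimes>\<^bsub>A\<^esub> a) x"
    using assms by (cases "x \<in> carrier A") (simp_all add: compose_def inn_def m_assoc inv_mult_Units)
qed

lemma inn_one: "inn \<one>\<^bsub>A\<^esub> = (\<lambda>x \<in> carrier A. x)"
  by (auto simp: inn_def)

lemma inn_alg_auto:
  assumes a: "a \<in> Units A"
  shows "inn a \<in> alg_auto K A"
proof (rule alg_autoI)
  have 1: "inn (inv\<^bsub>A\<^esub> a) (inn a x) = x" "inn a (inn (inv\<^bsub>A\<^esub> a) x) = x" if "x \<in> carrier A" for x
    using a that by (simp_all add: inn_def m_assoc)
  have "bij_betw (inn a) (carrier A) (carrier A)"
    using 1 a by (intro bij_betwI[of _ _ _ "inn (inv\<^bsub>A\<^esub> a)"]) (auto simp: inn_def)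
  moreover have "inn a \<in> ring_iso A A"
  proof (rule ring_iso_memI)
  qed (use a calculation in \<open>auto simp: inn_def m_assoc l_distr r_distr\<close>)
  ultimately show "inn a \<in> ring_auto A" by (simp add: ring_auto_def Bij_def inn_def)
qed (use a in \<open>simp add: inn_def smult_mult_left smult_mult_right\<close>)

lemma normal_inner_auto: "inner_auto A \<lhd> Aut"
proof (rule group.normal_invI[OF group_Aut])
  interpret Aut: group Aut by (rule group_Aut)
  show "subgroup (inner_auto A) Aut"
  proof (rule Aut.subgroupI)
    show "inv\<^bsub>Aut\<^esub> f \<in> inner_auto A" if "f \<in> inner_auto A" for f
    proof -
      from that obtain a where a: "a \<in> Units A" "f = inn a" by (auto simp: inner_auto_eq)
      then have "inv\<^bsub>Aut\<^esub> f = inn (inv\<^bsub>A\<^esub> a)"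
        by (intro Aut.inv_equality) (auto simp: inn_alg_auto inn_compose inn_one)
      then show ?thesis using a by (auto simp: inner_auto_eq)
    qed
  qed (auto simp: inner_auto_eq inn_alg_auto inn_compose)
  fix f h assume f: "f \<in> carrier Aut" and h: "h \<in> inner_auto A"
  then obtain a where a: "a \<in> Units A" "h = inn a" by (auto simp: inner_auto_eq)
  have "f \<otimes>\<^bsub>Aut\<^esub> h = inn (f a) \<otimes>\<^bsub>Aut\<^esub> f"
    using a f alg_auto(5)[of f a]
    by (auto simp: inn_alg_auto) (auto simp: compose_def alg_auto inn_def fun_eq_iff)
  then have "f \<otimes>\<^bsub>Aut\<^esub> h \<otimes>\<^bsub>Aut\<^esub> inv\<^bsub>Aut\<^esub> f = inn (f a)"
    using f a inn_alg_auto alg_auto(5)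
    by (metis Aut.inv_solve_right' Aut_simps(1) Aut.m_closed)
  then show "f \<otimes>\<^bsub>Aut\<^esub> h \<otimes>\<^bsub>Aut\<^esub> inv\<^bsub>Aut\<^esub> f \<in> inner_auto A"
    using f a alg_auto(5) by (auto simp: inner_auto_eq)
qed

lemma outer_class_eq_iff:
  assumes s: "\<sigma> \<in> alg_auto K A" and t: "\<tau> \<in> alg_auto K A"
  shows "outer_class K A \<sigma> = outer_class K A \<tau> \<longleftrightarrow>
    (\<exists>u \<in> Units A. \<forall>x \<in> carrier A. \<tau> x = inv\<^bsub>A\<^esub> u \<otimes>\<^bsub>A\<^esub> \<sigma> x \<otimes>\<^bsub>A\<^esub> u)"
proof -
  interpret N: normal "inner_auto A" Aut by (rule normal_inner_auto)
  have "outer_class K A \<sigma> = outer_class K A \<tau> \<longleftrightarrow> \<tau> \<in> outer_class K A \<sigma>"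
    unfolding outer_class_def using assms N.subgroup_axioms
    by (metis Aut_simps(1) N.rcos_self N.repr_independence)
  also have "\<dots> \<longleftrightarrow> (\<exists>u \<in> Units A. \<tau> = inn u \<otimes>\<^bsub>Aut\<^esub> \<sigma>)"
    by (auto simp: outer_class_def r_coset_def inner_auto_eq)
  also have "\<dots> \<longleftrightarrow> (\<exists>u \<in> Units A. \<forall>x \<in> carrier A. \<tau> x = inv\<^bsub>A\<^esub> u \<otimes>\<^bsub>A\<^esub> \<sigma> x \<otimes>\<^bsub>A\<^esub> u)"
  proof (rule bex_cong[OF refl])
    fix u assume u: "u \<in> Units A"
    have "\<tau> = compose (carrier A) (inn u) \<sigma> \<longleftrightarrow> (\<forall>x \<in> carrier A. \<tau> x = inn u (\<sigma> x))"
      using alg_auto_Bij[OF t] by (auto simp: compose_def Bij_def extensional_def fun_eq_iff)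
    also have "\<dots> \<longleftrightarrow> (\<forall>x \<in> carrier A. \<tau> x = inv\<^bsub>A\<^esub> u \<otimes>\<^bsub>A\<^esub> \<sigma> x \<otimes>\<^bsub>A\<^esub> u)"
      using alg_auto(1)[OF s] by (simp add: inn_def)
    finally show "\<tau> = inn u \<otimes>\<^bsub>Aut\<^esub> \<sigma> \<longleftrightarrow> (\<forall>x \<in> carrier A. \<tau> x = inv\<^bsub>A\<^esub> u \<otimes>\<^bsub>A\<^esub> \<sigma> x \<otimes>\<^bsub>A\<^esub> u)"
      using u s by (simp add: inn_alg_auto)
  qed
  finally show ?thesis .
qed

lemma group_Out: "group (outer_auto_group K A)"
  unfolding outer_auto_group_def by (rule normal.factorgroup_is_group[OF normal_inner_auto])

lemma carrier_Out: "carrier (outer_auto_group K A) = outer_class K A ` alg_auto K A"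
  by (auto simp: outer_auto_group_def FactGroup_def RCOSETS_def outer_class_def)

lemma outer_class_mult:
  assumes "\<sigma> \<in> alg_auto K A" "\<tau> \<in> alg_auto K A"
  shows "outer_class K A \<sigma> \<otimes>\<^bsub>outer_auto_group K A\<^esub> outer_class K A \<tau> = outer_class K A (\<sigma> \<otimes>\<^bsub>Aut\<^esub> \<tau>)"
  unfolding outer_auto_group_def FactGroup_def outer_class_def
  using normal.rcos_sum[OF normal_inner_auto, of \<sigma> \<tau>] assms by (simp del: Aut_simps(3))

lemma outer_class_inv:
  assumes "\<sigma> \<in> alg_auto K A"
  shows "inv\<^bsub>outer_auto_group K A\<^esub> (outer_class K A \<sigma>) = outer_class K A (inv\<^bsub>Aut\<^esub> \<sigma>)"
proof -
  have "inner_auto A #>\<^bsub>Aut\<^esub> \<sigma> \<in> carrier (Aut Mod inner_auto A)"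
    using assms by (auto simp: FactGroup_def RCOSETS_def)
  then show ?thesis
    unfolding outer_auto_group_def outer_class_def
    using normal.inv_FactGroup[OF normal_inner_auto] normal.rcos_inv[OF normal_inner_auto, of \<sigma>] assms
    by (metis Aut_simps(1))
qed

end

section \<open>Classification of weak actions of a cyclic group\<close>

lemma conj_class_eq_iff:
  assumes "group G" "x \<in> carrier G" "x' \<in> carrier G"
  shows "conj_class G x = conj_class G x' \<longleftrightarrow> (\<exists>y \<in> carrier G. x' = y \<otimes>\<^bsub>G\<^esub> x \<otimes>\<^bsub>G\<^esub> inv\<^bsub>G\<^esub> y)"
proof -
  interpret G: group G by fact
  have self: "x' \<in> conj_class G x'"
    unfolding conj_class_def using assms by (intro CollectI exI[of _ "\<one>\<^bsub>G\<^esub>"]) simp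
  have sub: "conj_class G (y \<otimes>\<^bsub>G\<^esub> z \<otimes>\<^bsub>G\<^esub> inv\<^bsub>G\<^esub> y) \<subseteq> conj_class G z"
    if "y \<in> carrier G" "z \<in> carrier G" for y z
  proof
    fix v assume "v \<in> conj_class G (y \<otimes>\<^bsub>G\<^esub> z \<otimes>\<^bsub>G\<^esub> inv\<^bsub>G\<^esub> y)"
    then obtain w where "w \<in> carrier G" "v = w \<otimes>\<^bsub>G\<^esub> (y \<otimes>\<^bsub>G\<^esub> z \<otimes>\<^bsub>G\<^esub> inv\<^bsub>G\<^esub> y) \<otimes>\<^bsub>G\<^esub> inv\<^bsub>G\<^esub> w"
      by (auto simp: conj_class_def)
    then have "w \<otimes>\<^bsub>G\<^esub> y \<in> carrier G" "v = w \<otimes>\<^bsub>G\<^esub> y \<otimes>\<^bsub>G\<^esub> z \<otimes>\<^bsub>G\<^esub> inv\<^bsub>G\<^esub> (w \<otimes>\<^bsub>G\<^esub> y)"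
      using that by (simp_all add: G.inv_mult_group G.m_assoc)
    then show "v \<in> conj_class G z" unfolding conj_class_def by blast
  qed
  show ?thesis
  proof
    assume "conj_class G x = conj_class G x'"
    then show "\<exists>y \<in> carrier G. x' = y \<otimes>\<^bsub>G\<^esub> x \<otimes>\<^bsub>G\<^esub> inv\<^bsub>G\<^esub> y"
      using self by (auto simp: conj_class_def)
  next
    assume "\<exists>y \<in> carrier G. x' = y \<otimes>\<^bsub>G\<^esub> x \<otimes>\<^bsub>G\<^esub> inv\<^bsub>G\<^esub> y"
    then obtain y where y: "y \<in> carrier G" "x' = y \<otimes>\<^bsub>G\<^esub> x \<otimes>\<^bsub>G\<^esub> inv\<^bsub>G\<^esub> y" by blast
    have "x = inv\<^bsub>G\<^esub> y \<otimes>\<^bsub>G\<^esub> x' \<otimes>\<^bsub>G\<^esub> inv\<^bsub>G\<^esub> (inv\<^bsub>G\<^esub> y)"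
      unfolding y(2) using y(1) assms by (simp add: G.m_assoc)
    then show "conj_class G x = conj_class G x'"
      using sub[of y x] sub[of "inv\<^bsub>G\<^esub> y" x'] y assms by (metis G.inv_closed equalityI)
  qed
qed

text \<open>A complete invariant identifies the classes with its values. All three correspondences are
  obtained in this way, which also gives the values of the bijections on classes.\<close>

lemma quotient_invariant:
  assumes "\<And>x y. \<lbrakk>x \<in> S; y \<in> S\<rbrakk> \<Longrightarrow> P x y \<longleftrightarrow> f x = f y"
  shows "\<exists>\<Phi>. bij_betw \<Phi> (S // rel_on S P) (f ` S) \<and> (\<forall>x \<in> S. \<Phi> (rel_on S P `` {x}) = f x)"
proof -
  have cls: "rel_on S P `` {x} = {y \<in> S. f y = f x}" if "x \<in> S" for x
    using that assms by (auto simp: rel_on_def)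
  define \<Phi> where "\<Phi> C = f (SOME x. x \<in> C)" for C
  have val: "\<Phi> (rel_on S P `` {x}) = f x" if "x \<in> S" for x
  proof -
    have "(SOME y. y \<in> {y \<in> S. f y = f x}) \<in> {y \<in> S. f y = f x}"
      using that by (intro someI[of "\<lambda>y. y \<in> {y \<in> S. f y = f x}"]) auto
    then show ?thesis by (simp add: \<Phi>_def cls[OF that])
  qed
  have "bij_betw \<Phi> (S // rel_on S P) (f ` S)"
    unfolding bij_betw_def
  proof
    show "inj_on \<Phi> (S // rel_on S P)"
    proof (rule inj_onI)
      fix C D assume "C \<in> S // rel_on S P" "D \<in> S // rel_on S P" and eq: "\<Phi> C = \<Phi> D"
      then obtain x y where "x \<in> S" "C = rel_on S P `` {x}" "y \<in> S" "D = rel_on S P `` {y}"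
        by (auto elim!: quotientE)
      then show "C = D" using eq by (simp add: val) (simp add: cls)
    qed
    show "\<Phi> ` (S // rel_on S P) = f ` S"
      by (auto simp: quotient_def val image_iff)
  qed
  then show ?thesis using val by blast
qed

locale central_algebra_with_roots = assoc_algebra +
  fixes d :: nat
  assumes field: "field K" and center: "center_is_base K A" and d_ge_2: "d \<ge> 2"
    and roots: "\<forall>t \<in> carrier K. \<exists>s \<in> carrier K. s [^]\<^bsub>K\<^esub> d = t"
begin

lemma linear_weak_actionD:
  assumes "(\<rho>, c) \<in> linear_weak_actions (integer_mod_group d) K A"
  shows "cyclic_weak_action A d \<rho> c" "\<And>g. g \<in> carrier (integer_mod_group d) \<Longrightarrow> \<rho> g \<in> alg_auto K A"
  using assms d_ge_2 ring_axioms
  by (auto simp: linear_weak_actions_def cyclic_weak_action_def weak_action_def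
    weak_action_axioms_def cyclic_weak_action_axioms_def)

lemma scalar_mult:
  assumes "s \<in> carrier K" "t \<in> carrier K"
  shows "(s \<odot>\<^bsub>A\<^esub> \<one>\<^bsub>A\<^esub>) \<otimes>\<^bsub>A\<^esub> (t \<odot>\<^bsub>A\<^esub> \<one>\<^bsub>A\<^esub>) = (s \<otimes>\<^bsub>K\<^esub> t) \<odot>\<^bsub>A\<^esub> \<one>\<^bsub>A\<^esub>"
  using assms by (simp add: smult_mult_left smult_assoc1)

lemma scalar_power:
  assumes "s \<in> carrier K"
  shows "(s \<odot>\<^bsub>A\<^esub> \<one>\<^bsub>A\<^esub>) [^]\<^bsub>A\<^esub> (n::nat) = (s [^]\<^bsub>K\<^esub> n) \<odot>\<^bsub>A\<^esub> \<one>\<^bsub>A\<^esub>"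
proof (induction n)
  case 0
  then show ?case by simp
next
  case (Suc n)
  then show ?case using assms scalar_mult[of "s [^]\<^bsub>K\<^esub> n" s] by simp
qed

lemma scalar_fixed:
  assumes "\<sigma> \<in> alg_auto K A" "s \<in> carrier K"
  shows "\<sigma> (s \<odot>\<^bsub>A\<^esub> \<one>\<^bsub>A\<^esub>) = s \<odot>\<^bsub>A\<^esub> \<one>\<^bsub>A\<^esub>"
  using assms by (simp add: alg_auto_smult alg_auto(3))

text \<open>A central unit is a scalar, and so is a \<open>d\<close>-th root of it. Scalars are central, are fixed by
  all \<open>k\<close>-linear automorphisms, and divide their powers.\<close>

lemma central_root:
  assumes z: "z \<in> Units A" and comm: "\<And>x. x \<in> carrier A \<Longrightarrow> z \<otimes>\<^bsub>A\<^esub> x = x \<otimes>\<^bsub>A\<^esub> z"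
  obtains t where "t \<in> Units A" "\<And>x. x \<in> carrier A \<Longrightarrow> t \<otimes>\<^bsub>A\<^esub> x = x \<otimes>\<^bsub>A\<^esub> t"
    "\<And>\<sigma>. \<sigma> \<in> alg_auto K A \<Longrightarrow> \<sigma> t = t" "t [^]\<^bsub>A\<^esub> d = z"
proof -
  interpret K: field K by (rule field)
  have "z \<in> center A" using z comm by (simp add: center_def)
  then obtain s where s: "s \<in> carrier K" "z = s \<odot>\<^bsub>A\<^esub> \<one>\<^bsub>A\<^esub>"
    using center by (auto simp: center_is_base_def bij_betw_def)
  obtain r where r: "r \<in> carrier K" "r [^]\<^bsub>K\<^esub> d = s" using roots s by blast
  let ?t = "r \<odot>\<^bsub>A\<^esub> \<one>\<^bsub>A\<^esub>"
  have td: "?t [^]\<^bsub>A\<^esub> d = z" using r s by (simp add: scalar_power)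
  have tx: "?t \<otimes>\<^bsub>A\<^esub> x = x \<otimes>\<^bsub>A\<^esub> ?t" if "x \<in> carrier A" for x
    using that r by (simp add: smult_mult_left smult_mult_right)
  have tc: "?t \<in> carrier A" using r by simp
  obtain e where e: "d = Suc e" using d_ge_2 by (cases d) auto
  have te: "?t [^]\<^bsub>A\<^esub> e \<in> carrier A" using tc by simp
  have "?t \<otimes>\<^bsub>A\<^esub> (?t [^]\<^bsub>A\<^esub> e \<otimes>\<^bsub>A\<^esub> inv\<^bsub>A\<^esub> z) = \<one>\<^bsub>A\<^esub>"
  proof -
    have "?t \<otimes>\<^bsub>A\<^esub> (?t [^]\<^bsub>A\<^esub> e \<otimes>\<^bsub>A\<^esub> inv\<^bsub>A\<^esub> z) = (?t [^]\<^bsub>A\<^esub> e \<otimes>\<^bsub>A\<^esub> ?t) \<otimes>\<^bsub>A\<^esub> inv\<^bsub>A\<^esub> z"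
      using m_assoc[OF tc te, of "inv\<^bsub>A\<^esub> z"] tx[OF te] z by simp
    also have "\<dots> = \<one>\<^bsub>A\<^esub>" using td z unfolding e by simp
    finally show ?thesis .
  qed
  moreover have "?t [^]\<^bsub>A\<^esub> e \<otimes>\<^bsub>A\<^esub> inv\<^bsub>A\<^esub> z \<in> carrier A" using te z by simp
  ultimately have "?t \<in> Units A" using tx tc by (metis UnitsI)
  then show ?thesis using that td tx scalar_fixed r by blast
qed

text \<open>
  Let \<open>\<rho>'(1)(x) = v \<rho>(1)(x) v\<^sup>-\<^sup>1\<close>. Then \<open>v u\<^sub>1\<close> and \<open>u'\<^sub>1\<close> induce the same automorphism of \<open>A\<close>. Their
  \<open>d\<close>-th powers \<open>b\<close> and \<open>b'\<close> therefore induce the same inner automorphism and differ by a central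
  unit \<open>z = b' b\<^sup>-\<^sup>1\<close>. With \<open>t\<^sup>d = z\<close> the elements \<open>t v u\<^sub>1\<close> and \<open>u'\<^sub>1\<close> lead to the same normal form.
\<close>

lemma weak_action_iso_iff:
  assumes w: "(\<rho>, c) \<in> linear_weak_actions (integer_mod_group d) K A"
    and w': "(\<rho>', c') \<in> linear_weak_actions (integer_mod_group d) K A"
  shows "weak_action_iso (integer_mod_group d) A (\<rho>, c) (\<rho>', c') \<longleftrightarrow>
    outer_class K A (\<rho> 1) = outer_class K A (\<rho>' 1)"
proof -
  interpret W: cyclic_weak_action A d \<rho> c using linear_weak_actionD(1)[OF w] .
  interpret W': cyclic_weak_action A d \<rho>' c' using linear_weak_actionD(1)[OF w'] .
  have one: "1 \<in> carrier (integer_mod_group d)" by simp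
  note iff = outer_class_eq_iff[OF linear_weak_actionD(2)[OF w one] linear_weak_actionD(2)[OF w' one]]
  show ?thesis
  proof
    assume "weak_action_iso (integer_mod_group d) A (\<rho>, c) (\<rho>', c')"
    then show "outer_class K A (\<rho> 1) = outer_class K A (\<rho>' 1)"
      unfolding iff by (rule weak_action_isoE) (use one in blast)
  next
    assume "outer_class K A (\<rho> 1) = outer_class K A (\<rho>' 1)"
    then obtain u where u: "u \<in> Units A"
      "\<And>x. x \<in> carrier A \<Longrightarrow> \<rho>' 1 x = inv\<^bsub>A\<^esub> u \<otimes>\<^bsub>A\<^esub> \<rho> 1 x \<otimes>\<^bsub>A\<^esub> u"
      unfolding iff by blast
    define v where "v = inv\<^bsub>A\<^esub> u"
    have v [simp]: "v \<in> Units A" using u by (simp add: v_def)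
    define b b' where "b = W.dth_power v" and "b' = W'.dth_power \<one>\<^bsub>A\<^esub>"
    have bU: "b \<in> Units A" "b' \<in> Units A" by (simp_all add: b_def b'_def)
    have cl: "x \<in> carrier A \<Longrightarrow> W.conj_rho v x \<in> carrier A" for x
      by (simp add: W.conj_rho_def)
    have conj: "x \<in> carrier A \<Longrightarrow> W'.conj_rho \<one>\<^bsub>A\<^esub> x = W.conj_rho v x" for x
      using u by (simp add: W.conj_rho_def W'.conj_rho_def v_def)
    have pow: "x \<in> carrier A \<Longrightarrow> (W'.conj_rho \<one>\<^bsub>A\<^esub> ^^ n) x = (W.conj_rho v ^^ n) x \<and>
        (W.conj_rho v ^^ n) x \<in> carrier A" for x n
      by (induction n) (simp_all add: conj cl)
    have bb: "b \<otimes>\<^bsub>A\<^esub> x \<otimes>\<^bsub>A\<^esub> inv\<^bsub>A\<^esub> b = b' \<otimes>\<^bsub>A\<^esub> x \<otimes>\<^bsub>A\<^esub> inv\<^bsub>A\<^esub> b'" if "x \<in> carrier A" for x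
      using W.conj_rho_dth_power[OF v that] W'.conj_rho_dth_power[OF Units_one_closed that] pow[OF that, of d]
      by (simp add: b_def b'_def)
    define z where "z = b' \<otimes>\<^bsub>A\<^esub> inv\<^bsub>A\<^esub> b"
    have zU: "z \<in> Units A" using bU by (simp add: z_def)
    have zx: "z \<otimes>\<^bsub>A\<^esub> x = x \<otimes>\<^bsub>A\<^esub> z" if x: "x \<in> carrier A" for x
    proof -
      define y where "y = inv\<^bsub>A\<^esub> b \<otimes>\<^bsub>A\<^esub> x \<otimes>\<^bsub>A\<^esub> b"
      have y: "y \<in> carrier A" "x = b \<otimes>\<^bsub>A\<^esub> y \<otimes>\<^bsub>A\<^esub> inv\<^bsub>A\<^esub> b" using bU x by (simp_all add: y_def m_assoc)
      then have x': "x = b' \<otimes>\<^bsub>A\<^esub> y \<otimes>\<^bsub>A\<^esub> inv\<^bsub>A\<^esub> b'" using bb by simp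
      have "z \<otimes>\<^bsub>A\<^esub> x = b' \<otimes>\<^bsub>A\<^esub> y \<otimes>\<^bsub>A\<^esub> inv\<^bsub>A\<^esub> b"
        using bU y(1) unfolding y(2) z_def by (simp add: m_assoc)
      also have "\<dots> = x \<otimes>\<^bsub>A\<^esub> z" using bU y(1) unfolding x' z_def by (simp add: m_assoc)
      finally show ?thesis .
    qed
    obtain t where t: "t \<in> Units A" "\<And>x. x \<in> carrier A \<Longrightarrow> t \<otimes>\<^bsub>A\<^esub> x = x \<otimes>\<^bsub>A\<^esub> t"
      "\<And>\<sigma>. \<sigma> \<in> alg_auto K A \<Longrightarrow> \<sigma> t = t" "t [^]\<^bsub>A\<^esub> d = z"
      by (rule central_root[OF zU zx]) (assumption, rule that)
    have tv: "t \<otimes>\<^bsub>A\<^esub> v \<in> Units A" using t(1) by simp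
    have tw: "W.dth_power (t \<otimes>\<^bsub>A\<^esub> v) = W'.dth_power \<one>\<^bsub>A\<^esub>"
    proof -
      have "W.dth_power (t \<otimes>\<^bsub>A\<^esub> v) = z \<otimes>\<^bsub>A\<^esub> b"
        unfolding b_def t(4)[symmetric]
        by (rule W.dth_power_scale[OF v t(1,2)]) (use t(3) linear_weak_actionD(2)[OF w] in auto)
      also have "\<dots> = b'" using bU by (simp add: z_def m_assoc)
      finally show ?thesis by (simp add: b'_def)
    qed
    have conj': "W.conj_rho (t \<otimes>\<^bsub>A\<^esub> v) x = W'.conj_rho \<one>\<^bsub>A\<^esub> x" if x: "x \<in> carrier A" for x
    proof -
      have "W.conj_rho (t \<otimes>\<^bsub>A\<^esub> v) x = t \<otimes>\<^bsub>A\<^esub> W.conj_rho v x \<otimes>\<^bsub>A\<^esub> inv\<^bsub>A\<^esub> t"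
        using t(1) x by (simp add: W.conj_rho_def inv_mult_Units m_assoc)
      also have "\<dots> = W.conj_rho v x \<otimes>\<^bsub>A\<^esub> t \<otimes>\<^bsub>A\<^esub> inv\<^bsub>A\<^esub> t" using t(2)[OF cl[OF x]] by simp
      finally show ?thesis using t(1) cl[OF x] x by (simp add: m_assoc conj)
    qed
    have pow': "x \<in> carrier A \<Longrightarrow> (W.conj_rho (t \<otimes>\<^bsub>A\<^esub> v) ^^ n) x = (W'.conj_rho \<one>\<^bsub>A\<^esub> ^^ n) x" for x n
      by (induction n) (simp_all add: conj' pow)
    have std: "std_weak_action A d (W.conj_rho (t \<otimes>\<^bsub>A\<^esub> v)) b'' =
        std_weak_action A d (W'.conj_rho \<one>\<^bsub>A\<^esub>) b''" for b''
      by (auto simp: std_weak_action_def pow' fun_eq_iff)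
    show "weak_action_iso (integer_mod_group d) A (\<rho>, c) (\<rho>', c')"
    proof (rule weak_action_iso_euclidean)
      let ?s = "std_weak_action A d (W'.conj_rho \<one>\<^bsub>A\<^esub>) (W'.dth_power \<one>\<^bsub>A\<^esub>)"
      show "weak_action_iso (integer_mod_group d) A (\<rho>, c) (fst ?s, snd ?s)"
        using W.iso_std[OF tv] by (simp only: std tw prod.collapse)
      show "weak_action_iso (integer_mod_group d) A (\<rho>', c') (fst ?s, snd ?s)"
        using W'.iso_std[OF Units_one_closed] by (simp only: prod.collapse)
    qed unfold_locales
  qed
qed

lemma funpow_alg_auto:
  assumes "\<sigma> \<in> alg_auto K A"
  shows "restrict (\<sigma> ^^ n) (carrier A) \<in> alg_auto K A"
proof (induction n)
  case 0
  then show ?case using alg_auto_id by (simp add: restrict_def)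
next
  case (Suc n)
  have eq: "restrict (\<sigma> ^^ Suc n) (carrier A) = compose (carrier A) \<sigma> (restrict (\<sigma> ^^ n) (carrier A))"
    by (auto simp: compose_def)
  show ?case unfolding eq by (rule alg_auto_compose[OF assms Suc])
qed

text \<open>The multiplication of the basis \<open>1, u, \<dots>, u\<^bsup>d-1\<^esup>\<close> is consistent: both sides of the cocycle
  identity are the power of \<open>b\<close> that counts how often \<open>i + j + l\<close> passes \<open>d\<close>, as \<open>\<sigma>\<close> fixes \<open>b\<close>.\<close>

lemma std_weak_action_linear:
  assumes s: "\<sigma> \<in> alg_auto K A" and b: "b \<in> Units A" and sb: "\<sigma> b = b"
    and sd: "\<And>x. x \<in> carrier A \<Longrightarrow> (\<sigma> ^^ d) x = b \<otimes>\<^bsub>A\<^esub> x \<otimes>\<^bsub>A\<^esub> inv\<^bsub>A\<^esub> b"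
  shows "std_weak_action A d \<sigma> b \<in> linear_weak_actions (integer_mod_group d) K A"
proof -
  let ?Z = "integer_mod_group d"
  obtain \<rho> c where std: "std_weak_action A d \<sigma> b = (\<rho>, c)" by (cases "std_weak_action A d \<sigma> b")
  have r: "\<rho> i x = (\<sigma> ^^ nat i) x" if "x \<in> carrier A" for i x
    using std that by (auto simp: std_weak_action_def)
  have c: "c i j = (if i + j < int d then \<one>\<^bsub>A\<^esub> else b)" for i j
    using std by (auto simp: std_weak_action_def)
  have ra: "\<rho> i \<in> alg_auto K A" for i
    using std funpow_alg_auto[OF s, of "nat i"] by (auto simp: std_weak_action_def)
  have cU: "c i j \<in> Units A" for i j using b by (simp add: c)
  have cl: "(\<sigma> ^^ n) x \<in> carrier A" if "x \<in> carrier A" for x n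
    using that alg_auto(1)[OF s] by (induction n) auto
  have nb: "(\<sigma> ^^ n) b = b" "(\<sigma> ^^ n) \<one>\<^bsub>A\<^esub> = \<one>\<^bsub>A\<^esub>" for n
    using alg_auto(3)[OF s] by (induction n) (simp_all add: sb)
  have md: "(i + j) mod int d = (if i + j < int d then i + j else i + j - int d)" "0 \<le> i" "i < int d"
    if "i \<in> carrier ?Z" "j \<in> carrier ?Z" for i j
    using that d_ge_2 mod_pos_pos_trivial[of "i + j - int d" "int d"]
    by (auto simp: carrier_integer_mod_group)
  have mult: "\<rho> ((i + j) mod int d) x = inv\<^bsub>A\<^esub> (c i j) \<otimes>\<^bsub>A\<^esub> \<rho> i (\<rho> j x) \<otimes>\<^bsub>A\<^esub> c i j"
    if i: "i \<in> carrier ?Z" and j: "j \<in> carrier ?Z" and x: "x \<in> carrier A" for i j x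
  proof -
    have ij: "\<rho> i (\<rho> j x) = (\<sigma> ^^ nat (i + j)) x"
      using x md(2)[OF i j] md(2)[OF j i] cl by (simp add: r nat_add_distrib funpow_add)
    show ?thesis
    proof (cases "i + j < int d")
      case True
      then show ?thesis unfolding ij md(1)[OF i j] using x by (simp add: r c cl)
    next
      case False
      then have "nat (i + j) = d + nat (i + j - int d)" by auto
      then have "\<rho> i (\<rho> j x) = b \<otimes>\<^bsub>A\<^esub> (\<sigma> ^^ nat (i + j - int d)) x \<otimes>\<^bsub>A\<^esub> inv\<^bsub>A\<^esub> b"
        using x by (simp add: ij funpow_add sd cl)
      moreover have "(\<sigma> ^^ nat (i + j - int d)) x \<in> carrier A" using cl x by simp
      ultimately show ?thesis unfolding md(1)[OF i j] r[OF x] using False b by (simp add: c m_assoc)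
    qed
  qed
  have coc: "c i j \<otimes>\<^bsub>A\<^esub> c ((i + j) mod int d) l = \<rho> i (c j l) \<otimes>\<^bsub>A\<^esub> c i ((j + l) mod int d)"
    if i: "i \<in> carrier ?Z" and j: "j \<in> carrier ?Z" and l: "l \<in> carrier ?Z" for i j l
  proof -
    have "\<rho> i (c j l) = c j l" using b by (auto simp: c r nb)
    then show ?thesis using md(2,3)[OF i j] md(2,3)[OF j l] md(2,3)[OF l i] b
      unfolding md(1)[OF i j] md(1)[OF j l] by (auto simp: c)
  qed
  show ?thesis unfolding std
    using mult coc ra cU alg_auto_ring_auto by (simp add: linear_weak_actions_def is_weak_action_def)
qed

text \<open>The witness of \<open>d\<close>-compatibility is \<open>a = b\<^sup>-\<^sup>1\<close> with \<open>b = u\<^sub>1\<^sup>d\<close>: it conjugates by \<open>a\<^sup>-\<^sup>1 x a\<close>,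
  the \<open>d\<close>-th power by \<open>b x b\<^sup>-\<^sup>1\<close>.\<close>

lemma compatible_outer_image:
  "(\<lambda>(\<rho>, c). outer_class K A (\<rho> 1)) ` linear_weak_actions (integer_mod_group d) K A
    = compatible_outer K A d"
proof (intro equalityI subsetI)
  fix C assume "C \<in> (\<lambda>(\<rho>, c). outer_class K A (\<rho> 1)) ` linear_weak_actions (integer_mod_group d) K A"
  then obtain \<rho> c where w: "(\<rho>, c) \<in> linear_weak_actions (integer_mod_group d) K A"
    "C = outer_class K A (\<rho> 1)" by auto
  interpret W: cyclic_weak_action A d \<rho> c using linear_weak_actionD(1)[OF w(1)] .
  have conj: "x \<in> carrier A \<Longrightarrow> W.conj_rho \<one>\<^bsub>A\<^esub> x = \<rho> 1 x" for x
    by (simp add: W.conj_rho_def)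
  have pow: "x \<in> carrier A \<Longrightarrow> (W.conj_rho \<one>\<^bsub>A\<^esub> ^^ n) x = (\<rho> 1 ^^ n) x \<and> (\<rho> 1 ^^ n) x \<in> carrier A" for x n
    by (induction n) (simp_all add: conj)
  let ?b = "W.dth_power \<one>\<^bsub>A\<^esub>"
  have "compatible A d (\<rho> 1)"
    unfolding compatible_def
  proof (intro bexI conjI ballI)
    show "\<rho> 1 (inv\<^bsub>A\<^esub> ?b) = inv\<^bsub>A\<^esub> ?b"
      using W.dth_power_fixed[OF Units_one_closed] conj[of ?b] by simp
    show "(\<rho> 1 ^^ d) x = inv\<^bsub>A\<^esub> (inv\<^bsub>A\<^esub> ?b) \<otimes>\<^bsub>A\<^esub> x \<otimes>\<^bsub>A\<^esub> inv\<^bsub>A\<^esub> ?b" if "x \<in> carrier A" for x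
      using W.conj_rho_dth_power[OF Units_one_closed that] pow[OF that, of d] by simp
  qed simp
  then show "C \<in> compatible_outer K A d"
    using w(2) linear_weak_actionD(2)[OF w(1), of 1] by (auto simp: compatible_outer_def)
next
  fix C assume "C \<in> compatible_outer K A d"
  then obtain \<sigma> a where s: "C = outer_class K A \<sigma>" "\<sigma> \<in> alg_auto K A" "a \<in> Units A" "\<sigma> a = a"
    "\<And>x. x \<in> carrier A \<Longrightarrow> (\<sigma> ^^ d) x = inv\<^bsub>A\<^esub> a \<otimes>\<^bsub>A\<^esub> x \<otimes>\<^bsub>A\<^esub> a"
    by (auto simp: compatible_outer_def compatible_def)
  have "std_weak_action A d \<sigma> (inv\<^bsub>A\<^esub> a) \<in> linear_weak_actions (integer_mod_group d) K A"
    by (rule std_weak_action_linear) (use s alg_auto(6)[OF s(2,3)] in auto)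
  moreover have "fst (std_weak_action A d \<sigma> (inv\<^bsub>A\<^esub> a)) 1 = \<sigma>"
    using alg_auto_Bij[OF s(2)] by (auto simp: std_weak_action_def Bij_def fun_eq_iff extensional_def)
  ultimately show "C \<in> (\<lambda>(\<rho>, c). outer_class K A (\<rho> 1)) ` linear_weak_actions (integer_mod_group d) K A"
    using s(1) by (auto simp: case_prod_unfold intro!: image_eqI)
qed

text \<open>An algebra isomorphism may take any values outside the carrier, but a member of the
  automorphism group may not; this is why \<open>\<phi>\<close> is a restriction of \<open>f\<close>.\<close>

lemma transport_linear:
  assumes f: "f \<in> alg_iso K A A" and w: "(\<rho>, c) \<in> linear_weak_actions (integer_mod_group d) K A"
    and \<phi>: "\<phi> = restrict f (carrier A)" and w': "(\<rho>', c') = transport_weak_action A A f (\<rho>, c)"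
  shows "(\<rho>', c') \<in> linear_weak_actions (integer_mod_group d) K A"
    and "g \<in> carrier (integer_mod_group d) \<Longrightarrow> \<rho>' g = \<phi> \<otimes>\<^bsub>Aut\<^esub> \<rho> g \<otimes>\<^bsub>Aut\<^esub> inv\<^bsub>Aut\<^esub> \<phi>"
proof -
  let ?Z = "integer_mod_group d"
  interpret W: cyclic_weak_action A d \<rho> c using linear_weak_actionD(1)[OF w] .
  interpret Aut: group Aut by (rule group_Aut)
  have p: "\<phi> \<in> alg_auto K A" unfolding \<phi> by (rule alg_iso_restrict[OF f])
  note phi = alg_auto[OF p]
  define \<psi> where "\<psi> = inv_into (carrier A) f"
  have bij: "bij_betw f (carrier A) (carrier A)" using f by (auto simp: alg_iso_def ring_iso_memE(5))
  have psi: "\<psi> x \<in> carrier A" "f (\<psi> x) = x" "\<psi> (f x) = x" if "x \<in> carrier A" for x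
    using bij that by (auto simp: \<psi>_def bij_betw_def inv_into_into f_inv_into_f)
  have inv: "inv\<^bsub>Aut\<^esub> \<phi> = restrict \<psi> (carrier A)"
  proof (rule Aut.inv_equality)
    have "restrict (inv_into (carrier A) \<phi>) (carrier A) = restrict \<psi> (carrier A)"
      by (auto simp: \<phi> \<psi>_def inv_into_def fun_eq_iff intro!: arg_cong[of _ _ Eps])
    then have "restrict \<psi> (carrier A) \<in> alg_auto K A" using alg_auto_inv_into[OF p] by simp
    then show "restrict \<psi> (carrier A) \<in> carrier Aut"
      "restrict \<psi> (carrier A) \<otimes>\<^bsub>Aut\<^esub> \<phi> = \<one>\<^bsub>Aut\<^esub>"
      using p phi(1) psi by (auto simp: compose_def \<phi> fun_eq_iff)
  qed (use p in simp)
  have r': "\<rho>' g = (\<lambda>y \<in> carrier A. f (\<rho> g (\<psi> y)))" and c': "c' g h = f (c g h)" for g h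
    using w' by (auto simp: transport_weak_action_def \<psi>_def)
  show *: "\<rho>' g = \<phi> \<otimes>\<^bsub>Aut\<^esub> \<rho> g \<otimes>\<^bsub>Aut\<^esub> inv\<^bsub>Aut\<^esub> \<phi>" if g: "g \<in> carrier ?Z" for g
  proof -
    have "inv\<^bsub>Aut\<^esub> \<phi> \<in> alg_auto K A" using Aut.inv_closed[of \<phi>] p by simp
    then have "\<phi> \<otimes>\<^bsub>Aut\<^esub> \<rho> g \<otimes>\<^bsub>Aut\<^esub> inv\<^bsub>Aut\<^esub> \<phi> =
        compose (carrier A) (compose (carrier A) \<phi> (\<rho> g)) (restrict \<psi> (carrier A))"
      using p linear_weak_actionD(2)[OF w g] by (simp add: alg_auto_compose inv)
    also have "\<dots> = \<rho>' g"
    proof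
      fix x show "compose (carrier A) (compose (carrier A) \<phi> (\<rho> g)) (restrict \<psi> (carrier A)) x = \<rho>' g x"
        using psi(1)[of x] alg_auto(1)[OF linear_weak_actionD(2)[OF w g], of "\<psi> x"]
        by (cases "x \<in> carrier A") (simp_all add: compose_def r' \<phi>)
    qed
    finally show ?thesis by simp
  qed
  have ra: "\<rho>' g \<in> alg_auto K A" if "g \<in> carrier ?Z" for g
    using p linear_weak_actionD(2)[OF w that] Aut.inv_closed[of \<phi>] Aut.m_closed unfolding *[OF that] by (metis Aut_simps(1))
  have fp: "f x = \<phi> x" "\<psi> (\<phi> x) = x" if "x \<in> carrier A" for x using that psi(3) by (simp_all add: \<phi>)
  have c': "c' g h = \<phi> (c g h)" if "g \<in> carrier ?Z" "h \<in> carrier ?Z" for g h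
    unfolding c' using that by (intro fp(1)) simp
  have r': "\<rho>' g x = \<phi> (\<rho> g (\<psi> x))" if "g \<in> carrier ?Z" "x \<in> carrier A" for g x
    unfolding r' using that psi(1)[OF that(2)] W.rho(1) fp(1) by simp
  have "is_weak_action ?Z A (\<rho>', c')"
    unfolding is_weak_action_def prod.case
  proof (intro conjI ballI)
    show "\<rho>' \<in> carrier ?Z \<rightarrow> ring_auto A" using ra alg_auto_ring_auto by blast
    show "c' \<in> carrier ?Z \<rightarrow> carrier ?Z \<rightarrow> Units A" using phi(5) by (simp add: c')
  next
    fix g h x assume g: "g \<in> carrier ?Z" and h: "h \<in> carrier ?Z" and x: "x \<in> carrier A"
    have gh: "g \<otimes>\<^bsub>?Z\<^esub> h \<in> carrier ?Z" by (rule W.G.m_closed[OF g h])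
    have "\<rho>' (g \<otimes>\<^bsub>?Z\<^esub> h) x = \<phi> (inv\<^bsub>A\<^esub> (c g h) \<otimes>\<^bsub>A\<^esub> \<rho> g (\<rho> h (\<psi> x)) \<otimes>\<^bsub>A\<^esub> c g h)"
      unfolding r'[OF gh x] W.rho_mult[OF g h psi(1)[OF x]] ..
    also have "\<dots> = inv\<^bsub>A\<^esub> (\<phi> (c g h)) \<otimes>\<^bsub>A\<^esub> \<phi> (\<rho> g (\<rho> h (\<psi> x))) \<otimes>\<^bsub>A\<^esub> \<phi> (c g h)"
      using g h psi(1)[OF x] by (simp add: phi)
    also have "\<phi> (\<rho> g (\<rho> h (\<psi> x))) = \<rho>' g (\<rho>' h x)"
      using g h x psi(1)[OF x] by (simp add: r' phi(1) fp(2))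
    finally show "\<rho>' (g \<otimes>\<^bsub>?Z\<^esub> h) x = inv\<^bsub>A\<^esub> (c' g h) \<otimes>\<^bsub>A\<^esub> \<rho>' g (\<rho>' h x) \<otimes>\<^bsub>A\<^esub> c' g h"
      by (simp only: c'[OF g h])
  next
    fix g h l assume g: "g \<in> carrier ?Z" and h: "h \<in> carrier ?Z" and l: "l \<in> carrier ?Z"
    have gh: "g \<otimes>\<^bsub>?Z\<^esub> h \<in> carrier ?Z" and hl: "h \<otimes>\<^bsub>?Z\<^esub> l \<in> carrier ?Z"
      using W.G.m_closed g h l by auto
    have "\<phi> (c g h \<otimes>\<^bsub>A\<^esub> c (g \<otimes>\<^bsub>?Z\<^esub> h) l) = \<phi> (\<rho> g (c h l) \<otimes>\<^bsub>A\<^esub> c g (h \<otimes>\<^bsub>?Z\<^esub> l))"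
      using W.cocycle[OF g h l] by simp
    moreover have "\<rho>' g (\<phi> (c h l)) = \<phi> (\<rho> g (c h l))"
      using g h l by (simp add: r' phi(1) fp(2))
    ultimately show "c' g h \<otimes>\<^bsub>A\<^esub> c' (g \<otimes>\<^bsub>?Z\<^esub> h) l = \<rho>' g (c' h l) \<otimes>\<^bsub>A\<^esub> c' g (h \<otimes>\<^bsub>?Z\<^esub> l)"
      unfolding c'[OF g h] c'[OF gh l] c'[OF h l] c'[OF g hl]
      using phi(2)[OF W.c_closed[OF g h] W.c_closed[OF gh l]]
        phi(2)[OF W.rho(1)[OF g W.c_closed[OF h l]] W.c_closed[OF g hl]] by argo
  qed
  then show "(\<rho>', c') \<in> linear_weak_actions ?Z K A"
    using ra by (auto simp: linear_weak_actions_def)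
qed

text \<open>By \<open>transport_linear\<close> and \<open>weak_action_iso_iff\<close>, an equivalence along \<open>\<phi>\<close> exists exactly when
  the class of \<open>\<phi> \<rho>(1) \<phi>\<^sup>-\<^sup>1\<close> is the class of \<open>\<rho>'(1)\<close>.\<close>

lemma crossed_system_equiv_iff:
  assumes w: "(\<rho>, c) \<in> linear_weak_actions (integer_mod_group d) K A"
    and w': "(\<rho>', c') \<in> linear_weak_actions (integer_mod_group d) K A"
  shows "crossed_system_equiv (integer_mod_group d) K (A, (\<rho>, c)) (A, (\<rho>', c')) \<longleftrightarrow>
    conj_class (outer_auto_group K A) (outer_class K A (\<rho> 1)) =
    conj_class (outer_auto_group K A) (outer_class K A (\<rho>' 1))"
proof -
  let ?Z = "integer_mod_group d" and ?O = "outer_auto_group K A"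
  have one: "1 \<in> carrier ?Z" using d_ge_2 by simp
  interpret Aut: group Aut by (rule group_Aut)
  have r: "\<rho> 1 \<in> alg_auto K A" "\<rho>' 1 \<in> alg_auto K A" using linear_weak_actionD(2) w w' one by auto
  have O: "outer_class K A f \<otimes>\<^bsub>?O\<^esub> outer_class K A (\<rho> 1) \<otimes>\<^bsub>?O\<^esub> inv\<^bsub>?O\<^esub> (outer_class K A f) =
      outer_class K A (f \<otimes>\<^bsub>Aut\<^esub> \<rho> 1 \<otimes>\<^bsub>Aut\<^esub> inv\<^bsub>Aut\<^esub> f)" if f: "f \<in> alg_auto K A" for f
  proof -
    have "inv\<^bsub>Aut\<^esub> f \<in> alg_auto K A" "f \<otimes>\<^bsub>Aut\<^esub> \<rho> 1 \<in> alg_auto K A"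
      using Aut.inv_closed[of f] Aut.m_closed[of f "\<rho> 1"] f r by simp_all
    then show ?thesis using f r by (simp add: outer_class_mult outer_class_inv del: Aut_simps(3))
  qed
  have eq: "weak_action_iso ?Z A (transport_weak_action A A f (\<rho>, c)) (\<rho>', c') \<longleftrightarrow>
      outer_class K A (\<phi> \<otimes>\<^bsub>Aut\<^esub> \<rho> 1 \<otimes>\<^bsub>Aut\<^esub> inv\<^bsub>Aut\<^esub> \<phi>) = outer_class K A (\<rho>' 1)"
    if f: "f \<in> alg_iso K A A" and \<phi>: "\<phi> = restrict f (carrier A)" for f \<phi>
  proof -
    obtain \<rho>1 c1 where t: "(\<rho>1, c1) = transport_weak_action A A f (\<rho>, c)"
      by (metis surj_pair)
    show ?thesis
      using weak_action_iso_iff[OF transport_linear(1)[OF f w \<phi> t] w'] transport_linear(2)[OF f w \<phi> t one]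
      by (simp add: t)
  qed
  have "crossed_system_equiv ?Z K (A, (\<rho>, c)) (A, (\<rho>', c')) \<longleftrightarrow>
      (\<exists>f \<in> alg_iso K A A. weak_action_iso ?Z A (transport_weak_action A A f (\<rho>, c)) (\<rho>', c'))"
    by (simp add: crossed_system_equiv_def)
  also have "\<dots> \<longleftrightarrow> (\<exists>\<phi> \<in> alg_auto K A.
      outer_class K A (\<phi> \<otimes>\<^bsub>Aut\<^esub> \<rho> 1 \<otimes>\<^bsub>Aut\<^esub> inv\<^bsub>Aut\<^esub> \<phi>) = outer_class K A (\<rho>' 1))"
  proof
    assume "\<exists>f \<in> alg_iso K A A. weak_action_iso ?Z A (transport_weak_action A A f (\<rho>, c)) (\<rho>', c')"
    then show "\<exists>\<phi> \<in> alg_auto K A.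
        outer_class K A (\<phi> \<otimes>\<^bsub>Aut\<^esub> \<rho> 1 \<otimes>\<^bsub>Aut\<^esub> inv\<^bsub>Aut\<^esub> \<phi>) = outer_class K A (\<rho>' 1)"
      using eq alg_iso_restrict by blast
  next
    assume "\<exists>\<phi> \<in> alg_auto K A.
        outer_class K A (\<phi> \<otimes>\<^bsub>Aut\<^esub> \<rho> 1 \<otimes>\<^bsub>Aut\<^esub> inv\<^bsub>Aut\<^esub> \<phi>) = outer_class K A (\<rho>' 1)"
    then obtain \<phi> where p: "\<phi> \<in> alg_auto K A"
      "outer_class K A (\<phi> \<otimes>\<^bsub>Aut\<^esub> \<rho> 1 \<otimes>\<^bsub>Aut\<^esub> inv\<^bsub>Aut\<^esub> \<phi>) = outer_class K A (\<rho>' 1)" by blast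
    moreover have "\<phi> \<in> alg_iso K A A" "\<phi> = restrict \<phi> (carrier A)"
      using p(1) by (auto simp: alg_auto_def Bij_def extensional_restrict)
    ultimately show "\<exists>f \<in> alg_iso K A A. weak_action_iso ?Z A (transport_weak_action A A f (\<rho>, c)) (\<rho>', c')"
      using eq by blast
  qed
  also have "\<dots> \<longleftrightarrow> (\<exists>y \<in> carrier ?O. outer_class K A (\<rho>' 1) =
      y \<otimes>\<^bsub>?O\<^esub> outer_class K A (\<rho> 1) \<otimes>\<^bsub>?O\<^esub> inv\<^bsub>?O\<^esub> y)"
    unfolding carrier_Out using O by fastforce
  also have "\<dots> \<longleftrightarrow> conj_class ?O (outer_class K A (\<rho> 1)) = conj_class ?O (outer_class K A (\<rho>' 1))"
    using r by (intro conj_class_eq_iff[symmetric] group_Out) (auto simp: carrier_Out)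
  finally show ?thesis .
qed

end

section \<open>Strongly pi-regular rings\<close>

text \<open>Strong \<open>\<pi>\<close>-regularity (the powers of every element stabilise up to a commuting factor) is
  the one finiteness property of \<open>A\<close> that the module theory below rests on. It provides the Fitting
  decomposition with respect to an element and makes one-sided inverses two-sided.\<close>

locale pi_regular_ring = ring +
  assumes pi_regular: "x \<in> carrier R \<Longrightarrow>
    \<exists>(n::nat) y. y \<in> carrier R \<and> x \<otimes> y = y \<otimes> x \<and> x [^] n = x [^] Suc n \<otimes> y"
begin

lemma pow_comm:
  assumes "x \<in> carrier R" "y \<in> carrier R" "x \<otimes> y = y \<otimes> x"
  shows "x [^] (n::nat) \<otimes> y = y \<otimes> x [^] n"
  by (induction n) (use assms in \<open>simp_all add: m_assoc, simp flip: m_assoc\<close>)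

text \<open>Iterating \<open>x\<^sup>n = x\<^bsup>n+1\<^esup> y\<close> gives \<open>x\<^sup>n = x\<^bsup>2n\<^esup> y\<^sup>n\<close>, so that \<open>x\<^sup>n y\<^sup>n\<close> is an idempotent with
  \<open>x\<^sup>n\<close> invertible on its image. For an exponent that is certainly positive, \<open>n + 1\<close> is used.\<close>

lemma idempotent_power:
  assumes x: "x \<in> carrier R"
  obtains n :: nat and z where "0 < n" "z \<in> carrier R" "x \<otimes> z = z \<otimes> x"
    "x [^] n \<otimes> (x [^] n \<otimes> z) = x [^] n"
proof -
  obtain n :: nat and y where y: "y \<in> carrier R" "x \<otimes> y = y \<otimes> x" "x [^] n = x [^] Suc n \<otimes> y"
    using pi_regular[OF x] by blast
  have xn: "x [^] m \<in> carrier R" "y [^] m \<in> carrier R" for m :: nat using x y by simp_all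
  have step: "x [^] Suc n = x [^] Suc (Suc n) \<otimes> y"
  proof -
    have "x [^] Suc n = x [^] Suc n \<otimes> (y \<otimes> x)" using y(1,3) x xn
      by (metis m_assoc nat_pow_Suc)
    also have "\<dots> = x [^] Suc (Suc n) \<otimes> y" using x y(1) xn by (simp add: m_assoc flip: y(2))
    finally show ?thesis .
  qed
  let ?N = "Suc n"
  have it: "x [^] ?N = x [^] (?N + m) \<otimes> y [^] m" for m :: nat
  proof (induction m)
    case 0
    show ?case using x by simp
  next
    case (Suc m)
    have "x [^] (?N + m) = x [^] (?N + Suc m) \<otimes> y"
    proof -
      have "x [^] (?N + m) = x [^] m \<otimes> x [^] ?N" unfolding nat_pow_mult[OF x] by (simp add: add.commute)
      also have "\<dots> = x [^] m \<otimes> (x [^] Suc (Suc n) \<otimes> y)" using step by simp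
      also have "\<dots> = (x [^] m \<otimes> x [^] Suc (Suc n)) \<otimes> y"
        by (rule m_assoc[symmetric]) (use x y xn in auto)
      also have "x [^] m \<otimes> x [^] Suc (Suc n) = x [^] (?N + Suc m)"
        unfolding nat_pow_mult[OF x] by (simp add: add.commute)
      finally show ?thesis .
    qed
    then have "x [^] ?N = x [^] (?N + Suc m) \<otimes> y \<otimes> y [^] m" using Suc by simp
    also have "\<dots> = x [^] (?N + Suc m) \<otimes> (y \<otimes> y [^] m)"
      by (rule m_assoc) (use x y xn in auto)
    also have "y \<otimes> y [^] m = y [^] Suc m" using y(1) by (simp add: pow_comm)
    finally show ?case .
  qed
  have comm: "x \<otimes> y [^] ?N = y [^] ?N \<otimes> x" using pow_comm[of y x] x y by metis
  have "x [^] ?N \<otimes> (x [^] ?N \<otimes> y [^] ?N) = (x [^] ?N \<otimes> x [^] ?N) \<otimes> y [^] ?N"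
    by (rule m_assoc[symmetric]) (rule xn)+
  also have "\<dots> = x [^] ?N" using it[of ?N] unfolding nat_pow_mult[OF x] by simp
  finally show ?thesis by (rule that[OF zero_less_Suc xn(2) comm])
qed

text \<open>If \<open>c a = 1\<close>, then \<open>c\<^sup>n\<close> cancels \<open>a\<^sup>n\<close> in \<open>a\<^sup>n = a\<^bsup>n+1\<^esup> y\<close> and leaves \<open>1 = a y\<close>.\<close>

lemma left_inverse_imp_right_inverse:
  assumes a: "a \<in> carrier R" and c: "c \<in> carrier R" and ca: "c \<otimes> a = \<one>"
  shows "a \<otimes> c = \<one>"
proof -
  obtain n :: nat and y where y: "y \<in> carrier R" "a \<otimes> y = y \<otimes> a" "a [^] n = a [^] Suc n \<otimes> y"
    using pi_regular[OF a] by blast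
  have inv: "c [^] m \<otimes> a [^] m = \<one>" for m :: nat
  proof (induction m)
    case (Suc m)
    have "c [^] Suc m \<otimes> a [^] Suc m = c [^] m \<otimes> (c \<otimes> (a \<otimes> a [^] m))"
      unfolding nat_pow_Suc2[OF a] using a c by (simp add: m_assoc)
    also have "c \<otimes> (a \<otimes> a [^] m) = a [^] m" using a c ca by (simp flip: m_assoc)
    finally show ?case using Suc by simp
  qed simp
  have "\<one> = c [^] n \<otimes> (a [^] Suc n \<otimes> y)" unfolding y(3)[symmetric] using inv[of n] by simp
  also have "\<dots> = (c [^] n \<otimes> a [^] n) \<otimes> (a \<otimes> y)" using a c y(1) by (simp add: m_assoc)
  finally have ay: "a \<otimes> y = \<one>" using inv[of n] a y(1) by simp
  then have "c = y" using ca a c y(1) by (metis m_assoc l_one r_one)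
  then show ?thesis using ay by simp
qed

end

section \<open>Primitive idempotents have local corners\<close>

context ring
begin

lemma minus_distr:
  assumes "x \<in> carrier R" "y \<in> carrier R" "z \<in> carrier R"
  shows "(x \<ominus> y) \<otimes> z = x \<otimes> z \<ominus> y \<otimes> z" "z \<otimes> (x \<ominus> y) = z \<otimes> x \<ominus> z \<otimes> y"
  using assms by (simp_all add: a_minus_def l_distr r_distr l_minus r_minus)

lemma add_minus_cancel:
  assumes "x \<in> carrier R" "y \<in> carrier R"
  shows "y \<oplus> (x \<ominus> y) = x" "(x \<oplus> y) \<ominus> x = y"
  using assms by (simp_all add: a_minus_def a_comm[of x "\<ominus> y"] a_comm[of "x \<oplus> y" "\<ominus> x"] r_neg1 r_neg2)

lemma minus_minus_cancel:
  assumes "x \<in> carrier R" "y \<in> carrier R" "z \<in> carrier R"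
  shows "(x \<ominus> y) \<oplus> (y \<ominus> z) = x \<ominus> z"
  using assms by (simp add: a_minus_def a_assoc r_neg1)

lemma idempotent_complement:
  assumes "e \<in> carrier R" "e \<otimes> e = e" "g \<in> carrier R" "g \<otimes> g = g" "e \<otimes> g = g" "g \<otimes> e = g"
  shows "idempotent R g" "idempotent R (e \<ominus> g)" "orthogonal R g (e \<ominus> g)" "e = g \<oplus> (e \<ominus> g)"
proof -
  have z: "g \<ominus> g = \<zero>" using assms(3) by (simp add: a_minus_def r_neg)
  have z0: "(e \<ominus> g) \<ominus> \<zero> = e \<ominus> g" using assms by (simp add: a_minus_def)
  show "idempotent R g" using assms by (simp add: idempotent_def)
  show "orthogonal R g (e \<ominus> g)" using assms by (simp add: orthogonal_def minus_distr z)
  have "(e \<ominus> g) \<otimes> (e \<ominus> g) = e \<otimes> (e \<ominus> g) \<ominus> g \<otimes> (e \<ominus> g)"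
    using assms by (intro minus_distr(1)) auto
  then show "idempotent R (e \<ominus> g)" using assms by (simp add: idempotent_def minus_distr(2) z z0)
  show "e = g \<oplus> (e \<ominus> g)" using assms by (simp add: add_minus_cancel)
qed

definition corner :: "'a \<Rightarrow> 'a set" where
  "corner e = {x \<in> carrier R. e \<otimes> x = x \<and> x \<otimes> e = x}"

text \<open>In the corner \<open>eRe\<close> of a primitive idempotent, a right inverse is a two-sided one; see
  \<open>corner_inverse_comm\<close>.\<close>

definition corner_invertible :: "'a \<Rightarrow> 'a \<Rightarrow> bool" where
  "corner_invertible e x \<longleftrightarrow> (\<exists>y \<in> corner e. x \<otimes> y = e)"

lemma cornerI:
  "\<lbrakk>e \<in> carrier R; e \<otimes> e = e; x \<in> carrier R\<rbrakk> \<Longrightarrow> e \<otimes> x \<otimes> e \<in> corner e"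
  by (simp add: corner_def m_assoc) (simp flip: m_assoc)

lemma corner_closed: "x \<in> corner e \<Longrightarrow> x \<in> carrier R"
  by (simp add: corner_def)

lemma corner_unit: "x \<in> corner e \<Longrightarrow> e \<otimes> x = x" "x \<in> corner e \<Longrightarrow> x \<otimes> e = x"
  by (simp_all add: corner_def)

lemma corner_mult:
  assumes "e \<in> carrier R" "x \<in> corner e" "y \<in> corner e" shows "x \<otimes> y \<in> corner e"
proof -
  have "e \<otimes> (x \<otimes> y) = e \<otimes> x \<otimes> y" "x \<otimes> y \<otimes> e = x \<otimes> (y \<otimes> e)"
    using assms by (simp_all add: m_assoc corner_closed)
  then show ?thesis using assms unfolding corner_def by simp
qed

lemma corner_add:
  assumes "e \<in> carrier R" "x \<in> corner e" "y \<in> corner e" shows "x \<oplus> y \<in> corner e"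
  using assms by (simp add: corner_def l_distr r_distr)

lemma corner_uminus:
  assumes "e \<in> carrier R" "x \<in> corner e" shows "\<ominus> x \<in> corner e"
  using assms by (simp add: corner_def l_minus r_minus)

lemma corner_minus:
  assumes "e \<in> carrier R" "x \<in> corner e" "y \<in> corner e" shows "x \<ominus> y \<in> corner e"
  unfolding a_minus_def using assms by (intro corner_add corner_uminus)

lemma corner_self: "\<lbrakk>e \<in> carrier R; e \<otimes> e = e\<rbrakk> \<Longrightarrow> e \<in> corner e"
  by (simp add: corner_def)

text \<open>The partial sums of the geometric series. They invert \<open>e - x\<close> in the corner when \<open>x\<close> is
  nilpotent.\<close>

lemma corner_geometric:
  assumes e: "e \<in> carrier R" "e \<otimes> e = e" and x: "x \<in> corner e"
  shows "\<exists>y \<in> corner e. (e \<ominus> x) \<otimes> y = e \<ominus> x [^] Suc n"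
proof (induction n)
  note [simp] = corner_closed[OF x]
  case 0
  show ?case using corner_minus[OF e(1) corner_self[OF e] x] corner_self[OF e] x
    by (intro bexI[of _ e]) (simp_all add: corner_unit)
next
  note [simp] = corner_closed[OF x]
  case (Suc n)
  then obtain y where y: "y \<in> corner e" "(e \<ominus> x) \<otimes> y = e \<ominus> x [^] Suc n" by blast
  have xc: "x [^] Suc m \<in> corner e" for m :: nat
    by (induction m) (use x e in \<open>auto intro: corner_mult\<close>)
  have "x \<otimes> x [^] Suc n = x [^] Suc n \<otimes> x"
    using x by (metis corner_closed nat_pow_Suc2 nat_pow_Suc)
  then have "(e \<ominus> x) \<otimes> x [^] Suc n = x [^] Suc n \<ominus> x [^] Suc (Suc n)"
    using x e corner_closed[OF xc[of n]] corner_unit(1)[OF xc[of n]]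
    by (simp only: minus_distr corner_closed) simp
  then have "(e \<ominus> x) \<otimes> (y \<oplus> x [^] Suc n) = (e \<ominus> x [^] Suc n) \<oplus> (x [^] Suc n \<ominus> x [^] Suc (Suc n))"
    using y x e corner_closed[OF xc[of n]] corner_closed[OF y(1)] by (simp del: nat_pow_Suc add: r_distr)
  also have "\<dots> = e \<ominus> x [^] Suc (Suc n)"
    by (rule minus_minus_cancel[OF e(1) corner_closed[OF xc] corner_closed[OF xc]])
  finally show ?case using y(1) xc[of n] e by (blast intro: corner_add)
qed

end

context pi_regular_ring
begin

text \<open>Fitting's lemma. A power \<open>w\<close> of \<open>x\<close> is invertible on the image of an idempotent \<open>g = w z\<close> and
  vanishes off it. Primitivity leaves \<open>g = 0\<close>, where \<open>x\<close> is nilpotent, and \<open>g = e\<close>, where \<open>x\<close> is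
  invertible.\<close>

lemma corner_local:
  assumes e: "primitive_idempotent R e" and x: "x \<in> corner e"
  shows "corner_invertible e x \<or> corner_invertible e (e \<ominus> x)"
proof -
  have e': "e \<in> carrier R" "e \<otimes> e = e" "e \<noteq> \<zero>"
    using e by (auto simp: primitive_idempotent_def idempotent_def)
  have xc: "x \<in> carrier R" using x by (rule corner_closed)
  obtain n :: nat and z where z: "0 < n" "z \<in> carrier R" "x \<otimes> z = z \<otimes> x" "x [^] n \<otimes> (x [^] n \<otimes> z) = x [^] n"
    by (rule idempotent_power[OF xc]) (rule that)
  obtain m where m: "n = Suc m" using z(1) by (cases n) auto
  define w where "w = x [^] n"
  have wcar: "w \<in> carrier R" using xc by (simp add: w_def)
  have xpow: "x [^] Suc m \<in> corner e" for m :: nat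
    by (induction m) (use x xc e' in \<open>auto intro: corner_mult\<close>)
  have w: "w \<in> corner e" using xpow by (simp add: w_def m)
  have wz: "w \<otimes> z = z \<otimes> w" unfolding w_def by (rule pow_comm) (use xc z in auto)
  define g where "g = w \<otimes> z"
  have gc: "g \<in> carrier R" using wcar z(2) by (simp add: g_def)
  have wg: "w \<otimes> g = w" using z(4) by (simp add: w_def g_def)
  have "g \<otimes> g = z \<otimes> (w \<otimes> g)" using wcar z(2) gc by (simp add: g_def wz m_assoc)
  then have gg: "g \<otimes> g = g" unfolding wg by (simp add: g_def wz)
  have ge: "e \<otimes> g = g" using corner_unit(1)[OF w] wcar z(2) e' by (simp add: g_def flip: m_assoc)
  have "g \<otimes> e = z \<otimes> (w \<otimes> e)" using wcar z(2) e' by (simp add: g_def wz m_assoc)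
  then have eg: "g \<otimes> e = g" using corner_unit(2)[OF w] by (simp add: g_def wz)
  note h = idempotent_complement[OF e'(1,2) gc gg ge eg]
  then have "g = \<zero> \<or> e \<ominus> g = \<zero>"
    using e unfolding primitive_idempotent_def by blast
  then show ?thesis
  proof
    assume "g = \<zero>"
    then have "w = \<zero>" using wg wcar by simp
    then have "x [^] Suc m = \<zero>" by (simp add: w_def m)
    then show ?thesis
      using corner_geometric[OF e'(1,2) x, of m] e'(1)
      unfolding corner_invertible_def by (simp add: a_minus_def del: nat_pow_Suc)
  next
    assume "e \<ominus> g = \<zero>"
    then have "e = g" using h(4) gc by simp
    moreover have "g = x \<otimes> (x [^] m \<otimes> z)"
      unfolding g_def w_def m nat_pow_Suc2[OF xc] using xc z(2) by (simp add: m_assoc)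
    ultimately have xe: "x \<otimes> (x [^] m \<otimes> z) = e" by simp
    let ?y = "e \<otimes> (x [^] m \<otimes> z) \<otimes> e"
    have "x \<otimes> ?y = (x \<otimes> e) \<otimes> (x [^] m \<otimes> z) \<otimes> e" using xc z(2) e' by (simp add: m_assoc)
    also have "\<dots> = e" using corner_unit(2)[OF x] xe e' by simp
    finally have "x \<otimes> ?y = e" .
    moreover have "?y \<in> corner e" using e' xc z(2) by (intro cornerI) auto
    ultimately show ?thesis unfolding corner_invertible_def by blast
  qed
qed

text \<open>The product \<open>b a\<close> is an idempotent in \<open>fRf\<close>, and it is not zero because \<open>e = a (b a) b\<close>.\<close>

lemma corner_inverse_comm:
  assumes e: "primitive_idempotent R e" and f: "primitive_idempotent R f"
    and a: "a \<in> carrier R" "e \<otimes> a = a" "a \<otimes> f = a" and b: "b \<in> carrier R" "f \<otimes> b = b" "b \<otimes> e = b"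
    and ab: "a \<otimes> b = e"
  shows "b \<otimes> a = f"
proof -
  have e': "e \<in> carrier R" "e \<otimes> e = e" "e \<noteq> \<zero>" and f': "f \<in> carrier R" "f \<otimes> f = f"
    using e f by (auto simp: primitive_idempotent_def idempotent_def)
  define g where "g = b \<otimes> a"
  have gc: "g \<in> carrier R" using a b by (simp add: g_def)
  have "g \<otimes> g = b \<otimes> (a \<otimes> b) \<otimes> a" using a(1) b(1) by (simp add: g_def m_assoc)
  then have gg: "g \<otimes> g = g" unfolding ab b(3) by (simp add: g_def)
  have "f \<otimes> g = f \<otimes> b \<otimes> a" "g \<otimes> f = b \<otimes> (a \<otimes> f)"
    using a(1) b(1) f'(1) by (simp_all add: g_def m_assoc)
  then have fg: "f \<otimes> g = g" "g \<otimes> f = g" using a(3) b(2) by (simp_all add: g_def)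
  note h = idempotent_complement[OF f' gc gg fg]
  then have "g = \<zero> \<or> f \<ominus> g = \<zero>"
    using f unfolding primitive_idempotent_def by blast
  moreover have "g \<noteq> \<zero>"
  proof
    assume "g = \<zero>"
    have "e = (a \<otimes> b) \<otimes> (a \<otimes> b)" unfolding ab e'(2) ..
    also have "\<dots> = a \<otimes> g \<otimes> b" using a(1) b(1) by (simp add: g_def m_assoc)
    finally show False using \<open>g = \<zero>\<close> a(1) b(1) e'(3) by simp
  qed
  ultimately show ?thesis using h(4) gc by (simp add: g_def)
qed

text \<open>Normalise the sum to \<open>e\<close> by its inverse \<open>v\<close> and apply \<open>corner_local\<close> to \<open>x v\<close>.\<close>

lemma corner_invertible_add:
  assumes e: "primitive_idempotent R e" and x: "x \<in> corner e" and y: "y \<in> corner e"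
    and xy: "corner_invertible e (x \<oplus> y)"
  shows "corner_invertible e x \<or> corner_invertible e y"
proof -
  have e': "e \<in> carrier R" "e \<otimes> e = e" "e \<noteq> \<zero>"
    using e by (auto simp: primitive_idempotent_def idempotent_def)
  obtain v where v: "v \<in> corner e" "(x \<oplus> y) \<otimes> v = e" using xy unfolding corner_invertible_def by blast
  note [simp] = corner_closed[OF x] corner_closed[OF y] corner_closed[OF v(1)]
  have xv: "x \<otimes> v \<in> corner e" "y \<otimes> v \<in> corner e" using e' x y v by (auto intro: corner_mult)
  have "e \<ominus> x \<otimes> v = y \<otimes> v"
    unfolding v(2)[symmetric] using x y v(1) xv by (simp add: l_distr add_minus_cancel)
  then have "corner_invertible e (x \<otimes> v) \<or> corner_invertible e (y \<otimes> v)"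
    using corner_local[OF e xv(1)] by simp
  moreover have "corner_invertible e s" if "corner_invertible e (s \<otimes> v)" "s \<in> corner e" for s
    using that v(1) e' unfolding corner_invertible_def by (metis corner_closed corner_mult m_assoc)
  ultimately show ?thesis using x y by blast
qed

lemma not_corner_invertible_zero:
  assumes "primitive_idempotent R e" shows "\<not> corner_invertible e \<zero>"
proof
  assume "corner_invertible e \<zero>"
  then obtain y where y: "y \<in> corner e" "\<zero> \<otimes> y = e" unfolding corner_invertible_def by blast
  then have "e = \<zero>" using corner_closed[OF y(1)] by simp
  then show False using assms unfolding primitive_idempotent_def by blast
qed

lemma corner_invertible_finsum:
  assumes e: "primitive_idempotent R e" and "finite J" "\<And>j. j \<in> J \<Longrightarrow> x j \<in> corner e"
    and "corner_invertible e (\<Oplus>j \<in> J. x j)"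
  shows "\<exists>j \<in> J. corner_invertible e (x j)"
  using assms(2-)
proof (induction J)
  case empty
  then show ?case using not_corner_invertible_zero[OF e] by simp
next
  case (insert i J)
  have ec: "e \<in> carrier R" "e \<otimes> e = e"
    using e by (auto simp: primitive_idempotent_def idempotent_def)
  have sum: "(\<Oplus>j \<in> J'. x j) \<in> corner e" if "finite J'" "\<And>j. j \<in> J' \<Longrightarrow> x j \<in> corner e" for J'
    using that
  proof (induction J')
    case empty
    have "\<zero> \<in> corner e" unfolding corner_def using ec by simp
    then show ?case by simp
  next
    case (insert i J')
    then have "(\<Oplus>j \<in> insert i J'. x j) = x i \<oplus> (\<Oplus>j \<in> J'. x j)"
      by (intro finsum_insert) (auto intro: corner_closed)
    then show ?case using insert ec by (auto intro: corner_add)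
  qed
  have "(\<Oplus>j \<in> insert i J. x j) = x i \<oplus> (\<Oplus>j \<in> J. x j)"
    using insert by (intro finsum_insert) (auto intro: corner_closed)
  moreover have "x i \<in> corner e" "(\<Oplus>j \<in> J. x j) \<in> corner e"
    using sum insert.hyps insert.prems(1) by blast+
  ultimately consider "corner_invertible e (x i)" | "corner_invertible e (\<Oplus>j \<in> J. x j)"
    using corner_invertible_add[OF e] insert.prems(2) by metis
  then show ?case
    using insert.IH insert.prems(1) by cases blast+
qed

text \<open>Left multiplications by \<open>b\<close> and \<open>a\<close> are inverse to each other.\<close>

lemma principal_isoI:
  assumes e: "primitive_idempotent R e" and f: "primitive_idempotent R f"
    and a: "a \<in> carrier R" "e \<otimes> a = a" "a \<otimes> f = a" and b: "b \<in> carrier R" "f \<otimes> b = b" "b \<otimes> e = b"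
    and ab: "a \<otimes> b = e"
  shows "rmod_isomorphic R (principal_rmod R e) (principal_rmod R f)"
proof -
  have ba: "b \<otimes> a = f" by (rule corner_inverse_comm[OF e f a b ab])
  have ec: "e \<in> carrier R" "e \<otimes> e = e" and fc: "f \<in> carrier R" "f \<otimes> f = f"
    using e f by (auto simp: primitive_idempotent_def idempotent_def)
  have cP: "carrier (principal_rmod R g) = {x \<in> carrier R. g \<otimes> x = x}"
    if "g \<in> carrier R" "g \<otimes> g = g" for g
  proof (intro equalityI subsetI)
    fix x assume "x \<in> carrier (principal_rmod R g)"
    then obtain y where y: "y \<in> carrier R" "x = g \<otimes> y" by (auto simp: principal_rmod_def)
    then have "g \<otimes> x = x" using that by (simp flip: m_assoc)
    then show "x \<in> {x \<in> carrier R. g \<otimes> x = x}" using y that by simp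
  next
    fix x assume x: "x \<in> {x \<in> carrier R. g \<otimes> x = x}"
    then have "x = g \<otimes> x" "x \<in> carrier R" by auto
    then show "x \<in> carrier (principal_rmod R g)" unfolding principal_rmod_def by auto
  qed
  let ?h = "\<lambda>x \<in> carrier (principal_rmod R e). b \<otimes> x"
  have ba': "b \<otimes> (a \<otimes> x) = f \<otimes> x" "a \<otimes> (b \<otimes> x) = e \<otimes> x" "f \<otimes> (b \<otimes> x) = b \<otimes> x" "e \<otimes> (a \<otimes> x) = a \<otimes> x"
    if "x \<in> carrier R" for x
    using that a b ab ba ec fc by (simp_all flip: m_assoc)
  have P: "ring.add (principal_rmod R g) = (\<oplus>)" "ract (principal_rmod R g) = (\<otimes>)" for g
    by (simp_all add: principal_rmod_def)
  have "e \<otimes> (x \<otimes> t) = x \<otimes> t" if "x \<in> carrier R" "e \<otimes> x = x" "t \<in> carrier R" for x t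
    using that ec by (metis m_assoc)
  then have "?h \<in> rmod_hom R (principal_rmod R e) (principal_rmod R f)"
    unfolding rmod_hom_def cP[OF ec] cP[OF fc] P using b(1) ec ba'(3)
    by (simp add: r_distr m_assoc)
  moreover have "bij_betw ?h (carrier (principal_rmod R e)) (carrier (principal_rmod R f))"
    by (rule bij_betwI[of _ _ _ "\<lambda>x. a \<otimes> x"]) (use a b ba' in \<open>auto simp: cP[OF ec] cP[OF fc]\<close>)
  ultimately show ?thesis unfolding rmod_isomorphic_def by blast
qed

end

section \<open>Finite dimensional algebras are strongly pi-regular\<close>

lemma (in ring) Span_subset_closed:
  assumes "set Us \<subseteq> S" "\<zero> \<in> S" "\<And>x y. \<lbrakk>x \<in> S; y \<in> S\<rbrakk> \<Longrightarrow> x \<oplus> y \<in> S"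
    "\<And>k x. \<lbrakk>k \<in> L; x \<in> S\<rbrakk> \<Longrightarrow> k \<otimes> x \<in> S"
  shows "Span L Us \<subseteq> S"
  using assms(1)
proof (induction Us)
  case Nil
  then show ?case using assms(2) by simp
next
  case (Cons v Us)
  show ?case
  proof
    fix x assume "x \<in> Span L (v # Us)"
    then obtain k w where "k \<in> L" "w \<in> Span L Us" "x = k \<otimes> v \<oplus> w"
      by (auto simp: line_extension_mem_iff)
    then show "x \<in> S" using Cons assms(3,4) by (metis list.set_intros(1) set_subset_Cons subset_iff)
  qed
qed

lemma (in ring) dependent_split:
  assumes "dependent L Us" "set Us \<subseteq> carrier R"
  shows "\<exists>Vs u Ws. Us = Vs @ u # Ws \<and> u \<in> Span L Ws"
  using assms
proof (induction Us)
  case (Cons v Us)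
  show ?case
  proof (cases "independent L Us")
    case True
    then have "v \<in> Span L Us" using Cons.prems li_Cons by auto
    then show ?thesis by (intro exI[of _ "[]"]) auto
  next
    case False
    then obtain Vs u Ws where "Us = Vs @ u # Ws" "u \<in> Span L Ws" using Cons by auto
    then show ?thesis by (intro exI[of _ "v # Vs"]) auto
  qed
qed auto

text \<open>In a linear dependence between \<open>1, x, \<dots>, x\<^sup>n\<close> the lowest power can be expressed by the higher
  ones, \<open>x\<^sup>m = x\<^bsup>m+1\<^esup> y\<close> with \<open>y\<close> a polynomial in \<open>x\<close>. The scalars
  are taken from the centre, a subfield of \<open>A\<close> isomorphic to \<open>k\<close>.\<close>

lemma finite_dimensional_pi_regular:
  assumes K: "field K" and A: "assoc_algebra K A" and fd: "finite_dimensional K A"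
    and cb: "center_is_base K A"
  shows "pi_regular_ring A"
proof -
  interpret K: field K by fact
  interpret assoc_algebra K A by fact
  let ?h = "\<lambda>t. t \<odot>\<^bsub>A\<^esub> \<one>\<^bsub>A\<^esub>"
  let ?L = "center A"
  have img: "?h ` carrier K = ?L" and inj: "inj_on ?h (carrier K)"
    using cb by (simp_all add: center_is_base_def bij_betw_def)
  have "ring_hom_ring K A ?h"
  proof (rule ring_hom_ringI2)
    show "?h \<in> ring_hom K A"
      by (rule ring_hom_memI) (simp_all add: smult_l_distr smult_assoc1 smult_mult_left)
  qed (use K.ring_axioms ring_axioms in auto)
  moreover have "\<one>\<^bsub>A\<^esub> \<noteq> \<zero>\<^bsub>A\<^esub>"
  proof
    assume 0: "\<one>\<^bsub>A\<^esub> = \<zero>\<^bsub>A\<^esub>"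
    then have "?h \<one>\<^bsub>K\<^esub> = ?h \<zero>\<^bsub>K\<^esub>" by simp
    then show False using inj_onD[OF inj, of "\<one>\<^bsub>K\<^esub>" "\<zero>\<^bsub>K\<^esub>"] K.one_not_zero K.one_closed K.zero_closed by blast
  qed
  ultimately have sub: "subfield ?L A"
    using ring_hom_ring.img_is_subfield(2)[OF _ K.carrier_is_subfield] img by metis
  obtain B where B: "finite B" "B \<subseteq> carrier A"
    "\<And>x. x \<in> carrier A \<Longrightarrow> \<exists>t \<in> B \<rightarrow> carrier K. x = (\<Oplus>\<^bsub>A\<^esub>b \<in> B. t b \<odot>\<^bsub>A\<^esub> b)"
    using fd unfolding finite_dimensional_def by blast
  obtain Bs where Bs: "set Bs = B" using finite_list[OF B(1)] by blast
  have BsA: "set Bs \<subseteq> carrier A" using Bs B by simp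
  have span: "Span ?L Bs = carrier A"
  proof (intro equalityI subsetI)
    fix x assume "x \<in> carrier A"
    then obtain t where t: "t \<in> B \<rightarrow> carrier K" "x = (\<Oplus>\<^bsub>A\<^esub>b \<in> B. t b \<odot>\<^bsub>A\<^esub> b)" using B(3) by blast
    have "(\<Oplus>\<^bsub>A\<^esub>b \<in> B'. t b \<odot>\<^bsub>A\<^esub> b) \<in> Span ?L Bs" if "B' \<subseteq> B" for B'
      using finite_subset[OF that B(1)] that
    proof (induction B')
      case empty
      then show ?case using Span_subgroup_props(2)[OF sub BsA] by simp
    next
      case (insert b B')
      then have b: "b \<in> B" "t b \<in> carrier K" "b \<in> carrier A" using t B by auto
      have eq: "t b \<odot>\<^bsub>A\<^esub> b = ?h (t b) \<otimes>\<^bsub>A\<^esub> b" using b by (simp add: smult_mult_left)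
      have "?h (t b) \<in> ?L" using b(2) img by blast
      then have "t b \<odot>\<^bsub>A\<^esub> b \<in> Span ?L Bs"
        unfolding eq using Span_base_incl[OF sub BsA] Bs b(1) by (intro Span_smult_closed[OF sub BsA]) auto
      moreover have "(\<Oplus>\<^bsub>A\<^esub>b \<in> insert b B'. t b \<odot>\<^bsub>A\<^esub> b) = t b \<odot>\<^bsub>A\<^esub> b \<oplus>\<^bsub>A\<^esub> (\<Oplus>\<^bsub>A\<^esub>b \<in> B'. t b \<odot>\<^bsub>A\<^esub> b)"
        using insert b t B by (intro finsum_insert) (auto simp: Pi_iff)
      ultimately show ?case using insert Span_subgroup_props(3)[OF sub BsA] by simp
    qed
    then show "x \<in> Span ?L Bs" using t(2) by blast
  next
    fix x assume "x \<in> Span ?L Bs"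
    then show "x \<in> carrier A" using Span_subgroup_props(1)[OF sub BsA] by blast
  qed
  obtain n where n: "dimension n ?L (carrier A)"
    using Span_finite_dimension[OF sub BsA] unfolding span by (rule finite_dimensionE')
  show ?thesis
  proof (unfold_locales)
    fix x assume x: "x \<in> carrier A"
    let ?Us = "map (\<lambda>i. x [^]\<^bsub>A\<^esub> i) [0..<Suc n]"
    have Us: "set ?Us \<subseteq> carrier A" using x by auto
    have "dependent ?L ?Us"
      using independent_length_le_dimension[OF sub n _ Us] by auto
    then obtain Vs v Ws where V: "?Us = Vs @ v # Ws" "v \<in> Span ?L Ws"
      using dependent_split[OF _ Us] by blast
    let ?m = "length Vs"
    have lm: "?m < Suc n" using arg_cong[OF V(1), of length] by simp
    have v: "v = x [^]\<^bsub>A\<^esub> ?m"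
    proof -
      have "v = ?Us ! ?m" unfolding V(1) by simp
      also have "\<dots> = x [^]\<^bsub>A\<^esub> ?m" using lm by (simp del: upt_Suc)
      finally show ?thesis .
    qed
    have "Ws = drop (Suc ?m) ?Us" unfolding V(1) by simp
    then have W: "Ws = map (\<lambda>i. x [^]\<^bsub>A\<^esub> i) [Suc ?m..<Suc n]" by (simp add: drop_map del: upt_Suc)
    \<comment> \<open>Instead of polynomials in \<open>x\<close>, all \<open>y\<close> commuting with \<open>x\<close> are admitted.\<close>
    let ?S = "{x [^]\<^bsub>A\<^esub> Suc ?m \<otimes>\<^bsub>A\<^esub> y | y. y \<in> carrier A \<and> x \<otimes>\<^bsub>A\<^esub> y = y \<otimes>\<^bsub>A\<^esub> x}"
    have xm: "x [^]\<^bsub>A\<^esub> Suc ?m \<in> carrier A" using x by simp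
    have "Span ?L Ws \<subseteq> ?S"
    proof (rule Span_subset_closed)
      show "set Ws \<subseteq> ?S"
      proof
        fix w assume "w \<in> set Ws"
        then obtain i where i: "w = x [^]\<^bsub>A\<^esub> i" "Suc ?m \<le> i" by (auto simp: W)
        then have "w = x [^]\<^bsub>A\<^esub> Suc ?m \<otimes>\<^bsub>A\<^esub> x [^]\<^bsub>A\<^esub> (i - Suc ?m)"
          using x by (simp only: nat_pow_mult le_add_diff_inverse)
        moreover have "x \<otimes>\<^bsub>A\<^esub> x [^]\<^bsub>A\<^esub> (i - Suc ?m) = x [^]\<^bsub>A\<^esub> (i - Suc ?m) \<otimes>\<^bsub>A\<^esub> x"
          using x by (metis nat_pow_Suc2 nat_pow_Suc)
        ultimately show "w \<in> ?S" using x by blast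
      qed
      have "\<zero>\<^bsub>A\<^esub> = x [^]\<^bsub>A\<^esub> Suc ?m \<otimes>\<^bsub>A\<^esub> \<zero>\<^bsub>A\<^esub>" "x \<otimes>\<^bsub>A\<^esub> \<zero>\<^bsub>A\<^esub> = \<zero>\<^bsub>A\<^esub> \<otimes>\<^bsub>A\<^esub> x" using x by simp_all
      then show "\<zero>\<^bsub>A\<^esub> \<in> ?S" by blast
    next
      fix p q assume "p \<in> ?S" "q \<in> ?S"
      then obtain y z where y: "p = x [^]\<^bsub>A\<^esub> Suc ?m \<otimes>\<^bsub>A\<^esub> y" "y \<in> carrier A" "x \<otimes>\<^bsub>A\<^esub> y = y \<otimes>\<^bsub>A\<^esub> x"
        and z: "q = x [^]\<^bsub>A\<^esub> Suc ?m \<otimes>\<^bsub>A\<^esub> z" "z \<in> carrier A" "x \<otimes>\<^bsub>A\<^esub> z = z \<otimes>\<^bsub>A\<^esub> x" by blast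
      have "p \<oplus>\<^bsub>A\<^esub> q = x [^]\<^bsub>A\<^esub> Suc ?m \<otimes>\<^bsub>A\<^esub> (y \<oplus>\<^bsub>A\<^esub> z)"
        using y(1,2) z(1,2) xm by (simp only: r_distr)
      moreover have "x \<otimes>\<^bsub>A\<^esub> (y \<oplus>\<^bsub>A\<^esub> z) = (y \<oplus>\<^bsub>A\<^esub> z) \<otimes>\<^bsub>A\<^esub> x"
        using x y z by (simp add: l_distr r_distr)
      moreover have "y \<oplus>\<^bsub>A\<^esub> z \<in> carrier A" using y z by simp
      ultimately show "p \<oplus>\<^bsub>A\<^esub> q \<in> ?S" by blast
    next
      fix k p assume k: "k \<in> ?L" and "p \<in> ?S"
      then obtain y where y: "p = x [^]\<^bsub>A\<^esub> Suc ?m \<otimes>\<^bsub>A\<^esub> y" "y \<in> carrier A" "x \<otimes>\<^bsub>A\<^esub> y = y \<otimes>\<^bsub>A\<^esub> x" by blast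
      have kc: "k \<in> carrier A" "\<And>w. w \<in> carrier A \<Longrightarrow> k \<otimes>\<^bsub>A\<^esub> w = w \<otimes>\<^bsub>A\<^esub> k"
        using k by (auto simp: center_def)
      have "k \<otimes>\<^bsub>A\<^esub> p = (k \<otimes>\<^bsub>A\<^esub> x [^]\<^bsub>A\<^esub> Suc ?m) \<otimes>\<^bsub>A\<^esub> y"
        unfolding y(1) using kc(1) xm y(2) by (simp only: m_assoc)
      also have "\<dots> = x [^]\<^bsub>A\<^esub> Suc ?m \<otimes>\<^bsub>A\<^esub> (k \<otimes>\<^bsub>A\<^esub> y)"
        unfolding kc(2)[OF xm] using kc(1) xm y(2) by (simp only: m_assoc)
      finally have "k \<otimes>\<^bsub>A\<^esub> p = x [^]\<^bsub>A\<^esub> Suc ?m \<otimes>\<^bsub>A\<^esub> (k \<otimes>\<^bsub>A\<^esub> y)" .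
      moreover have "x \<otimes>\<^bsub>A\<^esub> (k \<otimes>\<^bsub>A\<^esub> y) = (k \<otimes>\<^bsub>A\<^esub> y) \<otimes>\<^bsub>A\<^esub> x"
        using kc(1) kc(2)[OF x] x y by (metis m_assoc)
      moreover have "k \<otimes>\<^bsub>A\<^esub> y \<in> carrier A" using kc y by simp
      ultimately show "k \<otimes>\<^bsub>A\<^esub> p \<in> ?S" by blast
    qed
    then have "v \<in> ?S" using V(2) by blast
    then show "\<exists>(n::nat) y. y \<in> carrier A \<and> x \<otimes>\<^bsub>A\<^esub> y = y \<otimes>\<^bsub>A\<^esub> x \<and>
        x [^]\<^bsub>A\<^esub> n = x [^]\<^bsub>A\<^esub> Suc n \<otimes>\<^bsub>A\<^esub> y"
      unfolding v by blast
  qed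
qed

section \<open>Modules and module homomorphisms\<close>

lemma rmod_homD:
  assumes "f \<in> rmod_hom A M N"
  shows "x \<in> carrier M \<Longrightarrow> f x \<in> carrier N"
    and "\<lbrakk>x \<in> carrier M; y \<in> carrier M\<rbrakk> \<Longrightarrow> f (x \<oplus>\<^bsub>M\<^esub> y) = f x \<oplus>\<^bsub>N\<^esub> f y"
    and "\<lbrakk>x \<in> carrier M; a \<in> carrier A\<rbrakk> \<Longrightarrow> f (x \<triangleleft>\<^bsub>M\<^esub> a) = f x \<triangleleft>\<^bsub>N\<^esub> a"
    and "f \<in> extensional (carrier M)"
  using assms by (auto simp: rmod_hom_def PiE_def)

lemma rmod_homI:
  assumes "\<And>x. x \<in> carrier M \<Longrightarrow> f x \<in> carrier N" "f \<in> extensional (carrier M)"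
    and "\<And>x y. \<lbrakk>x \<in> carrier M; y \<in> carrier M\<rbrakk> \<Longrightarrow> f (x \<oplus>\<^bsub>M\<^esub> y) = f x \<oplus>\<^bsub>N\<^esub> f y"
    and "\<And>x a. \<lbrakk>x \<in> carrier M; a \<in> carrier A\<rbrakk> \<Longrightarrow> f (x \<triangleleft>\<^bsub>M\<^esub> a) = f x \<triangleleft>\<^bsub>N\<^esub> a"
  shows "f \<in> rmod_hom A M N"
  using assms by (auto simp: rmod_hom_def PiE_def)

lemma rmod_hom_eqI:
  assumes "f \<in> rmod_hom A M N" "g \<in> rmod_hom A M N" "\<And>x. x \<in> carrier M \<Longrightarrow> f x = g x"
  shows "f = g"
  using assms by (intro extensionalityI[of f "carrier M" g]) (auto dest: rmod_homD(4))

abbreviation zero_hom :: "('a, 'm, 'y) rmodule_scheme \<Rightarrow> ('a, 'n, 'z) rmodule_scheme \<Rightarrow> 'm \<Rightarrow> 'n" where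
  "zero_hom M N \<equiv> \<lambda>x \<in> carrier M. \<zero>\<^bsub>N\<^esub>"

lemma mod_category_simps [simp]:
  "M \<in> objs (mod_category A) \<longleftrightarrow> right_module A M \<and> finitely_presented A M"
  "homs (mod_category A) = rmod_hom A"
  "ident (mod_category A) M = (\<lambda>x \<in> carrier M. x)"
  "comps (mod_category A) L M N g f = compose (carrier L) g f"
  "hom_add (mod_category A) M N f g = (\<lambda>x \<in> carrier M. f x \<oplus>\<^bsub>N\<^esub> g x)"
  "hom_smult (mod_category A) M N t f = (\<lambda>x \<in> carrier M. f x \<triangleleft>\<^bsub>N\<^esub> (t \<odot>\<^bsub>A\<^esub> \<one>\<^bsub>A\<^esub>))"
  by (simp_all add: mod_category_def)

abbreviation mods :: "('k, 'a, 'y) module_scheme \<Rightarrow> 'a fp_rmodule set" where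
  "mods A \<equiv> objs (mod_category A)"

lemma modsD: "M \<in> mods A \<Longrightarrow> right_module A M" "M \<in> mods A \<Longrightarrow> finitely_presented A M"
  by simp_all

declare mod_category_simps(1) [simp del]

context right_module
begin

lemmas ract = ract_closed ract_add_left ract_add_right ract_mult ract_one

lemma ract_zero_left: "a \<in> carrier R \<Longrightarrow> \<zero>\<^bsub>M\<^esub> \<triangleleft>\<^bsub>M\<^esub> a = \<zero>\<^bsub>M\<^esub>"
  using ract_add_left[of "\<zero>\<^bsub>M\<^esub>" "\<zero>\<^bsub>M\<^esub>" a] ract_closed[of "\<zero>\<^bsub>M\<^esub>" a]
    M.add.l_cancel_one'[of "\<zero>\<^bsub>M\<^esub> \<triangleleft>\<^bsub>M\<^esub> a" "\<zero>\<^bsub>M\<^esub> \<triangleleft>\<^bsub>M\<^esub> a"] by simp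

lemma ract_zero_right: "x \<in> carrier M \<Longrightarrow> x \<triangleleft>\<^bsub>M\<^esub> \<zero>\<^bsub>R\<^esub> = \<zero>\<^bsub>M\<^esub>"
  using ract_add_right[of x "\<zero>\<^bsub>R\<^esub>" "\<zero>\<^bsub>R\<^esub>"] ract_closed[of x "\<zero>\<^bsub>R\<^esub>"]
    M.add.l_cancel_one'[of "x \<triangleleft>\<^bsub>M\<^esub> \<zero>\<^bsub>R\<^esub>" "x \<triangleleft>\<^bsub>M\<^esub> \<zero>\<^bsub>R\<^esub>"] by simp

end

lemma rmod_hom_zero:
  assumes "f \<in> rmod_hom A M N" "right_module A M" "right_module A N"
  shows "f \<zero>\<^bsub>M\<^esub> = \<zero>\<^bsub>N\<^esub>"
proof -
  interpret M: right_module A M by fact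
  interpret N: right_module A N by fact
  have "f \<zero>\<^bsub>M\<^esub> \<oplus>\<^bsub>N\<^esub> f \<zero>\<^bsub>M\<^esub> = f \<zero>\<^bsub>M\<^esub>"
    using rmod_homD(2)[OF assms(1), of "\<zero>\<^bsub>M\<^esub>" "\<zero>\<^bsub>M\<^esub>"] by simp
  then show ?thesis
    using rmod_homD(1)[OF assms(1), of "\<zero>\<^bsub>M\<^esub>"] N.M.add.l_cancel_one'[of "f \<zero>\<^bsub>M\<^esub>" "f \<zero>\<^bsub>M\<^esub>"] by simp
qed

lemma rmod_hom_compose:
  assumes "right_module A L" "f \<in> rmod_hom A L M" "g \<in> rmod_hom A M N"
  shows "compose (carrier L) g f \<in> rmod_hom A L N"
proof -
  interpret right_module A L by fact
  show ?thesis
    using rmod_homD[OF assms(2)] rmod_homD[OF assms(3)]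
    by (intro rmod_homI) (auto simp: compose_def ract_closed)
qed

lemma zero_hom_in:
  assumes "right_module A M" "right_module A N"
  shows "zero_hom M N \<in> rmod_hom A M N"
proof -
  interpret M: right_module A M by fact
  interpret N: right_module A N by fact
  show ?thesis by (rule rmod_homI) (auto simp: M.ract_closed N.ract_zero_left)
qed

lemma rmod_hom_inverse:
  assumes "right_module A M" "f \<in> rmod_hom A M N" and bij: "bij_betw f (carrier M) (carrier N)"
  shows "restrict (inv_into (carrier M) f) (carrier N) \<in> rmod_hom A N M"
proof -
  interpret right_module A M by fact
  note f = rmod_homD[OF assms(2)]
  have g: "inv_into (carrier M) f y \<in> carrier M" "f (inv_into (carrier M) f y) = y" if "y \<in> carrier N" for y
    using bij that by (auto simp: bij_betw_def inv_into_into f_inv_into_f)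
  have eq: "inv_into (carrier M) f y = x" if "x \<in> carrier M" "f x = y" for x y
    using bij that by (auto simp: bij_betw_def)
  have cl: "y \<oplus>\<^bsub>N\<^esub> y' \<in> carrier N" if "y \<in> carrier N" "y' \<in> carrier N" for y y'
    using f(1,2) g that by (metis M.a_closed)
  have cl': "y \<triangleleft>\<^bsub>N\<^esub> a \<in> carrier N" if "y \<in> carrier N" "a \<in> carrier A" for y a
    using f(1,3) g that by (metis ract_closed)
  show ?thesis
    by (rule rmod_homI) (use f g cl cl' in \<open>auto intro!: eq ract_closed\<close>)
qed

lemma iso_arrow_mod_iff:
  assumes M: "M \<in> mods A" and N: "N \<in> mods A"
  shows "iso_arrow (mod_category A) M N f \<longleftrightarrow> f \<in> rmod_hom A M N \<and> bij_betw f (carrier M) (carrier N)"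
proof
  assume "iso_arrow (mod_category A) M N f"
  then obtain g where g: "f \<in> rmod_hom A M N" "g \<in> rmod_hom A N M"
    "compose (carrier M) g f = (\<lambda>x \<in> carrier M. x)" "compose (carrier N) f g = (\<lambda>x \<in> carrier N. x)"
    by (auto simp: iso_arrow_def)
  have "g (f x) = x" if "x \<in> carrier M" for x using fun_cong[OF g(3), of x] that by (simp add: compose_def)
  moreover have "f (g x) = x" if "x \<in> carrier N" for x using fun_cong[OF g(4), of x] that by (simp add: compose_def)
  ultimately have "bij_betw f (carrier M) (carrier N)"
    using rmod_homD(1)[OF g(1)] rmod_homD(1)[OF g(2)] by (intro bij_betwI[of _ _ _ g]) auto
  with g(1) show "f \<in> rmod_hom A M N \<and> bij_betw f (carrier M) (carrier N)" by simp
next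
  assume f: "f \<in> rmod_hom A M N \<and> bij_betw f (carrier M) (carrier N)"
  let ?g = "restrict (inv_into (carrier M) f) (carrier N)"
  have "?g \<in> rmod_hom A N M" using rmod_hom_inverse[of A M f N] modsD(1)[OF M] f by blast
  moreover have "compose (carrier M) ?g f = (\<lambda>x \<in> carrier M. x)"
    using f by (auto simp: compose_def bij_betw_def fun_eq_iff)
  moreover have "compose (carrier N) f ?g = (\<lambda>x \<in> carrier N. x)"
    using f by (auto simp: compose_def bij_betw_def fun_eq_iff f_inv_into_f)
  ultimately show "iso_arrow (mod_category A) M N f" using f by (auto simp: iso_arrow_def)
qed

section \<open>Endofunctors of the module category\<close>

abbreviation endofunctor where
  "endofunctor A F \<equiv> is_functor (mod_category A) (mod_category A) F"

lemma endofunctorD: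
  assumes "endofunctor A F"
  shows "X \<in> mods A \<Longrightarrow> omap F X \<in> mods A"
    and "\<lbrakk>X \<in> mods A; Y \<in> mods A; f \<in> rmod_hom A X Y\<rbrakk> \<Longrightarrow>
      amap F X Y f \<in> rmod_hom A (omap F X) (omap F Y)"
    and "\<lbrakk>X \<in> mods A; x \<in> carrier (omap F X)\<rbrakk> \<Longrightarrow> amap F X X (\<lambda>x \<in> carrier X. x) x = x"
    and "\<lbrakk>X \<in> mods A; Y \<in> mods A; Z \<in> mods A; f \<in> rmod_hom A X Y; g \<in> rmod_hom A Y Z;
      x \<in> carrier (omap F X)\<rbrakk> \<Longrightarrow>
      amap F X Z (compose (carrier X) g f) x = amap F Y Z g (amap F X Y f x)"
  using assms unfolding is_functor_def by (auto simp: compose_def)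

lemma endofunctor_closed:
  assumes "endofunctor A F" "X \<in> mods A" "Y \<in> mods A" "f \<in> rmod_hom A X Y" "x \<in> carrier (omap F X)"
  shows "amap F X Y f x \<in> carrier (omap F Y)"
  using endofunctorD(2)[OF assms(1-4)] assms(5) by (rule rmod_homD(1))

lemma endofunctor_id: "endofunctor A id_functor"
  by (auto simp: is_functor_def id_functor_def)

lemma endofunctor_comp:
  assumes "endofunctor A F" "endofunctor A G"
  shows "endofunctor A (comp_functor F G)"
  using assms unfolding is_functor_def comp_functor_def by simp

lemma comp_functor_simps [simp]:
  "omap (comp_functor F G) X = omap F (omap G X)"
  "amap (comp_functor F G) X Y f = amap F (omap G X) (omap G Y) (amap G X Y f)"
  "omap id_functor X = X" "amap id_functor X Y f = f"
  by (simp_all add: comp_functor_def id_functor_def)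

lemma natural_iso_mod_iff:
  assumes F: "endofunctor A F" and F': "endofunctor A F'"
  shows "natural_iso (mod_category A) (mod_category A) F F' \<eta> \<longleftrightarrow>
    (\<forall>X \<in> mods A. \<eta> X \<in> rmod_hom A (omap F X) (omap F' X) \<and>
      bij_betw (\<eta> X) (carrier (omap F X)) (carrier (omap F' X))) \<and>
    (\<forall>X \<in> mods A. \<forall>Y \<in> mods A. \<forall>f \<in> rmod_hom A X Y. \<forall>x \<in> carrier (omap F X).
      \<eta> Y (amap F X Y f x) = amap F' X Y f (\<eta> X x))"
proof -
  have "compose (carrier (omap F X)) (\<eta> Y) (amap F X Y f) = compose (carrier (omap F X)) (amap F' X Y f) (\<eta> X) \<longleftrightarrow>
      (\<forall>x \<in> carrier (omap F X). \<eta> Y (amap F X Y f x) = amap F' X Y f (\<eta> X x))" for X Y f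
    unfolding compose_def restrict_def fun_eq_iff by metis
  then show ?thesis
    unfolding natural_iso_def using endofunctorD(1)[OF F] endofunctorD(1)[OF F']
    by (simp add: iso_arrow_mod_iff)
qed

lemma natural_iso_modD:
  assumes "natural_iso (mod_category A) (mod_category A) F F' \<eta>" "endofunctor A F" "endofunctor A F'"
  shows "X \<in> mods A \<Longrightarrow> \<eta> X \<in> rmod_hom A (omap F X) (omap F' X)"
    and "X \<in> mods A \<Longrightarrow> bij_betw (\<eta> X) (carrier (omap F X)) (carrier (omap F' X))"
    and "\<lbrakk>X \<in> mods A; Y \<in> mods A; f \<in> rmod_hom A X Y; x \<in> carrier (omap F X)\<rbrakk> \<Longrightarrow>
      \<eta> Y (amap F X Y f x) = amap F' X Y f (\<eta> X x)"
  using assms(1) unfolding natural_iso_mod_iff[OF assms(2,3)] by blast+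

lemma natural_iso_inverse:
  assumes \<eta>: "natural_iso (mod_category A) (mod_category A) F F' \<eta>"
    and F: "endofunctor A F" and F': "endofunctor A F'"
  shows "natural_iso (mod_category A) (mod_category A) F' F
    (\<lambda>X. restrict (inv_into (carrier (omap F X)) (\<eta> X)) (carrier (omap F' X)))"
proof -
  note n = natural_iso_modD[OF \<eta> F F']
  have i: "inv_into (carrier (omap F X)) (\<eta> X) y \<in> carrier (omap F X)"
    "\<eta> X (inv_into (carrier (omap F X)) (\<eta> X) y) = y" if "X \<in> mods A" "y \<in> carrier (omap F' X)" for X y
    using n(2)[OF that(1)] that(2) by (auto simp: bij_betw_def inv_into_into f_inv_into_f)
  have eq: "inv_into (carrier (omap F X)) (\<eta> X) y = x"
    if "X \<in> mods A" "x \<in> carrier (omap F X)" "\<eta> X x = y" for X x y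
    using n(2)[OF that(1)] that(2,3) by (auto simp: bij_betw_def)
  show ?thesis unfolding natural_iso_mod_iff[OF F' F]
  proof (intro conjI ballI)
    fix X assume X: "X \<in> mods A"
    show "restrict (inv_into (carrier (omap F X)) (\<eta> X)) (carrier (omap F' X))
        \<in> rmod_hom A (omap F' X) (omap F X)"
      by (rule rmod_hom_inverse[OF modsD(1)[OF endofunctorD(1)[OF F X]] n(1,2)[OF X]])
    show "bij_betw (restrict (inv_into (carrier (omap F X)) (\<eta> X)) (carrier (omap F' X)))
        (carrier (omap F' X)) (carrier (omap F X))"
      using bij_betw_inv_into[OF n(2)[OF X]] by (simp cong: bij_betw_cong)
  next
    fix X Y f x assume X: "X \<in> mods A" and Y: "Y \<in> mods A" and f: "f \<in> rmod_hom A X Y"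
      and x: "x \<in> carrier (omap F' X)"
    have "inv_into (carrier (omap F Y)) (\<eta> Y) (amap F' X Y f x) =
        amap F X Y f (inv_into (carrier (omap F X)) (\<eta> X) x)"
      using n(3)[OF X Y f, of "inv_into (carrier (omap F X)) (\<eta> X) x"] i[OF X x] X Y f
      by (intro eq) (auto intro: endofunctor_closed[OF F])
    then show "restrict (inv_into (carrier (omap F Y)) (\<eta> Y)) (carrier (omap F' Y)) (amap F' X Y f x) =
        amap F X Y f (restrict (inv_into (carrier (omap F X)) (\<eta> X)) (carrier (omap F' X)) x)"
      using endofunctor_closed[OF F' X Y f x] x by simp
  qed
qed

section \<open>A free object of rank one\<close>

text \<open>The carriers of the objects of the module category are sets of sets of vectors, so the regular
  module is not an object itself. An isomorphic object \<open>U\<close> with a free generator \<open>u\<close> replaces it.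
  Then \<open>hat M x\<close> is the homomorphism \<open>U \<rightarrow> M\<close> with \<open>u \<mapsto> x\<close>.\<close>

locale free_object = ring A for A :: "('k, 'a, 'y) module_scheme" (structure) +
  fixes U :: "'a fp_rmodule" and u
  assumes U: "U \<in> mods A" and u: "u \<in> carrier U"
    and free: "bij_betw (\<lambda>a. u \<triangleleft>\<^bsub>U\<^esub> a) (carrier A) (carrier U)"
begin

lemma Umod: "right_module A U" using U by (rule modsD)

definition coord where "coord = inv_into (carrier A) (\<lambda>a. u \<triangleleft>\<^bsub>U\<^esub> a)"

lemma coord [simp]: "a \<in> carrier A \<Longrightarrow> coord (u \<triangleleft>\<^bsub>U\<^esub> a) = a"
  "y \<in> carrier U \<Longrightarrow> coord y \<in> carrier A" "y \<in> carrier U \<Longrightarrow> u \<triangleleft>\<^bsub>U\<^esub> coord y = y"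
  "a \<in> carrier A \<Longrightarrow> u \<triangleleft>\<^bsub>U\<^esub> a \<in> carrier U" "coord u = \<one>"
proof -
  interpret right_module A U by (rule Umod)
  show 1: "coord (u \<triangleleft>\<^bsub>U\<^esub> a) = a" if "a \<in> carrier A" for a
    using free that by (auto simp: coord_def bij_betw_def)
  show "y \<in> carrier U \<Longrightarrow> coord y \<in> carrier A" "y \<in> carrier U \<Longrightarrow> u \<triangleleft>\<^bsub>U\<^esub> coord y = y"
    using free by (auto simp: coord_def bij_betw_def inv_into_into f_inv_into_f[of y "\<lambda>a. u \<triangleleft>\<^bsub>U\<^esub> a" "carrier A"])
  show "a \<in> carrier A \<Longrightarrow> u \<triangleleft>\<^bsub>U\<^esub> a \<in> carrier U" using u by (rule ract_closed)
  show "coord u = \<one>" using 1[of \<one>] u by (simp add: ract_one)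
qed

lemma coord_add:
  assumes "x \<in> carrier U" "y \<in> carrier U" shows "coord (x \<oplus>\<^bsub>U\<^esub> y) = coord x \<oplus> coord y"
proof -
  interpret right_module A U by (rule Umod)
  have "x \<oplus>\<^bsub>U\<^esub> y = u \<triangleleft>\<^bsub>U\<^esub> (coord x \<oplus> coord y)"
    using assms u by (simp add: ract_add_right)
  then show ?thesis using assms by simp
qed

lemma coord_ract:
  assumes "x \<in> carrier U" "a \<in> carrier A" shows "coord (x \<triangleleft>\<^bsub>U\<^esub> a) = coord x \<otimes> a"
proof -
  interpret right_module A U by (rule Umod)
  have "x \<triangleleft>\<^bsub>U\<^esub> a = u \<triangleleft>\<^bsub>U\<^esub> (coord x \<otimes> a)"
    using assms u by (simp add: ract_mult)
  then show ?thesis using assms by simp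
qed

definition hat :: "'a fp_rmodule \<Rightarrow> (nat \<Rightarrow> 'a) set \<Rightarrow> 'a fp_arrow" where
  "hat M x = (\<lambda>y \<in> carrier U. x \<triangleleft>\<^bsub>M\<^esub> coord y)"

lemma hat_hom:
  assumes M: "right_module A M" and x: "x \<in> carrier M"
  shows "hat M x \<in> rmod_hom A U M"
proof -
  interpret U: right_module A U by (rule Umod)
  interpret right_module A M by fact
  show ?thesis
    by (rule rmod_homI)
      (use x in \<open>auto simp: hat_def ract_closed U.ract_closed coord_add coord_ract ract_add_right ract_mult\<close>)
qed

lemma hat_u:
  assumes "right_module A M" "x \<in> carrier M"
  shows "hat M x u = x"
  using assms u right_module.ract_one by (simp add: hat_def)

lemma hat_eqI:
  assumes f: "f \<in> rmod_hom A U M" and x: "f u = x"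
  shows "f = hat M x"
proof
  fix y show "f y = hat M x y"
  proof (cases "y \<in> carrier U")
    case True
    then have "f y = f (u \<triangleleft>\<^bsub>U\<^esub> coord y)" by simp
    also have "\<dots> = x \<triangleleft>\<^bsub>M\<^esub> coord y"
      using rmod_homD(3)[OF f u coord(2)[OF True]] unfolding x .
    finally show ?thesis using True by (simp add: hat_def)
  qed (use rmod_homD(4)[OF f] in \<open>simp add: hat_def extensional_def\<close>)
qed

lemma compose_hat:
  assumes "right_module A M" "x \<in> carrier M" "f \<in> rmod_hom A M N"
  shows "compose (carrier U) f (hat M x) = hat N (f x)"
  by (rule hat_eqI[OF rmod_hom_compose[OF Umod hat_hom[OF assms(1,2)] assms(3)]])
    (use u assms in \<open>simp add: compose_def hat_u\<close>)

lemma hat_id: "hat U u = (\<lambda>x \<in> carrier U. x)"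
  unfolding hat_def by (rule restrict_ext) simp

end

text \<open>The regular module is presented by \<open>0 \<rightarrow> A \<rightarrow> A \<rightarrow> 0\<close>.\<close>

lemma exists_free_object:
  fixes A :: "('k, 'a, 'y) module_scheme"
  assumes "ring A"
  shows "\<exists>U u. free_object A U u"
proof -
  interpret A: ring A by fact
  let ?P = "principal_rmod A \<one>\<^bsub>A\<^esub>"
  have cP: "carrier ?P = carrier A"
    by (auto simp: principal_rmod_def) (metis A.l_one)
  have P: "ring.zero ?P = \<zero>\<^bsub>A\<^esub>" "ring.add ?P = (\<oplus>\<^bsub>A\<^esub>)" "ract ?P = (\<otimes>\<^bsub>A\<^esub>)"
    by (simp_all add: principal_rmod_def)
  have "abelian_group ?P"
  proof (rule abelian_groupI)
    fix x assume "x \<in> carrier ?P"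
    then show "\<exists>y \<in> carrier ?P. y \<oplus>\<^bsub>?P\<^esub> x = \<zero>\<^bsub>?P\<^esub>"
      by (intro bexI[of _ "\<ominus>\<^bsub>A\<^esub> x"]) (simp_all add: cP P A.l_neg)
  qed (simp_all add: cP P A.a_assoc, simp add: A.a_comm)
  moreover have "right_module_axioms A ?P"
    by unfold_locales (auto simp: cP P A.l_distr A.r_distr A.m_assoc)
  ultimately have mod: "right_module A ?P" by (simp add: right_module_def A.ring_axioms)
  let ?f = "\<lambda>v \<in> carrier (free_rmod A 0). \<lambda>i \<in> {..<1::nat}. \<zero>\<^bsub>A\<^esub>"
  let ?g = "\<lambda>v \<in> carrier (free_rmod A 1). v 0"
  have "finitely_presented A ?P"
    unfolding finitely_presented_def
  proof (intro exI conjI)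
    show "?f \<in> rmod_hom A (free_rmod A 0) (free_rmod A 1)"
      by (auto simp: rmod_hom_def free_rmod_def fun_eq_iff)
    show "?g \<in> rmod_hom A (free_rmod A 1) ?P"
      by (auto simp: rmod_hom_def free_rmod_def cP P)
    show "?g ` carrier (free_rmod A 1) = carrier ?P"
    proof (intro equalityI subsetI)
      fix x assume "x \<in> carrier ?P"
      then show "x \<in> ?g ` carrier (free_rmod A 1)"
        by (intro image_eqI[of _ _ "\<lambda>i \<in> {..<1}. x"]) (auto simp: cP free_rmod_def)
    qed (auto simp: cP free_rmod_def)
    show "?f ` carrier (free_rmod A 0) = {v \<in> carrier (free_rmod A 1). ?g v = \<zero>\<^bsub>?P\<^esub>}"
    proof -
      have "carrier (free_rmod A 0) = {\<lambda>_. undefined}" by (simp add: free_rmod_def)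
      then have "?f ` carrier (free_rmod A 0) = {\<lambda>i \<in> {..<1}. \<zero>\<^bsub>A\<^esub>}" by simp
      moreover have "{v \<in> carrier (free_rmod A 1). ?g v = \<zero>\<^bsub>?P\<^esub>} = {\<lambda>i \<in> {..<1}. \<zero>\<^bsub>A\<^esub>}"
      proof (intro equalityI subsetI)
        fix v assume "v \<in> {v \<in> carrier (free_rmod A 1). ?g v = \<zero>\<^bsub>?P\<^esub>}"
        then have "v \<in> extensional {..<1}" "v 0 = \<zero>\<^bsub>A\<^esub>" by (auto simp: free_rmod_def P PiE_def)
        then have "v = (\<lambda>i \<in> {..<1}. \<zero>\<^bsub>A\<^esub>)" by (intro extensionalityI[of _ "{..<1}"]) simp_all
        then show "v \<in> {\<lambda>i \<in> {..<1}. \<zero>\<^bsub>A\<^esub>}" by simp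
      next
        fix v assume "v \<in> {\<lambda>i \<in> {..<1::nat}. \<zero>\<^bsub>A\<^esub>}"
        then show "v \<in> {v \<in> carrier (free_rmod A 1). ?g v = \<zero>\<^bsub>?P\<^esub>}" by (simp add: free_rmod_def P)
      qed
      ultimately show ?thesis by (simp only:)
    qed
  qed
  from finitely_presented_representable[OF mod this] obtain N f where N: "N \<in> mods A"
    and f: "f \<in> rmod_hom A ?P N" "bij_betw f (carrier ?P) (carrier N)"
    unfolding rmod_isomorphic_def by blast
  have "f x = f \<one>\<^bsub>A\<^esub> \<triangleleft>\<^bsub>N\<^esub> x" if "x \<in> carrier A" for x
    using rmod_homD(3)[OF f(1), of "\<one>\<^bsub>A\<^esub>" x] that by (simp add: cP P)
  then have "bij_betw (\<lambda>a. f \<one>\<^bsub>A\<^esub> \<triangleleft>\<^bsub>N\<^esub> a) (carrier A) (carrier N)"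
    using f(2) bij_betw_cong[of "carrier A" f "\<lambda>a. f \<one>\<^bsub>A\<^esub> \<triangleleft>\<^bsub>N\<^esub> a" "carrier N"] unfolding cP by blast
  moreover have "f \<one>\<^bsub>A\<^esub> \<in> carrier N" using rmod_homD(1)[OF f(1)] by (simp add: cP)
  ultimately have "free_object A N (f \<one>\<^bsub>A\<^esub>)"
    using N by (simp add: free_object_def free_object_axioms_def A.ring_axioms)
  then show ?thesis by blast
qed

section \<open>Splitting off direct summands\<close>

definition functionals :: "('a, 'x) ring_scheme \<Rightarrow> ('a, 'm, 'y) rmodule_scheme \<Rightarrow> ('m \<Rightarrow> 'a) set" where
  "functionals R M = {\<alpha> \<in> carrier M \<rightarrow> carrier R.
     (\<forall>x \<in> carrier M. \<forall>y \<in> carrier M. \<alpha> (x \<oplus>\<^bsub>M\<^esub> y) = \<alpha> x \<oplus>\<^bsub>R\<^esub> \<alpha> y) \<and>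
     (\<forall>x \<in> carrier M. \<forall>a \<in> carrier R. \<alpha> (x \<triangleleft>\<^bsub>M\<^esub> a) = \<alpha> x \<otimes>\<^bsub>R\<^esub> a)}"

text \<open>For an idempotent \<open>e\<close> this says that \<open>eR\<close> is a direct summand of \<open>M\<close>: after replacing \<open>p\<close> by \<open>p e\<close>
  and \<open>\<alpha>\<close> by \<open>e \<alpha>\<close>, the maps \<open>e r \<mapsto> p r\<close> and \<open>\<alpha>\<close> compose to the identity of \<open>eR\<close>. For \<open>e = 1\<close> the
  module \<open>R\<close> itself is a summand.\<close>

definition splits_off :: "('a, 'x) ring_scheme \<Rightarrow> ('a, 'm, 'y) rmodule_scheme \<Rightarrow> 'a \<Rightarrow> bool" where
  "splits_off R M e \<longleftrightarrow> (\<exists>p \<in> carrier M. \<exists>\<alpha> \<in> functionals R M. \<alpha> p = e)"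

context right_module
begin

lemma functionalD:
  assumes "\<alpha> \<in> functionals R M"
  shows "x \<in> carrier M \<Longrightarrow> \<alpha> x \<in> carrier R"
    and "\<lbrakk>x \<in> carrier M; y \<in> carrier M\<rbrakk> \<Longrightarrow> \<alpha> (x \<oplus>\<^bsub>M\<^esub> y) = \<alpha> x \<oplus> \<alpha> y"
    and "\<lbrakk>x \<in> carrier M; a \<in> carrier R\<rbrakk> \<Longrightarrow> \<alpha> (x \<triangleleft>\<^bsub>M\<^esub> a) = \<alpha> x \<otimes> a"
  using assms by (auto simp: functionals_def)

lemma functional_minus:
  assumes a: "\<alpha> \<in> functionals R M" and x: "x \<in> carrier M" and y: "y \<in> carrier M"
  shows "\<alpha> (x \<ominus>\<^bsub>M\<^esub> y) = \<alpha> x \<ominus> \<alpha> y"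
proof -
  have c: "x \<ominus>\<^bsub>M\<^esub> y \<in> carrier M" using x y by simp
  have "y \<oplus>\<^bsub>M\<^esub> (x \<ominus>\<^bsub>M\<^esub> y) = x"
    using x y by (simp add: a_minus_def M.a_comm[of x "\<ominus>\<^bsub>M\<^esub> y"] M.r_neg2)
  then have "\<alpha> x = \<alpha> y \<oplus> \<alpha> (x \<ominus>\<^bsub>M\<^esub> y)" using functionalD(2)[OF a y c] by simp
  then show ?thesis
    using R.add_minus_cancel(2)[of "\<alpha> y" "\<alpha> (x \<ominus>\<^bsub>M\<^esub> y)"] functionalD(1)[OF a] y c by simp
qed

lemma functional_lmult:
  assumes "\<alpha> \<in> functionals R M" "a \<in> carrier R"
  shows "(\<lambda>x. a \<otimes> \<alpha> x) \<in> functionals R M"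
  using functionalD[OF assms(1)] assms(2) by (simp add: functionals_def R.r_distr R.m_assoc)

lemma functional_add:
  assumes "\<alpha> \<in> functionals R M" "\<beta> \<in> functionals R M"
  shows "(\<lambda>x. \<alpha> x \<oplus> \<beta> x) \<in> functionals R M"
  using functionalD[OF assms(1)] functionalD[OF assms(2)]
  by (simp add: functionals_def R.l_distr R.a_ac)

lemma functionals_cong:
  assumes "\<alpha> \<in> functionals R M" "\<And>x. x \<in> carrier M \<Longrightarrow> \<alpha> x = \<beta> x"
  shows "\<beta> \<in> functionals R M"
  using assms unfolding functionals_def by (simp add: Pi_iff ract_closed)

lemma functional_diff:
  assumes "\<alpha> \<in> functionals R M" "\<beta> \<in> functionals R M"
  shows "(\<lambda>x. \<alpha> x \<ominus> \<beta> x) \<in> functionals R M"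
proof -
  have "\<alpha> x \<oplus> (\<ominus> \<one>) \<otimes> \<beta> x = \<alpha> x \<ominus> \<beta> x" if "x \<in> carrier M" for x
    using functionalD(1)[OF assms(2) that] by (simp add: a_minus_def R.l_minus)
  then show ?thesis
    using functionals_cong[OF functional_add[OF assms(1) functional_lmult[OF assms(2), of "\<ominus> \<one>"]]] by simp
qed

lemma splits_off_idempotent:
  assumes s: "splits_off R M e" and e: "e \<in> carrier R" "e \<otimes> e = e"
  obtains p \<alpha> where "p \<in> carrier M" "\<alpha> \<in> functionals R M" "\<alpha> p = e"
    "p \<triangleleft>\<^bsub>M\<^esub> e = p" "\<And>x. x \<in> carrier M \<Longrightarrow> e \<otimes> \<alpha> x = \<alpha> x"
proof -
  obtain p \<alpha> where p: "p \<in> carrier M" "\<alpha> \<in> functionals R M" "\<alpha> p = e"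
    using s unfolding splits_off_def by blast
  show ?thesis
  proof (rule that)
    show "p \<triangleleft>\<^bsub>M\<^esub> e \<in> carrier M" using p e by (simp add: ract_closed)
    show "(\<lambda>x. e \<otimes> \<alpha> x) \<in> functionals R M" using p e by (intro functional_lmult)
    show "e \<otimes> \<alpha> (p \<triangleleft>\<^bsub>M\<^esub> e) = e" using p e by (simp add: functionalD(3))
    show "p \<triangleleft>\<^bsub>M\<^esub> e \<triangleleft>\<^bsub>M\<^esub> e = p \<triangleleft>\<^bsub>M\<^esub> e" using p e by (simp flip: ract_mult)
    show "e \<otimes> (e \<otimes> \<alpha> x) = e \<otimes> \<alpha> x" if "x \<in> carrier M" for x
      using functionalD(1)[OF p(2) that] e by (simp flip: R.m_assoc)
  qed
qed

end

context pi_regular_ring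
begin

text \<open>If values of functionals on \<open>M\<close> generate the right ideal \<open>R\<close>, then \<open>e\<close> is the sum of the
  elements \<open>e a\<^sub>i v\<^sub>i e\<close> of the local ring \<open>eRe\<close>, and one of them is invertible.\<close>

lemma splits_off_primitive:
  assumes M: "right_module R M" and e: "primitive_idempotent R e"
    and sum: "\<one> = (\<Oplus>i \<in> {..<n::nat}. a i \<otimes> v i)"
    and a: "\<And>i. i < n \<Longrightarrow> \<exists>\<alpha> \<in> functionals R M. a i \<in> \<alpha> ` carrier M"
    and v: "v \<in> {..<n} \<rightarrow> carrier R"
  shows "splits_off R M e"
proof -
  interpret M: right_module R M by fact
  have ec: "e \<in> carrier R" "e \<otimes> e = e"
    using e by (auto simp: primitive_idempotent_def idempotent_def)
  have ac: "a i \<in> carrier R" if i: "i < n" for i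
  proof -
    obtain \<alpha> p where "\<alpha> \<in> functionals R M" "p \<in> carrier M" "a i = \<alpha> p" using a[OF i] by (elim bexE imageE)
    then show ?thesis by (simp add: M.functionalD(1))
  qed
  have vc: "v i \<in> carrier R" if "i < n" for i using v that by auto
  have "e = e \<otimes> (\<Oplus>i \<in> {..<n}. a i \<otimes> v i) \<otimes> e"
    using ec unfolding sum[symmetric] by simp
  also have "\<dots> = (\<Oplus>i \<in> {..<n}. e \<otimes> (a i \<otimes> v i)) \<otimes> e"
    by (subst finsum_rdistr) (use ec ac vc in auto)
  also have "\<dots> = (\<Oplus>i \<in> {..<n}. e \<otimes> (a i \<otimes> v i) \<otimes> e)"
    by (subst finsum_ldistr) (use ec ac vc in auto)
  finally have "(\<Oplus>i \<in> {..<n}. e \<otimes> (a i \<otimes> v i) \<otimes> e) = e" by simp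
  moreover have "corner_invertible e e"
    unfolding corner_invertible_def using corner_self[OF ec] ec(2) by blast
  moreover have "e \<otimes> (a i \<otimes> v i) \<otimes> e \<in> corner e" if "i \<in> {..<n}" for i
    using that ec ac vc by (intro cornerI) auto
  ultimately obtain i where i: "i < n" "corner_invertible e (e \<otimes> (a i \<otimes> v i) \<otimes> e)"
    using corner_invertible_finsum[OF e, of "{..<n}" "\<lambda>i. e \<otimes> (a i \<otimes> v i) \<otimes> e"] by auto
  then obtain y where y: "y \<in> corner e" "e \<otimes> (a i \<otimes> v i) \<otimes> e \<otimes> y = e"
    unfolding corner_invertible_def by blast
  obtain \<alpha> p where p: "\<alpha> \<in> functionals R M" "p \<in> carrier M" "a i = \<alpha> p" using a[OF i(1)] by (elim bexE imageE)
  have yc: "y \<in> carrier R" using y(1) by (rule corner_closed)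
  let ?p = "p \<triangleleft>\<^bsub>M\<^esub> (v i \<otimes> e \<otimes> y)"
  have "e \<otimes> \<alpha> ?p = e \<otimes> (a i \<otimes> v i) \<otimes> e \<otimes> y"
    using p(1,2) ec(1) yc vc[OF i(1)] ac[OF i(1)]
    by (simp add: M.functionalD(3)) (simp add: p(3) m_assoc)
  then show ?thesis
    unfolding splits_off_def using M.functional_lmult[OF p(1) ec(1)] p(2) ec(1) yc vc[OF i(1)] y(2)
    by (intro bexI[of _ ?p] bexI[of _ "\<lambda>x. e \<otimes> \<alpha> x"]) (auto intro: M.ract_closed)
qed

text \<open>The exchange argument: let \<open>f\<close> and \<open>e\<close> split off with projections \<open>\<alpha>\<close> and \<open>\<beta>\<close>, and let
  no endomorphism of \<open>eR\<close> that factors through \<open>fR\<close> be invertible. As the endomorphism ring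
  of \<open>eR\<close> is local, \<open>\<beta>\<close> is still split epi on the complement of \<open>fR\<close>.\<close>

lemma splits_off_add:
  assumes M: "right_module R M" and e: "primitive_idempotent R e" and f: "idempotent R f"
    and orth: "orthogonal R f e" and sf: "splits_off R M f" and se: "splits_off R M e"
    and no: "\<And>x y. \<lbrakk>x \<in> carrier R; y \<in> carrier R; e \<otimes> y = y; y \<otimes> f = y; f \<otimes> x = x; x \<otimes> e = x\<rbrakk> \<Longrightarrow>
      \<not> corner_invertible e (y \<otimes> x)"
  shows "splits_off R M (f \<oplus> e)"
proof -
  interpret M: right_module R M by fact
  have ec: "e \<in> carrier R" "e \<otimes> e = e" and fc: "f \<in> carrier R" "f \<otimes> f = f"
    using e f by (auto simp: primitive_idempotent_def idempotent_def)
  obtain p \<alpha> where p: "p \<in> carrier M" "\<alpha> \<in> functionals R M" "\<alpha> p = f" "p \<triangleleft>\<^bsub>M\<^esub> f = p"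
    "\<And>x. x \<in> carrier M \<Longrightarrow> f \<otimes> \<alpha> x = \<alpha> x"
    by (rule M.splits_off_idempotent[OF sf fc]) (rule that)
  obtain q \<beta> where q: "q \<in> carrier M" "\<beta> \<in> functionals R M" "\<beta> q = e" "q \<triangleleft>\<^bsub>M\<^esub> e = q"
    "\<And>x. x \<in> carrier M \<Longrightarrow> e \<otimes> \<beta> x = \<beta> x"
    by (rule M.splits_off_idempotent[OF se ec]) (rule that)
  define x where "x = \<alpha> q"
  define y where "y = \<beta> p"
  have xc: "x \<in> carrier R" "f \<otimes> x = x" using M.functionalD(1)[OF p(2) q(1)] p(5) q(1) by (simp_all add: x_def)
  have yc: "y \<in> carrier R" "e \<otimes> y = y" using M.functionalD(1)[OF q(2) p(1)] q(5) p(1) by (simp_all add: y_def)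
  have xe: "x \<otimes> e = x" using M.functionalD(3)[OF p(2) q(1) ec(1)] by (simp add: x_def q(4))
  have yf: "y \<otimes> f = y" using M.functionalD(3)[OF q(2) p(1) fc(1)] by (simp add: y_def p(4))
  have "e \<otimes> (y \<otimes> x) = y \<otimes> x" "y \<otimes> x \<otimes> e = y \<otimes> x"
    using m_assoc[OF ec(1) yc(1) xc(1)] m_assoc[OF yc(1) xc(1) ec(1)] yc(2) xe by simp_all
  then have yx: "y \<otimes> x \<in> corner e" unfolding corner_def using xc(1) yc(1) by simp
  have "\<not> corner_invertible e (y \<otimes> x)" using no xc yc xe yf by blast
  then have "corner_invertible e (e \<ominus> y \<otimes> x)" using corner_local[OF e yx] by blast
  then obtain v where v: "v \<in> corner e" "(e \<ominus> y \<otimes> x) \<otimes> v = e"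
    unfolding corner_invertible_def by blast
  have vc: "v \<in> carrier R" using v(1) by (rule corner_closed)
  define r where "r = (q \<ominus>\<^bsub>M\<^esub> p \<triangleleft>\<^bsub>M\<^esub> x) \<triangleleft>\<^bsub>M\<^esub> v"
  have px: "p \<triangleleft>\<^bsub>M\<^esub> x \<in> carrier M" using p(1) xc(1) by (rule M.ract_closed)
  have qpx: "q \<ominus>\<^bsub>M\<^esub> p \<triangleleft>\<^bsub>M\<^esub> x \<in> carrier M" using px q(1) by simp
  have rc: "r \<in> carrier M" unfolding r_def using qpx vc by (rule M.ract_closed)
  have "\<alpha> r = (x \<ominus> f \<otimes> x) \<otimes> v"
    unfolding r_def M.functionalD(3)[OF p(2) qpx vc] M.functional_minus[OF p(2) q(1) px]
    using M.functionalD(3)[OF p(2,1) xc(1)] p(3) by (simp add: x_def)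
  then have ar: "\<alpha> r = \<zero>" using xc vc by (simp add: a_minus_def r_neg)
  have br: "\<beta> r = e"
    unfolding r_def M.functionalD(3)[OF q(2) qpx vc] M.functional_minus[OF q(2) q(1) px]
    using M.functionalD(3)[OF q(2) p(1) xc(1)] q(3) v(2) by (simp add: y_def)
  \<comment> \<open>The element \<open>r\<close> is killed by \<open>\<alpha>\<close> and sent to \<open>e\<close> by \<open>\<beta>\<close>; subtracting \<open>y \<alpha>\<close> removes
    the value of \<open>\<beta>\<close> at \<open>p\<close>.\<close>
  let ?\<gamma> = "\<lambda>z. (\<alpha> z \<oplus> \<beta> z) \<ominus> y \<otimes> \<alpha> z"
  have "?\<gamma> \<in> functionals R M"
    by (intro M.functional_diff M.functional_add M.functional_lmult p q yc)
  moreover have "?\<gamma> (p \<oplus>\<^bsub>M\<^esub> r) = f \<oplus> e"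
  proof -
    have "\<alpha> (p \<oplus>\<^bsub>M\<^esub> r) = f" using M.functionalD(2)[OF p(2) p(1) rc] p(3) ar fc by simp
    moreover have "\<beta> (p \<oplus>\<^bsub>M\<^esub> r) = y \<oplus> e" using M.functionalD(2)[OF q(2) p(1) rc] br by (simp add: y_def)
    ultimately have "?\<gamma> (p \<oplus>\<^bsub>M\<^esub> r) = (y \<oplus> (f \<oplus> e)) \<ominus> y"
      using fc ec yc(1) yf by (simp add: a_lcomm)
    then show ?thesis using add_minus_cancel(2)[of y "f \<oplus> e"] fc ec yc(1) by simp
  qed
  ultimately show ?thesis unfolding splits_off_def
    using M.M.a_closed[OF p(1) rc] by (intro bexI[of _ "p \<oplus>\<^bsub>M\<^esub> r"] bexI[of _ ?\<gamma>])
qed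

text \<open>The primitive idempotents of a basic decomposition are split off one after the other. An
  invertible endomorphism of \<open>eR\<close> through the sum \<open>f\<close> of the earlier ones would give one through a single
  \<open>gR\<close>, and then \<open>eR\<close> and \<open>gR\<close> would be isomorphic.\<close>

lemma splits_off_one:
  assumes M: "right_module R M" and bas: "basic R"
    and prim: "\<And>e. primitive_idempotent R e \<Longrightarrow> splits_off R M e"
  shows "splits_off R M \<one>"
proof -
  interpret M: right_module R M by fact
  obtain E where E0: "finite E" "\<forall>e \<in> E. primitive_idempotent R e"
    "\<forall>e \<in> E. \<forall>f \<in> E. e \<noteq> f \<longrightarrow> orthogonal R e f" "(\<Oplus>e \<in> E. e) = \<one>"
    "\<forall>e \<in> E. \<forall>f \<in> E. e \<noteq> f \<longrightarrow> \<not> rmod_isomorphic R (principal_rmod R e) (principal_rmod R f)"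
    using bas unfolding basic_def by (elim exE conjE) (rule that)
  have E: "finite E" "\<And>e. e \<in> E \<Longrightarrow> primitive_idempotent R e"
    "\<And>e f. \<lbrakk>e \<in> E; f \<in> E; e \<noteq> f\<rbrakk> \<Longrightarrow> orthogonal R e f" "(\<Oplus>e \<in> E. e) = \<one>"
    "\<And>e f. \<lbrakk>e \<in> E; f \<in> E; e \<noteq> f\<rbrakk> \<Longrightarrow> \<not> rmod_isomorphic R (principal_rmod R e) (principal_rmod R f)"
    using E0 by blast+
  have Ec: "e \<in> carrier R" "e \<otimes> e = e" if "e \<in> E" for e
    using E(2)[OF that] by (auto simp: primitive_idempotent_def idempotent_def)
  have "idempotent R (\<Oplus>e \<in> S. e) \<and> splits_off R M (\<Oplus>e \<in> S. e) \<and>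
      (\<forall>e \<in> E - S. orthogonal R (\<Oplus>e \<in> S. e) e)" if "finite S" "S \<subseteq> E" for S
    using that
  proof (induction S)
    case empty
    have "(\<lambda>x. \<zero>) \<in> functionals R M" by (simp add: functionals_def)
    then have "splits_off R M \<zero>" unfolding splits_off_def
      by (intro bexI[of _ "\<zero>\<^bsub>M\<^esub>"] bexI[of _ "\<lambda>x. \<zero>"]) simp_all
    then show ?case using Ec(1) by (simp add: idempotent_def orthogonal_def)
  next
    case (insert e S)
    let ?f = "\<Oplus>e \<in> S. e"
    have e: "e \<in> E" "e \<in> carrier R" "e \<otimes> e = e" using insert.prems Ec by auto
    have IH: "idempotent R ?f" "splits_off R M ?f" "\<And>e. e \<in> E - S \<Longrightarrow> orthogonal R ?f e"
      using insert by auto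
    have fc: "?f \<in> carrier R" "?f \<otimes> ?f = ?f" using IH(1) by (auto simp: idempotent_def)
    have Sc: "\<And>g. g \<in> S \<Longrightarrow> g \<in> carrier R" using insert.prems Ec by auto
    have sum: "(\<Oplus>e \<in> insert e S. e) = ?f \<oplus> e"
    proof -
      have "(\<Oplus>e \<in> insert e S. e) = e \<oplus> ?f"
        using insert.hyps e(2) Sc by (intro finsum_insert) auto
      then show ?thesis using fc e by (simp add: a_comm)
    qed
    have oef: "?f \<otimes> e = \<zero>" "e \<otimes> ?f = \<zero>" using IH(3)[of e] e insert.hyps by (auto simp: orthogonal_def)
    have "idempotent R (?f \<oplus> e)"
      using fc e oef by (simp add: idempotent_def l_distr r_distr)
    moreover have "splits_off R M (?f \<oplus> e)"
    proof (rule splits_off_add[OF M E(2)[OF e(1)] IH(1) _ IH(2) prim[OF E(2)[OF e(1)]]])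
      show "orthogonal R ?f e" using oef by (simp add: orthogonal_def)
      fix x y assume x: "x \<in> carrier R" "?f \<otimes> x = x" "x \<otimes> e = x"
        and y: "y \<in> carrier R" "e \<otimes> y = y" "y \<otimes> ?f = y"
      show "\<not> corner_invertible e (y \<otimes> x)"
      proof
        assume inv: "corner_invertible e (y \<otimes> x)"
        have "y \<otimes> x = y \<otimes> ?f \<otimes> x" using y(3) by simp
        also have "\<dots> = (\<Oplus>g \<in> S. y \<otimes> g) \<otimes> x"
          by (subst finsum_rdistr) (use insert.hyps Sc y in auto)
        also have "\<dots> = (\<Oplus>g \<in> S. y \<otimes> g \<otimes> x)"
          by (subst finsum_ldistr) (use insert.hyps Sc x y in auto)
        finally have eq: "y \<otimes> x = (\<Oplus>g \<in> S. y \<otimes> g \<otimes> x)" .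
        have "y \<otimes> g \<otimes> x \<in> corner e" if "g \<in> S" for g
        proof -
          have "e \<otimes> (y \<otimes> g \<otimes> x) = e \<otimes> y \<otimes> g \<otimes> x" "y \<otimes> g \<otimes> x \<otimes> e = y \<otimes> g \<otimes> (x \<otimes> e)"
            using e(2) y(1) x(1) Sc[OF that] by (simp_all add: m_assoc)
          then show ?thesis unfolding corner_def using y(1,2) x(1,3) Sc[OF that] by simp
        qed
        then obtain g where g: "g \<in> S" "corner_invertible e (y \<otimes> g \<otimes> x)"
          using corner_invertible_finsum[OF E(2)[OF e(1)] insert.hyps(1), of "\<lambda>g. y \<otimes> g \<otimes> x"] inv
          unfolding eq by blast
        then obtain z where z: "z \<in> corner e" "y \<otimes> g \<otimes> x \<otimes> z = e"
          unfolding corner_invertible_def by blast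
        have zc: "z \<in> carrier R" "z \<otimes> e = z" using z(1) by (auto simp: corner_def)
        have gE: "g \<in> E" "g \<in> carrier R" "g \<otimes> g = g" using g(1) insert.prems Ec by auto
        have "rmod_isomorphic R (principal_rmod R e) (principal_rmod R g)"
        proof (rule principal_isoI[OF E(2)[OF e(1)] E(2)[OF gE(1)], of "y \<otimes> g" "g \<otimes> x \<otimes> z"])
          show "e \<otimes> (y \<otimes> g) = y \<otimes> g" using y e(2) gE by (simp flip: m_assoc)
          show "y \<otimes> g \<otimes> g = y \<otimes> g" using y gE by (simp add: m_assoc)
          show "g \<otimes> (g \<otimes> x \<otimes> z) = g \<otimes> x \<otimes> z" using gE x(1) zc(1) by (simp flip: m_assoc)
          show "g \<otimes> x \<otimes> z \<otimes> e = g \<otimes> x \<otimes> z" using gE x(1) zc e(2) by (simp add: m_assoc)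
          have "y \<otimes> g \<otimes> (g \<otimes> x \<otimes> z) = y \<otimes> (g \<otimes> g) \<otimes> x \<otimes> z"
            using y(1) gE(2) x(1) zc(1) by (simp add: m_assoc)
          then show "y \<otimes> g \<otimes> (g \<otimes> x \<otimes> z) = e" using gE(3) z(2) by simp
        qed (use x(1) y(1) zc gE in auto)
        moreover have "e \<noteq> g" using g(1) insert.hyps by blast
        ultimately show False using E(5)[OF e(1) gE(1)] by blast
      qed
    qed
    moreover have "orthogonal R (?f \<oplus> e) g" if "g \<in> E - insert e S" for g
    proof -
      have "orthogonal R ?f g" "orthogonal R e g" "g \<in> carrier R"
        using that IH(3) E(3)[OF e(1)] Ec by auto
      then show ?thesis using fc e by (simp add: orthogonal_def l_distr r_distr)
    qed
    ultimately show ?case unfolding sum by blast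
  qed
  from this[OF E(1) subset_refl] show ?thesis unfolding E(4) by blast
qed

end

section \<open>Finitely presented modules\<close>

text \<open>Stated as an induction principle for the generated submodule, since this is how generators
  are used; linear combinations do not occur.\<close>

definition generates :: "('a, 'x) ring_scheme \<Rightarrow> ('a, 'm, 'y) rmodule_scheme \<Rightarrow> nat \<Rightarrow> (nat \<Rightarrow> 'm) \<Rightarrow> bool" where
  "generates R M n q \<longleftrightarrow> (\<forall>i < n. q i \<in> carrier M) \<and>
     (\<forall>S. (\<forall>i < n. q i \<in> S) \<longrightarrow> \<zero>\<^bsub>M\<^esub> \<in> S \<longrightarrow>
        (\<forall>x \<in> carrier M. \<forall>y \<in> carrier M. x \<in> S \<longrightarrow> y \<in> S \<longrightarrow> x \<oplus>\<^bsub>M\<^esub> y \<in> S) \<longrightarrow>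
        (\<forall>x \<in> carrier M. \<forall>a \<in> carrier R. x \<in> S \<longrightarrow> x \<triangleleft>\<^bsub>M\<^esub> a \<in> S) \<longrightarrow> carrier M \<subseteq> S)"

lemma generatesD:
  assumes "generates A M n q"
  shows "i < n \<Longrightarrow> q i \<in> carrier M"
    and "\<lbrakk>\<And>i. i < n \<Longrightarrow> q i \<in> S; \<zero>\<^bsub>M\<^esub> \<in> S;
      \<And>x y. \<lbrakk>x \<in> carrier M; y \<in> carrier M; x \<in> S; y \<in> S\<rbrakk> \<Longrightarrow> x \<oplus>\<^bsub>M\<^esub> y \<in> S;
      \<And>x a. \<lbrakk>x \<in> carrier M; a \<in> carrier A; x \<in> S\<rbrakk> \<Longrightarrow> x \<triangleleft>\<^bsub>M\<^esub> a \<in> S\<rbrakk> \<Longrightarrow> carrier M \<subseteq> S"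
  using assms unfolding generates_def by simp_all

text \<open>The images of the unit vectors generate. For the induction principle, a vector is built up
  from its truncations \<open>t k\<close> to the first \<open>k\<close> coordinates.\<close>

lemma finitely_presented_generators:
  assumes M: "right_module A M" and fp: "finitely_presented A M"
  shows "\<exists>n q. generates A M n q"
proof -
  interpret right_module A M by fact
  obtain n g where g: "g \<in> rmod_hom A (free_rmod A n) M" "g ` carrier (free_rmod A n) = carrier M"
    using fp unfolding finitely_presented_def by blast
  let ?F = "free_rmod A n"
  have F: "carrier ?F = {..<n} \<rightarrow>\<^sub>E carrier A" "ring.add ?F = (\<lambda>v w. \<lambda>i \<in> {..<n}. v i \<oplus>\<^bsub>A\<^esub> w i)"
    "ract ?F = (\<lambda>v a. \<lambda>i \<in> {..<n}. v i \<otimes>\<^bsub>A\<^esub> a)"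
    by (simp_all add: free_rmod_def)
  define unit where "unit i = (\<lambda>j \<in> {..<n}. if j = i then \<one>\<^bsub>A\<^esub> else \<zero>\<^bsub>A\<^esub>)" for i
  have unit: "unit i \<in> carrier ?F" for i by (auto simp: unit_def F)
  define q where "q i = g (unit i)" for i
  note gD = rmod_homD[OF g(1)]
  have "generates A M n q"
    unfolding generates_def
  proof (intro conjI allI impI)
    show "q i \<in> carrier M" for i using gD(1) unit by (simp add: q_def)
  next
    fix S assume S0: "\<forall>i < n. q i \<in> S" "\<zero>\<^bsub>M\<^esub> \<in> S"
      "\<forall>x \<in> carrier M. \<forall>y \<in> carrier M. x \<in> S \<longrightarrow> y \<in> S \<longrightarrow> x \<oplus>\<^bsub>M\<^esub> y \<in> S"
      "\<forall>x \<in> carrier M. \<forall>a \<in> carrier A. x \<in> S \<longrightarrow> x \<triangleleft>\<^bsub>M\<^esub> a \<in> S"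
    have S: "\<And>i. i < n \<Longrightarrow> q i \<in> S" "\<zero>\<^bsub>M\<^esub> \<in> S"
      "\<And>x y. \<lbrakk>x \<in> carrier M; y \<in> carrier M; x \<in> S; y \<in> S\<rbrakk> \<Longrightarrow> x \<oplus>\<^bsub>M\<^esub> y \<in> S"
      "\<And>x a. \<lbrakk>x \<in> carrier M; x \<in> S; a \<in> carrier A\<rbrakk> \<Longrightarrow> x \<triangleleft>\<^bsub>M\<^esub> a \<in> S"
      using S0 by blast+
    show "carrier M \<subseteq> S"
    proof
      fix x assume "x \<in> carrier M"
      then obtain v where v: "v \<in> carrier ?F" "x = g v" using g(2) by blast
      then have vA: "v i \<in> carrier A" if "i < n" for i using that by (auto simp: F)
      define t where "t k = (\<lambda>j \<in> {..<n}. if j < k then v j else \<zero>\<^bsub>A\<^esub>)" for k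
      have tF: "t k \<in> carrier ?F" for k using vA by (auto simp: t_def F)
      have "g (t k) \<in> S" if "k \<le> n" for k
        using that
      proof (induction k)
        case 0
        have "t 0 = t 0 \<triangleleft>\<^bsub>?F\<^esub> \<zero>\<^bsub>A\<^esub>" unfolding F t_def by (rule restrict_ext) simp
        then have "g (t 0) = g (t 0) \<triangleleft>\<^bsub>M\<^esub> \<zero>\<^bsub>A\<^esub>" using gD(3)[OF tF[of 0] R.zero_closed] by simp
        then show ?case using ract_zero_right[OF gD(1)[OF tF[of 0]]] S(2) by simp
      next
        case (Suc k)
        then have k: "k < n" by simp
        have uk: "unit k \<triangleleft>\<^bsub>?F\<^esub> v k \<in> carrier ?F" using vA[OF k] by (auto simp: unit_def F)
        have "t (Suc k) = t k \<oplus>\<^bsub>?F\<^esub> (unit k \<triangleleft>\<^bsub>?F\<^esub> v k)"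
          unfolding F t_def unit_def by (rule restrict_ext) (use vA k in \<open>auto simp: less_Suc_eq\<close>)
        then have "g (t (Suc k)) = g (t k) \<oplus>\<^bsub>M\<^esub> q k \<triangleleft>\<^bsub>M\<^esub> v k"
          using gD(2)[OF tF uk] gD(3)[OF unit vA[OF k]] by (simp add: q_def)
        moreover have "q k \<triangleleft>\<^bsub>M\<^esub> v k \<in> S" "q k \<triangleleft>\<^bsub>M\<^esub> v k \<in> carrier M"
          using S(1)[OF k] S(4) vA[OF k] gD(1)[OF unit] by (auto simp: q_def intro: ract_closed)
        ultimately show ?case using S(3) gD(1)[OF tF] Suc by simp
      qed
      moreover have "t n = v"
        by (rule extensionalityI[of _ "{..<n}"]) (use v(1) in \<open>auto simp: t_def F PiE_def\<close>)
      ultimately show "x \<in> S" using v(2) by (metis order_refl)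
    qed
  qed
  then show ?thesis by blast
qed

definition right_ideal_gen :: "('a, 'x) ring_scheme \<Rightarrow> nat \<Rightarrow> (nat \<Rightarrow> 'a) \<Rightarrow> 'a set" where
  "right_ideal_gen A m a = {\<Oplus>\<^bsub>A\<^esub>i \<in> {..<m}. a i \<otimes>\<^bsub>A\<^esub> v i | v. v \<in> {..<m} \<rightarrow> carrier A}"

lemma (in ring) right_ideal_gen:
  assumes a: "a \<in> {..<m} \<rightarrow> carrier R"
  shows "right_ideal_gen R m a \<subseteq> carrier R"
    and "\<zero> \<in> right_ideal_gen R m a"
    and "\<lbrakk>x \<in> right_ideal_gen R m a; y \<in> right_ideal_gen R m a\<rbrakk> \<Longrightarrow> x \<oplus> y \<in> right_ideal_gen R m a"
    and "\<lbrakk>x \<in> right_ideal_gen R m a; r \<in> carrier R\<rbrakk> \<Longrightarrow> x \<otimes> r \<in> right_ideal_gen R m a"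
    and "\<lbrakk>x \<in> right_ideal_gen R m a; y \<in> right_ideal_gen R m a\<rbrakk> \<Longrightarrow> x \<ominus> y \<in> right_ideal_gen R m a"
    and "i < m \<Longrightarrow> a i \<in> right_ideal_gen R m a"
proof -
  let ?L = "right_ideal_gen R m a"
  have ac: "a i \<in> carrier R" if "i < m" for i using a that by auto
  show sub: "?L \<subseteq> carrier R" using ac by (auto simp: right_ideal_gen_def Pi_iff intro!: finsum_closed)
  have "(\<Oplus>i \<in> {..<m}. a i \<otimes> \<zero>) = (\<Oplus>i \<in> {..<m}. \<zero>)" using ac by (intro finsum_cong') auto
  then show "\<zero> \<in> ?L" unfolding right_ideal_gen_def by (intro CollectI exI[of _ "\<lambda>_. \<zero>"]) auto
  show add: "x \<oplus> y \<in> ?L" if "x \<in> ?L" "y \<in> ?L" for x y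
  proof -
    from that obtain v w where v: "v \<in> {..<m} \<rightarrow> carrier R" "x = (\<Oplus>i \<in> {..<m}. a i \<otimes> v i)"
      and w: "w \<in> {..<m} \<rightarrow> carrier R" "y = (\<Oplus>i \<in> {..<m}. a i \<otimes> w i)"
      unfolding right_ideal_gen_def by blast
    have "x \<oplus> y = (\<Oplus>i \<in> {..<m}. a i \<otimes> v i \<oplus> a i \<otimes> w i)"
      unfolding v(2) w(2) by (rule finsum_addf[symmetric]) (use ac v(1) w(1) in auto)
    also have "\<dots> = (\<Oplus>i \<in> {..<m}. a i \<otimes> (v i \<oplus> w i))"
      by (intro finsum_cong') (use ac v(1) w(1) in \<open>auto simp: r_distr Pi_iff\<close>)
    finally show ?thesis unfolding right_ideal_gen_def using v(1) w(1)
      by (intro CollectI exI[of _ "\<lambda>i. v i \<oplus> w i"]) auto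
  qed
  show mult: "x \<otimes> r \<in> ?L" if "x \<in> ?L" "r \<in> carrier R" for x r
  proof -
    from that obtain v where v: "v \<in> {..<m} \<rightarrow> carrier R" "x = (\<Oplus>i \<in> {..<m}. a i \<otimes> v i)"
      unfolding right_ideal_gen_def by blast
    have "x \<otimes> r = (\<Oplus>i \<in> {..<m}. a i \<otimes> v i \<otimes> r)"
      unfolding v(2) by (rule finsum_ldistr) (use ac v(1) that in auto)
    also have "\<dots> = (\<Oplus>i \<in> {..<m}. a i \<otimes> (v i \<otimes> r))"
      by (intro finsum_cong') (use ac v(1) that in \<open>auto simp: m_assoc Pi_iff\<close>)
    finally show ?thesis unfolding right_ideal_gen_def using v(1) that
      by (intro CollectI exI[of _ "\<lambda>i. v i \<otimes> r"]) auto
  qed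
  show "x \<ominus> y \<in> ?L" if "x \<in> ?L" "y \<in> ?L" for x y
  proof -
    have "x \<ominus> y = x \<oplus> y \<otimes> (\<ominus> \<one>)" using that sub by (simp add: a_minus_def r_minus subsetD)
    then show ?thesis using add[OF that(1) mult[OF that(2)]] by simp
  qed
  show "a i \<in> ?L" if "i < m"
  proof -
    have "(\<Oplus>j \<in> {..<m}. a j \<otimes> (if i = j then \<one> else \<zero>)) = (\<Oplus>j \<in> {..<m}. if i = j then a j else \<zero>)"
      using ac by (intro finsum_cong') auto
    also have "\<dots> = a i" using that a by (intro add.finprod_singleton) auto
    finally show ?thesis unfolding right_ideal_gen_def
      by (intro CollectI exI[of _ "\<lambda>j. if i = j then \<one> else \<zero>"]) auto
  qed
qed

text \<open>The quotient of \<open>A\<close> by the right ideal generated by \<open>a\<^sub>1, \<dots>, a\<^sub>m\<close> has the presentation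
  \<open>A\<^sup>m \<rightarrow> A\<close>. It is realised on a system of representatives, so that its elements have the type of
  those of \<open>A\<close>.\<close>

lemma finitely_presented_quotient:
  fixes A :: "('k, 'a, 'y) module_scheme"
  assumes "ring A" and a: "a \<in> {..<m} \<rightarrow> carrier A"
  obtains N \<pi> where "N \<in> mods A" "\<And>x. x \<in> carrier A \<Longrightarrow> \<pi> x \<in> carrier N"
    "\<And>x y. \<lbrakk>x \<in> carrier A; y \<in> carrier A\<rbrakk> \<Longrightarrow> \<pi> (x \<oplus>\<^bsub>A\<^esub> y) = \<pi> x \<oplus>\<^bsub>N\<^esub> \<pi> y"
    "\<And>x y. \<lbrakk>x \<in> carrier A; y \<in> carrier A\<rbrakk> \<Longrightarrow> \<pi> (x \<otimes>\<^bsub>A\<^esub> y) = \<pi> x \<triangleleft>\<^bsub>N\<^esub> y"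
    "\<And>x. x \<in> carrier A \<Longrightarrow> \<pi> x = \<zero>\<^bsub>N\<^esub> \<longleftrightarrow> x \<in> right_ideal_gen A m a"
proof -
  interpret A: ring A by fact
  let ?L = "right_ideal_gen A m a"
  note L = A.right_ideal_gen[OF a]
  define rep where "rep x = (SOME y. y \<in> carrier A \<and> y \<ominus>\<^bsub>A\<^esub> x \<in> ?L)" for x
  have rep: "rep x \<in> carrier A" "rep x \<ominus>\<^bsub>A\<^esub> x \<in> ?L" if "x \<in> carrier A" for x
  proof -
    have "\<exists>y. y \<in> carrier A \<and> y \<ominus>\<^bsub>A\<^esub> x \<in> ?L"
      using that L(2) by (intro exI[of _ x]) (simp add: a_minus_def A.r_neg)
    then have "rep x \<in> carrier A \<and> rep x \<ominus>\<^bsub>A\<^esub> x \<in> ?L" unfolding rep_def by (rule someI_ex)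
    then show "rep x \<in> carrier A" "rep x \<ominus>\<^bsub>A\<^esub> x \<in> ?L" by auto
  qed
  have minus0: "x \<ominus>\<^bsub>A\<^esub> \<zero>\<^bsub>A\<^esub> = x" if "x \<in> carrier A" for x
    using that by (simp add: a_minus_def)
  have sym: "y \<ominus>\<^bsub>A\<^esub> x \<in> ?L" if "x \<in> carrier A" "y \<in> carrier A" "x \<ominus>\<^bsub>A\<^esub> y \<in> ?L" for x y
  proof -
    have "\<zero>\<^bsub>A\<^esub> \<ominus>\<^bsub>A\<^esub> (x \<ominus>\<^bsub>A\<^esub> y) = y \<ominus>\<^bsub>A\<^esub> x"
      using that(1,2) by (simp add: a_minus_def A.minus_add A.a_comm)
    then show ?thesis using L(5)[OF L(2) that(3)] by simp
  qed
  have tr: "x \<ominus>\<^bsub>A\<^esub> z \<in> ?L" if "x \<in> carrier A" "y \<in> carrier A" "z \<in> carrier A"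
    "x \<ominus>\<^bsub>A\<^esub> y \<in> ?L" "y \<ominus>\<^bsub>A\<^esub> z \<in> ?L" for x y z
    using L(3)[OF that(4,5)] A.minus_minus_cancel[OF that(1-3)] by simp
  have rep_eq: "rep x = rep y \<longleftrightarrow> x \<ominus>\<^bsub>A\<^esub> y \<in> ?L" if "x \<in> carrier A" "y \<in> carrier A" for x y
  proof
    assume "rep x = rep y"
    then show "x \<ominus>\<^bsub>A\<^esub> y \<in> ?L"
      using tr[OF that(1) rep(1)[OF that(1)] that(2)] sym[OF rep(1)[OF that(1)] that(1)] rep that by metis
  next
    assume xy: "x \<ominus>\<^bsub>A\<^esub> y \<in> ?L"
    have "(z \<in> carrier A \<and> z \<ominus>\<^bsub>A\<^esub> x \<in> ?L) \<longleftrightarrow> (z \<in> carrier A \<and> z \<ominus>\<^bsub>A\<^esub> y \<in> ?L)" for z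
      using tr[of z x y] tr[of z y x] sym that xy by blast
    then show "rep x = rep y" unfolding rep_def by simp
  qed
  have rep_add: "rep (rep x \<oplus>\<^bsub>A\<^esub> y) = rep (x \<oplus>\<^bsub>A\<^esub> y)" if "x \<in> carrier A" "y \<in> carrier A" for x y
  proof -
    have "(rep x \<oplus>\<^bsub>A\<^esub> y) \<ominus>\<^bsub>A\<^esub> (x \<oplus>\<^bsub>A\<^esub> y) = rep x \<ominus>\<^bsub>A\<^esub> x"
      using rep(1)[OF that(1)] that
      by (simp add: a_minus_def A.minus_add A.a_assoc A.a_comm[of "\<ominus>\<^bsub>A\<^esub> x" "\<ominus>\<^bsub>A\<^esub> y"] A.r_neg2)
    then show ?thesis using rep that by (subst rep_eq) auto
  qed
  have rep_add': "rep (x \<oplus>\<^bsub>A\<^esub> rep y) = rep (x \<oplus>\<^bsub>A\<^esub> y)" if "x \<in> carrier A" "y \<in> carrier A" for x y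
    using rep_add[OF that(2,1)] rep(1) that by (simp add: A.a_comm)
  have rep_mult: "rep (rep x \<otimes>\<^bsub>A\<^esub> y) = rep (x \<otimes>\<^bsub>A\<^esub> y)" if "x \<in> carrier A" "y \<in> carrier A" for x y
  proof -
    have "(rep x \<otimes>\<^bsub>A\<^esub> y) \<ominus>\<^bsub>A\<^esub> (x \<otimes>\<^bsub>A\<^esub> y) = (rep x \<ominus>\<^bsub>A\<^esub> x) \<otimes>\<^bsub>A\<^esub> y"
      using rep(1)[OF that(1)] that by (simp add: A.minus_distr)
    then show ?thesis using rep that L(4) by (subst rep_eq) auto
  qed
  define N :: "('a, 'a) rmodule" where
    "N = \<lparr>carrier = rep ` carrier A, monoid.mult = undefined, one = undefined, ring.zero = rep \<zero>\<^bsub>A\<^esub>,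
      ring.add = (\<lambda>x y. rep (x \<oplus>\<^bsub>A\<^esub> y)), ract = (\<lambda>x y. rep (x \<otimes>\<^bsub>A\<^esub> y))\<rparr>"
  have N [simp]: "carrier N = rep ` carrier A" "ring.zero N = rep \<zero>\<^bsub>A\<^esub>"
    "ring.add N = (\<lambda>x y. rep (x \<oplus>\<^bsub>A\<^esub> y))" "ract N = (\<lambda>x y. rep (x \<otimes>\<^bsub>A\<^esub> y))"
    by (simp_all add: N_def)
  have abel: "abelian_group N"
  proof (rule abelian_groupI)
    fix S assume "S \<in> carrier N"
    then obtain x where "x \<in> carrier A" "S = rep x" by auto
    then show "\<exists>T \<in> carrier N. T \<oplus>\<^bsub>N\<^esub> S = \<zero>\<^bsub>N\<^esub>"
      by (intro bexI[of _ "rep (\<ominus>\<^bsub>A\<^esub> x)"]) (auto simp: rep_add rep_add' rep(1) A.l_neg)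
  next
    fix S T V assume "S \<in> carrier N" "T \<in> carrier N" "V \<in> carrier N"
    then show "S \<oplus>\<^bsub>N\<^esub> T \<oplus>\<^bsub>N\<^esub> V = S \<oplus>\<^bsub>N\<^esub> (T \<oplus>\<^bsub>N\<^esub> V)"
      by (auto simp: rep_add rep_add' rep(1) A.a_assoc)
  next
    fix S T assume "S \<in> carrier N" "T \<in> carrier N"
    then show "S \<oplus>\<^bsub>N\<^esub> T = T \<oplus>\<^bsub>N\<^esub> S" by (auto simp: rep(1) A.a_comm)
  qed (auto simp: rep_add rep_add' rep(1))
  have "right_module_axioms A N"
  proof (rule right_module_axioms.intro)
    fix x a assume "x \<in> carrier N" and a: "a \<in> carrier A"
    then obtain x' where x: "x' \<in> carrier A" "x = rep x'" by auto
    show "x \<triangleleft>\<^bsub>N\<^esub> a \<in> carrier N" using x a rep(1) by simp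
    fix b assume b: "b \<in> carrier A"
    show "x \<triangleleft>\<^bsub>N\<^esub> (a \<otimes>\<^bsub>A\<^esub> b) = (x \<triangleleft>\<^bsub>N\<^esub> a) \<triangleleft>\<^bsub>N\<^esub> b"
      using x a b by (simp add: rep_mult A.m_assoc)
    show "x \<triangleleft>\<^bsub>N\<^esub> (a \<oplus>\<^bsub>A\<^esub> b) = x \<triangleleft>\<^bsub>N\<^esub> a \<oplus>\<^bsub>N\<^esub> x \<triangleleft>\<^bsub>N\<^esub> b"
    proof -
      have "x \<triangleleft>\<^bsub>N\<^esub> (a \<oplus>\<^bsub>A\<^esub> b) = rep (x' \<otimes>\<^bsub>A\<^esub> (a \<oplus>\<^bsub>A\<^esub> b))"
        using x a b by (simp add: rep_mult)
      also have "\<dots> = rep (x' \<otimes>\<^bsub>A\<^esub> a \<oplus>\<^bsub>A\<^esub> x' \<otimes>\<^bsub>A\<^esub> b)" using x(1) a b by (simp add: A.r_distr)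
      finally show ?thesis using x a b rep(1) by (simp add: rep_mult rep_add rep_add')
    qed
  next
    fix x assume "x \<in> carrier N"
    then obtain x' where x: "x' \<in> carrier A" "x = rep x'" by auto
    then show "x \<triangleleft>\<^bsub>N\<^esub> \<one>\<^bsub>A\<^esub> = x" by (simp add: rep_mult)
  next
    fix x y a assume "x \<in> carrier N" "y \<in> carrier N" and a: "a \<in> carrier A"
    then obtain x' y' where x: "x' \<in> carrier A" "x = rep x'" and y: "y' \<in> carrier A" "y = rep y'" by auto
    show "(x \<oplus>\<^bsub>N\<^esub> y) \<triangleleft>\<^bsub>N\<^esub> a = x \<triangleleft>\<^bsub>N\<^esub> a \<oplus>\<^bsub>N\<^esub> y \<triangleleft>\<^bsub>N\<^esub> a"
    proof -
      have "(x \<oplus>\<^bsub>N\<^esub> y) \<triangleleft>\<^bsub>N\<^esub> a = rep ((x' \<oplus>\<^bsub>A\<^esub> y') \<otimes>\<^bsub>A\<^esub> a)"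
        using x y a rep(1) by (simp add: rep_mult rep_add rep_add')
      also have "\<dots> = rep (x' \<otimes>\<^bsub>A\<^esub> a \<oplus>\<^bsub>A\<^esub> y' \<otimes>\<^bsub>A\<^esub> a)" using x(1) y(1) a by (simp add: A.l_distr)
      finally show ?thesis using x y a rep(1) by (simp add: rep_mult rep_add rep_add')
    qed
  qed
  with abel have mod: "right_module A N" by (simp add: right_module_def A.ring_axioms)
  let ?f = "\<lambda>v \<in> carrier (free_rmod A m). \<lambda>i \<in> {..<1::nat}. (\<Oplus>\<^bsub>A\<^esub>i \<in> {..<m}. a i \<otimes>\<^bsub>A\<^esub> v i)"
  let ?g = "\<lambda>v \<in> carrier (free_rmod A 1). rep (v 0)"
  have ac: "a i \<in> carrier A" if "i < m" for i using a that by auto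
  have "finitely_presented A N"
    unfolding finitely_presented_def
  proof (intro exI conjI)
    show "?f \<in> rmod_hom A (free_rmod A m) (free_rmod A 1)"
    proof (rule rmod_homI)
      fix v assume "v \<in> carrier (free_rmod A m)"
      then have v: "v i \<in> carrier A" if "i < m" for i using that by (auto simp: free_rmod_def)
      show "?f v \<in> carrier (free_rmod A 1)"
        using v ac \<open>v \<in> carrier (free_rmod A m)\<close> by (auto simp: free_rmod_def intro!: A.finsum_closed)
      fix w assume "w \<in> carrier (free_rmod A m)"
      then have w: "w i \<in> carrier A" if "i < m" for i using that by (auto simp: free_rmod_def)
      have "(\<Oplus>\<^bsub>A\<^esub>i \<in> {..<m}. a i \<otimes>\<^bsub>A\<^esub> (v \<oplus>\<^bsub>free_rmod A m\<^esub> w) i) =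
          (\<Oplus>\<^bsub>A\<^esub>i \<in> {..<m}. a i \<otimes>\<^bsub>A\<^esub> v i \<oplus>\<^bsub>A\<^esub> a i \<otimes>\<^bsub>A\<^esub> w i)"
        by (intro A.finsum_cong') (use v w ac in \<open>auto simp: free_rmod_def A.r_distr\<close>)
      also have "\<dots> = (\<Oplus>\<^bsub>A\<^esub>i \<in> {..<m}. a i \<otimes>\<^bsub>A\<^esub> v i) \<oplus>\<^bsub>A\<^esub> (\<Oplus>\<^bsub>A\<^esub>i \<in> {..<m}. a i \<otimes>\<^bsub>A\<^esub> w i)"
        by (rule A.finsum_addf) (use v w ac in auto)
      moreover have "v \<oplus>\<^bsub>free_rmod A m\<^esub> w \<in> carrier (free_rmod A m)"
        using \<open>v \<in> carrier (free_rmod A m)\<close> \<open>w \<in> carrier (free_rmod A m)\<close>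
        by (auto simp: free_rmod_def)
      ultimately show "?f (v \<oplus>\<^bsub>free_rmod A m\<^esub> w) = ?f v \<oplus>\<^bsub>free_rmod A 1\<^esub> ?f w"
        using \<open>v \<in> carrier (free_rmod A m)\<close> \<open>w \<in> carrier (free_rmod A m)\<close>
        by (simp add: free_rmod_def restrict_def fun_eq_iff)
    next
      fix v r assume vF: "v \<in> carrier (free_rmod A m)" and r: "r \<in> carrier A"
      then have v: "v i \<in> carrier A" if "i < m" for i using that by (auto simp: free_rmod_def)
      have "(\<Oplus>\<^bsub>A\<^esub>i \<in> {..<m}. a i \<otimes>\<^bsub>A\<^esub> (v \<triangleleft>\<^bsub>free_rmod A m\<^esub> r) i) =
          (\<Oplus>\<^bsub>A\<^esub>i \<in> {..<m}. a i \<otimes>\<^bsub>A\<^esub> v i \<otimes>\<^bsub>A\<^esub> r)"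
        by (intro A.finsum_cong') (use v r ac in \<open>auto simp: free_rmod_def A.m_assoc\<close>)
      also have "\<dots> = (\<Oplus>\<^bsub>A\<^esub>i \<in> {..<m}. a i \<otimes>\<^bsub>A\<^esub> v i) \<otimes>\<^bsub>A\<^esub> r"
        by (rule A.finsum_ldistr[symmetric]) (use v r ac in auto)
      moreover have "v \<triangleleft>\<^bsub>free_rmod A m\<^esub> r \<in> carrier (free_rmod A m)"
        using vF r by (auto simp: free_rmod_def)
      ultimately show "?f (v \<triangleleft>\<^bsub>free_rmod A m\<^esub> r) = ?f v \<triangleleft>\<^bsub>free_rmod A 1\<^esub> r"
        using vF by (simp add: free_rmod_def restrict_def fun_eq_iff)
    qed auto
    show "?g \<in> rmod_hom A (free_rmod A 1) N"
    proof (rule rmod_homI)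
      fix v w assume "v \<in> carrier (free_rmod A 1)" "w \<in> carrier (free_rmod A 1)"
      then show "?g (v \<oplus>\<^bsub>free_rmod A 1\<^esub> w) = ?g v \<oplus>\<^bsub>N\<^esub> ?g w"
        by (auto simp: free_rmod_def rep_add rep_add' rep(1) PiE_def Pi_iff)
    next
      fix v r assume "v \<in> carrier (free_rmod A 1)" "r \<in> carrier A"
      then show "?g (v \<triangleleft>\<^bsub>free_rmod A 1\<^esub> r) = ?g v \<triangleleft>\<^bsub>N\<^esub> r"
        by (auto simp: free_rmod_def rep_mult PiE_def Pi_iff)
    qed (auto simp: free_rmod_def PiE_def Pi_iff)
    show "?g ` carrier (free_rmod A 1) = carrier N"
    proof (intro equalityI subsetI)
      fix z assume "z \<in> carrier N"
      then obtain x where "x \<in> carrier A" "z = rep x" by auto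
      then show "z \<in> ?g ` carrier (free_rmod A 1)"
        by (intro image_eqI[of _ _ "\<lambda>i \<in> {..<1}. x"]) (auto simp: free_rmod_def)
    qed (auto simp: free_rmod_def PiE_def Pi_iff)
    show "?f ` carrier (free_rmod A m) = {v \<in> carrier (free_rmod A 1). ?g v = \<zero>\<^bsub>N\<^esub>}"
    proof (intro equalityI subsetI)
      fix z assume "z \<in> ?f ` carrier (free_rmod A m)"
      then obtain v where v: "v \<in> carrier (free_rmod A m)" "z = ?f v" by blast
      let ?s = "\<Oplus>\<^bsub>A\<^esub>i \<in> {..<m}. a i \<otimes>\<^bsub>A\<^esub> v i"
      have s: "?s \<in> ?L" using v(1) unfolding right_ideal_gen_def by (auto simp: free_rmod_def)
      then have sA: "?s \<in> carrier A" using L(1) by blast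
      have "?s \<ominus>\<^bsub>A\<^esub> \<zero>\<^bsub>A\<^esub> \<in> ?L" unfolding minus0[OF sA] by (rule s)
      then have "rep ?s = rep \<zero>\<^bsub>A\<^esub>" using rep_eq[OF sA A.zero_closed] by blast
      moreover have z: "z = (\<lambda>i \<in> {..<1}. ?s)" using v by simp
      moreover have "(\<lambda>i \<in> {..<1}. t) \<in> {v \<in> carrier (free_rmod A 1). ?g v = \<zero>\<^bsub>N\<^esub>}"
        if "t \<in> carrier A" "rep t = rep \<zero>\<^bsub>A\<^esub>" for t
        using that by (simp add: free_rmod_def)
      ultimately show "z \<in> {v \<in> carrier (free_rmod A 1). ?g v = \<zero>\<^bsub>N\<^esub>}"
        using sA by blast
    next
      fix z assume "z \<in> {v \<in> carrier (free_rmod A 1). ?g v = \<zero>\<^bsub>N\<^esub>}"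
      then have z: "z \<in> {..<1} \<rightarrow>\<^sub>E carrier A" "rep (z 0) = rep \<zero>\<^bsub>A\<^esub>"
        by (auto simp: free_rmod_def split: if_splits)
      have z0: "z 0 \<in> carrier A" using z(1) by auto
      then have "z 0 \<in> ?L" using z(2) rep_eq[OF z0 A.zero_closed] minus0[OF z0] by simp
      then obtain v where v: "v \<in> {..<m} \<rightarrow> carrier A" "z 0 = (\<Oplus>\<^bsub>A\<^esub>i \<in> {..<m}. a i \<otimes>\<^bsub>A\<^esub> v i)"
        unfolding right_ideal_gen_def by blast
      let ?v = "restrict v {..<m}"
      have vF: "?v \<in> carrier (free_rmod A m)" using v(1) by (auto simp: free_rmod_def)
      have "(\<Oplus>\<^bsub>A\<^esub>i \<in> {..<m}. a i \<otimes>\<^bsub>A\<^esub> ?v i) = z 0"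
        unfolding v(2) by (intro A.finsum_cong') (use v(1) ac in auto)
      then have "z = ?f ?v"
        using vF z(1) by (intro extensionalityI[of _ "{..<1}"]) (auto simp: PiE_def)
      then show "z \<in> ?f ` carrier (free_rmod A m)" using vF by blast
    qed
  qed
  from finitely_presented_representable[OF mod this] obtain N' f where N': "N' \<in> mods A"
    and f: "f \<in> rmod_hom A N N'" "bij_betw f (carrier N) (carrier N')"
    unfolding rmod_isomorphic_def by blast
  note fD = rmod_homD[OF f(1)]
  show ?thesis
  proof (rule that[OF N', of "\<lambda>x. f (rep x)"])
    fix x assume x: "x \<in> carrier A"
    show "f (rep x) \<in> carrier N'" using fD(1) x by simp
    have "f (rep x) = \<zero>\<^bsub>N'\<^esub> \<longleftrightarrow> f (rep x) = f (rep \<zero>\<^bsub>A\<^esub>)"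
      using rmod_hom_zero[OF f(1) mod modsD(1)[OF N']] by simp
    also have "\<dots> \<longleftrightarrow> rep x = rep \<zero>\<^bsub>A\<^esub>"
      by (rule inj_on_eq_iff[OF bij_betw_imp_inj_on[OF f(2)]]) (use x in simp_all)
    finally show "f (rep x) = \<zero>\<^bsub>N'\<^esub> \<longleftrightarrow> x \<in> ?L"
      using rep_eq[OF x A.zero_closed] minus0[OF x] by simp
    fix y assume y: "y \<in> carrier A"
    show "f (rep (x \<oplus>\<^bsub>A\<^esub> y)) = f (rep x) \<oplus>\<^bsub>N'\<^esub> f (rep y)"
      using fD(2)[of "rep x" "rep y"] x y by (simp add: rep_add rep_add' rep(1))
    show "f (rep (x \<otimes>\<^bsub>A\<^esub> y)) = f (rep x) \<triangleleft>\<^bsub>N'\<^esub> y"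
      using fD(3)[of "rep x" y] x y by (simp add: rep_mult)
  qed
qed

section \<open>Autoequivalences preserve the regular module\<close>

text \<open>Additivity enters only through the preservation of zero maps. This passes to the quasi-inverse
  (\<open>G_zero\<close>), so that \<open>F\<close> and \<open>G\<close> have symmetric roles.\<close>

locale equivalence_pair = free_object A U u
  for A :: "('k, 'a, 'y) module_scheme" (structure) and U u +
  fixes F G \<eta> \<theta>
  assumes F: "endofunctor A F" and G: "endofunctor A G"
    and eta: "natural_iso (mod_category A) (mod_category A) id_functor (comp_functor G F) \<eta>"
    and theta: "natural_iso (mod_category A) (mod_category A) (comp_functor F G) id_functor \<theta>"
    and F_zero: "\<lbrakk>X \<in> mods A; Y \<in> mods A\<rbrakk> \<Longrightarrow>
      amap F X Y (zero_hom X Y) = zero_hom (omap F X) (omap F Y)"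
begin

lemmas FD = endofunctorD[OF F]
lemmas GD = endofunctorD[OF G]
lemmas F_closed = endofunctor_closed[OF F]
lemmas GF = endofunctor_comp[OF G F]
lemmas FG = endofunctor_comp[OF F G]
lemmas etaD = natural_iso_modD[OF eta endofunctor_id GF, simplified]
lemmas thetaD = natural_iso_modD[OF theta FG endofunctor_id, simplified]

lemma F_faithful:
  assumes X: "X \<in> mods A" and Y: "Y \<in> mods A"
    and f: "f \<in> rmod_hom A X Y" and g: "g \<in> rmod_hom A X Y" and eq: "amap F X Y f = amap F X Y g"
  shows "f = g"
proof (rule rmod_hom_eqI[OF f g])
  fix x assume x: "x \<in> carrier X"
  have "\<eta> Y (f x) = \<eta> Y (g x)"
    using etaD(3)[OF X Y f x] etaD(3)[OF X Y g x] eq by simp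
  then show "f x = g x"
    using etaD(2)[OF Y] rmod_homD(1)[OF f x] rmod_homD(1)[OF g x] by (auto simp: bij_betw_def dest: inj_onD)
qed

lemma G_faithful:
  assumes X: "X \<in> mods A" and Y: "Y \<in> mods A"
    and f: "f \<in> rmod_hom A X Y" and g: "g \<in> rmod_hom A X Y" and eq: "amap G X Y f = amap G X Y g"
  shows "f = g"
proof (rule rmod_hom_eqI[OF f g])
  fix x assume x: "x \<in> carrier X"
  then obtain z where z: "z \<in> carrier (omap F (omap G X))" "x = \<theta> X z"
    using thetaD(2)[OF X] by (auto simp: bij_betw_def)
  show "f x = g x"
    using thetaD(3)[OF X Y f z(1)] thetaD(3)[OF X Y g z(1)] eq z(2) by simp
qed

text \<open>The preimage of \<open>h\<close> is \<open>\<eta>\<^sup>-\<^sup>1 (G h) \<eta>\<close>; faithfulness of \<open>G\<close> shows that \<open>F\<close> maps it to \<open>h\<close>.\<close>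

lemma F_full:
  assumes X: "X \<in> mods A" and Y: "Y \<in> mods A" and h: "h \<in> rmod_hom A (omap F X) (omap F Y)"
  shows "\<exists>f \<in> rmod_hom A X Y. amap F X Y f = h"
proof -
  note FX = FD(1)[OF X] and FY = FD(1)[OF Y]
  let ?i = "restrict (inv_into (carrier Y) (\<eta> Y)) (carrier (omap G (omap F Y)))"
  have i: "?i \<in> rmod_hom A (omap G (omap F Y)) Y"
    by (rule rmod_hom_inverse[OF modsD(1)[OF Y] etaD(1,2)[OF Y]])
  have Gh: "amap G (omap F X) (omap F Y) h \<in> rmod_hom A (omap G (omap F X)) (omap G (omap F Y))"
    by (rule GD(2)[OF FX FY h])
  define f where "f = compose (carrier X) ?i (compose (carrier X) (amap G (omap F X) (omap F Y) h) (\<eta> X))"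
  have f: "f \<in> rmod_hom A X Y"
    unfolding f_def
    by (rule rmod_hom_compose[OF modsD(1)[OF X] rmod_hom_compose[OF modsD(1)[OF X] etaD(1)[OF X] Gh] i])
  have ef: "\<eta> Y (f x) = amap G (omap F X) (omap F Y) h (\<eta> X x)" if x: "x \<in> carrier X" for x
  proof -
    have "amap G (omap F X) (omap F Y) h (\<eta> X x) \<in> carrier (omap G (omap F Y))"
      by (rule rmod_homD(1)[OF Gh rmod_homD(1)[OF etaD(1)[OF X] x]])
    then show ?thesis using x etaD(2)[OF Y] by (simp add: f_def compose_def bij_betw_def f_inv_into_f)
  qed
  have "amap G (omap F X) (omap F Y) (amap F X Y f) = amap G (omap F X) (omap F Y) h"
  proof (rule rmod_hom_eqI[OF GD(2)[OF FX FY FD(2)[OF X Y f]] Gh])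
    fix y assume "y \<in> carrier (omap G (omap F X))"
    then obtain x where x: "x \<in> carrier X" "y = \<eta> X x" using etaD(2)[OF X] by (auto simp: bij_betw_def)
    show "amap G (omap F X) (omap F Y) (amap F X Y f) y = amap G (omap F X) (omap F Y) h y"
      using etaD(3)[OF X Y f x(1)] ef[OF x(1)] x(2) by simp
  qed
  then have "amap F X Y f = h" by (rule G_faithful[OF FX FY FD(2)[OF X Y f] h])
  then show ?thesis using f by blast
qed

text \<open>Both sides have the same image under \<open>F\<close>, because \<open>F G\<close> is isomorphic to the identity.\<close>

lemma G_zero:
  assumes X: "X \<in> mods A" and Y: "Y \<in> mods A"
  shows "amap G X Y (zero_hom X Y) = zero_hom (omap G X) (omap G Y)"
proof -
  note GX = GD(1)[OF X] and GY = GD(1)[OF Y]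
  note FGX = FD(1)[OF GX] and FGY = FD(1)[OF GY]
  have z: "zero_hom X Y \<in> rmod_hom A X Y" by (rule zero_hom_in[OF modsD(1)[OF X] modsD(1)[OF Y]])
  have z': "zero_hom (omap G X) (omap G Y) \<in> rmod_hom A (omap G X) (omap G Y)"
    by (rule zero_hom_in[OF modsD(1)[OF GX] modsD(1)[OF GY]])
  have z0: "\<zero>\<^bsub>omap F (omap G Y)\<^esub> \<in> carrier (omap F (omap G Y))"
    using modsD(1)[OF FGY] by (simp add: right_module_def abelian_group.axioms(1) abelian_monoid.zero_closed)
  have "amap F (omap G X) (omap G Y) (amap G X Y (zero_hom X Y)) =
      amap F (omap G X) (omap G Y) (zero_hom (omap G X) (omap G Y))"
  proof (rule rmod_hom_eqI[OF FD(2)[OF GX GY GD(2)[OF X Y z]] FD(2)[OF GX GY z']])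
    fix x assume x: "x \<in> carrier (omap F (omap G X))"
    let ?x = "amap F (omap G X) (omap G Y) (amap G X Y (zero_hom X Y)) x"
    have "\<theta> Y ?x = zero_hom X Y (\<theta> X x)" by (rule thetaD(3)[OF X Y z x])
    also have "\<dots> = \<zero>\<^bsub>Y\<^esub>" using rmod_homD(1)[OF thetaD(1)[OF X] x] by simp
    also have "\<dots> = \<theta> Y \<zero>\<^bsub>omap F (omap G Y)\<^esub>"
      by (rule rmod_hom_zero[OF thetaD(1)[OF Y] modsD(1)[OF FGY] modsD(1)[OF Y], symmetric])
    finally have "?x = \<zero>\<^bsub>omap F (omap G Y)\<^esub>"
      using inj_on_eq_iff[OF bij_betw_imp_inj_on[OF thetaD(2)[OF Y]] _ z0]
        F_closed[OF GX GY GD(2)[OF X Y z] x] by blast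
    then show "?x = amap F (omap G X) (omap G Y) (zero_hom (omap G X) (omap G Y)) x"
      unfolding F_zero[OF GX GY] using x by simp
  qed
  then show ?thesis by (rule F_faithful[OF GX GY GD(2)[OF X Y z] z'])
qed

lemma swap: "\<exists>\<eta>' \<theta>'. equivalence_pair A U u G F \<eta>' \<theta>'"
  using natural_iso_inverse[OF eta endofunctor_id GF] natural_iso_inverse[OF theta FG endofunctor_id]
    F G G_zero free_object_axioms
  unfolding equivalence_pair_def equivalence_pair_axioms_def by blast

text \<open>The images of all homomorphisms from \<open>FU\<close> to the regular module generate it. Otherwise
  the projection \<open>P\<close> of \<open>U\<close> onto the quotient would correspond to a nonzero morphism out of \<open>GU\<close>
  that kills every map from \<open>U\<close> to \<open>GU\<close>, that is, every element of \<open>GU\<close>. To stay within finitely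
  presented modules, only the functionals \<open>\<alpha>\<^sub>i\<close> that correspond to generators \<open>q\<^sub>i\<close> of \<open>GU\<close> are
  used, with their values at generators \<open>p\<^sub>j\<close> of \<open>FU\<close>.\<close>

lemma trace_one:
  "\<exists>(m::nat) a v. \<one> = (\<Oplus>k \<in> {..<m}. a k \<otimes> v k) \<and> v \<in> {..<m} \<rightarrow> carrier A \<and>
    (\<forall>k < m. \<exists>\<alpha> \<in> functionals A (omap F U). a k \<in> \<alpha> ` carrier (omap F U))"
proof -
  note FU = FD(1)[OF U] and GU = GD(1)[OF U]
  note FGU = FD(1)[OF GU]
  interpret FU: right_module A "omap F U" by (rule modsD[OF FU])
  obtain n q where qg: "generates A (omap G U) n q"
    using finitely_presented_generators[OF modsD[OF GU]] by blast
  note q = generatesD(1)[OF qg] and qgen = generatesD(2)[OF qg]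
  obtain l p where pg: "generates A (omap F U) l p"
    using finitely_presented_generators[OF modsD[OF FU]] by blast
  note p = generatesD(1)[OF pg] and pgen = generatesD(2)[OF pg]
  have qhat: "hat (omap G U) (q i) \<in> rmod_hom A U (omap G U)" if "i < n" for i
    by (rule hat_hom[OF modsD(1)[OF GU] q[OF that]])
  define \<alpha> where "\<alpha> i x = coord (\<theta> U (amap F U (omap G U) (hat (omap G U) (q i)) x))" for i x
  have af: "\<alpha> i \<in> functionals A (omap F U)" if i: "i < n" for i
  proof -
    note Fq = FD(2)[OF U GU qhat[OF i]]
    note th = thetaD(1)[OF U]
    show ?thesis unfolding functionals_def \<alpha>_def
      using rmod_homD(1-3)[OF Fq] rmod_homD(1-3)[OF th] by (simp add: coord_add coord_ract)
  qed
  \<comment> \<open>The pairs \<open>(i, j)\<close> with \<open>i < n\<close> and \<open>j < l\<close> are numbered by \<open>k = i l + j\<close>.\<close>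
  define a where "a k = \<alpha> (k div l) (p (k mod l))" for k
  have kl: "k div l < n" "k mod l < l" if "k < n * l" for k
    using that by (metis less_mult_imp_div_less, metis mod_less_divisor mult_0_right neq0_conv not_less_zero)
  have a: "a \<in> {..<n * l} \<rightarrow> carrier A"
    using kl p FU.functionalD(1)[OF af] by (auto simp: a_def)
  obtain N \<pi> where N: "N \<in> mods A" and pi: "\<And>x. x \<in> carrier A \<Longrightarrow> \<pi> x \<in> carrier N"
    "\<And>x y. \<lbrakk>x \<in> carrier A; y \<in> carrier A\<rbrakk> \<Longrightarrow> \<pi> (x \<oplus>\<^bsub>A\<^esub> y) = \<pi> x \<oplus>\<^bsub>N\<^esub> \<pi> y"
    "\<And>x y. \<lbrakk>x \<in> carrier A; y \<in> carrier A\<rbrakk> \<Longrightarrow> \<pi> (x \<otimes>\<^bsub>A\<^esub> y) = \<pi> x \<triangleleft>\<^bsub>N\<^esub> y"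
    "\<And>x. x \<in> carrier A \<Longrightarrow> \<pi> x = \<zero>\<^bsub>N\<^esub> \<longleftrightarrow> x \<in> right_ideal_gen A (n * l) a"
    by (rule finitely_presented_quotient[OF ring_axioms a]) (rule that)
  let ?L = "right_ideal_gen A (n * l) a"
  note L = right_ideal_gen[OF a]
  have aL: "\<alpha> i x \<in> ?L" if i: "i < n" and x: "x \<in> carrier (omap F U)" for i x
  proof -
    note D = FU.functionalD[OF af[OF i]]
    have "carrier (omap F U) \<subseteq> {x \<in> carrier (omap F U). \<alpha> i x \<in> ?L}"
    proof (rule pgen)
      fix j assume j: "j < l"
      have k: "i * l + j < n * l"
        using i j by (metis add.commute add_less_cancel_right less_le_trans mult_Suc mult_le_mono1 Suc_leI)
      have "a (i * l + j) = \<alpha> i (p j)" using j by (simp add: a_def)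
      then show "p j \<in> {x \<in> carrier (omap F U). \<alpha> i x \<in> ?L}" using L(6)[OF k] p[OF j] by simp
    next
      have "\<alpha> i \<zero>\<^bsub>omap F U\<^esub> = \<alpha> i (\<zero>\<^bsub>omap F U\<^esub> \<triangleleft>\<^bsub>omap F U\<^esub> \<zero>)"
        by (simp add: FU.ract_zero_left)
      then have "\<alpha> i \<zero>\<^bsub>omap F U\<^esub> = \<zero>" using D(1,3) by simp
      then show "\<zero>\<^bsub>omap F U\<^esub> \<in> {x \<in> carrier (omap F U). \<alpha> i x \<in> ?L}" using L(2) by simp
    qed (use D L(3,4) in \<open>auto intro: FU.ract_closed\<close>)
    then show ?thesis using x by blast
  qed
  define P where "P = (\<lambda>y \<in> carrier U. \<pi> (coord y))"
  have P: "P \<in> rmod_hom A U N"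
  proof -
    interpret U: right_module A U by (rule Umod)
    show ?thesis by (rule rmod_homI) (auto simp: P_def pi(1-3) coord_add coord_ract U.ract_closed)
  qed
  note GN = GD(1)[OF N]
  note GP = GD(2)[OF U N P]
  note FGP = FD(2)[OF GU GN GP]
  interpret GU: right_module A "omap G U" by (rule modsD[OF GU])
  interpret GN: right_module A "omap G N" by (rule modsD[OF GN])
  interpret FGN: right_module A "omap F (omap G N)" by (rule modsD[OF FD(1)[OF GN]])
  have th0: "y = \<zero>\<^bsub>omap F (omap G N)\<^esub>" if "y \<in> carrier (omap F (omap G N))" "\<theta> N y = \<zero>\<^bsub>N\<^esub>" for y
    using that inj_on_eq_iff[OF bij_betw_imp_inj_on[OF thetaD(2)[OF N]] that(1) FGN.M.zero_closed]
      rmod_hom_zero[OF thetaD(1)[OF N] FGN.right_module_axioms modsD(1)[OF N]] by simp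
  have kill: "compose (carrier U) (amap G U N P) (hat (omap G U) (q i)) = zero_hom U (omap G N)"
    if i: "i < n" for i
  proof (rule F_faithful[OF U GN rmod_hom_compose[OF Umod qhat[OF i] GP]])
    show z: "zero_hom U (omap G N) \<in> rmod_hom A U (omap G N)" by (rule zero_hom_in[OF Umod modsD(1)[OF GN]])
    show "amap F U (omap G N) (compose (carrier U) (amap G U N P) (hat (omap G U) (q i))) =
        amap F U (omap G N) (zero_hom U (omap G N))"
    proof (rule rmod_hom_eqI[OF FD(2)[OF U GN rmod_hom_compose[OF Umod qhat[OF i] GP]] FD(2)[OF U GN z]])
      fix x assume x: "x \<in> carrier (omap F U)"
      let ?y = "amap F U (omap G U) (hat (omap G U) (q i)) x"
      have y: "?y \<in> carrier (omap F (omap G U))" by (rule F_closed[OF U GU qhat[OF i] x])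
      have "\<theta> N (amap F (omap G U) (omap G N) (amap G U N P) ?y) = P (\<theta> U ?y)"
        by (rule thetaD(3)[OF U N P y])
      also have "\<dots> = \<pi> (\<alpha> i x)" using rmod_homD(1)[OF thetaD(1)[OF U] y] by (simp add: P_def \<alpha>_def)
      also have "\<dots> = \<zero>\<^bsub>N\<^esub>" using pi(4) aL[OF i x] L(1) by blast
      finally have "amap F (omap G U) (omap G N) (amap G U N P) ?y = \<zero>\<^bsub>omap F (omap G N)\<^esub>"
        by (rule th0[OF rmod_homD(1)[OF FGP y]])
      then show "amap F U (omap G N) (compose (carrier U) (amap G U N P) (hat (omap G U) (q i))) x =
          amap F U (omap G N) (zero_hom U (omap G N)) x"
        using FD(4)[OF U GU GN qhat[OF i] GP x] F_zero[OF U GN] x by simp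
    qed
  qed
  have "carrier (omap G U) \<subseteq> {x \<in> carrier (omap G U). amap G U N P x = \<zero>\<^bsub>omap G N\<^esub>}"
  proof (rule qgen)
    fix i assume i: "i < n"
    have "amap G U N P (q i) = compose (carrier U) (amap G U N P) (hat (omap G U) (q i)) u"
      using u hat_u[OF modsD(1)[OF GU] q[OF i]] by (simp add: compose_def)
    then show "q i \<in> {x \<in> carrier (omap G U). amap G U N P x = \<zero>\<^bsub>omap G N\<^esub>}"
      unfolding kill[OF i] using u q[OF i] by simp
  next
    show "\<zero>\<^bsub>omap G U\<^esub> \<in> {x \<in> carrier (omap G U). amap G U N P x = \<zero>\<^bsub>omap G N\<^esub>}"
      using rmod_hom_zero[OF GP modsD(1)[OF GU] modsD(1)[OF GN]] by simp
  qed (use rmod_homD(2,3)[OF GP] in \<open>auto intro: GU.ract_closed simp: GN.ract_zero_left\<close>)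
  then have GP0: "amap G U N P = zero_hom (omap G U) (omap G N)"
    by (intro rmod_hom_eqI[OF GP zero_hom_in[OF modsD(1)[OF GU] modsD(1)[OF GN]]]) auto
  have FGP0: "amap F (omap G U) (omap G N) (amap G U N P) = zero_hom (omap F (omap G U)) (omap F (omap G N))"
    unfolding GP0 by (rule F_zero[OF GU GN])
  have "u \<in> \<theta> U ` carrier (omap F (omap G U))" using u unfolding bij_betw_imp_surj_on[OF thetaD(2)[OF U]] .
  then obtain z where z: "z \<in> carrier (omap F (omap G U))" "\<theta> U z = u" by (elim imageE) simp
  have "\<pi> \<one> = P u" using u by (simp add: P_def)
  also have "\<dots> = \<theta> N \<zero>\<^bsub>omap F (omap G N)\<^esub>"
    using thetaD(3)[OF U N P z(1)] z FGP0 by simp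
  also have "\<dots> = \<zero>\<^bsub>N\<^esub>"
    by (rule rmod_hom_zero[OF thetaD(1)[OF N] FGN.right_module_axioms modsD(1)[OF N]])
  finally have "\<one> \<in> ?L" using pi(4)[of \<one>] by simp
  then obtain v where v: "v \<in> {..<n * l} \<rightarrow> carrier A" "\<one> = (\<Oplus>k \<in> {..<n * l}. a k \<otimes> v k)"
    unfolding right_ideal_gen_def by blast
  have "\<forall>k < n * l. \<exists>\<alpha> \<in> functionals A (omap F U). a k \<in> \<alpha> ` carrier (omap F U)"
    using af kl p unfolding a_def by blast
  then show ?thesis using v by blast
qed

lemma regular_splits_off:
  assumes "pi_regular_ring A" "basic A"
  obtains s r where "s \<in> rmod_hom A U (omap F U)" "r \<in> rmod_hom A (omap F U) U"
    "compose (carrier U) r s = (\<lambda>x \<in> carrier U. x)"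
proof -
  interpret pi_regular_ring A by fact
  note FU = modsD(1)[OF FD(1)[OF U]]
  interpret FU: right_module A "omap F U" by (rule FU)
  interpret U: right_module A U by (rule Umod)
  obtain m :: nat and a v where t: "\<one> = (\<Oplus>k \<in> {..<m}. a k \<otimes> v k)" "v \<in> {..<m} \<rightarrow> carrier A"
    "\<And>k. k < m \<Longrightarrow> \<exists>\<alpha> \<in> functionals A (omap F U). a k \<in> \<alpha> ` carrier (omap F U)"
    using trace_one by blast
  have "splits_off A (omap F U) \<one>"
    by (rule splits_off_one[OF FU assms(2)]) (rule splits_off_primitive[OF FU _ t(1,3,2)])
  then obtain p \<alpha> where p: "p \<in> carrier (omap F U)" "\<alpha> \<in> functionals A (omap F U)" "\<alpha> p = \<one>"
    unfolding splits_off_def by blast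
  let ?s = "hat (omap F U) p" and ?r = "\<lambda>y \<in> carrier (omap F U). u \<triangleleft>\<^bsub>U\<^esub> \<alpha> y"
  have s: "?s \<in> rmod_hom A U (omap F U)" by (rule hat_hom[OF FU p(1)])
  have r: "?r \<in> rmod_hom A (omap F U) U"
    by (rule rmod_homI)
      (use FU.functionalD[OF p(2)] u in \<open>auto simp: U.ract_add_right U.ract_mult FU.ract_closed\<close>)
  have "compose (carrier U) ?r ?s = hat U (?r p)" by (rule compose_hat[OF FU p(1) r])
  also have "?r p = u" using p u by (simp add: U.ract_one)
  finally have "compose (carrier U) ?r ?s = hat U u" .
  then show ?thesis unfolding hat_id by (rule that[OF s r])
qed

end

definition free_gen :: "('a, 'x) ring_scheme \<Rightarrow> ('a, 'm, 'y) rmodule_scheme \<Rightarrow> 'm \<Rightarrow> bool" where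
  "free_gen R M b \<longleftrightarrow> b \<in> carrier M \<and> bij_betw (\<lambda>a. b \<triangleleft>\<^bsub>M\<^esub> a) (carrier R) (carrier M)"

text \<open>By \<open>regular_splits_off\<close> for both functors, \<open>FU\<close> and \<open>U\<close> are direct summands of each other;
  the resulting one-sided unit of \<open>A\<close> is a unit.\<close>

lemma (in equivalence_pair) image_free:
  assumes pi: "pi_regular_ring A" and bas: "basic A"
  shows "\<exists>b. free_gen A (omap F U) b"
proof -
  interpret pi_regular_ring A by fact
  note FU = FD(1)[OF U] and GU = GD(1)[OF U]
  note FGU = FD(1)[OF GU]
  interpret U: right_module A U by (rule Umod)
  interpret FU: right_module A "omap F U" by (rule modsD[OF FU])
  obtain s r where s: "s \<in> rmod_hom A U (omap F U)" and r: "r \<in> rmod_hom A (omap F U) U"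
    and rs: "compose (carrier U) r s = (\<lambda>x \<in> carrier U. x)"
    by (rule regular_splits_off[OF pi bas])
  obtain \<eta>' \<theta>' where "equivalence_pair A U u G F \<eta>' \<theta>'" using swap by blast
  then obtain s' r' where s': "s' \<in> rmod_hom A U (omap G U)" and r': "r' \<in> rmod_hom A (omap G U) U"
    and rs': "compose (carrier U) r' s' = (\<lambda>x \<in> carrier U. x)"
    by (rule equivalence_pair.regular_splits_off[OF _ pi bas])
  let ?Fs = "amap F U (omap G U) s'" and ?Fr = "amap F (omap G U) U r'"
  let ?i = "restrict (inv_into (carrier (omap F (omap G U))) (\<theta> U)) (carrier U)"
  have i: "?i \<in> rmod_hom A U (omap F (omap G U))"
    by (rule rmod_hom_inverse[OF modsD(1)[OF FGU] thetaD(1,2)[OF U]])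
  have ith: "?i (\<theta> U z) = z" if "z \<in> carrier (omap F (omap G U))" for z
    using thetaD(2)[OF U] that rmod_homD(1)[OF thetaD(1)[OF U] that] by (simp add: bij_betw_def)
  define m where "m y = \<theta> U (?Fs y)" for y
  define n where "n x = ?Fr (?i x)" for x
  note FsD = rmod_homD[OF FD(2)[OF U GU s']] and FrD = rmod_homD[OF FD(2)[OF GU U r']]
  note thD = rmod_homD[OF thetaD(1)[OF U]] and iD = rmod_homD[OF i]
  have m: "m y \<in> carrier U" "a \<in> carrier A \<Longrightarrow> m (y \<triangleleft>\<^bsub>omap F U\<^esub> a) = m y \<triangleleft>\<^bsub>U\<^esub> a"
    if "y \<in> carrier (omap F U)" for y a
    using that FsD thD by (auto simp: m_def)
  have n: "n x \<in> carrier (omap F U)" "a \<in> carrier A \<Longrightarrow> n (x \<triangleleft>\<^bsub>U\<^esub> a) = n x \<triangleleft>\<^bsub>omap F U\<^esub> a"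
    if "x \<in> carrier U" for x a
    unfolding n_def using that FrD(1,3) iD(1,3) by (metis, metis)
  have nm: "n (m y) = y" if y: "y \<in> carrier (omap F U)" for y
  proof -
    have "n (m y) = ?Fr (?Fs y)" using ith[OF FsD(1)[OF y]] by (simp add: n_def m_def)
    also have "\<dots> = amap F U U (compose (carrier U) r' s') y" by (rule FD(4)[OF U GU U s' r' y, symmetric])
    finally show ?thesis unfolding rs' using FD(3)[OF U y] by simp
  qed
  note sD = rmod_homD[OF s] and rD = rmod_homD[OF r]
  have rs: "r (s x) = x" if "x \<in> carrier U" for x
    using fun_cong[OF rs, of x] that by (simp add: compose_def)
  define a where "a = coord (m (s u))"
  define c where "c = coord (r (n u))"
  have msu: "m (s u) \<in> carrier U" using m(1) sD(1) u by blast
  have rnu: "r (n u) \<in> carrier U" using n(1) rD(1) u by blast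
  have ac: "a \<in> carrier A" "c \<in> carrier A" using msu rnu by (simp_all add: a_def c_def)
  have ua: "u \<triangleleft>\<^bsub>U\<^esub> a = m (s u)" and uc: "u \<triangleleft>\<^bsub>U\<^esub> c = r (n u)" using msu rnu by (simp_all add: a_def c_def)
  have "u \<triangleleft>\<^bsub>U\<^esub> (c \<otimes> a) = r (n u) \<triangleleft>\<^bsub>U\<^esub> a" using ac u by (simp add: U.ract_mult uc)
  also have "\<dots> = r (n (u \<triangleleft>\<^bsub>U\<^esub> a))" using n[OF u] rD(3)[OF n(1)[OF u]] ac by simp
  also have "\<dots> = u" unfolding ua using nm sD(1) rs u by simp
  finally have "coord (u \<triangleleft>\<^bsub>U\<^esub> (c \<otimes> a)) = coord u" by simp
  then have "c \<otimes> a = \<one>" using ac by simp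
  then have ac1: "a \<otimes> c = \<one>" by (rule left_inverse_imp_right_inverse[OF ac])
  define b where "b = s u \<triangleleft>\<^bsub>omap F U\<^esub> c"
  have bc: "b \<in> carrier (omap F U)" using sD(1)[OF u] ac by (simp add: b_def FU.ract_closed)
  have "m b = u \<triangleleft>\<^bsub>U\<^esub> (a \<otimes> c)" using m(2)[OF sD(1)[OF u] ac(2)] ac u by (simp add: b_def U.ract_mult ua)
  then have mb: "m b = u" using u by (simp add: ac1 U.ract_one)
  have "bij_betw (\<lambda>a. b \<triangleleft>\<^bsub>omap F U\<^esub> a) (carrier A) (carrier (omap F U))"
  proof (rule bij_betwI[of _ _ _ "\<lambda>y. coord (m y)"])
    show "coord (m (b \<triangleleft>\<^bsub>omap F U\<^esub> t)) = t" if "t \<in> carrier A" for t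
      using m(2)[OF bc that] that by (simp add: mb)
    show "b \<triangleleft>\<^bsub>omap F U\<^esub> coord (m y) = y" if y: "y \<in> carrier (omap F U)" for y
    proof -
      have t: "coord (m y) \<in> carrier A" using m(1)[OF y] by simp
      have "m (b \<triangleleft>\<^bsub>omap F U\<^esub> coord (m y)) = m y" using m(2)[OF bc t] m(1)[OF y] by (simp add: mb)
      then show ?thesis using nm[OF y] nm[OF FU.ract_closed[OF bc t]] by simp
    qed
  qed (use bc m(1) FU.ract_closed in auto)
  then show ?thesis using bc unfolding free_gen_def by blast
qed

section \<open>Linear autoequivalences as semilinear twists\<close>

context ring
begin

lemma free_genD:
  assumes "free_gen R M b"
  shows "b \<in> carrier M"
    and "y \<in> carrier M \<Longrightarrow> \<exists>a \<in> carrier R. y = b \<triangleleft>\<^bsub>M\<^esub> a"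
    and "\<lbrakk>a \<in> carrier R; a' \<in> carrier R; b \<triangleleft>\<^bsub>M\<^esub> a = b \<triangleleft>\<^bsub>M\<^esub> a'\<rbrakk> \<Longrightarrow> a = a'"
  using assms by (auto simp: free_gen_def bij_betw_def inj_on_def)

lemma free_gen_unit:
  assumes M: "right_module R M" and b: "free_gen R M b" and b': "free_gen R M b'"
  shows "\<exists>a \<in> Units R. b' = b \<triangleleft>\<^bsub>M\<^esub> a"
proof -
  interpret right_module R M by fact
  obtain a where a: "a \<in> carrier R" "b' = b \<triangleleft>\<^bsub>M\<^esub> a" using free_genD(2)[OF b free_genD(1)[OF b']] by blast
  obtain a' where a': "a' \<in> carrier R" "b = b' \<triangleleft>\<^bsub>M\<^esub> a'" using free_genD(2)[OF b' free_genD(1)[OF b]] by blast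
  have "b \<triangleleft>\<^bsub>M\<^esub> (a \<otimes> a') = b \<triangleleft>\<^bsub>M\<^esub> \<one>"
    using a a' free_genD(1)[OF b] by (metis ract_mult ract_one)
  then have 1: "a \<otimes> a' = \<one>" using a(1) a'(1) by (intro free_genD(3)[OF b]) auto
  have "b' \<triangleleft>\<^bsub>M\<^esub> (a' \<otimes> a) = b' \<triangleleft>\<^bsub>M\<^esub> \<one>"
    using a a' free_genD(1)[OF b'] by (metis ract_mult ract_one)
  then have "a' \<otimes> a = \<one>" using a(1) a'(1) by (intro free_genD(3)[OF b']) auto
  then show ?thesis using UnitsI[OF a(1) a'(1) 1] a(2) by blast
qed

lemma free_gen_ract:
  assumes M: "right_module R M" and b: "free_gen R M b" and v: "v \<in> Units R"
  shows "free_gen R M (b \<triangleleft>\<^bsub>M\<^esub> v)"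
proof -
  interpret right_module R M by fact
  have bc: "b \<in> carrier M" and vc: "v \<in> carrier R" "inv v \<in> carrier R"
    using free_genD(1)[OF b] v by auto
  have "bij_betw (\<lambda>a. b \<triangleleft>\<^bsub>M\<^esub> v \<triangleleft>\<^bsub>M\<^esub> a) (carrier R) (carrier M)"
    unfolding bij_betw_def
  proof (intro conjI inj_onI equalityI subsetI)
    fix x y assume x: "x \<in> carrier R" and y: "y \<in> carrier R" and eq: "b \<triangleleft>\<^bsub>M\<^esub> v \<triangleleft>\<^bsub>M\<^esub> x = b \<triangleleft>\<^bsub>M\<^esub> v \<triangleleft>\<^bsub>M\<^esub> y"
    then have "b \<triangleleft>\<^bsub>M\<^esub> (v \<otimes> x) = b \<triangleleft>\<^bsub>M\<^esub> (v \<otimes> y)" using bc vc by (simp add: ract_mult)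
    then have "v \<otimes> x = v \<otimes> y" using x y vc by (intro free_genD(3)[OF b]) auto
    then show "x = y" using x y v by simp
  next
    fix z assume "z \<in> carrier M"
    then obtain a where a: "a \<in> carrier R" "z = b \<triangleleft>\<^bsub>M\<^esub> a" using free_genD(2)[OF b] by blast
    have "z = b \<triangleleft>\<^bsub>M\<^esub> (v \<otimes> (inv v \<otimes> a))" using a v by simp
    also have "\<dots> = b \<triangleleft>\<^bsub>M\<^esub> v \<triangleleft>\<^bsub>M\<^esub> (inv v \<otimes> a)" using a(1) vc bc by (simp only: ract_mult m_closed)
    finally show "z \<in> (\<lambda>a. b \<triangleleft>\<^bsub>M\<^esub> v \<triangleleft>\<^bsub>M\<^esub> a) ` carrier R" using a(1) vc by blast
  qed (use bc vc ract_closed in auto)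
  then show ?thesis unfolding free_gen_def using bc vc ract_closed by blast
qed

lemma free_gen_ract_rev:
  assumes M: "right_module R M" and b: "free_gen R M b" and v: "v \<in> Units R"
    and w: "w \<in> carrier M" "w \<triangleleft>\<^bsub>M\<^esub> v = b"
  shows "free_gen R M w"
proof -
  interpret right_module R M by fact
  have "b \<triangleleft>\<^bsub>M\<^esub> inv v = w" using w v by (simp add: ract_one flip: w(2) ract_mult)
  then show ?thesis using free_gen_ract[OF M b Units_inv_Units[OF v]] by simp
qed

lemma free_gen_image:
  assumes b: "free_gen R M b" and f: "f \<in> rmod_hom R M N" and bij: "bij_betw f (carrier M) (carrier N)"
  shows "free_gen R N (f b)"
proof -
  note bc = free_genD(1)[OF b]
  have "bij_betw (f \<circ> (\<lambda>a. b \<triangleleft>\<^bsub>M\<^esub> a)) (carrier R) (carrier N)"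
    using b bij by (intro bij_betw_trans) (auto simp: free_gen_def)
  moreover have "(f \<circ> (\<lambda>a. b \<triangleleft>\<^bsub>M\<^esub> a)) a = f b \<triangleleft>\<^bsub>N\<^esub> a" if "a \<in> carrier R" for a
    using rmod_homD(3)[OF f bc that] by simp
  ultimately have "bij_betw (\<lambda>a. f b \<triangleleft>\<^bsub>N\<^esub> a) (carrier R) (carrier N)"
    using bij_betw_cong[of "carrier R" "f \<circ> (\<lambda>a. b \<triangleleft>\<^bsub>M\<^esub> a)" "\<lambda>a. f b \<triangleleft>\<^bsub>N\<^esub> a" "carrier N"] by blast
  then show ?thesis unfolding free_gen_def using rmod_homD(1)[OF f bc] by blast
qed

end

lemma endofunctor_bij:
  assumes F: "endofunctor A F" and X: "X \<in> mods A" and Y: "Y \<in> mods A"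
    and f: "f \<in> rmod_hom A X Y" and bij: "bij_betw f (carrier X) (carrier Y)"
  shows "bij_betw (amap F X Y f) (carrier (omap F X)) (carrier (omap F Y))"
proof -
  note FD = endofunctorD[OF F]
  let ?g = "restrict (inv_into (carrier X) f) (carrier Y)"
  have g: "?g \<in> rmod_hom A Y X" by (rule rmod_hom_inverse[OF modsD(1)[OF X] f bij])
  have "compose (carrier X) ?g f = (\<lambda>x \<in> carrier X. x)"
    unfolding compose_def by (rule restrict_ext) (use bij rmod_homD(1)[OF f] in \<open>simp add: bij_betw_def\<close>)
  then have 1: "amap F Y X ?g (amap F X Y f x) = x" if "x \<in> carrier (omap F X)" for x
    using FD(4)[OF X Y X f g that] FD(3)[OF X that] by simp
  have "compose (carrier Y) f ?g = (\<lambda>x \<in> carrier Y. x)"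
    unfolding compose_def by (rule restrict_ext) (use bij in \<open>simp add: bij_betw_def f_inv_into_f\<close>)
  then have 2: "amap F X Y f (amap F Y X ?g y) = y" if "y \<in> carrier (omap F Y)" for y
    using FD(4)[OF Y X Y g f that] FD(3)[OF Y that] by simp
  show ?thesis
    by (rule bij_betwI[of _ _ _ "amap F Y X ?g"])
      (use 1 2 endofunctor_closed[OF F X Y f] endofunctor_closed[OF F Y X g] in auto)
qed

text \<open>By Yoneda, \<open>x \<in> M\<close> is a map \<open>U \<rightarrow> M\<close>; \<open>\<gamma>\<close> evaluates its image under \<open>F\<close> at a chosen element
  of \<open>FU\<close>.\<close>

definition (in free_object) gamma where
  "gamma F b M x = amap F U M (hat M x) b"

context free_object
begin

context
  fixes F b
  assumes F: "endofunctor A F" and b: "b \<in> carrier (omap F U)"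
begin

lemma gamma_closed:
  assumes M: "M \<in> mods A" and x: "x \<in> carrier M"
  shows "gamma F b M x \<in> carrier (omap F M)"
  unfolding gamma_def by (rule endofunctor_closed[OF F U M hat_hom[OF modsD(1)[OF M] x] b])

lemma gamma_natural:
  assumes M: "M \<in> mods A" and N: "N \<in> mods A" and f: "f \<in> rmod_hom A M N" and x: "x \<in> carrier M"
  shows "amap F M N f (gamma F b M x) = gamma F b N (f x)"
  using endofunctorD(4)[OF F U M N hat_hom[OF modsD(1)[OF M] x] f b]
  by (simp add: gamma_def compose_hat[OF modsD(1)[OF M] x f])

lemma gamma_u: "gamma F b U u = b"
  using endofunctorD(3)[OF F U b] by (simp add: gamma_def hat_id)

text \<open>Semilinearity over one pair \<open>(a, r)\<close> of scalars propagates from \<open>u\<close> to every element of every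
  module by naturality, since \<open>x a\<close> is the image of \<open>u a\<close> under \<open>hat M x\<close>.\<close>

lemma gamma_semilinear:
  assumes M: "M \<in> mods A" and x: "x \<in> carrier M" and a: "a \<in> carrier A" and r: "r \<in> carrier A"
    and eq: "gamma F b U (u \<triangleleft>\<^bsub>U\<^esub> a) = b \<triangleleft>\<^bsub>omap F U\<^esub> r"
  shows "gamma F b M (x \<triangleleft>\<^bsub>M\<^esub> a) = gamma F b M x \<triangleleft>\<^bsub>omap F M\<^esub> r"
proof -
  note h = hat_hom[OF modsD(1)[OF M] x]
  have "hat M x (u \<triangleleft>\<^bsub>U\<^esub> a) = x \<triangleleft>\<^bsub>M\<^esub> a" using a by (simp add: hat_def)
  then have "gamma F b M (x \<triangleleft>\<^bsub>M\<^esub> a) = amap F U M (hat M x) (gamma F b U (u \<triangleleft>\<^bsub>U\<^esub> a))"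
    using gamma_natural[OF U M h, of "u \<triangleleft>\<^bsub>U\<^esub> a"] a by simp
  also have "\<dots> = gamma F b M x \<triangleleft>\<^bsub>omap F M\<^esub> r"
    unfolding eq using rmod_homD(3)[OF endofunctorD(2)[OF F U M h] b r] by (simp add: gamma_def)
  finally show ?thesis .
qed

lemma gamma_ract_gen:
  assumes M: "M \<in> mods A" and x: "x \<in> carrier M" and v: "v \<in> carrier A"
  shows "gamma F (b \<triangleleft>\<^bsub>omap F U\<^esub> v) M x = gamma F b M x \<triangleleft>\<^bsub>omap F M\<^esub> v"
  unfolding gamma_def
  by (rule rmod_homD(3)[OF endofunctorD(2)[OF F U M hat_hom[OF modsD(1)[OF M] x]] b v])

end

end

locale linear_autoequivalence = assoc_algebra K A + free_object A U u
  for K :: "('k, 'x) ring_scheme" and A :: "('k, 'a, 'y) module_scheme" (structure) and U u +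
  fixes F
  assumes lin: "linear_functor K (mod_category A) (mod_category A) F"
    and autoeq: "autoequivalence (mod_category A) F"
begin

lemma F: "endofunctor A F"
  using lin by (simp add: linear_functor_def)

lemma F_add:
  assumes "X \<in> mods A" "Y \<in> mods A" "f \<in> rmod_hom A X Y" "g \<in> rmod_hom A X Y" "x \<in> carrier (omap F X)"
  shows "amap F X Y (\<lambda>x \<in> carrier X. f x \<oplus>\<^bsub>Y\<^esub> g x) x = amap F X Y f x \<oplus>\<^bsub>omap F Y\<^esub> amap F X Y g x"
  using lin assms by (simp add: linear_functor_def)

lemma F_smult:
  assumes "X \<in> mods A" "Y \<in> mods A" "f \<in> rmod_hom A X Y" "t \<in> carrier K" "x \<in> carrier (omap F X)"
  shows "amap F X Y (\<lambda>x \<in> carrier X. f x \<triangleleft>\<^bsub>Y\<^esub> (t \<odot>\<^bsub>A\<^esub> \<one>)) x = amap F X Y f x \<triangleleft>\<^bsub>omap F Y\<^esub> (t \<odot>\<^bsub>A\<^esub> \<one>)"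
  using lin assms by (simp add: linear_functor_def)

lemma F_zero:
  assumes X: "X \<in> mods A" and Y: "Y \<in> mods A"
  shows "amap F X Y (zero_hom X Y) = zero_hom (omap F X) (omap F Y)"
proof -
  note FX = endofunctorD(1)[OF F X] and FY = endofunctorD(1)[OF F Y]
  interpret Y: right_module A Y by (rule modsD[OF Y])
  interpret FY: right_module A "omap F Y" by (rule modsD[OF FY])
  have z: "zero_hom X Y \<in> rmod_hom A X Y" by (rule zero_hom_in[OF modsD(1)[OF X] modsD(1)[OF Y]])
  note Fz = endofunctorD(2)[OF F X Y z]
  have s0: "\<zero>\<^bsub>K\<^esub> \<odot>\<^bsub>A\<^esub> \<one> = \<zero>" by simp
  have eq: "(\<lambda>x \<in> carrier X. zero_hom X Y x \<triangleleft>\<^bsub>Y\<^esub> (\<zero>\<^bsub>K\<^esub> \<odot>\<^bsub>A\<^esub> \<one>)) = zero_hom X Y"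
    unfolding s0 by (rule restrict_ext) (simp add: Y.ract_zero_left)
  show ?thesis
  proof (rule rmod_hom_eqI[OF Fz zero_hom_in[OF modsD(1)[OF FX] modsD(1)[OF FY]]])
    fix x assume x: "x \<in> carrier (omap F X)"
    have "amap F X Y (zero_hom X Y) x = amap F X Y (zero_hom X Y) x \<triangleleft>\<^bsub>omap F Y\<^esub> \<zero>"
      using F_smult[OF X Y z _ x, of "\<zero>\<^bsub>K\<^esub>", unfolded eq] unfolding s0 by simp
    also have "\<dots> = \<zero>\<^bsub>omap F Y\<^esub>" by (rule FY.ract_zero_right[OF rmod_homD(1)[OF Fz x]])
    finally show "amap F X Y (zero_hom X Y) x = zero_hom (omap F X) (omap F Y) x" using x by simp
  qed
qed

lemma exists_quasi_inverse: "\<exists>G \<eta> \<theta>. equivalence_pair A U u F G \<eta> \<theta>"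
proof -
  obtain G \<eta> \<theta> where "endofunctor A G"
    "natural_iso (mod_category A) (mod_category A) id_functor (comp_functor G F) \<eta>"
    "natural_iso (mod_category A) (mod_category A) (comp_functor F G) id_functor \<theta>"
    using autoeq unfolding autoequivalence_def by blast
  then have "equivalence_pair A U u F G \<eta> \<theta>"
    by unfold_locales (use F F_zero in auto)
  then show ?thesis by blast
qed

lemma faithful:
  "\<lbrakk>X \<in> mods A; Y \<in> mods A; f \<in> rmod_hom A X Y; g \<in> rmod_hom A X Y; amap F X Y f = amap F X Y g\<rbrakk> \<Longrightarrow> f = g"
  using exists_quasi_inverse equivalence_pair.F_faithful by blast

lemma full:
  "\<lbrakk>X \<in> mods A; Y \<in> mods A; h \<in> rmod_hom A (omap F X) (omap F Y)\<rbrakk> \<Longrightarrow> \<exists>f \<in> rmod_hom A X Y. amap F X Y f = h"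
  using exists_quasi_inverse equivalence_pair.F_full by blast

lemma gamma_add:
  assumes b: "b \<in> carrier (omap F U)" and M: "M \<in> mods A" and x: "x \<in> carrier M" and y: "y \<in> carrier M"
  shows "gamma F b M (x \<oplus>\<^bsub>M\<^esub> y) = gamma F b M x \<oplus>\<^bsub>omap F M\<^esub> gamma F b M y"
proof -
  interpret M: right_module A M by (rule modsD[OF M])
  have "hat M (x \<oplus>\<^bsub>M\<^esub> y) = (\<lambda>z \<in> carrier U. hat M x z \<oplus>\<^bsub>M\<^esub> hat M y z)"
    unfolding hat_def by (rule restrict_ext) (use x y in \<open>simp add: M.ract_add_left\<close>)
  then show ?thesis
    using F_add[OF U M hat_hom[OF modsD(1)[OF M] x] hat_hom[OF modsD(1)[OF M] y] b]
    by (simp add: gamma_def)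
qed

text \<open>Here \<open>F\<close> is fully faithful and \<open>Hom(FU, FM) = FM\<close> because \<open>FU\<close> is free on \<open>b\<close>.\<close>

lemma gamma_bij:
  assumes b: "free_gen A (omap F U) b" and M: "M \<in> mods A"
  shows "bij_betw (gamma F b M) (carrier M) (carrier (omap F M))"
proof -
  note FU = endofunctorD(1)[OF F U] and FM = endofunctorD(1)[OF F M]
  note bc = free_genD(1)[OF b]
  interpret B: free_object A "omap F U" b
    by unfold_locales (use b FU in \<open>auto simp: free_gen_def\<close>)
  have inj: "inj_on (gamma F b M) (carrier M)"
  proof (rule inj_onI)
    fix x y assume x: "x \<in> carrier M" and y: "y \<in> carrier M" and eq: "gamma F b M x = gamma F b M y"
    note hx = hat_hom[OF modsD(1)[OF M] x] and hy = hat_hom[OF modsD(1)[OF M] y]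
    have "amap F U M (hat M x) = amap F U M (hat M y)"
      using B.hat_eqI[OF endofunctorD(2)[OF F U M hx] refl] B.hat_eqI[OF endofunctorD(2)[OF F U M hy] refl] eq
      unfolding gamma_def by metis
    then have "hat M x = hat M y" by (rule faithful[OF U M hx hy])
    then have "hat M x u = hat M y u" by (rule fun_cong)
    with hat_u[OF modsD(1)[OF M] x] hat_u[OF modsD(1)[OF M] y] show "x = y" by metis
  qed
  have "gamma F b M ` carrier M = carrier (omap F M)"
  proof (intro equalityI subsetI)
    fix y assume "y \<in> gamma F b M ` carrier M"
    then show "y \<in> carrier (omap F M)" using gamma_closed[OF F bc M] by blast
  next
    fix y assume y: "y \<in> carrier (omap F M)"
    obtain f where f: "f \<in> rmod_hom A U M" "amap F U M f = B.hat (omap F M) y"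
      using full[OF U M B.hat_hom[OF modsD(1)[OF FM] y]] by blast
    have "gamma F b M (f u) = y"
      unfolding gamma_def hat_eqI[OF f(1) refl, symmetric] f(2) by (rule B.hat_u[OF modsD(1)[OF FM] y])
    then show "y \<in> gamma F b M ` carrier M" using rmod_homD(1)[OF f(1) u] by blast
  qed
  with inj show ?thesis by (simp add: bij_betw_def)
qed

text \<open>In coordinates at \<open>u\<close> and \<open>b\<close>, the action of \<open>F\<close> on \<open>End(U) = A\<close> is the automorphism \<open>\<sigma>\<close>.
  Linearity of \<open>F\<close> makes it \<open>k\<close>-linear.\<close>

lemma gamma_auto:
  assumes b: "free_gen A (omap F U) b"
  shows "\<exists>\<sigma> \<in> alg_auto K A. \<forall>a \<in> carrier A. gamma F b U (u \<triangleleft>\<^bsub>U\<^esub> a) = b \<triangleleft>\<^bsub>omap F U\<^esub> \<sigma> a"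
proof -
  note FU = endofunctorD(1)[OF F U]
  note bc = free_genD(1)[OF b]
  interpret U: right_module A U by (rule Umod)
  interpret FU: right_module A "omap F U" by (rule modsD[OF FU])
  interpret B: free_object A "omap F U" b
    by unfold_locales (use b FU in \<open>auto simp: free_gen_def\<close>)
  define \<sigma> where "\<sigma> = (\<lambda>a \<in> carrier A. B.coord (gamma F b U (u \<triangleleft>\<^bsub>U\<^esub> a)))"
  have g: "gamma F b U (u \<triangleleft>\<^bsub>U\<^esub> a) \<in> carrier (omap F U)" if "a \<in> carrier A" for a
    using gamma_closed[OF F bc U] that by simp
  have sc: "\<sigma> a \<in> carrier A" if "a \<in> carrier A" for a using g[OF that] that by (simp add: \<sigma>_def)
  have s: "gamma F b U (u \<triangleleft>\<^bsub>U\<^esub> a) = b \<triangleleft>\<^bsub>omap F U\<^esub> \<sigma> a" if "a \<in> carrier A" for a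
    using g[OF that] that by (simp add: \<sigma>_def)
  have eqI: "\<sigma> a = t" if "a \<in> carrier A" "t \<in> carrier A" "gamma F b U (u \<triangleleft>\<^bsub>U\<^esub> a) = b \<triangleleft>\<^bsub>omap F U\<^esub> t" for a t
    using that by (simp add: \<sigma>_def)
  have mult: "\<sigma> (x \<otimes> y) = \<sigma> x \<otimes> \<sigma> y" if x: "x \<in> carrier A" and y: "y \<in> carrier A" for x y
  proof (rule eqI)
    have "gamma F b U (u \<triangleleft>\<^bsub>U\<^esub> x \<triangleleft>\<^bsub>U\<^esub> y) = gamma F b U (u \<triangleleft>\<^bsub>U\<^esub> x) \<triangleleft>\<^bsub>omap F U\<^esub> \<sigma> y"
      by (rule gamma_semilinear[OF F bc U _ y sc[OF y] s[OF y]]) (use x in simp)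
    then show "gamma F b U (u \<triangleleft>\<^bsub>U\<^esub> (x \<otimes> y)) = b \<triangleleft>\<^bsub>omap F U\<^esub> (\<sigma> x \<otimes> \<sigma> y)"
      using x y u bc sc by (simp add: U.ract_mult FU.ract_mult s)
  qed (use x y sc in auto)
  have add: "\<sigma> (x \<oplus> y) = \<sigma> x \<oplus> \<sigma> y" if x: "x \<in> carrier A" and y: "y \<in> carrier A" for x y
  proof (rule eqI)
    show "gamma F b U (u \<triangleleft>\<^bsub>U\<^esub> (x \<oplus> y)) = b \<triangleleft>\<^bsub>omap F U\<^esub> (\<sigma> x \<oplus> \<sigma> y)"
      using gamma_add[OF bc U, of "u \<triangleleft>\<^bsub>U\<^esub> x" "u \<triangleleft>\<^bsub>U\<^esub> y"] x y u bc sc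
      by (simp add: U.ract_add_right FU.ract_add_right s)
  qed (use x y sc in auto)
  have one: "\<sigma> \<one> = \<one>"
    by (rule eqI) (use gamma_u[OF F bc] u bc in \<open>simp_all add: U.ract_one FU.ract_one\<close>)
  have smult: "\<sigma> (t \<odot>\<^bsub>A\<^esub> x) = t \<odot>\<^bsub>A\<^esub> \<sigma> x" if t: "t \<in> carrier K" and x: "x \<in> carrier A" for t x
  proof (rule eqI)
    let ?h = "hat U (u \<triangleleft>\<^bsub>U\<^esub> x)"
    have t1: "t \<odot>\<^bsub>A\<^esub> \<one> \<in> carrier A" using t by simp
    have ux: "u \<triangleleft>\<^bsub>U\<^esub> x \<in> carrier U" using x by simp
    have tx: "y \<otimes> (t \<odot>\<^bsub>A\<^esub> \<one>) = t \<odot>\<^bsub>A\<^esub> y" if "y \<in> carrier A" for y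
      using t that by (simp add: smult_mult_right)
    have "hat U (u \<triangleleft>\<^bsub>U\<^esub> (t \<odot>\<^bsub>A\<^esub> x)) = (\<lambda>z \<in> carrier U. ?h z \<triangleleft>\<^bsub>U\<^esub> (t \<odot>\<^bsub>A\<^esub> \<one>))"
      unfolding hat_def
    proof (rule restrict_ext)
      fix z assume z: "z \<in> carrier U"
      have "u \<triangleleft>\<^bsub>U\<^esub> (t \<odot>\<^bsub>A\<^esub> x) \<triangleleft>\<^bsub>U\<^esub> coord z = u \<triangleleft>\<^bsub>U\<^esub> (t \<odot>\<^bsub>A\<^esub> (x \<otimes> coord z))"
        using t x z u by (simp add: smult_mult_left flip: U.ract_mult)
      also have "\<dots> = u \<triangleleft>\<^bsub>U\<^esub> (x \<otimes> coord z \<otimes> (t \<odot>\<^bsub>A\<^esub> \<one>))" using x z by (simp add: tx)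
      also have "\<dots> = u \<triangleleft>\<^bsub>U\<^esub> x \<triangleleft>\<^bsub>U\<^esub> coord z \<triangleleft>\<^bsub>U\<^esub> (t \<odot>\<^bsub>A\<^esub> \<one>)"
        using x z u t1 by (simp only: U.ract_mult m_closed coord)
      finally show "u \<triangleleft>\<^bsub>U\<^esub> (t \<odot>\<^bsub>A\<^esub> x) \<triangleleft>\<^bsub>U\<^esub> coord z =
          (\<lambda>y \<in> carrier U. u \<triangleleft>\<^bsub>U\<^esub> x \<triangleleft>\<^bsub>U\<^esub> coord y) z \<triangleleft>\<^bsub>U\<^esub> (t \<odot>\<^bsub>A\<^esub> \<one>)" using z by simp
    qed
    then have "gamma F b U (u \<triangleleft>\<^bsub>U\<^esub> (t \<odot>\<^bsub>A\<^esub> x)) = gamma F b U (u \<triangleleft>\<^bsub>U\<^esub> x) \<triangleleft>\<^bsub>omap F U\<^esub> (t \<odot>\<^bsub>A\<^esub> \<one>)"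
      using F_smult[OF U U hat_hom[OF Umod ux] t bc] by (simp add: gamma_def)
    also have "\<dots> = b \<triangleleft>\<^bsub>omap F U\<^esub> (t \<odot>\<^bsub>A\<^esub> \<sigma> x)"
      unfolding s[OF x] FU.ract_mult[OF bc sc[OF x] t1, symmetric] tx[OF sc[OF x]] ..
    finally show "gamma F b U (u \<triangleleft>\<^bsub>U\<^esub> (t \<odot>\<^bsub>A\<^esub> x)) = b \<triangleleft>\<^bsub>omap F U\<^esub> (t \<odot>\<^bsub>A\<^esub> \<sigma> x)" .
  qed (use t x sc in auto)
  have bij: "bij_betw \<sigma> (carrier A) (carrier A)"
    unfolding bij_betw_def
  proof (intro conjI inj_onI equalityI subsetI)
    note gb = gamma_bij[OF b U]
    fix x y assume x: "x \<in> carrier A" and y: "y \<in> carrier A" and eq: "\<sigma> x = \<sigma> y"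
    have "gamma F b U (u \<triangleleft>\<^bsub>U\<^esub> x) = gamma F b U (u \<triangleleft>\<^bsub>U\<^esub> y)" using s x y eq by simp
    then have "u \<triangleleft>\<^bsub>U\<^esub> x = u \<triangleleft>\<^bsub>U\<^esub> y" using inj_onD[OF bij_betw_imp_inj_on[OF gb]] x y by simp
    then have "coord (u \<triangleleft>\<^bsub>U\<^esub> x) = coord (u \<triangleleft>\<^bsub>U\<^esub> y)" by simp
    then show "x = y" using x y by simp
  next
    fix y assume y: "y \<in> carrier A"
    have "b \<triangleleft>\<^bsub>omap F U\<^esub> y \<in> gamma F b U ` carrier U"
      unfolding bij_betw_imp_surj_on[OF gamma_bij[OF b U]] using bc y by (rule FU.ract_closed)
    then obtain z where z: "z \<in> carrier U" "b \<triangleleft>\<^bsub>omap F U\<^esub> y = gamma F b U z" by (elim imageE)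
    have "\<sigma> (coord z) = y" by (rule eqI) (use z y in simp_all)
    then show "y \<in> \<sigma> ` carrier A" using z(1) coord(2) by blast
  qed (use sc in auto)
  have "\<sigma> \<in> ring_iso A A" by (rule ring_iso_memI) (use sc mult add one bij in auto)
  then have "\<sigma> \<in> ring_auto A" using bij by (simp add: ring_auto_def Bij_def \<sigma>_def)
  then have "\<sigma> \<in> alg_auto K A" by (rule alg_autoI) (use smult in auto)
  then show ?thesis using s by blast
qed

lemma exists_free_gen: "\<lbrakk>pi_regular_ring A; basic A\<rbrakk> \<Longrightarrow> \<exists>b. free_gen A (omap F U) b"
  using exists_quasi_inverse equivalence_pair.image_free by blast

end

section \<open>Actions represented by weak actions\<close>

text \<open>The weak action \<open>(\<rho>, c)\<close> describes the action \<open>(F, \<epsilon>)\<close> in the coordinates given by free generators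
  \<open>b\<^sub>g\<close> of \<open>F\<^sub>g U\<close>. The last condition is \<open>\<epsilon>\<^bsub>g,h\<^esub>(\<gamma>\<^sub>g(\<gamma>\<^sub>h(u))) c(g, h) = \<gamma>\<^bsub>gh\<^esub>(u)\<close>, because \<open>\<gamma>\<^sub>g(u) = b\<^sub>g\<close>.\<close>

definition (in free_object) represents where
  "represents G F \<epsilon> b \<rho> c \<longleftrightarrow>
     (\<forall>g \<in> carrier G. free_gen A (omap (F g) U) (b g)) \<and>
     (\<forall>g \<in> carrier G. \<forall>a \<in> carrier A.
        gamma (F g) (b g) U (u \<triangleleft>\<^bsub>U\<^esub> a) = b g \<triangleleft>\<^bsub>omap (F g) U\<^esub> \<rho> g a) \<and>
     (\<forall>g \<in> carrier G. \<forall>h \<in> carrier G.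
        \<epsilon> g h U (gamma (F g) (b g) (omap (F h) U) (b h)) \<triangleleft>\<^bsub>omap (F (g \<otimes>\<^bsub>G\<^esub> h)) U\<^esub> c g h
          = b (g \<otimes>\<^bsub>G\<^esub> h))"

locale linear_mod_action = assoc_algebra K A + free_object A U u + G: group G
  for K :: "('k, 'x) ring_scheme" and A :: "('k, 'a, 'y) module_scheme" (structure) and U u
    and G :: "('g, 'w) monoid_scheme" +
  fixes F \<epsilon>
  assumes act: "(F, \<epsilon>) \<in> linear_actions G K (mod_category A)"
begin

abbreviation gmult (infixl \<open>\<cdot>\<close> 70) where "g \<cdot> h \<equiv> g \<otimes>\<^bsub>G\<^esub> h"

lemma lin_aut: "g \<in> carrier G \<Longrightarrow> linear_autoequivalence K A U u (F g)"
  using act by unfold_locales (auto simp: linear_actions_def is_action_def)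

lemmas Fun = linear_autoequivalence.F[OF lin_aut]
lemmas Fobj = endofunctorD(1)[OF Fun]
lemmas Fmod = modsD(1)[OF Fobj]

lemma eps_nat:
  assumes g: "g \<in> carrier G" and h: "h \<in> carrier G"
  shows "natural_iso (mod_category A) (mod_category A) (comp_functor (F g) (F h)) (F (g \<cdot> h)) (\<epsilon> g h)"
  using act g h by (simp add: linear_actions_def is_action_def)

lemma eps:
  assumes g: "g \<in> carrier G" and h: "h \<in> carrier G"
  shows "X \<in> mods A \<Longrightarrow> \<epsilon> g h X \<in> rmod_hom A (omap (F g) (omap (F h) X)) (omap (F (g \<cdot> h)) X)"
    and "X \<in> mods A \<Longrightarrow> bij_betw (\<epsilon> g h X) (carrier (omap (F g) (omap (F h) X))) (carrier (omap (F (g \<cdot> h)) X))"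
    and "\<lbrakk>X \<in> mods A; Y \<in> mods A; f \<in> rmod_hom A X Y; x \<in> carrier (omap (F g) (omap (F h) X))\<rbrakk> \<Longrightarrow>
      \<epsilon> g h Y (amap (F g) (omap (F h) X) (omap (F h) Y) (amap (F h) X Y f) x) =
      amap (F (g \<cdot> h)) X Y f (\<epsilon> g h X x)"
  using natural_iso_modD[OF eps_nat[OF g h] endofunctor_comp[OF Fun[OF g] Fun[OF h]] Fun[OF G.m_closed[OF g h]]]
  by simp_all

lemma coherence:
  assumes g: "g \<in> carrier G" and h: "h \<in> carrier G" and l: "l \<in> carrier G" and X: "X \<in> mods A"
    and x: "x \<in> carrier (omap (F g) (omap (F h) (omap (F l) X)))"
  shows "\<epsilon> (g \<cdot> h) l X (\<epsilon> g h (omap (F l) X) x) =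
    \<epsilon> g (h \<cdot> l) X (amap (F g) (omap (F h) (omap (F l) X)) (omap (F (h \<cdot> l)) X) (\<epsilon> h l X) x)"
proof -
  let ?S = "omap (F g) (omap (F h) (omap (F l) X))"
  have "compose (carrier ?S) (\<epsilon> (g \<cdot> h) l X) (\<epsilon> g h (omap (F l) X)) =
      compose (carrier ?S) (\<epsilon> g (h \<cdot> l) X) (amap (F g) (omap (F h) (omap (F l) X)) (omap (F (h \<cdot> l)) X) (\<epsilon> h l X))"
    using act g h l X by (simp add: linear_actions_def is_action_def Let_def)
  from fun_cong[OF this, of x] show ?thesis using x by (simp add: compose_def)
qed

text \<open>Naturality along \<open>hat X x\<close> reduces the structure isomorphism at any \<open>X\<close> to its value at one
  element of \<open>F\<^sub>g F\<^sub>h U\<close>.\<close>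

lemma eps_gamma:
  assumes g: "g \<in> carrier G" and h: "h \<in> carrier G"
    and b: "b \<in> carrier (omap (F g) U)" "b' \<in> carrier (omap (F h) U)"
    and X: "X \<in> mods A" and x: "x \<in> carrier X"
  shows "\<epsilon> g h X (gamma (F g) b (omap (F h) X) (gamma (F h) b' X x)) =
    amap (F (g \<cdot> h)) U X (hat X x) (\<epsilon> g h U (gamma (F g) b (omap (F h) U) b'))"
proof -
  note hx = hat_hom[OF modsD(1)[OF X] x]
  have "gamma (F g) b (omap (F h) X) (gamma (F h) b' X x) =
      amap (F g) (omap (F h) U) (omap (F h) X) (amap (F h) U X (hat X x)) (gamma (F g) b (omap (F h) U) b')"
    using gamma_natural[OF Fun[OF g] b(1) Fobj[OF h U] Fobj[OF h X] endofunctorD(2)[OF Fun[OF h] U X hx] b(2)]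
    by (simp add: gamma_def)
  then show ?thesis
    using eps(3)[OF g h U X hx gamma_closed[OF Fun[OF g] b(1) Fobj[OF h U] b(2)]] by simp
qed

end

locale represented_action = linear_mod_action K A U u G F \<epsilon>
  for K :: "('k, 'x) ring_scheme" and A :: "('k, 'a, 'y) module_scheme" (structure) and U u
    and G :: "('g, 'w) monoid_scheme" and F \<epsilon> +
  fixes b \<rho> c
  assumes rep: "represents G F \<epsilon> b \<rho> c"
    and rho: "\<And>g. g \<in> carrier G \<Longrightarrow> \<rho> g \<in> alg_auto K A"
    and c: "\<And>g h. \<lbrakk>g \<in> carrier G; h \<in> carrier G\<rbrakk> \<Longrightarrow> c g h \<in> Units A"
begin

abbreviation gam where "gam g \<equiv> gamma (F g) (b g)"

lemma b: "g \<in> carrier G \<Longrightarrow> free_gen A (omap (F g) U) (b g)"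
  using rep by (simp add: represents_def)

lemmas bc = free_genD(1)[OF b]

lemma rho_closed: "\<lbrakk>g \<in> carrier G; a \<in> carrier A\<rbrakk> \<Longrightarrow> \<rho> g a \<in> carrier A"
  by (rule alg_auto(1)[OF rho])

lemma c_closed: "\<lbrakk>g \<in> carrier G; h \<in> carrier G\<rbrakk> \<Longrightarrow> c g h \<in> carrier A"
  by (rule Units_closed[OF c])

lemma gam_closed: "\<lbrakk>g \<in> carrier G; X \<in> mods A; x \<in> carrier X\<rbrakk> \<Longrightarrow> gam g X x \<in> carrier (omap (F g) X)"
  by (rule gamma_closed[OF Fun bc])

lemma gam_ract:
  assumes "g \<in> carrier G" "X \<in> mods A" "x \<in> carrier X" "a \<in> carrier A"
  shows "gam g X (x \<triangleleft>\<^bsub>X\<^esub> a) = gam g X x \<triangleleft>\<^bsub>omap (F g) X\<^esub> \<rho> g a"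
  using rep assms by (intro gamma_semilinear[OF Fun bc] rho_closed) (auto simp: represents_def)

lemma gam_bij: "\<lbrakk>g \<in> carrier G; X \<in> mods A\<rbrakk> \<Longrightarrow> bij_betw (gam g X) (carrier X) (carrier (omap (F g) X))"
  by (rule linear_autoequivalence.gamma_bij[OF lin_aut b])

lemma gam_natural:
  assumes "g \<in> carrier G" "X \<in> mods A" "Y \<in> mods A" "f \<in> rmod_hom A X Y" "x \<in> carrier X"
  shows "amap (F g) X Y f (gam g X x) = gam g Y (f x)"
  by (rule gamma_natural[OF Fun bc]) (use assms in auto)

lemma eps_gam_closed:
  assumes g: "g \<in> carrier G" and h: "h \<in> carrier G" and X: "X \<in> mods A" and x: "x \<in> carrier X"
  shows "\<epsilon> g h X (gam g (omap (F h) X) (gam h X x)) \<in> carrier (omap (F (g \<cdot> h)) X)"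
  by (rule rmod_homD(1)[OF eps(1)[OF g h X] gam_closed[OF g Fobj[OF h X] gam_closed[OF h X x]]])

lemma eps_gam:
  assumes g: "g \<in> carrier G" and h: "h \<in> carrier G" and X: "X \<in> mods A" and x: "x \<in> carrier X"
  shows "\<epsilon> g h X (gam g (omap (F h) X) (gam h X x)) \<triangleleft>\<^bsub>omap (F (g \<cdot> h)) X\<^esub> c g h = gam (g \<cdot> h) X x"
proof -
  note gh = G.m_closed[OF g h]
  let ?e = "\<epsilon> g h U (gam g (omap (F h) U) (b h))"
  have e: "?e \<in> carrier (omap (F (g \<cdot> h)) U)"
    by (rule rmod_homD(1)[OF eps(1)[OF g h U] gam_closed[OF g Fobj[OF h U] bc[OF h]]])
  have "amap (F (g \<cdot> h)) U X (hat X x) ?e \<triangleleft>\<^bsub>omap (F (g \<cdot> h)) X\<^esub> c g h =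
      amap (F (g \<cdot> h)) U X (hat X x) (?e \<triangleleft>\<^bsub>omap (F (g \<cdot> h)) U\<^esub> c g h)"
    by (rule rmod_homD(3)[OF endofunctorD(2)[OF Fun[OF gh] U X hat_hom[OF modsD(1)[OF X] x]] e c_closed[OF g h], symmetric])
  also have "?e \<triangleleft>\<^bsub>omap (F (g \<cdot> h)) U\<^esub> c g h = b (g \<cdot> h)"
    using rep g h by (simp add: represents_def)
  finally show ?thesis
    unfolding eps_gamma[OF g h bc[OF g] bc[OF h] X x] by (simp add: gamma_def)
qed

text \<open>Write \<open>w = \<epsilon>\<^bsub>g,h\<^esub>(\<gamma>\<^sub>g(\<gamma>\<^sub>h(u)))\<close>. Moving a scalar \<open>a\<close> out of \<open>\<epsilon>\<^bsub>g,h\<^esub>(\<gamma>\<^sub>g(\<gamma>\<^sub>h(u a)))\<close> and out of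
  \<open>\<gamma>\<^bsub>gh\<^esub>(u a)\<close> gives \<open>w \<rho>(g)(\<rho>(h)(a)) c(g, h) = w c(g, h) \<rho>(gh)(a)\<close>. The cocycle identity arises in the
  same way from the two sides of the coherence condition at \<open>\<gamma>\<^sub>g(\<gamma>\<^sub>h(\<gamma>\<^sub>l(u)))\<close>. In both cases \<open>w\<close>
  can be cancelled, as it is a unit multiple of a free generator.\<close>

lemma is_weak_action: "is_weak_action G A (\<rho>, c)"
  unfolding is_weak_action_def prod.case
proof (intro conjI ballI)
  show "\<rho> \<in> carrier G \<rightarrow> ring_auto A" using rho alg_auto_ring_auto by blast
  show "c \<in> carrier G \<rightarrow> carrier G \<rightarrow> Units A" using c by blast
next
  fix g h a assume g: "g \<in> carrier G" and h: "h \<in> carrier G" and a: "a \<in> carrier A"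
  note gh = G.m_closed[OF g h]
  interpret FghU: right_module A "omap (F (g \<cdot> h)) U" by (rule Fmod[OF gh U])
  let ?w = "\<epsilon> g h U (gam g (omap (F h) U) (gam h U u))"
  let ?act = "ract (omap (F (g \<cdot> h)) U)"
  have w: "?w \<in> carrier (omap (F (g \<cdot> h)) U)" by (rule eps_gam_closed[OF g h U u])
  have gu: "gam k U u = b k" if "k \<in> carrier G" for k by (rule gamma_u[OF Fun[OF that] bc[OF that]])
  have wc: "?act ?w (c g h) = b (g \<cdot> h)" using eps_gam[OF g h U u] gu[OF gh] by simp
  have ua: "u \<triangleleft>\<^bsub>U\<^esub> a \<in> carrier U" using a by simp
  have ra: "\<rho> g (\<rho> h a) \<in> carrier A" "\<rho> h a \<in> carrier A" "\<rho> (g \<cdot> h) a \<in> carrier A"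
    using rho_closed g h gh a by auto
  have ghu: "gam h U u \<in> carrier (omap (F h) U)" by (rule gam_closed[OF h U u])
  have "\<epsilon> g h U (gam g (omap (F h) U) (gam h U (u \<triangleleft>\<^bsub>U\<^esub> a))) = ?act ?w (\<rho> g (\<rho> h a))"
    unfolding gam_ract[OF h U u a] gam_ract[OF g Fobj[OF h U] ghu ra(2)]
    by (rule rmod_homD(3)[OF eps(1)[OF g h U] gam_closed[OF g Fobj[OF h U] ghu] ra(1)])
  then have "?act (?act ?w (\<rho> g (\<rho> h a))) (c g h) = gam (g \<cdot> h) U (u \<triangleleft>\<^bsub>U\<^esub> a)"
    using eps_gam[OF g h U ua] by simp
  also have "\<dots> = ?act (?act ?w (c g h)) (\<rho> (g \<cdot> h) a)"
    unfolding gam_ract[OF gh U u a] gu[OF gh] wc ..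
  finally have "?act ?w (\<rho> g (\<rho> h a) \<otimes> c g h) = ?act ?w (c g h \<otimes> \<rho> (g \<cdot> h) a)"
    using FghU.ract_mult[OF w ra(1) c_closed[OF g h]] FghU.ract_mult[OF w c_closed[OF g h] ra(3)] by simp
  then have eq: "\<rho> g (\<rho> h a) \<otimes> c g h = c g h \<otimes> \<rho> (g \<cdot> h) a"
    using ra c_closed[OF g h]
    by (intro free_genD(3)[OF free_gen_ract_rev[OF Fmod[OF gh U] b[OF gh] c[OF g h] w wc]]) auto
  have "inv (c g h) \<otimes> \<rho> g (\<rho> h a) \<otimes> c g h = inv (c g h) \<otimes> (\<rho> g (\<rho> h a) \<otimes> c g h)"
    using ra c[OF g h] by (simp add: m_assoc)
  also have "\<dots> = \<rho> (g \<cdot> h) a" unfolding eq using ra(3) c[OF g h] by simp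
  finally show "\<rho> (g \<cdot> h) a = inv (c g h) \<otimes> \<rho> g (\<rho> h a) \<otimes> c g h" ..
next
  fix g h l assume g: "g \<in> carrier G" and h: "h \<in> carrier G" and l: "l \<in> carrier G"
  note gh = G.m_closed[OF g h] and hl = G.m_closed[OF h l]
  note ghl = G.m_closed[OF gh l]
  have as: "g \<cdot> (h \<cdot> l) = g \<cdot> h \<cdot> l" using g h l by (simp add: G.m_assoc)
  let ?T = "omap (F (g \<cdot> h \<cdot> l)) U"
  interpret T: right_module A ?T by (rule Fmod[OF ghl U])
  let ?y = "gam l U u"
  let ?z = "gam g (omap (F h) (omap (F l) U)) (gam h (omap (F l) U) ?y)"
  have y: "?y \<in> carrier (omap (F l) U)" by (rule gam_closed[OF l U u])
  have hy: "gam h (omap (F l) U) ?y \<in> carrier (omap (F h) (omap (F l) U))" by (rule gam_closed[OF h Fobj[OF l U] y])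
  have z: "?z \<in> carrier (omap (F g) (omap (F h) (omap (F l) U)))"
    by (rule gam_closed[OF g Fobj[OF h Fobj[OF l U]] hy])
  let ?w = "\<epsilon> (g \<cdot> h) l U (\<epsilon> g h (omap (F l) U) ?z)"
  note e1 = eps(1)[OF gh l U] and e2 = eps(1)[OF g h Fobj[OF l U]]
    and e3 = eps(1)[OF g hl U] and e4 = eps(1)[OF h l U]
  have w: "?w \<in> carrier ?T" by (rule rmod_homD(1)[OF e1 rmod_homD(1)[OF e2 z]])
  note cc = c_closed[OF g h] c_closed[OF gh l] c_closed[OF h l] c_closed[OF g hl]
  have rc: "\<rho> g (c h l) \<in> carrier A" by (rule rho_closed[OF g cc(3)])
  have b': "gam (g \<cdot> h \<cdot> l) U u = b (g \<cdot> h \<cdot> l)" by (rule gamma_u[OF Fun[OF ghl] bc[OF ghl]])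
  have "?w \<triangleleft>\<^bsub>?T\<^esub> c g h = \<epsilon> (g \<cdot> h) l U (gam (g \<cdot> h) (omap (F l) U) ?y)"
    unfolding rmod_homD(3)[OF e1 rmod_homD(1)[OF e2 z] cc(1), symmetric] eps_gam[OF g h Fobj[OF l U] y] ..
  then have left: "?w \<triangleleft>\<^bsub>?T\<^esub> (c g h \<otimes> c (g \<cdot> h) l) = b (g \<cdot> h \<cdot> l)"
    using T.ract_mult[OF w cc(1,2)] eps_gam[OF gh l U u] b' by simp
  let ?v = "\<epsilon> h l U (gam h (omap (F l) U) ?y)"
  have v: "?v \<in> carrier (omap (F (h \<cdot> l)) U)" by (rule eps_gam_closed[OF h l U u])
  have "?w = \<epsilon> g (h \<cdot> l) U (gam g (omap (F (h \<cdot> l)) U) ?v)"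
    unfolding coherence[OF g h l U z] gam_natural[OF g Fobj[OF h Fobj[OF l U]] Fobj[OF hl U] e4 hy] ..
  then have "?w \<triangleleft>\<^bsub>?T\<^esub> \<rho> g (c h l) = \<epsilon> g (h \<cdot> l) U (gam g (omap (F (h \<cdot> l)) U) ?v) \<triangleleft>\<^bsub>?T\<^esub> \<rho> g (c h l)" by simp
  also have "\<dots> = \<epsilon> g (h \<cdot> l) U (gam g (omap (F (h \<cdot> l)) U) ?v \<triangleleft>\<^bsub>omap (F g) (omap (F (h \<cdot> l)) U)\<^esub> \<rho> g (c h l))"
    using rmod_homD(3)[OF e3 gam_closed[OF g Fobj[OF hl U] v] rc] unfolding as by simp
  also have "\<dots> = \<epsilon> g (h \<cdot> l) U (gam g (omap (F (h \<cdot> l)) U) (gam (h \<cdot> l) U u))"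
    unfolding gam_ract[OF g Fobj[OF hl U] v cc(3), symmetric] eps_gam[OF h l U u] ..
  finally have "?w \<triangleleft>\<^bsub>?T\<^esub> (\<rho> g (c h l) \<otimes> c g (h \<cdot> l)) = b (g \<cdot> h \<cdot> l)"
    using T.ract_mult[OF w rc cc(4)] eps_gam[OF g hl U u] b' unfolding as by simp
  then have "?w \<triangleleft>\<^bsub>?T\<^esub> (c g h \<otimes> c (g \<cdot> h) l) = ?w \<triangleleft>\<^bsub>?T\<^esub> (\<rho> g (c h l) \<otimes> c g (h \<cdot> l))"
    using left by simp
  then show "c g h \<otimes> c (g \<cdot> h) l = \<rho> g (c h l) \<otimes> c g (h \<cdot> l)"
    using cc rc
    by (intro free_genD(3)[OF free_gen_ract_rev[OF Fmod[OF ghl U] b[OF ghl] _ w left]])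
      (auto intro: c g h l gh)
qed

lemma linear_weak: "(\<rho>, c) \<in> linear_weak_actions G K A"
  using is_weak_action rho by (auto simp: linear_weak_actions_def)

text \<open>The map \<open>\<gamma>\<close> of the generator \<open>b\<^sub>g \<delta>(g)\<close> is that of \<open>b\<^sub>g\<close> multiplied by \<open>\<delta>(g)\<close>. Comparing coefficients at
  free generators turns the conditions of \<open>represents\<close> into the equations that define an isomorphism
  of weak actions.\<close>

lemma change_generators:
  assumes d: "\<And>g. g \<in> carrier G \<Longrightarrow> \<delta> g \<in> Units A"
    and b': "\<And>g. g \<in> carrier G \<Longrightarrow> b' g = b g \<triangleleft>\<^bsub>omap (F g) U\<^esub> \<delta> g"
    and rho': "\<And>g a. \<lbrakk>g \<in> carrier G; a \<in> carrier A\<rbrakk> \<Longrightarrow> \<rho>' g a \<in> carrier A"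
    and c': "\<And>g h. \<lbrakk>g \<in> carrier G; h \<in> carrier G\<rbrakk> \<Longrightarrow> c' g h \<in> carrier A"
  shows "represents G F \<epsilon> b' \<rho>' c' \<longleftrightarrow>
    (\<forall>g \<in> carrier G. \<forall>a \<in> carrier A. \<rho>' g a = inv (\<delta> g) \<otimes> \<rho> g a \<otimes> \<delta> g) \<and>
    (\<forall>g \<in> carrier G. \<forall>h \<in> carrier G.
      c' g h = inv (\<delta> g) \<otimes> \<rho> g (inv (\<delta> h)) \<otimes> c g h \<otimes> \<delta> (g \<cdot> h))"
proof -
  have free: "free_gen A (omap (F g) U) (b' g)" if "g \<in> carrier G" for g
    unfolding b'[OF that] by (rule free_gen_ract[OF Fmod[OF that U] b[OF that] d[OF that]])
  have dc: "\<delta> g \<in> carrier A" if "g \<in> carrier G" for g by (rule Units_closed[OF d[OF that]])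
  have idc: "inv (\<delta> g) \<in> carrier A" if "g \<in> carrier G" for g by (rule Units_inv_closed[OF d[OF that]])
  have gam': "gamma (F g) (b' g) X x = gam g X x \<triangleleft>\<^bsub>omap (F g) X\<^esub> \<delta> g"
    if "g \<in> carrier G" "X \<in> mods A" "x \<in> carrier X" for g X x
    unfolding b'[OF that(1)] by (rule gamma_ract_gen[OF Fun[OF that(1)] bc[OF that(1)] that(2,3) dc[OF that(1)]])
  have one: "gamma (F g) (b' g) U (u \<triangleleft>\<^bsub>U\<^esub> a) = b' g \<triangleleft>\<^bsub>omap (F g) U\<^esub> \<rho>' g a \<longleftrightarrow>
      \<rho>' g a = inv (\<delta> g) \<otimes> \<rho> g a \<otimes> \<delta> g" if g: "g \<in> carrier G" and a: "a \<in> carrier A" for g a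
  proof -
    interpret FU: right_module A "omap (F g) U" by (rule Fmod[OF g U])
    have ua: "u \<triangleleft>\<^bsub>U\<^esub> a \<in> carrier U" using a by simp
    have ra: "\<rho> g a \<in> carrier A" by (rule rho_closed[OF g a])
    have "gamma (F g) (b' g) U (u \<triangleleft>\<^bsub>U\<^esub> a) = b g \<triangleleft>\<^bsub>omap (F g) U\<^esub> (\<rho> g a \<otimes> \<delta> g)"
      unfolding gam'[OF g U ua] gam_ract[OF g U u a] gamma_u[OF Fun[OF g] bc[OF g]]
      by (rule FU.ract_mult[OF bc[OF g] ra dc[OF g], symmetric])
    moreover have "b' g \<triangleleft>\<^bsub>omap (F g) U\<^esub> \<rho>' g a = b g \<triangleleft>\<^bsub>omap (F g) U\<^esub> (\<delta> g \<otimes> \<rho>' g a)"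
      unfolding b'[OF g] by (rule FU.ract_mult[OF bc[OF g] dc[OF g] rho'[OF g a], symmetric])
    moreover have "b g \<triangleleft>\<^bsub>omap (F g) U\<^esub> (\<rho> g a \<otimes> \<delta> g) = b g \<triangleleft>\<^bsub>omap (F g) U\<^esub> (\<delta> g \<otimes> \<rho>' g a) \<longleftrightarrow>
        \<rho> g a \<otimes> \<delta> g = \<delta> g \<otimes> \<rho>' g a"
      using free_genD(3)[OF b[OF g] m_closed[OF ra dc[OF g]] m_closed[OF dc[OF g] rho'[OF g a]]] by auto
    moreover have "\<rho> g a \<otimes> \<delta> g = \<delta> g \<otimes> \<rho>' g a \<longleftrightarrow> \<rho>' g a = inv (\<delta> g) \<otimes> \<rho> g a \<otimes> \<delta> g"
    proof
      assume eq: "\<rho> g a \<otimes> \<delta> g = \<delta> g \<otimes> \<rho>' g a"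
      have "inv (\<delta> g) \<otimes> \<rho> g a \<otimes> \<delta> g = inv (\<delta> g) \<otimes> (\<rho> g a \<otimes> \<delta> g)"
        by (rule m_assoc[OF idc[OF g] ra dc[OF g]])
      also have "\<dots> = \<rho>' g a" unfolding eq by (rule Units_cancel_left(1)[OF d[OF g] rho'[OF g a]])
      finally show "\<rho>' g a = inv (\<delta> g) \<otimes> \<rho> g a \<otimes> \<delta> g" ..
    next
      assume eq: "\<rho>' g a = inv (\<delta> g) \<otimes> \<rho> g a \<otimes> \<delta> g"
      show "\<rho> g a \<otimes> \<delta> g = \<delta> g \<otimes> \<rho>' g a"
        unfolding eq m_assoc[OF idc[OF g] ra dc[OF g]]
        by (rule Units_cancel_left(2)[OF d[OF g] m_closed[OF ra dc[OF g]], symmetric])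
    qed
    ultimately show ?thesis by simp
  qed
  have two: "\<epsilon> g h U (gamma (F g) (b' g) (omap (F h) U) (b' h)) \<triangleleft>\<^bsub>omap (F (g \<cdot> h)) U\<^esub> c' g h = b' (g \<cdot> h) \<longleftrightarrow>
      c' g h = inv (\<delta> g) \<otimes> \<rho> g (inv (\<delta> h)) \<otimes> c g h \<otimes> \<delta> (g \<cdot> h)"
    if g: "g \<in> carrier G" and h: "h \<in> carrier G" for g h
  proof -
    note gh = G.m_closed[OF g h]
    let ?T = "omap (F (g \<cdot> h)) U"
    interpret T: right_module A ?T by (rule Fmod[OF gh U])
    interpret S: right_module A "omap (F g) (omap (F h) U)" by (rule Fmod[OF g Fobj[OF h U]])
    interpret FhU: right_module A "omap (F h) U" by (rule Fmod[OF h U])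
    let ?e = "\<epsilon> g h U (gam g (omap (F h) U) (b h))"
    note bh = bc[OF h]
    note z = gam_closed[OF g Fobj[OF h U] bh]
    have e: "?e \<in> carrier ?T" by (rule rmod_homD(1)[OF eps(1)[OF g h U] z])
    have ec: "?e \<triangleleft>\<^bsub>?T\<^esub> c g h = b (g \<cdot> h)" using rep g h by (simp add: represents_def)
    note ef = free_gen_ract_rev[OF Fmod[OF gh U] b[OF gh] c[OF g h] e ec]
    let ?r = "\<rho> g (\<delta> h) \<otimes> \<delta> g"
    have rd: "\<rho> g (\<delta> h) \<in> Units A" by (rule alg_auto(5)[OF rho[OF g] d[OF h]])
    have rU: "?r \<in> Units A" by (rule Units_m_closed[OF rd d[OF g]])
    have "gamma (F g) (b' g) (omap (F h) U) (b' h) = gam g (omap (F h) U) (b h \<triangleleft>\<^bsub>omap (F h) U\<^esub> \<delta> h)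
        \<triangleleft>\<^bsub>omap (F g) (omap (F h) U)\<^esub> \<delta> g"
      unfolding b'[OF h] by (rule gam'[OF g Fobj[OF h U] FhU.ract_closed[OF bh dc[OF h]]])
    also have "\<dots> = gam g (omap (F h) U) (b h) \<triangleleft>\<^bsub>omap (F g) (omap (F h) U)\<^esub> ?r"
      unfolding gam_ract[OF g Fobj[OF h U] bh dc[OF h]]
      by (rule S.ract_mult[OF z Units_closed[OF rd] dc[OF g], symmetric])
    finally have "\<epsilon> g h U (gamma (F g) (b' g) (omap (F h) U) (b' h)) = ?e \<triangleleft>\<^bsub>?T\<^esub> ?r"
      using rmod_homD(3)[OF eps(1)[OF g h U] z Units_closed[OF rU]] by simp
    then have "\<epsilon> g h U (gamma (F g) (b' g) (omap (F h) U) (b' h)) \<triangleleft>\<^bsub>?T\<^esub> c' g h = ?e \<triangleleft>\<^bsub>?T\<^esub> (?r \<otimes> c' g h)"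
      using T.ract_mult[OF e Units_closed[OF rU] c'[OF g h]] by simp
    moreover have "b' (g \<cdot> h) = ?e \<triangleleft>\<^bsub>?T\<^esub> (c g h \<otimes> \<delta> (g \<cdot> h))"
      unfolding b'[OF gh] ec[symmetric] by (rule T.ract_mult[OF e c_closed[OF g h] dc[OF gh], symmetric])
    moreover have "?e \<triangleleft>\<^bsub>?T\<^esub> (?r \<otimes> c' g h) = ?e \<triangleleft>\<^bsub>?T\<^esub> (c g h \<otimes> \<delta> (g \<cdot> h)) \<longleftrightarrow>
        ?r \<otimes> c' g h = c g h \<otimes> \<delta> (g \<cdot> h)"
      using free_genD(3)[OF ef m_closed[OF Units_closed[OF rU] c'[OF g h]] m_closed[OF c_closed[OF g h] dc[OF gh]]]
      by auto
    moreover have "?r \<otimes> c' g h = c g h \<otimes> \<delta> (g \<cdot> h) \<longleftrightarrow> c' g h = inv ?r \<otimes> (c g h \<otimes> \<delta> (g \<cdot> h))"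
      using Units_cancel_left[OF rU c'[OF g h]] Units_cancel_left[OF rU m_closed[OF c_closed[OF g h] dc[OF gh]]]
      by metis
    moreover have "inv ?r \<otimes> (c g h \<otimes> \<delta> (g \<cdot> h)) = inv (\<delta> g) \<otimes> \<rho> g (inv (\<delta> h)) \<otimes> c g h \<otimes> \<delta> (g \<cdot> h)"
      unfolding inv_mult_Units[OF rd d[OF g]] alg_auto(6)[OF rho[OF g] d[OF h]]
      using m_assoc[OF m_closed[OF idc[OF g] Units_inv_closed[OF rd]] c_closed[OF g h] dc[OF gh]] by simp
    ultimately show ?thesis by simp
  qed
  show ?thesis unfolding represents_def using free one two by (simp cong: ball_cong)
qed

end

context linear_mod_action
begin

text \<open>The generators exist by \<open>exists_free_gen\<close>, the automorphisms by \<open>gamma_auto\<close>. Both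
  \<open>\<epsilon>\<^bsub>g,h\<^esub>(\<gamma>\<^sub>g(\<gamma>\<^sub>h(u)))\<close> and \<open>b\<^bsub>gh\<^esub>\<close> are free generators, so they differ by a unit \<open>c(g, h)\<close>.\<close>

lemma exists_representation:
  assumes pi: "pi_regular_ring A" and bas: "basic A"
  shows "\<exists>b \<rho> c. represents G F \<epsilon> b \<rho> c \<and> (\<rho>, c) \<in> linear_weak_actions G K A"
proof -
  have "\<forall>g \<in> carrier G. \<exists>b. free_gen A (omap (F g) U) b"
    using linear_autoequivalence.exists_free_gen[OF lin_aut pi bas] by blast
  then obtain b where b: "\<And>g. g \<in> carrier G \<Longrightarrow> free_gen A (omap (F g) U) (b g)" by metis
  note bc = free_genD(1)[OF b]
  have "\<forall>g \<in> carrier G. \<exists>\<sigma>. \<sigma> \<in> alg_auto K A \<and>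
      (\<forall>a \<in> carrier A. gamma (F g) (b g) U (u \<triangleleft>\<^bsub>U\<^esub> a) = b g \<triangleleft>\<^bsub>omap (F g) U\<^esub> \<sigma> a)"
    using linear_autoequivalence.gamma_auto[OF lin_aut b] by blast
  from bchoice[OF this] obtain \<rho> where rho: "\<And>g. g \<in> carrier G \<Longrightarrow> \<rho> g \<in> alg_auto K A"
    "\<And>g a. \<lbrakk>g \<in> carrier G; a \<in> carrier A\<rbrakk> \<Longrightarrow>
      gamma (F g) (b g) U (u \<triangleleft>\<^bsub>U\<^esub> a) = b g \<triangleleft>\<^bsub>omap (F g) U\<^esub> \<rho> g a" by blast
  define P where "P g h v \<longleftrightarrow> v \<in> Units A \<and>
      \<epsilon> g h U (gamma (F g) (b g) (omap (F h) U) (b h)) \<triangleleft>\<^bsub>omap (F (g \<cdot> h)) U\<^esub> v = b (g \<cdot> h)" for g h v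
  define c where "c g h = (SOME v. P g h v)" for g h
  have P: "P g h (c g h)" if g: "g \<in> carrier G" and h: "h \<in> carrier G" for g h
  proof -
    note gh = G.m_closed[OF g h]
    note hb = hat_hom[OF Fmod[OF h U] bc[OF h]]
    interpret FhU: right_module A "omap (F h) U" by (rule Fmod[OF h U])
    have "bij_betw (hat (omap (F h) U) (b h)) (carrier U) (carrier (omap (F h) U))"
    proof (rule bij_betw_imageI)
      show "inj_on (hat (omap (F h) U) (b h)) (carrier U)"
      proof (rule inj_onI)
        fix x y assume x: "x \<in> carrier U" and y: "y \<in> carrier U"
          and "hat (omap (F h) U) (b h) x = hat (omap (F h) U) (b h) y"
        then have "b h \<triangleleft>\<^bsub>omap (F h) U\<^esub> coord x = b h \<triangleleft>\<^bsub>omap (F h) U\<^esub> coord y" by (simp add: hat_def)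
        then have "coord x = coord y" using free_genD(3)[OF b[OF h] coord(2)[OF x] coord(2)[OF y]] by simp
        then show "x = y" using coord(3)[OF x] coord(3)[OF y] by metis
      qed
      show "hat (omap (F h) U) (b h) ` carrier U = carrier (omap (F h) U)"
      proof (intro equalityI subsetI)
        fix y assume "y \<in> carrier (omap (F h) U)"
        then obtain a where a: "a \<in> carrier A" "y = b h \<triangleleft>\<^bsub>omap (F h) U\<^esub> a" using free_genD(2)[OF b[OF h]] by blast
        then have "y = hat (omap (F h) U) (b h) (u \<triangleleft>\<^bsub>U\<^esub> a)" by (simp add: hat_def)
        then show "y \<in> hat (omap (F h) U) (b h) ` carrier U" using a(1) coord(4) by blast
      next
        fix y assume "y \<in> hat (omap (F h) U) (b h) ` carrier U"
        then show "y \<in> carrier (omap (F h) U)" using rmod_homD(1)[OF hb] by blast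
      qed
    qed
    then have "free_gen A (omap (F g) (omap (F h) U)) (gamma (F g) (b g) (omap (F h) U) (b h))"
      unfolding gamma_def
      by (rule free_gen_image[OF b[OF g] endofunctorD(2)[OF Fun[OF g] U Fobj[OF h U] hb]
            endofunctor_bij[OF Fun[OF g] U Fobj[OF h U] hb]])
    then have "free_gen A (omap (F (g \<cdot> h)) U) (\<epsilon> g h U (gamma (F g) (b g) (omap (F h) U) (b h)))"
      by (rule free_gen_image[OF _ eps(1,2)[OF g h U]])
    from free_gen_unit[OF Fmod[OF gh U] this b[OF gh]] have "\<exists>v. P g h v" unfolding P_def by metis
    then show ?thesis unfolding c_def by (rule someI_ex)
  qed
  have rep: "represents G F \<epsilon> b \<rho> c" unfolding represents_def using b rho(2) P by (simp add: P_def)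
  then interpret represented_action K A U u G F \<epsilon> b \<rho> c
    by unfold_locales (use rho(1) P in \<open>auto simp: P_def\<close>)
  show ?thesis using rep linear_weak by blast
qed

text \<open>Two choices of generators differ by units \<open>\<delta>(g)\<close>.\<close>

lemma representation_iso:
  assumes w: "(\<rho>, c) \<in> linear_weak_actions G K A" and w': "(\<rho>', c') \<in> linear_weak_actions G K A"
    and r: "represents G F \<epsilon> b \<rho> c" and r': "represents G F \<epsilon> b' \<rho>' c'"
  shows "weak_action_iso G A (\<rho>, c) (\<rho>', c')"
proof -
  have W: "\<And>g. g \<in> carrier G \<Longrightarrow> \<rho> g \<in> alg_auto K A" "\<And>g h. \<lbrakk>g \<in> carrier G; h \<in> carrier G\<rbrakk> \<Longrightarrow> c g h \<in> Units A"
    using w by (auto simp: linear_weak_actions_def is_weak_action_def Pi_iff)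
  have W': "\<And>g. g \<in> carrier G \<Longrightarrow> \<rho>' g \<in> alg_auto K A" "\<And>g h. \<lbrakk>g \<in> carrier G; h \<in> carrier G\<rbrakk> \<Longrightarrow> c' g h \<in> Units A"
    using w' by (auto simp: linear_weak_actions_def is_weak_action_def Pi_iff)
  interpret represented_action K A U u G F \<epsilon> b \<rho> c
    by unfold_locales (use r W in auto)
  have b': "free_gen A (omap (F g) U) (b' g)" if "g \<in> carrier G" for g
    using r' that by (simp add: represents_def)
  have "\<forall>g \<in> carrier G. \<exists>v. v \<in> Units A \<and> b' g = b g \<triangleleft>\<^bsub>omap (F g) U\<^esub> v"
    using free_gen_unit[OF Fmod[OF _ U] b b'] by blast
  from bchoice[OF this] obtain \<delta> where d: "\<And>g. g \<in> carrier G \<Longrightarrow> \<delta> g \<in> Units A"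
    "\<And>g. g \<in> carrier G \<Longrightarrow> b' g = b g \<triangleleft>\<^bsub>omap (F g) U\<^esub> \<delta> g" by blast
  have "(\<forall>g \<in> carrier G. \<forall>a \<in> carrier A. \<rho>' g a = inv (\<delta> g) \<otimes> \<rho> g a \<otimes> \<delta> g) \<and>
    (\<forall>g \<in> carrier G. \<forall>h \<in> carrier G. c' g h = inv (\<delta> g) \<otimes> \<rho> g (inv (\<delta> h)) \<otimes> c g h \<otimes> \<delta> (g \<cdot> h))"
    using change_generators[OF d, of \<rho>' c'] alg_auto(1)[OF W'(1)] Units_closed[OF W'(2)] r' by blast
  then show ?thesis unfolding weak_action_iso_def prod.case using d(1)
    by (intro bexI[of _ \<delta>]) auto
qed

lemma representation_transfer:
  assumes w: "(\<rho>, c) \<in> linear_weak_actions G K A" and w': "(\<rho>', c') \<in> linear_weak_actions G K A"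
    and r: "represents G F \<epsilon> b \<rho> c" and iso: "weak_action_iso G A (\<rho>, c) (\<rho>', c')"
  shows "\<exists>b'. represents G F \<epsilon> b' \<rho>' c'"
proof -
  have W: "\<And>g. g \<in> carrier G \<Longrightarrow> \<rho> g \<in> alg_auto K A" "\<And>g h. \<lbrakk>g \<in> carrier G; h \<in> carrier G\<rbrakk> \<Longrightarrow> c g h \<in> Units A"
    using w by (auto simp: linear_weak_actions_def is_weak_action_def Pi_iff)
  have W': "\<And>g. g \<in> carrier G \<Longrightarrow> \<rho>' g \<in> alg_auto K A" "\<And>g h. \<lbrakk>g \<in> carrier G; h \<in> carrier G\<rbrakk> \<Longrightarrow> c' g h \<in> Units A"
    using w' by (auto simp: linear_weak_actions_def is_weak_action_def Pi_iff)
  interpret represented_action K A U u G F \<epsilon> b \<rho> c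
    by unfold_locales (use r W in auto)
  obtain \<delta> where d: "\<And>g. g \<in> carrier G \<Longrightarrow> \<delta> g \<in> Units A"
    "\<And>g x. \<lbrakk>g \<in> carrier G; x \<in> carrier A\<rbrakk> \<Longrightarrow> \<rho>' g x = inv (\<delta> g) \<otimes> \<rho> g x \<otimes> \<delta> g"
    "\<And>g h. \<lbrakk>g \<in> carrier G; h \<in> carrier G\<rbrakk> \<Longrightarrow> c' g h = inv (\<delta> g) \<otimes> \<rho> g (inv (\<delta> h)) \<otimes> c g h \<otimes> \<delta> (g \<cdot> h)"
    by (rule weak_action_isoE[OF iso]) (rule that)
  have "represents G F \<epsilon> (\<lambda>g. b g \<triangleleft>\<^bsub>omap (F g) U\<^esub> \<delta> g) \<rho>' c'"
    using change_generators[of \<delta> "\<lambda>g. b g \<triangleleft>\<^bsub>omap (F g) U\<^esub> \<delta> g" \<rho>' c'] d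
      alg_auto(1)[OF W'(1)] Units_closed[OF W'(2)] by blast
  then show ?thesis by blast
qed

end

text \<open>The isomorphism is \<open>\<gamma>' \<gamma>\<^sup>-\<^sup>1\<close>. It is linear because both maps are semilinear along the same
  \<open>\<rho>(g)\<close>, and compatible with \<open>\<epsilon>\<close> and \<open>\<epsilon>'\<close> because both are given by the same \<open>c\<close>.\<close>

lemma represented_actions_iso:
  assumes R: "represented_action K A U u G F \<epsilon> b \<rho> c" and R': "represented_action K A U u G F' \<epsilon>' b' \<rho> c"
  shows "action_iso G (mod_category A) (F, \<epsilon>) (F', \<epsilon>')"
proof -
  interpret R: represented_action K A U u G F \<epsilon> b \<rho> c by fact
  interpret R': represented_action K A U u G F' \<epsilon>' b' \<rho> c by fact
  define \<delta> where "\<delta> g X = (\<lambda>y \<in> carrier (omap (F g) X). R'.gam g X (inv_into (carrier X) (R.gam g X) y))" for g X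
  have surj: "\<exists>x \<in> carrier X. y = R.gam g X x" if "g \<in> carrier G" "X \<in> mods A" "y \<in> carrier (omap (F g) X)" for g X y
    using bij_betw_imp_surj_on[OF R.gam_bij[OF that(1,2)]] that(3) by blast
  have dg: "\<delta> g X (R.gam g X x) = R'.gam g X x" if "g \<in> carrier G" "X \<in> mods A" "x \<in> carrier X" for g X x
    using R.gam_closed[OF that] bij_betw_inv_into_left[OF R.gam_bij[OF that(1,2)] that(3)] by (simp add: \<delta>_def)
  have hom: "\<delta> g X \<in> rmod_hom A (omap (F g) X) (omap (F' g) X)" if g: "g \<in> carrier G" and X: "X \<in> mods A" for g X
  proof (rule rmod_homI)
    interpret X: right_module A X by (rule modsD[OF X])
    fix y assume "y \<in> carrier (omap (F g) X)"
    then obtain x where x: "x \<in> carrier X" "y = R.gam g X x" using surj[OF g X] by blast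
    show "\<delta> g X y \<in> carrier (omap (F' g) X)" unfolding x(2) dg[OF g X x(1)] by (rule R'.gam_closed[OF g X x(1)])
    {
      fix a assume a: "a \<in> carrier A"
      obtain a' where a': "a' \<in> carrier A" "a = \<rho> g a'"
        using bij_betw_imp_surj_on[OF R.alg_auto(4)[OF R.rho[OF g]]] a by blast
      have xa: "x \<triangleleft>\<^bsub>X\<^esub> a' \<in> carrier X" by (rule X.ract_closed[OF x(1) a'(1)])
      show "\<delta> g X (y \<triangleleft>\<^bsub>omap (F g) X\<^esub> a) = \<delta> g X y \<triangleleft>\<^bsub>omap (F' g) X\<^esub> a"
        unfolding x(2) a'(2) R.gam_ract[OF g X x(1) a'(1), symmetric] dg[OF g X x(1)] dg[OF g X xa]
        by (rule R'.gam_ract[OF g X x(1) a'(1)])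
    }
    fix y' assume "y' \<in> carrier (omap (F g) X)"
    then obtain x' where x': "x' \<in> carrier X" "y' = R.gam g X x'" using surj[OF g X] by blast
    have xx: "x \<oplus>\<^bsub>X\<^esub> x' \<in> carrier X" using x(1) x'(1) by simp
    note add = linear_autoequivalence.gamma_add[OF R.lin_aut[OF g] R.bc[OF g] X x(1) x'(1)]
      and add' = linear_autoequivalence.gamma_add[OF R'.lin_aut[OF g] R'.bc[OF g] X x(1) x'(1)]
    show "\<delta> g X (y \<oplus>\<^bsub>omap (F g) X\<^esub> y') = \<delta> g X y \<oplus>\<^bsub>omap (F' g) X\<^esub> \<delta> g X y'"
      unfolding x(2) x'(2) add[symmetric] dg[OF g X x(1)] dg[OF g X x'(1)] dg[OF g X xx] by (rule add')
  qed (simp add: \<delta>_def)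
  have bij: "bij_betw (\<delta> g X) (carrier (omap (F g) X)) (carrier (omap (F' g) X))"
    if g: "g \<in> carrier G" and X: "X \<in> mods A" for g X
  proof -
    have "bij_betw (R'.gam g X \<circ> inv_into (carrier X) (R.gam g X)) (carrier (omap (F g) X)) (carrier (omap (F' g) X))"
      by (rule bij_betw_trans[OF bij_betw_inv_into[OF R.gam_bij[OF g X]] R'.gam_bij[OF g X]])
    then show ?thesis
      by (rule bij_betw_cong[THEN iffD1, rotated]) (simp add: \<delta>_def)
  qed
  have nat: "natural_iso (mod_category A) (mod_category A) (F g) (F' g) (\<delta> g)" if g: "g \<in> carrier G" for g
    unfolding natural_iso_mod_iff[OF R.Fun[OF g] R'.Fun[OF g]]
  proof (intro conjI ballI hom bij g)
    fix X Y f y assume X: "X \<in> mods A" and Y: "Y \<in> mods A" and f: "f \<in> rmod_hom A X Y" and y: "y \<in> carrier (omap (F g) X)"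
    obtain x where x: "x \<in> carrier X" "y = R.gam g X x" using surj[OF g X y] by blast
    note fx = rmod_homD(1)[OF f x(1)]
    show "\<delta> g Y (amap (F g) X Y f y) = amap (F' g) X Y f (\<delta> g X y)"
      unfolding x(2) R.gam_natural[OF g X Y f x(1)] dg[OF g X x(1)] dg[OF g Y fx] R'.gam_natural[OF g X Y f x(1)] ..
  qed
  have coh: "\<delta> (g \<otimes>\<^bsub>G\<^esub> h) X (\<epsilon> g h X y) =
      \<epsilon>' g h X (amap (F' g) (omap (F h) X) (omap (F' h) X) (\<delta> h X) (\<delta> g (omap (F h) X) y))"
    if g: "g \<in> carrier G" and h: "h \<in> carrier G" and X: "X \<in> mods A"
      and y: "y \<in> carrier (omap (F g) (omap (F h) X))" for g h X y
  proof -
    note gh = R.G.m_closed[OF g h] and FhX = R.Fobj[OF h X]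
    obtain z where z: "z \<in> carrier (omap (F h) X)" "y = R.gam g (omap (F h) X) z" using surj[OF g FhX y] by blast
    obtain x where x: "x \<in> carrier X" "z = R.gam h X x" using surj[OF h X z(1)] by blast
    let ?T = "omap (F (g \<otimes>\<^bsub>G\<^esub> h)) X" and ?T' = "omap (F' (g \<otimes>\<^bsub>G\<^esub> h)) X"
    interpret T': right_module A ?T' by (rule R'.Fmod[OF gh X])
    have e: "\<epsilon> g h X y \<in> carrier ?T" by (rule rmod_homD(1)[OF R.eps(1)[OF g h X] y])
    have "\<delta> (g \<otimes>\<^bsub>G\<^esub> h) X (\<epsilon> g h X y) \<triangleleft>\<^bsub>?T'\<^esub> c g h = \<delta> (g \<otimes>\<^bsub>G\<^esub> h) X (\<epsilon> g h X y \<triangleleft>\<^bsub>?T\<^esub> c g h)"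
      by (rule rmod_homD(3)[OF hom[OF gh X] e R.c_closed[OF g h], symmetric])
    also have "\<dots> = R'.gam (g \<otimes>\<^bsub>G\<^esub> h) X x"
      unfolding z(2) x(2) R.eps_gam[OF g h X x(1)] by (rule dg[OF gh X x(1)])
    finally have 1: "\<delta> (g \<otimes>\<^bsub>G\<^esub> h) X (\<epsilon> g h X y) \<triangleleft>\<^bsub>?T'\<^esub> c g h = R'.gam (g \<otimes>\<^bsub>G\<^esub> h) X x" .
    have "amap (F' g) (omap (F h) X) (omap (F' h) X) (\<delta> h X) (\<delta> g (omap (F h) X) y) =
        R'.gam g (omap (F' h) X) (R'.gam h X x)"
      unfolding z(2) dg[OF g FhX z(1)] R'.gam_natural[OF g FhX R'.Fobj[OF h X] hom[OF h X] z(1)]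
      unfolding x(2) dg[OF h X x(1)] ..
    then have 2: "\<epsilon>' g h X (amap (F' g) (omap (F h) X) (omap (F' h) X) (\<delta> h X) (\<delta> g (omap (F h) X) y)) =
        \<epsilon>' g h X (R'.gam g (omap (F' h) X) (R'.gam h X x))" (is "?l = ?r") by simp
    have r: "?r \<in> carrier ?T'" by (rule R'.eps_gam_closed[OF g h X x(1)])
    have l: "\<delta> (g \<otimes>\<^bsub>G\<^esub> h) X (\<epsilon> g h X y) \<in> carrier ?T'" by (rule rmod_homD(1)[OF hom[OF gh X] e])
    have canc: "p = p \<triangleleft>\<^bsub>?T'\<^esub> c g h \<triangleleft>\<^bsub>?T'\<^esub> inv\<^bsub>A\<^esub> (c g h)" if p: "p \<in> carrier ?T'" for p
      using T'.ract_mult[OF p R.c_closed[OF g h] R.Units_inv_closed[OF R.c[OF g h]]]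
        R.Units_r_inv[OF R.c[OF g h]] T'.ract_one[OF p] by simp
    have "\<delta> (g \<otimes>\<^bsub>G\<^esub> h) X (\<epsilon> g h X y) = ?r"
      using canc[OF l] canc[OF r] unfolding 1 R'.eps_gam[OF g h X x(1)] by simp
    then show ?thesis unfolding 2 .
  qed
  show ?thesis unfolding action_iso_def prod.case
  proof (intro exI[of _ \<delta>] conjI ballI nat)
    fix g h X assume g: "g \<in> carrier G" and h: "h \<in> carrier G" and X: "X \<in> mods A"
    show "let gh = g \<otimes>\<^bsub>G\<^esub> h; S = omap (F g) (omap (F h) X);
              S' = omap (F' g) (omap (F' h) X); T' = omap (F' gh) X
          in comps (mod_category A) S (omap (F gh) X) T' (\<delta> gh X) (\<epsilon> g h X) =
             comps (mod_category A) S S' T' (\<epsilon>' g h X)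
               (comps (mod_category A) S (omap (F' g) (omap (F h) X)) S'
                  (amap (F' g) (omap (F h) X) (omap (F' h) X) (\<delta> h X))
                  (\<delta> g (omap (F h) X)))"
      unfolding Let_def mod_category_simps compose_def
      by (rule restrict_ext) (use coh[OF g h X] in simp)
  qed
qed

text \<open>An isomorphism of actions carries the generators \<open>b\<^sub>g\<close> to generators with the same \<open>(\<rho>, c)\<close>.\<close>

lemma represents_iso_invariant:
  assumes L: "linear_mod_action K A U u G F \<epsilon>" and L': "linear_mod_action K A U u G F' \<epsilon>'"
    and iso: "action_iso G (mod_category A) (F, \<epsilon>) (F', \<epsilon>')"
    and w: "(\<rho>, c) \<in> linear_weak_actions G K A"
    and r: "free_object.represents A U u G F \<epsilon> b \<rho> c"
  shows "\<exists>b'. free_object.represents A U u G F' \<epsilon>' b' \<rho> c"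
proof -
  interpret L: linear_mod_action K A U u G F \<epsilon> by fact
  interpret L': linear_mod_action K A U u G F' \<epsilon>' by fact
  have W: "\<And>g. g \<in> carrier G \<Longrightarrow> \<rho> g \<in> alg_auto K A" "\<And>g h. \<lbrakk>g \<in> carrier G; h \<in> carrier G\<rbrakk> \<Longrightarrow> c g h \<in> Units A"
    using w by (auto simp: linear_weak_actions_def is_weak_action_def Pi_iff)
  interpret R: represented_action K A U u G F \<epsilon> b \<rho> c
    by unfold_locales (use r W in auto)
  obtain \<delta> where n: "\<forall>g \<in> carrier G. natural_iso (mod_category A) (mod_category A) (F g) (F' g) (\<delta> g)"
    and coh: "\<forall>g \<in> carrier G. \<forall>h \<in> carrier G. \<forall>X \<in> mods A.
      compose (carrier (omap (F g) (omap (F h) X))) (\<delta> (g \<otimes>\<^bsub>G\<^esub> h) X) (\<epsilon> g h X) =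
      compose (carrier (omap (F g) (omap (F h) X))) (\<epsilon>' g h X)
        (compose (carrier (omap (F g) (omap (F h) X)))
          (amap (F' g) (omap (F h) X) (omap (F' h) X) (\<delta> h X)) (\<delta> g (omap (F h) X)))"
    using iso unfolding action_iso_def prod.case Let_def mod_category_simps by blast
  have dn: "natural_iso (mod_category A) (mod_category A) (F g) (F' g) (\<delta> g)" if "g \<in> carrier G" for g
    using n that by blast
  note d = natural_iso_modD[OF dn L.Fun L'.Fun]
  define b' where "b' g = \<delta> g U (b g)" for g
  have U: "U \<in> mods A" and u: "u \<in> carrier U" by (rule L.U, rule L.u)
  have free: "free_gen A (omap (F' g) U) (b' g)" if g: "g \<in> carrier G" for g
    unfolding b'_def by (rule L.free_gen_image[OF R.b[OF g] d(1,2)[OF g g g U]])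
  have gam: "L.gamma (F' g) (b' g) X x = \<delta> g X (R.gam g X x)"
    if g: "g \<in> carrier G" and X: "X \<in> mods A" and x: "x \<in> carrier X" for g X x
    unfolding L.gamma_def b'_def
    by (rule d(3)[OF g g g U X L.hat_hom[OF modsD(1)[OF X] x] R.bc[OF g], symmetric])
  have "L.represents G F' \<epsilon>' b' \<rho> c"
    unfolding L.represents_def
  proof (intro conjI ballI free)
    fix g a assume g: "g \<in> carrier G" and a: "a \<in> carrier A"
    have ua: "u \<triangleleft>\<^bsub>U\<^esub> a \<in> carrier U" using a by simp
    have "L.gamma (F' g) (b' g) U (u \<triangleleft>\<^bsub>U\<^esub> a) = \<delta> g U (b g \<triangleleft>\<^bsub>omap (F g) U\<^esub> \<rho> g a)"
      unfolding gam[OF g U ua] R.gam_ract[OF g U u a] L.gamma_u[OF L.Fun[OF g] R.bc[OF g]] ..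
    also have "\<dots> = b' g \<triangleleft>\<^bsub>omap (F' g) U\<^esub> \<rho> g a"
      unfolding b'_def by (rule rmod_homD(3)[OF d(1)[OF g g g U] R.bc[OF g] R.rho_closed[OF g a]])
    finally show "L.gamma (F' g) (b' g) U (u \<triangleleft>\<^bsub>U\<^esub> a) = b' g \<triangleleft>\<^bsub>omap (F' g) U\<^esub> \<rho> g a" .
  next
    fix g h assume g: "g \<in> carrier G" and h: "h \<in> carrier G"
    note gh = L.G.m_closed[OF g h] and FhU = L.Fobj[OF h U] and F'hU = L'.Fobj[OF h U]
    let ?z = "R.gam g (omap (F h) U) (b h)"
    let ?T = "omap (F (g \<otimes>\<^bsub>G\<^esub> h)) U" and ?T' = "omap (F' (g \<otimes>\<^bsub>G\<^esub> h)) U"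
    have z: "?z \<in> carrier (omap (F g) (omap (F h) U))" by (rule R.gam_closed[OF g FhU R.bc[OF h]])
    have e: "\<epsilon> g h U ?z \<in> carrier ?T" by (rule rmod_homD(1)[OF L.eps(1)[OF g h U] z])
    have "L.gamma (F' g) (b' g) (omap (F' h) U) (b' h) =
        amap (F' g) (omap (F h) U) (omap (F' h) U) (\<delta> h U) (L.gamma (F' g) (b' g) (omap (F h) U) (b h))"
      unfolding b'_def[of h]
      by (rule L.gamma_natural[OF L'.Fun[OF g] L.free_genD(1)[OF free[OF g]] FhU F'hU d(1)[OF h h h U] R.bc[OF h], symmetric])
    also have "\<dots> = amap (F' g) (omap (F h) U) (omap (F' h) U) (\<delta> h U) (\<delta> g (omap (F h) U) ?z)"
      unfolding gam[OF g FhU R.bc[OF h]] ..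
    finally have "\<epsilon>' g h U (L.gamma (F' g) (b' g) (omap (F' h) U) (b' h)) = \<delta> (g \<otimes>\<^bsub>G\<^esub> h) U (\<epsilon> g h U ?z)"
      using fun_cong[OF coh[rule_format, OF g h U], of ?z] z by (simp add: compose_def)
    then have "\<epsilon>' g h U (L.gamma (F' g) (b' g) (omap (F' h) U) (b' h)) \<triangleleft>\<^bsub>?T'\<^esub> c g h =
        \<delta> (g \<otimes>\<^bsub>G\<^esub> h) U (\<epsilon> g h U ?z \<triangleleft>\<^bsub>?T\<^esub> c g h)"
      using rmod_homD(3)[OF d(1)[OF gh gh gh U] e R.c_closed[OF g h]] by simp
    also have "\<epsilon> g h U ?z \<triangleleft>\<^bsub>?T\<^esub> c g h = b (g \<otimes>\<^bsub>G\<^esub> h)" using r g h by (simp add: L.represents_def)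
    finally show "\<epsilon>' g h U (L.gamma (F' g) (b' g) (omap (F' h) U) (b' h)) \<triangleleft>\<^bsub>?T'\<^esub> c g h = b' (g \<otimes>\<^bsub>G\<^esub> h)"
      by (simp add: b'_def)
  qed
  then show ?thesis by blast
qed

section \<open>Twisting modules by automorphisms\<close>

definition twist_mod :: "('a \<Rightarrow> 'a) \<Rightarrow> 'a fp_rmodule \<Rightarrow> 'a fp_rmodule" where
  "twist_mod \<tau> M = M\<lparr>ract := (\<lambda>x a. x \<triangleleft>\<^bsub>M\<^esub> \<tau> a)\<rparr>"

lemma twist_mod_simps [simp]:
  "carrier (twist_mod \<tau> M) = carrier M" "ring.add (twist_mod \<tau> M) = ring.add M"
  "ring.zero (twist_mod \<tau> M) = ring.zero M" "ract (twist_mod \<tau> M) = (\<lambda>x a. x \<triangleleft>\<^bsub>M\<^esub> \<tau> a)"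
  by (simp_all add: twist_mod_def)

definition twist_functor :: "('a \<Rightarrow> 'a) \<Rightarrow> ('a fp_rmodule, 'a fp_arrow, 'a fp_rmodule, 'a fp_arrow) cat_functor" where
  "twist_functor \<tau> = \<lparr>omap = twist_mod \<tau>, amap = (\<lambda>X Y f. f)\<rparr>"

lemma twist_functor_simps [simp]:
  "omap (twist_functor \<tau>) = twist_mod \<tau>" "amap (twist_functor \<tau>) X Y f = f"
  by (simp_all add: twist_functor_def)

context assoc_algebra
begin

context
  fixes \<tau> \<sigma>
  assumes tau: "\<tau> \<in> alg_auto K A" and sigma: "\<sigma> \<in> alg_auto K A"
    and inv: "\<And>x. x \<in> carrier A \<Longrightarrow> \<sigma> (\<tau> x) = x" "\<And>x. x \<in> carrier A \<Longrightarrow> \<tau> (\<sigma> x) = x"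
begin

lemma twist_mod_right_module:
  assumes "right_module A M"
  shows "right_module A (twist_mod \<tau> M)"
proof -
  interpret M: right_module A M by fact
  have "abelian_group (twist_mod \<tau> M)"
  proof (rule abelian_groupI)
    fix x assume "x \<in> carrier (twist_mod \<tau> M)"
    then show "\<exists>y \<in> carrier (twist_mod \<tau> M). y \<oplus>\<^bsub>twist_mod \<tau> M\<^esub> x = \<zero>\<^bsub>twist_mod \<tau> M\<^esub>"
      by (intro bexI[of _ "\<ominus>\<^bsub>M\<^esub> x"]) (simp_all add: M.M.l_neg)
  qed (simp_all add: M.M.a_assoc, simp add: M.M.a_comm)
  moreover have "right_module_axioms A (twist_mod \<tau> M)"
    by (rule right_module_axioms.intro)
      (simp_all add: alg_auto[OF tau] alg_auto_add[OF tau] M.ract)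
  ultimately show ?thesis using M.right_module_axioms by (simp add: right_module_def)
qed

text \<open>A presentation is twisted by applying the automorphism to the coordinates of the
  free modules.\<close>

lemma twist_mod_finitely_presented:
  assumes M: "right_module A M" and fp: "finitely_presented A M"
  shows "finitely_presented A (twist_mod \<tau> M)"
proof -
  interpret M: right_module A M by fact
  obtain m n f g where f: "f \<in> rmod_hom A (free_rmod A m) (free_rmod A n)"
    and g: "g \<in> rmod_hom A (free_rmod A n) M" "g ` carrier (free_rmod A n) = carrier M"
    and ker: "f ` carrier (free_rmod A m) = {v \<in> carrier (free_rmod A n). g v = \<zero>\<^bsub>M\<^esub>}"
    using fp unfolding finitely_presented_def by (elim exE conjE) (rule that)
  have F: "carrier (free_rmod A k) = {..<k} \<rightarrow>\<^sub>E carrier A"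
    "ring.add (free_rmod A k) = (\<lambda>v w. \<lambda>i \<in> {..<k}. v i \<oplus>\<^bsub>A\<^esub> w i)"
    "ract (free_rmod A k) = (\<lambda>v a. \<lambda>i \<in> {..<k}. v i \<otimes>\<^bsub>A\<^esub> a)" for k
    by (simp_all add: free_rmod_def)
  let ?C = "\<lambda>k. carrier (free_rmod A k)"
  define T where "T k v = (\<lambda>i \<in> {..<k}. \<tau> (v i))" for k :: nat and v
  define S where "S k v = (\<lambda>i \<in> {..<k}. \<sigma> (v i))" for k :: nat and v
  have TC: "T k v \<in> ?C k" and SC: "S k v \<in> ?C k" if "v \<in> ?C k" for k v
    using that alg_auto(1)[OF tau] alg_auto(1)[OF sigma] by (auto simp: F T_def S_def)
  have TS: "T k (S k v) = v" and ST: "S k (T k v) = v" if "v \<in> ?C k" for k v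
  proof -
    have v: "v i \<in> carrier A" if "i < k" for i using \<open>v \<in> ?C k\<close> that by (auto simp: F)
    have e: "v \<in> extensional {..<k}" using that by (simp add: F PiE_def)
    show "T k (S k v) = v"
      by (rule extensionalityI[OF _ e]) (simp_all add: T_def S_def inv v)
    show "S k (T k v) = v"
      by (rule extensionalityI[OF _ e]) (simp_all add: T_def S_def inv v)
  qed
  have Tadd: "T k (v \<oplus>\<^bsub>free_rmod A k\<^esub> w) = T k v \<oplus>\<^bsub>free_rmod A k\<^esub> T k w"
    and Sadd: "S k (v \<oplus>\<^bsub>free_rmod A k\<^esub> w) = S k v \<oplus>\<^bsub>free_rmod A k\<^esub> S k w"
    if "v \<in> ?C k" "w \<in> ?C k" for k v w
  proof -
    have v: "v i \<in> carrier A" "w i \<in> carrier A" if "i < k" for i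
      using \<open>v \<in> ?C k\<close> \<open>w \<in> ?C k\<close> that by (auto simp: F)
    show "T k (v \<oplus>\<^bsub>free_rmod A k\<^esub> w) = T k v \<oplus>\<^bsub>free_rmod A k\<^esub> T k w"
      unfolding T_def F by (rule restrict_ext) (simp add: v alg_auto_add[OF tau])
    show "S k (v \<oplus>\<^bsub>free_rmod A k\<^esub> w) = S k v \<oplus>\<^bsub>free_rmod A k\<^esub> S k w"
      unfolding S_def F by (rule restrict_ext) (simp add: v alg_auto_add[OF sigma])
  qed
  have Tract: "T k (v \<triangleleft>\<^bsub>free_rmod A k\<^esub> a) = T k v \<triangleleft>\<^bsub>free_rmod A k\<^esub> \<tau> a"
    and Sract: "S k (v \<triangleleft>\<^bsub>free_rmod A k\<^esub> a) = S k v \<triangleleft>\<^bsub>free_rmod A k\<^esub> \<sigma> a"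
    if "v \<in> ?C k" "a \<in> carrier A" for k v a
  proof -
    have v: "v i \<in> carrier A" if "i < k" for i using \<open>v \<in> ?C k\<close> that by (auto simp: F)
    show "T k (v \<triangleleft>\<^bsub>free_rmod A k\<^esub> a) = T k v \<triangleleft>\<^bsub>free_rmod A k\<^esub> \<tau> a"
      unfolding T_def F by (rule restrict_ext) (simp add: v that(2) alg_auto(2)[OF tau])
    show "S k (v \<triangleleft>\<^bsub>free_rmod A k\<^esub> a) = S k v \<triangleleft>\<^bsub>free_rmod A k\<^esub> \<sigma> a"
      unfolding S_def F by (rule restrict_ext) (simp add: v that(2) alg_auto(2)[OF sigma])
  qed
  have cl: "v \<oplus>\<^bsub>free_rmod A k\<^esub> w \<in> ?C k" "v \<triangleleft>\<^bsub>free_rmod A k\<^esub> a \<in> ?C k"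
    if "v \<in> ?C k" "w \<in> ?C k" "a \<in> carrier A" for k v w a
    using that by (auto simp: F)
  note fD = rmod_homD[OF f] and gD = rmod_homD[OF g(1)]
  let ?f = "\<lambda>v \<in> ?C m. S n (f (T m v))"
  let ?g = "\<lambda>v \<in> ?C n. g (T n v)"
  have f': "?f \<in> rmod_hom A (free_rmod A m) (free_rmod A n)"
  proof (rule rmod_homI)
    fix v assume v: "v \<in> ?C m"
    show "?f v \<in> ?C n" using SC[OF fD(1)[OF TC[OF v]]] v by simp
    fix w assume w: "w \<in> ?C m"
    have vw: "v \<oplus>\<^bsub>free_rmod A m\<^esub> w \<in> ?C m" using cl(1)[OF v w one_closed] .
    show "?f (v \<oplus>\<^bsub>free_rmod A m\<^esub> w) = ?f v \<oplus>\<^bsub>free_rmod A n\<^esub> ?f w"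
      using v w vw Tadd[OF v w] fD(2)[OF TC[OF v] TC[OF w]] Sadd[OF fD(1)[OF TC[OF v]] fD(1)[OF TC[OF w]]]
      by simp
  next
    fix v a assume v: "v \<in> ?C m" and a: "a \<in> carrier A"
    have va: "v \<triangleleft>\<^bsub>free_rmod A m\<^esub> a \<in> ?C m" using cl(2)[OF v v a] .
    have ta: "\<tau> a \<in> carrier A" by (rule alg_auto(1)[OF tau a])
    show "?f (v \<triangleleft>\<^bsub>free_rmod A m\<^esub> a) = ?f v \<triangleleft>\<^bsub>free_rmod A n\<^esub> a"
      using v va Tract[OF v a] fD(3)[OF TC[OF v] ta] Sract[OF fD(1)[OF TC[OF v]] ta] inv(1)[OF a] by simp
  qed simp
  have g': "?g \<in> rmod_hom A (free_rmod A n) (twist_mod \<tau> M)"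
  proof (rule rmod_homI)
    fix v assume v: "v \<in> ?C n"
    show "?g v \<in> carrier (twist_mod \<tau> M)" using gD(1)[OF TC[OF v]] v by simp
    fix w assume w: "w \<in> ?C n"
    have vw: "v \<oplus>\<^bsub>free_rmod A n\<^esub> w \<in> ?C n" using cl(1)[OF v w one_closed] .
    show "?g (v \<oplus>\<^bsub>free_rmod A n\<^esub> w) = ?g v \<oplus>\<^bsub>twist_mod \<tau> M\<^esub> ?g w"
      using v w vw Tadd[OF v w] gD(2)[OF TC[OF v] TC[OF w]] by simp
  next
    fix v a assume v: "v \<in> ?C n" and a: "a \<in> carrier A"
    have va: "v \<triangleleft>\<^bsub>free_rmod A n\<^esub> a \<in> ?C n" using cl(2)[OF v v a] .
    have ta: "\<tau> a \<in> carrier A" by (rule alg_auto(1)[OF tau a])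
    show "?g (v \<triangleleft>\<^bsub>free_rmod A n\<^esub> a) = ?g v \<triangleleft>\<^bsub>twist_mod \<tau> M\<^esub> a"
      using v va Tract[OF v a] gD(3)[OF TC[OF v] ta] by simp
  qed simp
  have gimg: "?g ` ?C n = carrier (twist_mod \<tau> M)"
  proof (intro equalityI subsetI)
    fix x assume "x \<in> carrier (twist_mod \<tau> M)"
    then have "x \<in> g ` ?C n" using g(2) by simp
    then obtain v where v: "v \<in> ?C n" "x = g v" by blast
    then have "x = ?g (S n v)" using SC[OF v(1)] TS[OF v(1)] by simp
    then show "x \<in> ?g ` ?C n" using SC[OF v(1)] by blast
  next
    fix x assume "x \<in> ?g ` ?C n"
    then obtain v where v: "v \<in> ?C n" "x = g (T n v)" by auto
    then show "x \<in> carrier (twist_mod \<tau> M)" using gD(1)[OF TC[OF v(1)]] by simp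
  qed
  have ker': "?f ` ?C m = {v \<in> ?C n. ?g v = \<zero>\<^bsub>twist_mod \<tau> M\<^esub>}"
  proof (intro equalityI subsetI)
    fix y assume "y \<in> ?f ` ?C m"
    then obtain v where v: "v \<in> ?C m" "y = S n (f (T m v))" by auto
    let ?w = "f (T m v)"
    have "?w \<in> f ` ?C m" using TC[OF v(1)] by blast
    then have w: "?w \<in> ?C n" "g ?w = \<zero>\<^bsub>M\<^esub>" unfolding ker by auto
    then show "y \<in> {v \<in> ?C n. ?g v = \<zero>\<^bsub>twist_mod \<tau> M\<^esub>}" using SC[OF w(1)] TS[OF w(1)] v(2) by simp
  next
    fix y assume "y \<in> {v \<in> ?C n. ?g v = \<zero>\<^bsub>twist_mod \<tau> M\<^esub>}"
    then have y0: "y \<in> ?C n" "?g y = \<zero>\<^bsub>M\<^esub>" unfolding mem_Collect_eq twist_mod_simps(3) by blast+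
    then have y: "y \<in> ?C n" "g (T n y) = \<zero>\<^bsub>M\<^esub>" by simp_all
    have "T n y \<in> f ` ?C m" unfolding ker using TC[OF y(1)] y(2) by simp
    then obtain v where v: "v \<in> ?C m" "T n y = f v" by blast
    have "?f (S m v) = S n (T n y)" unfolding v(2) using SC[OF v(1)] TS[OF v(1)] by simp
    then have "y = ?f (S m v)" using ST[OF y(1)] by simp
    then show "y \<in> ?f ` ?C m" using SC[OF v(1)] by blast
  qed
  show ?thesis unfolding finitely_presented_def
    by (rule exI[of _ m], rule exI[of _ n], rule exI[of _ ?f], rule exI[of _ ?g])
      (intro conjI f' g' gimg ker')
qed

lemma twist_mod_mods: "M \<in> mods A \<Longrightarrow> twist_mod \<tau> M \<in> mods A"
  using twist_mod_right_module twist_mod_finitely_presented by (simp add: mod_category_simps(1))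

lemma twist_mod_hom: "f \<in> rmod_hom A M N \<Longrightarrow> f \<in> rmod_hom A (twist_mod \<tau> M) (twist_mod \<tau> N)"
  by (rule rmod_homI) (simp_all add: rmod_homD alg_auto(1)[OF tau])

lemma twist_endofunctor: "endofunctor A (twist_functor \<tau>)"
  unfolding is_functor_def by (simp add: twist_mod_mods twist_mod_hom)

lemma twist_linear: "linear_functor K (mod_category A) (mod_category A) (twist_functor \<tau>)"
proof -
  have "\<tau> (t \<odot>\<^bsub>A\<^esub> \<one>\<^bsub>A\<^esub>) = t \<odot>\<^bsub>A\<^esub> \<one>\<^bsub>A\<^esub>" if "t \<in> carrier K" for t
    using that by (simp add: alg_auto_smult[OF tau] alg_auto(3)[OF tau])
  then show ?thesis using twist_endofunctor by (simp add: linear_functor_def)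
qed

end

lemma twist_mod_twist_mod_hom:
  assumes "M \<in> mods A" and "\<And>a. a \<in> carrier A \<Longrightarrow> \<tau> (\<sigma> a) = a"
  shows "(\<lambda>x \<in> carrier M. x) \<in> rmod_hom A M (twist_mod \<sigma> (twist_mod \<tau> M))"
    and "(\<lambda>x \<in> carrier M. x) \<in> rmod_hom A (twist_mod \<sigma> (twist_mod \<tau> M)) M"
proof -
  interpret M: right_module A M by (rule modsD[OF assms(1)])
  show "(\<lambda>x \<in> carrier M. x) \<in> rmod_hom A M (twist_mod \<sigma> (twist_mod \<tau> M))"
    by (rule rmod_homI) (simp_all add: assms(2) M.ract_closed)
  show "(\<lambda>x \<in> carrier M. x) \<in> rmod_hom A (twist_mod \<sigma> (twist_mod \<tau> M)) M"
    by (rule rmod_homI) (simp_all add: assms(2) M.ract_closed)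
qed

lemma twist_autoequivalence:
  assumes tau: "\<tau> \<in> alg_auto K A" and sigma: "\<sigma> \<in> alg_auto K A"
    and inv: "\<And>x. x \<in> carrier A \<Longrightarrow> \<sigma> (\<tau> x) = x" "\<And>x. x \<in> carrier A \<Longrightarrow> \<tau> (\<sigma> x) = x"
  shows "autoequivalence (mod_category A) (twist_functor \<tau>)"
proof -
  have F: "endofunctor A (twist_functor \<tau>)" by (rule twist_endofunctor[OF tau sigma]) (simp_all add: inv)
  have G: "endofunctor A (twist_functor \<sigma>)" by (rule twist_endofunctor[OF sigma tau]) (simp_all add: inv)
  note GF = endofunctor_comp[OF G F] and FG = endofunctor_comp[OF F G]
  have bij: "bij_betw (\<lambda>x \<in> carrier X. x) (carrier X) (carrier X)" for X :: "'c fp_rmodule"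
    by (rule bij_betwI[of _ _ _ "\<lambda>x. x"]) auto
  have fc: "f x \<in> carrier Y" if "f \<in> rmod_hom A X Y" "x \<in> carrier X" for X Y :: "'c fp_rmodule" and f x
    by (rule rmod_homD(1)[OF that])
  have 1: "natural_iso (mod_category A) (mod_category A) id_functor
      (comp_functor (twist_functor \<sigma>) (twist_functor \<tau>)) (\<lambda>X. \<lambda>x \<in> carrier X. x)"
    unfolding natural_iso_mod_iff[OF endofunctor_id GF]
    using bij fc by (simp add: twist_mod_twist_mod_hom(1) inv)
  have 2: "natural_iso (mod_category A) (mod_category A)
      (comp_functor (twist_functor \<tau>) (twist_functor \<sigma>)) id_functor (\<lambda>X. \<lambda>x \<in> carrier X. x)"
    unfolding natural_iso_mod_iff[OF FG endofunctor_id]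
    using bij fc by (simp add: twist_mod_twist_mod_hom(2) inv)
  show ?thesis unfolding autoequivalence_def using F G 1 2 by blast
qed

end

text \<open>The weak action \<open>(\<rho>, c)\<close> is realised by the twists \<open>F\<^sub>g\<close> along \<open>\<tau>(g) = \<rho>(g)\<^sup>-\<^sup>1\<close>. All \<open>\<gamma>\<^sub>g\<close> for the
  generator \<open>u\<close> are then identity maps. The composite \<open>F\<^sub>g F\<^sub>h\<close> is the twist along \<open>\<tau>(h) \<tau>(g)\<close>, which
  differs from \<open>\<tau>(gh)\<close> by the inner automorphism of \<open>d(g, h) = \<tau>(gh)(c(g, h)\<^sup>-\<^sup>1)\<close>; multiplication by
  \<open>d(g, h)\<close> is the structure isomorphism, and its coherence is the cocycle identity.\<close>

lemma exists_represented_action: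
  fixes K :: "('k, 'x) ring_scheme" and A :: "('k, 'a, 'y) module_scheme"
  assumes alg: "assoc_algebra K A" and fo: "free_object A U u" and "group G"
    and w: "(\<rho>, c) \<in> linear_weak_actions G K A"
  shows "\<exists>F \<epsilon> b. (F, \<epsilon>) \<in> linear_actions G K (mod_category A) \<and>
    free_object.represents A U u G F \<epsilon> b \<rho> c"
proof -
  interpret assoc_algebra K A by fact
  interpret W: weak_action A G \<rho> c
    using w \<open>group G\<close> ring_axioms by (simp add: weak_action_def weak_action_axioms_def linear_weak_actions_def)
  interpret free_object A U u by fact
  have rho: "\<rho> g \<in> alg_auto K A" if "g \<in> carrier G" for g
    using w that by (auto simp: linear_weak_actions_def)
  define \<tau> where "\<tau> g = restrict (inv_into (carrier A) (\<rho> g)) (carrier A)" for g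
  have tau: "\<tau> g \<in> alg_auto K A" if "g \<in> carrier G" for g
    unfolding \<tau>_def by (rule alg_auto_inv_into[OF rho[OF that]])
  note tc = alg_auto(1)[OF tau] and rc = alg_auto(1)[OF rho]
  have rt: "\<rho> g (\<tau> g x) = x" and tr: "\<tau> g (\<rho> g x) = x" if g: "g \<in> carrier G" and x: "x \<in> carrier A" for g x
    using alg_auto(4)[OF rho[OF g]] x rc[OF g x] by (auto simp: \<tau>_def bij_betw_def f_inv_into_f)
  define F where "F g = twist_functor (\<tau> g)" for g
  define d where "d g h = \<tau> (g \<otimes>\<^bsub>G\<^esub> h) (inv\<^bsub>A\<^esub> (c g h))" for g h
  define \<epsilon> where "\<epsilon> g h X = (\<lambda>x \<in> carrier X. x \<triangleleft>\<^bsub>X\<^esub> d g h)" for g h and X :: "'a fp_rmodule"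
  have aut: "autoequivalence (mod_category A) (F g)" "linear_functor K (mod_category A) (mod_category A) (F g)"
    "endofunctor A (F g)" if g: "g \<in> carrier G" for g
    unfolding F_def
    using twist_autoequivalence[OF tau[OF g] rho[OF g] rt[OF g] tr[OF g]]
      twist_linear[OF tau[OF g] rho[OF g] rt[OF g] tr[OF g]]
      twist_endofunctor[OF tau[OF g] rho[OF g] rt[OF g] tr[OF g]] by auto
  have omF: "omap (F g) X = twist_mod (\<tau> g) X" for g X by (simp add: F_def)
  have amF: "amap (F g) X Y f = f" for g X Y f by (simp add: F_def)
  have dU: "d g h \<in> Units A" if g: "g \<in> carrier G" and h: "h \<in> carrier G" for g h
    unfolding d_def by (rule alg_auto(5)[OF tau[OF W.G.m_closed[OF g h]] Units_inv_Units[OF W.c_Units[OF g h]]])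
  note dc = Units_closed[OF dU]
  have cc: "c g h \<in> carrier A" "inv\<^bsub>A\<^esub> (c g h) \<in> carrier A" if g: "g \<in> carrier G" and h: "h \<in> carrier G" for g h
    using W.c_Units[OF g h] by auto
  have d_inv: "d g h \<otimes>\<^bsub>A\<^esub> \<tau> (g \<otimes>\<^bsub>G\<^esub> h) (c g h) = \<one>\<^bsub>A\<^esub>" if g: "g \<in> carrier G" and h: "h \<in> carrier G" for g h
    unfolding d_def alg_auto(2)[OF tau[OF W.G.m_closed[OF g h]] cc(2,1)[OF g h], symmetric]
    using W.c_Units[OF g h] alg_auto(3)[OF tau[OF W.G.m_closed[OF g h]]] by simp
  have comm: "\<tau> h (\<tau> g a) \<otimes>\<^bsub>A\<^esub> d g h = d g h \<otimes>\<^bsub>A\<^esub> \<tau> (g \<otimes>\<^bsub>G\<^esub> h) a"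
    if g: "g \<in> carrier G" and h: "h \<in> carrier G" and a: "a \<in> carrier A" for g h a
  proof -
    note gh = W.G.m_closed[OF g h]
    have y: "\<tau> h (\<tau> g a) \<in> carrier A" by (rule tc[OF h tc[OF g a]])
    have "\<rho> (g \<otimes>\<^bsub>G\<^esub> h) (\<tau> h (\<tau> g a)) = inv\<^bsub>A\<^esub> (c g h) \<otimes>\<^bsub>A\<^esub> a \<otimes>\<^bsub>A\<^esub> c g h"
      unfolding W.rho_mult[OF g h y] rt[OF h tc[OF g a]] rt[OF g a] ..
    then have t: "\<tau> h (\<tau> g a) = \<tau> (g \<otimes>\<^bsub>G\<^esub> h) (inv\<^bsub>A\<^esub> (c g h) \<otimes>\<^bsub>A\<^esub> a \<otimes>\<^bsub>A\<^esub> c g h)"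
      using tr[OF gh y] by simp
    have "\<tau> h (\<tau> g a) \<otimes>\<^bsub>A\<^esub> d g h =
        \<tau> (g \<otimes>\<^bsub>G\<^esub> h) (inv\<^bsub>A\<^esub> (c g h) \<otimes>\<^bsub>A\<^esub> a \<otimes>\<^bsub>A\<^esub> c g h \<otimes>\<^bsub>A\<^esub> inv\<^bsub>A\<^esub> (c g h))"
      unfolding t d_def using cc[OF g h] a by (intro alg_auto(2)[OF tau[OF gh], symmetric]) auto
    also have "inv\<^bsub>A\<^esub> (c g h) \<otimes>\<^bsub>A\<^esub> a \<otimes>\<^bsub>A\<^esub> c g h \<otimes>\<^bsub>A\<^esub> inv\<^bsub>A\<^esub> (c g h) = inv\<^bsub>A\<^esub> (c g h) \<otimes>\<^bsub>A\<^esub> a"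
      using cc[OF g h] a W.c_Units[OF g h] by (simp add: m_assoc)
    also have "\<tau> (g \<otimes>\<^bsub>G\<^esub> h) (inv\<^bsub>A\<^esub> (c g h) \<otimes>\<^bsub>A\<^esub> a) = d g h \<otimes>\<^bsub>A\<^esub> \<tau> (g \<otimes>\<^bsub>G\<^esub> h) a"
      unfolding d_def by (rule alg_auto(2)[OF tau[OF gh] cc(2)[OF g h] a])
    finally show ?thesis .
  qed
  have eps_nat: "natural_iso (mod_category A) (mod_category A) (comp_functor (F g) (F h)) (F (g \<otimes>\<^bsub>G\<^esub> h)) (\<epsilon> g h)"
    if g: "g \<in> carrier G" and h: "h \<in> carrier G" for g h
    unfolding natural_iso_mod_iff[OF endofunctor_comp[OF aut(3)[OF g] aut(3)[OF h]] aut(3)[OF W.G.m_closed[OF g h]]]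
  proof (intro conjI ballI)
    fix X assume X: "X \<in> mods A"
    interpret X: right_module A X by (rule modsD[OF X])
    note gh = W.G.m_closed[OF g h]
    show "\<epsilon> g h X \<in> rmod_hom A (omap (comp_functor (F g) (F h)) X) (omap (F (g \<otimes>\<^bsub>G\<^esub> h)) X)"
    proof (rule rmod_homI)
      fix x a assume "x \<in> carrier (omap (comp_functor (F g) (F h)) X)" and a: "a \<in> carrier A"
      then have x: "x \<in> carrier X" by (simp add: omF)
      have t: "\<tau> h (\<tau> g a) \<in> carrier A" "\<tau> (g \<otimes>\<^bsub>G\<^esub> h) a \<in> carrier A"
        by (rule tc[OF h tc[OF g a]], rule tc[OF gh a])
      have "x \<triangleleft>\<^bsub>X\<^esub> \<tau> h (\<tau> g a) \<triangleleft>\<^bsub>X\<^esub> d g h = x \<triangleleft>\<^bsub>X\<^esub> d g h \<triangleleft>\<^bsub>X\<^esub> \<tau> (g \<otimes>\<^bsub>G\<^esub> h) a"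
        unfolding X.ract_mult[OF x t(1) dc[OF g h], symmetric] X.ract_mult[OF x dc[OF g h] t(2), symmetric]
          comm[OF g h a] ..
      then show "\<epsilon> g h X (x \<triangleleft>\<^bsub>omap (comp_functor (F g) (F h)) X\<^esub> a) = \<epsilon> g h X x \<triangleleft>\<^bsub>omap (F (g \<otimes>\<^bsub>G\<^esub> h)) X\<^esub> a"
        using x X.ract_closed[OF x t(1)] by (simp add: omF \<epsilon>_def)
    qed (use dc[OF g h] in \<open>simp_all add: omF \<epsilon>_def X.ract\<close>)
    have iv: "x \<triangleleft>\<^bsub>X\<^esub> d g h \<triangleleft>\<^bsub>X\<^esub> inv\<^bsub>A\<^esub> (d g h) = x" "x \<triangleleft>\<^bsub>X\<^esub> inv\<^bsub>A\<^esub> (d g h) \<triangleleft>\<^bsub>X\<^esub> d g h = x"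
      if x: "x \<in> carrier X" for x
    proof -
      have i: "inv\<^bsub>A\<^esub> (d g h) \<in> carrier A" by (rule Units_inv_closed[OF dU[OF g h]])
      show "x \<triangleleft>\<^bsub>X\<^esub> d g h \<triangleleft>\<^bsub>X\<^esub> inv\<^bsub>A\<^esub> (d g h) = x" "x \<triangleleft>\<^bsub>X\<^esub> inv\<^bsub>A\<^esub> (d g h) \<triangleleft>\<^bsub>X\<^esub> d g h = x"
        unfolding X.ract_mult[OF x dc[OF g h] i, symmetric] X.ract_mult[OF x i dc[OF g h], symmetric]
          Units_r_inv[OF dU[OF g h]] Units_l_inv[OF dU[OF g h]] by (rule X.ract_one[OF x])+
    qed
    have "bij_betw (\<epsilon> g h X) (carrier X) (carrier X)"
      by (rule bij_betwI[of _ _ _ "\<lambda>x. x \<triangleleft>\<^bsub>X\<^esub> inv\<^bsub>A\<^esub> (d g h)"])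
        (use dc[OF g h] Units_inv_closed[OF dU[OF g h]] iv in \<open>simp_all add: \<epsilon>_def X.ract_closed\<close>)
    then show "bij_betw (\<epsilon> g h X) (carrier (omap (comp_functor (F g) (F h)) X)) (carrier (omap (F (g \<otimes>\<^bsub>G\<^esub> h)) X))"
      by (simp add: omF)
  next
    fix X Y f x assume X: "X \<in> mods A" and Y: "Y \<in> mods A" and f: "f \<in> rmod_hom A X Y"
      and "x \<in> carrier (omap (comp_functor (F g) (F h)) X)"
    then have x: "x \<in> carrier X" by (simp add: omF)
    show "\<epsilon> g h Y (amap (comp_functor (F g) (F h)) X Y f x) = amap (F (g \<otimes>\<^bsub>G\<^esub> h)) X Y f (\<epsilon> g h X x)"
      using x rmod_homD(1,3)[OF f x] dc[OF g h] by (simp add: amF \<epsilon>_def)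
  qed
  have coh: "x \<triangleleft>\<^bsub>X\<^esub> \<tau> l (d g h) \<triangleleft>\<^bsub>X\<^esub> d (g \<otimes>\<^bsub>G\<^esub> h) l = x \<triangleleft>\<^bsub>X\<^esub> d h l \<triangleleft>\<^bsub>X\<^esub> d g (h \<otimes>\<^bsub>G\<^esub> l)"
    if g: "g \<in> carrier G" and h: "h \<in> carrier G" and l: "l \<in> carrier G" and X: "X \<in> mods A" and x: "x \<in> carrier X"
    for g h l X x
  proof -
    interpret X: right_module A X by (rule modsD[OF X])
    note gh = W.G.m_closed[OF g h] and hl = W.G.m_closed[OF h l]
    note ghl = W.G.m_closed[OF gh l]
    have as: "g \<otimes>\<^bsub>G\<^esub> (h \<otimes>\<^bsub>G\<^esub> l) = g \<otimes>\<^bsub>G\<^esub> h \<otimes>\<^bsub>G\<^esub> l" using g h l by (simp add: W.G.m_assoc)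
    let ?t = "\<tau> (g \<otimes>\<^bsub>G\<^esub> h \<otimes>\<^bsub>G\<^esub> l)"
    have "\<tau> l (d g h) \<otimes>\<^bsub>A\<^esub> d (g \<otimes>\<^bsub>G\<^esub> h) l = d (g \<otimes>\<^bsub>G\<^esub> h) l \<otimes>\<^bsub>A\<^esub> ?t (inv\<^bsub>A\<^esub> (c g h))"
      unfolding d_def[of g h] by (rule comm[OF gh l cc(2)[OF g h]])
    also have "\<dots> = ?t (inv\<^bsub>A\<^esub> (c (g \<otimes>\<^bsub>G\<^esub> h) l) \<otimes>\<^bsub>A\<^esub> inv\<^bsub>A\<^esub> (c g h))"
      unfolding d_def[of "g \<otimes>\<^bsub>G\<^esub> h"] by (rule alg_auto(2)[OF tau[OF ghl] cc(2)[OF gh l] cc(2)[OF g h], symmetric])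
    also have "\<dots> = ?t (inv\<^bsub>A\<^esub> (c g h \<otimes>\<^bsub>A\<^esub> c (g \<otimes>\<^bsub>G\<^esub> h) l))"
      unfolding inv_mult_Units[OF W.c_Units[OF g h] W.c_Units[OF gh l]] ..
    also have "\<dots> = ?t (inv\<^bsub>A\<^esub> (\<rho> g (c h l) \<otimes>\<^bsub>A\<^esub> c g (h \<otimes>\<^bsub>G\<^esub> l)))"
      unfolding W.cocycle[OF g h l] ..
    also have "\<dots> = ?t (inv\<^bsub>A\<^esub> (c g (h \<otimes>\<^bsub>G\<^esub> l)) \<otimes>\<^bsub>A\<^esub> \<rho> g (inv\<^bsub>A\<^esub> (c h l)))"
      unfolding inv_mult_Units[OF alg_auto(5)[OF rho[OF g] W.c_Units[OF h l]] W.c_Units[OF g hl]]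
        alg_auto(6)[OF rho[OF g] W.c_Units[OF h l]] ..
    also have "\<dots> = d g (h \<otimes>\<^bsub>G\<^esub> l) \<otimes>\<^bsub>A\<^esub> ?t (\<rho> g (inv\<^bsub>A\<^esub> (c h l)))"
      unfolding d_def as
      by (rule alg_auto(2)[OF tau[OF ghl] cc(2)[OF g hl] rc[OF g cc(2)[OF h l]]])
    also have "\<dots> = \<tau> (h \<otimes>\<^bsub>G\<^esub> l) (\<tau> g (\<rho> g (inv\<^bsub>A\<^esub> (c h l)))) \<otimes>\<^bsub>A\<^esub> d g (h \<otimes>\<^bsub>G\<^esub> l)"
      using comm[OF g hl rc[OF g cc(2)[OF h l]]] unfolding as by simp
    also have "\<dots> = d h l \<otimes>\<^bsub>A\<^esub> d g (h \<otimes>\<^bsub>G\<^esub> l)"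
      unfolding tr[OF g cc(2)[OF h l]] d_def[of h l] ..
    finally have eq: "\<tau> l (d g h) \<otimes>\<^bsub>A\<^esub> d (g \<otimes>\<^bsub>G\<^esub> h) l = d h l \<otimes>\<^bsub>A\<^esub> d g (h \<otimes>\<^bsub>G\<^esub> l)" .
    show ?thesis
      unfolding X.ract_mult[OF x tc[OF l dc[OF g h]] dc[OF gh l], symmetric]
        X.ract_mult[OF x dc[OF h l] dc[OF g hl], symmetric] eq ..
  qed
  have action: "(F, \<epsilon>) \<in> linear_actions G K (mod_category A)"
    unfolding linear_actions_def is_action_def mem_Collect_eq prod.case
  proof (intro conjI ballI)
    fix g h l X assume g: "g \<in> carrier G" and h: "h \<in> carrier G" and l: "l \<in> carrier G" and X: "X \<in> mods A"
    interpret X: right_module A X by (rule modsD[OF X])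
    note gh = W.G.m_closed[OF g h] and hl = W.G.m_closed[OF h l]
    show "let gh = g \<otimes>\<^bsub>G\<^esub> h; hl = h \<otimes>\<^bsub>G\<^esub> l; ghl = g \<otimes>\<^bsub>G\<^esub> h \<otimes>\<^bsub>G\<^esub> l;
            FlX = omap (F l) X; FhFlX = omap (F h) FlX; S = omap (F g) FhFlX;
            T = omap (F ghl) X
        in comps (mod_category A) S (omap (F gh) FlX) T (\<epsilon> gh l X) (\<epsilon> g h FlX) =
           comps (mod_category A) S (omap (F g) (omap (F hl) X)) T (\<epsilon> g hl X)
             (amap (F g) FhFlX (omap (F hl) X) (\<epsilon> h l X))"
      unfolding Let_def mod_category_simps compose_def
    proof (rule restrict_ext)
      fix x assume "x \<in> carrier (omap (F g) (omap (F h) (omap (F l) X)))"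
      then have x: "x \<in> carrier X" by (simp add: omF)
      have 1: "\<epsilon> (g \<otimes>\<^bsub>G\<^esub> h) l X (\<epsilon> g h (omap (F l) X) x) = x \<triangleleft>\<^bsub>X\<^esub> \<tau> l (d g h) \<triangleleft>\<^bsub>X\<^esub> d (g \<otimes>\<^bsub>G\<^esub> h) l"
        using x X.ract_closed[OF x tc[OF l dc[OF g h]]] by (simp add: omF \<epsilon>_def)
      have 2: "\<epsilon> g (h \<otimes>\<^bsub>G\<^esub> l) X (\<epsilon> h l X x) = x \<triangleleft>\<^bsub>X\<^esub> d h l \<triangleleft>\<^bsub>X\<^esub> d g (h \<otimes>\<^bsub>G\<^esub> l)"
        using x X.ract_closed[OF x dc[OF h l]] by (simp add: \<epsilon>_def)
      show "\<epsilon> (g \<otimes>\<^bsub>G\<^esub> h) l X (\<epsilon> g h (omap (F l) X) x) =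
          \<epsilon> g (h \<otimes>\<^bsub>G\<^esub> l) X (amap (F g) (omap (F h) (omap (F l) X)) (omap (F (h \<otimes>\<^bsub>G\<^esub> l)) X) (\<epsilon> h l X) x)"
        unfolding amF 1 2 by (rule coh[OF g h l X x])
    qed
  qed (use aut eps_nat in auto)
  interpret U: right_module A U by (rule Umod)
  have gam: "gamma (F g) u X x = x" if "X \<in> mods A" "x \<in> carrier X" for g X x
    unfolding gamma_def amF by (rule hat_u[OF modsD(1)[OF that(1)] that(2)])
  have "represents G F \<epsilon> (\<lambda>g. u) \<rho> c"
    unfolding represents_def
  proof (intro conjI ballI)
    fix g assume g: "g \<in> carrier G"
    have "bij_betw ((\<lambda>a. u \<triangleleft>\<^bsub>U\<^esub> a) \<circ> \<tau> g) (carrier A) (carrier U)"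
      by (rule bij_betw_trans[OF alg_auto(4)[OF tau[OF g]] free])
    then show "free_gen A (omap (F g) U) u" using u by (simp add: free_gen_def omF comp_def)
    fix a assume a: "a \<in> carrier A"
    show "gamma (F g) u U (u \<triangleleft>\<^bsub>U\<^esub> a) = u \<triangleleft>\<^bsub>omap (F g) U\<^esub> \<rho> g a"
      using gam[OF U, of "u \<triangleleft>\<^bsub>U\<^esub> a"] a tr[OF g a] by (simp add: omF)
  next
    fix g h assume g: "g \<in> carrier G" and h: "h \<in> carrier G"
    note gh = W.G.m_closed[OF g h]
    have hU: "omap (F h) U \<in> mods A" by (rule endofunctorD(1)[OF aut(3)[OF h] U])
    have "gamma (F g) u (omap (F h) U) u = u" by (rule gam[OF hU]) (simp add: omF u)
    then have "\<epsilon> g h U (gamma (F g) u (omap (F h) U) u) = u \<triangleleft>\<^bsub>U\<^esub> d g h" using u by (simp add: \<epsilon>_def)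
    moreover have "u \<triangleleft>\<^bsub>U\<^esub> d g h \<triangleleft>\<^bsub>U\<^esub> \<tau> (g \<otimes>\<^bsub>G\<^esub> h) (c g h) = u"
      unfolding U.ract_mult[OF u dc[OF g h] tc[OF gh cc(1)[OF g h]], symmetric] d_inv[OF g h]
      by (rule U.ract_one[OF u])
    ultimately show "\<epsilon> g h U (gamma (F g) u (omap (F h) U) u) \<triangleleft>\<^bsub>omap (F (g \<otimes>\<^bsub>G\<^esub> h)) U\<^esub> c g h = u"
      by (simp add: omF)
  qed
  with action show ?thesis by blast
qed

section \<open>The correspondences\<close>

text \<open>The relation \<open>rep\<close> between actions and weak actions is total and onto, and compatible with
  isomorphism on both sides. The outer class of any weak action representing an action is therefore
  a complete invariant of the action, and it takes all \<open>d\<close>-compatible values. This does not depend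
  on the choice \<open>ch\<close> of a representing weak action.\<close>

lemma action_classes_bij:
  fixes K :: "('k, 'x) ring_scheme" and A :: "('k, 'a, 'y) module_scheme"
  assumes field: "field K" and alg: "assoc_algebra K A" and fd: "finite_dimensional K A" and bas: "basic A"
    and cb: "center_is_base K A" and d: "d \<ge> 2"
    and roots: "\<forall>t \<in> carrier K. \<exists>s \<in> carrier K. s [^]\<^bsub>K\<^esub> d = t"
  shows "\<exists>\<Phi>. bij_betw \<Phi> (action_classes (integer_mod_group d) K (mod_category A)) (compatible_outer K A d)"
proof -
  let ?Z = "integer_mod_group d"
  let ?S = "linear_actions ?Z K (mod_category A)" and ?W = "linear_weak_actions ?Z K A"
  interpret central_algebra_with_roots K A d
    using assms by (simp add: central_algebra_with_roots_def central_algebra_with_roots_axioms_def)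
  have pi: "pi_regular_ring A" by (rule finite_dimensional_pi_regular[OF field alg fd cb])
  obtain U u where free: "free_object A U u" using exists_free_object[OF ring_axioms] by blast
  have L: "linear_mod_action K A U u ?Z F \<epsilon>" if "(F, \<epsilon>) \<in> ?S" for F \<epsilon>
    using that alg free by (simp add: linear_mod_action_def linear_mod_action_axioms_def)
  define rep where "rep s w \<longleftrightarrow> (\<exists>b. free_object.represents A U u ?Z (fst s) (snd s) b (fst w) (snd w))"
    for s :: "(int, 'a fp_rmodule, 'a fp_arrow) cat_action" and w :: "(int, 'a) weak_action"
  have total: "\<exists>w \<in> ?W. rep s w" if "s \<in> ?S" for s
  proof -
    have s: "(fst s, snd s) \<in> ?S" using that by simp
    show ?thesis using linear_mod_action.exists_representation[OF L[OF s] pi bas] unfolding rep_def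
      by (metis fst_conv snd_conv)
  qed
  have onto: "\<exists>s \<in> ?S. rep s w" if "w \<in> ?W" for w
  proof -
    have w: "(fst w, snd w) \<in> ?W" using that by simp
    show ?thesis using exists_represented_action[OF alg free group_integer_mod_group w] unfolding rep_def
      by (metis fst_conv snd_conv)
  qed
  have uniq: "weak_action_iso ?Z A w w'" if "s \<in> ?S" "w \<in> ?W" "w' \<in> ?W" and r: "rep s w" "rep s w'" for s w w'
  proof -
    have s: "(fst s, snd s) \<in> ?S" and w: "(fst w, snd w) \<in> ?W" and w': "(fst w', snd w') \<in> ?W" using that by simp_all
    obtain b b' where "free_object.represents A U u ?Z (fst s) (snd s) b (fst w) (snd w)"
      "free_object.represents A U u ?Z (fst s) (snd s) b' (fst w') (snd w')"
      using r unfolding rep_def by blast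
    from linear_mod_action.representation_iso[OF L[OF s] w w' this] show ?thesis by simp
  qed
  have transfer: "rep s w'" if "s \<in> ?S" "w \<in> ?W" "w' \<in> ?W" and r: "rep s w" and "weak_action_iso ?Z A w w'" for s w w'
  proof -
    have s: "(fst s, snd s) \<in> ?S" and w: "(fst w, snd w) \<in> ?W" and w': "(fst w', snd w') \<in> ?W"
      and iso: "weak_action_iso ?Z A (fst w, snd w) (fst w', snd w')" using that by simp_all
    obtain b where "free_object.represents A U u ?Z (fst s) (snd s) b (fst w) (snd w)"
      using r unfolding rep_def by blast
    from linear_mod_action.representation_transfer[OF L[OF s] w w' this iso] show ?thesis
      unfolding rep_def .
  qed
  have same: "action_iso ?Z (mod_category A) s s'" if "s \<in> ?S" "s' \<in> ?S" "w \<in> ?W" and r: "rep s w" "rep s' w" for s s' w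
  proof -
    have s: "(fst s, snd s) \<in> ?S" and s': "(fst s', snd s') \<in> ?S" and w: "(fst w, snd w) \<in> ?W" using that by simp_all
    have W: "\<And>g. g \<in> carrier ?Z \<Longrightarrow> fst w g \<in> alg_auto K A"
      "\<And>g h. \<lbrakk>g \<in> carrier ?Z; h \<in> carrier ?Z\<rbrakk> \<Longrightarrow> snd w g h \<in> Units A"
      using w unfolding linear_weak_actions_def is_weak_action_def mem_Collect_eq prod.case by blast+
    obtain b b' where "free_object.represents A U u ?Z (fst s) (snd s) b (fst w) (snd w)"
      "free_object.represents A U u ?Z (fst s') (snd s') b' (fst w) (snd w)"
      using r unfolding rep_def by blast
    then have "represented_action K A U u ?Z (fst s) (snd s) b (fst w) (snd w)"
      "represented_action K A U u ?Z (fst s') (snd s') b' (fst w) (snd w)"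
      using L[OF s] L[OF s'] W by (simp_all add: represented_action_def represented_action_axioms_def)
    from represented_actions_iso[OF this] show ?thesis by simp
  qed
  have invariant: "rep s' w" if "s \<in> ?S" "s' \<in> ?S" "w \<in> ?W" and r: "rep s w" and "action_iso ?Z (mod_category A) s s'" for s s' w
  proof -
    have s: "(fst s, snd s) \<in> ?S" and s': "(fst s', snd s') \<in> ?S" and w: "(fst w, snd w) \<in> ?W"
      and iso: "action_iso ?Z (mod_category A) (fst s, snd s) (fst s', snd s')" using that by simp_all
    obtain b where "free_object.represents A U u ?Z (fst s) (snd s) b (fst w) (snd w)"
      using r unfolding rep_def by blast
    from represents_iso_invariant[OF L[OF s] L[OF s'] iso w this] show ?thesis unfolding rep_def .
  qed
  define cls where "cls w = outer_class K A (fst w 1)" for w :: "(int, 'a) weak_action"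
  have cls: "weak_action_iso ?Z A w w' \<longleftrightarrow> cls w = cls w'" if "w \<in> ?W" "w' \<in> ?W" for w w'
    using weak_action_iso_iff[of "fst w" "snd w" "fst w'" "snd w'"] that by (simp add: cls_def)
  define ch where "ch s = (SOME w. w \<in> ?W \<and> rep s w)" for s
  have ch: "ch s \<in> ?W" "rep s (ch s)" if "s \<in> ?S" for s
    using someI_ex[of "\<lambda>w. w \<in> ?W \<and> rep s w"] total[OF that] unfolding ch_def by blast+
  have inv: "action_iso ?Z (mod_category A) s s' \<longleftrightarrow> cls (ch s) = cls (ch s')" if s: "s \<in> ?S" and s': "s' \<in> ?S" for s s'
  proof
    assume "action_iso ?Z (mod_category A) s s'"
    then have "rep s' (ch s)" using invariant[OF s s' ch[OF s]] by blast
    then show "cls (ch s) = cls (ch s')"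
      using uniq[OF s' ch(1)[OF s] ch(1)[OF s'] _ ch(2)[OF s']] cls ch(1) s s' by blast
  next
    assume "cls (ch s) = cls (ch s')"
    then have "rep s (ch s')" using transfer[OF s ch(1)[OF s] ch(1)[OF s'] ch(2)[OF s]] cls ch(1) s s' by blast
    then show "action_iso ?Z (mod_category A) s s'" by (rule same[OF s s' ch(1)[OF s'] _ ch(2)[OF s']])
  qed
  have "(\<lambda>s. cls (ch s)) ` ?S = cls ` ?W"
  proof (intro equalityI subsetI)
    fix C assume "C \<in> cls ` ?W"
    then obtain w where w: "w \<in> ?W" "C = cls w" by blast
    obtain s where s: "s \<in> ?S" "rep s w" using onto[OF w(1)] by blast
    have "cls w = cls (ch s)" using uniq[OF s(1) w(1) ch(1)[OF s(1)] s(2) ch(2)[OF s(1)]] cls[OF w(1) ch(1)[OF s(1)]] by blast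
    then show "C \<in> (\<lambda>s. cls (ch s)) ` ?S" using w s by blast
  qed (use ch in blast)
  also have "cls ` ?W = compatible_outer K A d"
    unfolding compatible_outer_image[symmetric] cls_def by (auto simp: case_prod_unfold)
  finally have img: "(\<lambda>s. cls (ch s)) ` ?S = compatible_outer K A d" .
  from quotient_invariant[of ?S "action_iso ?Z (mod_category A)" "\<lambda>s. cls (ch s)", OF inv]
  show ?thesis unfolding img action_classes_def by blast
qed

theorem proposition3p9:
  fixes K :: "('k, 'x) ring_scheme"
    and A :: "('k, 'a, 'y) module_scheme"
    and d :: nat
  assumes "field K" and "assoc_algebra K A" and "finite_dimensional K A" and "basic A"
    and "center_is_base K A" and "d \<ge> 2"
    and "\<forall>t \<in> carrier K. \<exists>s \<in> carrier K. s [^]\<^bsub>K\<^esub> d = t"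
  shows "\<exists>\<Phi> \<Psi> \<Theta>.
    bij_betw \<Phi> (action_classes (integer_mod_group d) K (mod_category A))
      (weak_action_classes (integer_mod_group d) K A) \<and>
    bij_betw \<Psi> (weak_action_classes (integer_mod_group d) K A) (compatible_outer K A d) \<and>
    (\<forall>(\<rho>, c) \<in> linear_weak_actions (integer_mod_group d) K A.
      \<Psi> (weak_action_rel (integer_mod_group d) K A `` {(\<rho>, c)}) = outer_class K A (\<rho> 1)) \<and>
    bij_betw \<Theta> (crossed_system_classes (integer_mod_group d) K A)
      (conj_class (outer_auto_group K A) ` compatible_outer K A d) \<and>
    (\<forall>w \<in> linear_weak_actions (integer_mod_group d) K A.
      \<Theta> (crossed_system_rel (integer_mod_group d) K A `` {w}) =
        conj_class (outer_auto_group K A)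
          (\<Psi> (weak_action_rel (integer_mod_group d) K A `` {w})))"
proof -
  let ?Z = "integer_mod_group d" and ?O = "outer_auto_group K A"
  let ?W = "linear_weak_actions ?Z K A"
  interpret central_algebra_with_roots K A d
    using assms by (simp add: central_algebra_with_roots_def central_algebra_with_roots_axioms_def)
  let ?cls = "\<lambda>w. outer_class K A (fst w 1)"
  have img: "?cls ` ?W = compatible_outer K A d"
    unfolding compatible_outer_image[symmetric] by (auto simp: case_prod_unfold)
  have 1: "weak_action_iso ?Z A w w' \<longleftrightarrow> ?cls w = ?cls w'" if "w \<in> ?W" "w' \<in> ?W" for w w'
    using weak_action_iso_iff[of "fst w" "snd w" "fst w'" "snd w'"] that by simp
  obtain \<Psi> where Psi: "bij_betw \<Psi> (weak_action_classes ?Z K A) (compatible_outer K A d)"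
    "\<forall>w \<in> ?W. \<Psi> (weak_action_rel ?Z K A `` {w}) = ?cls w"
    using quotient_invariant[of ?W "weak_action_iso ?Z A" ?cls, OF 1]
    unfolding img weak_action_classes_def weak_action_rel_def by blast
  have 2: "crossed_system_equiv ?Z K (A, w) (A, w') \<longleftrightarrow> conj_class ?O (?cls w) = conj_class ?O (?cls w')"
    if "w \<in> ?W" "w' \<in> ?W" for w w'
    using crossed_system_equiv_iff[of "fst w" "snd w" "fst w'" "snd w'"] that by simp
  have img2: "(\<lambda>w. conj_class ?O (?cls w)) ` ?W = conj_class ?O ` compatible_outer K A d"
    unfolding img[symmetric] image_image ..
  obtain \<Theta> where Theta: "bij_betw \<Theta> (crossed_system_classes ?Z K A) (conj_class ?O ` compatible_outer K A d)"
    "\<forall>w \<in> ?W. \<Theta> (crossed_system_rel ?Z K A `` {w}) = conj_class ?O (?cls w)"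
    using quotient_invariant[of ?W "\<lambda>w w'. crossed_system_equiv ?Z K (A, w) (A, w')" "\<lambda>w. conj_class ?O (?cls w)", OF 2]
    unfolding img2 crossed_system_classes_def crossed_system_rel_def by blast
  obtain \<Phi> where Phi: "bij_betw \<Phi> (action_classes ?Z K (mod_category A)) (compatible_outer K A d)"
    using action_classes_bij[OF assms] by blast
  have "bij_betw (inv_into (weak_action_classes ?Z K A) \<Psi> \<circ> \<Phi>)
      (action_classes ?Z K (mod_category A)) (weak_action_classes ?Z K A)"
    by (rule bij_betw_trans[OF Phi bij_betw_inv_into[OF Psi(1)]])
  then show ?thesis
    using Psi Theta
    by (intro exI[of _ "inv_into (weak_action_classes ?Z K A) \<Psi> \<circ> \<Phi>"] exI[of _ \<Psi>] exI[of _ \<Theta>])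
      (auto simp: case_prod_unfold)
qed

end
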